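(* There exists a positive universal constant $C_0$ such that the following holds. In the Bayesian spike-and-slab regression setting described in the context, with exact random-scan Gibbs kernel $T$ and hybrid kernel $\hat T$ targeting the posterior $\Pi$, suppose that $\ell$ is continuously twice-differentiable and that its Hessian $H(\beta)$ satisfies $O_d\preccurlyeq -H(\beta)\preccurlyeq L_dI_d$ for every $\beta\in\mathbb R^d$, where $L_d>0$, and that $\sigma_d^2=1/[2d(b_dL_d+1)]$. Then $$\frac{C_0}{d(b_dL_d+1)}(1-\|T\|_\Pi)\le1-\|\hat T\|_\Pi\le1-\|T\|_\Pi,$$ and, for every $f\in L_0^2(\Pi)$, $$\mathrm{var}_T(f)\le\mathrm{var}_{\hat T}(f)\le\frac{d(b_dL_d+1)}{C_0}\,\mathrm{var}_T(f)+\frac{d(b_dL_d+1)-C_0}{C_0}\,\|f\|_\Pi^2.$$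
   Context: $L^2$ conventions. For a probability measure $\omega$, $L_0^2(\omega)$ is the real Hilbert space of square-integrable functions with $\omega$-mean zero (modulo a.e. equality), with norm $\|\cdot\|_\omega$. A Markov kernel $K$ reversible with respect to $\omega$ acts as a self-adjoint operator on $L_0^2(\omega)$; $\|K\|_\omega\in[0,1]$ is its operator norm on $L_0^2(\omega)$. The asymptotic variance of $f$ is $\mathrm{var}_K(f)=\lim_{t\to\infty}t^{-1}\,\mathrm{var}\big[\sum_{s=1}^t f(X(s))\big]\in[0,\infty]$, where $(X(s))_{s\ge0}$ is the chain with kernel $K$ and $X(0)\sim\omega$; when $\|K\|_\omega<1$ and $f\in L_0^2(\omega)$ it equals $2\langle f,(I-K)^{-1}f\rangle_\omega-\|f\|_\omega^2$. $O_d$ and $I_d$ are the $d\times d$ zero and identity matrices; for symmetric matrices, $A_1\preccurlyeq A_2$ means $A_2-A_1$ is positive semi-definite. Spike-and-slab setting. Let $d\ge1$, $0<a_d<b_d$, let $f_d$ be a probability density on $(0,1)$, and let $\ell:\mathbb R^d\to\mathbb R$ be a log-likelihood function. For $z_j\in\{0,1\}$ put $\tau(z_j)=z_jb_d+(1-z_j)a_d$. The posterior $\Pi$ on $(\beta,z,q)\in\mathbb R^d\times\{0,1\}^d\times(0,1)$ has density proportional to $$e^{\ell(\beta)}\Big[\prod_{j=1}^d\tfrac{1}{\sqrt{\tau(z_j)}}\exp\Big(-\tfrac{\beta_j^2}{2\tau(z_j)}\Big)q^{z_j}(1-q)^{1-z_j}\Big]f_d(q).$$ $\Pi_{1,(z,q)}$,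 $\Pi_{2,(\beta,q)}$, $\Pi_{3,(\beta,z)}$ are the conditional distributions under $\Pi$ of $\beta$ given $(z,q)$, of $z$ given $(\beta,q)$, and of $q$ given $(\beta,z)$. $Q_{1,(z,q)}$ is the Markov kernel on $\mathbb R^d$ of the random-walk Metropolis–Hastings algorithm targeting $\Pi_{1,(z,q)}$: given the current state $\beta$, draw independently $\beta_j'\sim N(\beta_j,\tau(z_j)\sigma_d^2)$, $j=1,\dots,d$, where $\sigma_d>0$, and accept $\beta'$ (else stay at $\beta$) with the Metropolis probability $\min\{1,\pi(\beta')/\pi(\beta)\}$, where $\pi$ is the density of $\Pi_{1,(z,q)}$. For a probability vector $(p_1,p_2,p_3)$, $$T((\beta,z,q),d(\beta',z',q'))=p_1\Pi_{1,(z,q)}(d\beta')\delta_{(z,q)}(d(z',q'))+p_2\Pi_{2,(\beta,q)}(dz')\delta_{(\beta,q)}(d(\beta',q'))+p_3\Pi_{3,(\beta,z)}(dq')\delta_{(\beta,z)}(d(\beta',z')),$$ where $\delta$ denotes a point mass, and $\hat T$ is obtained from $T$ by replacing $\Pi_{1,(z,q)}(d\beta')$ with $Q_{1,(z,q)}(\beta,d\beta')$. *)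

theory Defs
  imports "HOL-Probability.Probability"
begin

section \<open>Markov kernels acting on square-integrable functions\<close>

text \<open>A Markov kernel on the space of a measure \<open>\<omega>\<close> is a function \<open>'a \<Rightarrow> 'a measure\<close>. Functions are
  not identified up to a.e. equality; when \<open>K\<close> leaves
  \<open>\<omega>\<close> invariant, the quantities below do not depend on the representatives.\<close>

definition L20 :: "'a measure \<Rightarrow> ('a \<Rightarrow> real) set" where
  "L20 \<omega> = {f \<in> borel_measurable \<omega>. integrable \<omega> (\<lambda>x. (f x)\<^sup>2) \<and> (\<integral>x. f x \<partial>\<omega>) = 0}"

definition L2_norm :: "'a measure \<Rightarrow> ('a \<Rightarrow> real) \<Rightarrow> real" where
  "L2_norm \<omega> f = sqrt (\<integral>x. (f x)\<^sup>2 \<partial>\<omega>)"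

definition kernel_op :: "('a \<Rightarrow> 'a measure) \<Rightarrow> ('a \<Rightarrow> real) \<Rightarrow> 'a \<Rightarrow> real" where
  "kernel_op K f x = (\<integral>y. f y \<partial>K x)"

definition kernel_norm :: "'a measure \<Rightarrow> ('a \<Rightarrow> 'a measure) \<Rightarrow> real" where
  "kernel_norm \<omega> K = (SUP f \<in> {f \<in> L20 \<omega>. L2_norm \<omega> f \<le> 1}. L2_norm \<omega> (kernel_op K f))"

text \<open>The law of the whole trajectory \<open>(X 0, X 1, \<dots>)\<close> with \<open>X 0 \<sim> \<omega>\<close> and transition kernel \<open>K\<close>,
  given by the Ionescu Tulcea construction: the conditional law of the coordinate \<open>n\<close> given the
  earlier coordinates \<open>x 0, \<dots>, x (n - 1)\<close> is \<open>K (x (n - 1))\<close>.\<close>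

definition chain_step :: "'a measure \<Rightarrow> ('a \<Rightarrow> 'a measure) \<Rightarrow> nat \<Rightarrow> (nat \<Rightarrow> 'a) \<Rightarrow> 'a measure" where
  "chain_step \<omega> K n x = (case n of 0 \<Rightarrow> \<omega> | Suc m \<Rightarrow> K (x m))"

definition chain_law :: "'a measure \<Rightarrow> ('a \<Rightarrow> 'a measure) \<Rightarrow> (nat \<Rightarrow> 'a) measure" where
  "chain_law \<omega> K =
     projective_family.lim UNIV (Ionescu_Tulcea.CI (chain_step \<omega> K) (\<lambda>_. \<omega>)) (\<lambda>_. \<omega>)"

definition asymp_var :: "'a measure \<Rightarrow> ('a \<Rightarrow> 'a measure) \<Rightarrow> ('a \<Rightarrow> real) \<Rightarrow> ereal" where
  "asymp_var \<omega> K f =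
     lim (\<lambda>t::nat. ereal (prob_space.variance (chain_law \<omega> K) (\<lambda>X. \<Sum>s=1..t. f (X s)) / real t))"


section \<open>Probability measures given by unnormalized densities\<close>

definition normalized_density :: "'a measure \<Rightarrow> ('a \<Rightarrow> real) \<Rightarrow> 'a \<Rightarrow> real" where
  "normalized_density N g x = g x / (\<integral>y. g y \<partial>N)"

definition normalized :: "'a measure \<Rightarrow> ('a \<Rightarrow> real) \<Rightarrow> 'a measure" where
  "normalized N g = density N (\<lambda>x. ennreal (normalized_density N g x))"


section \<open>Twice continuously differentiable functions and matrices, in arbitrary dimension\<close>

text \<open>The dimension \<open>d\<close> has to be a natural number rather than a type, because the constant of the
  theorem does not depend on it. Vectors of length \<open>d\<close> are the functions in \<open>Rd d\<close>, with the
  subspace topology of the product topology; it is the Euclidean topology, since the coordinates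
  outside \<open>{..<d}\<close> are frozen. Matrices are functions \<open>nat \<Rightarrow> nat \<Rightarrow> real\<close> of which only the entries
  with indices below \<open>d\<close> matter.\<close>

definition Rd :: "nat \<Rightarrow> (nat \<Rightarrow> real) set" where
  "Rd d = (\<Pi>\<^sub>E i\<in>{..<d}. UNIV)"

definition partial :: "nat \<Rightarrow> ((nat \<Rightarrow> real) \<Rightarrow> real) \<Rightarrow> (nat \<Rightarrow> real) \<Rightarrow> real" where
  "partial i g x = deriv (\<lambda>t. g (x(i := t))) (x i)"

definition has_partial :: "nat \<Rightarrow> ((nat \<Rightarrow> real) \<Rightarrow> real) \<Rightarrow> (nat \<Rightarrow> real) \<Rightarrow> bool" where
  "has_partial i g x \<longleftrightarrow> (\<lambda>t. g (x(i := t))) differentiable (at (x i))"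

definition C1_on_Rd :: "nat \<Rightarrow> ((nat \<Rightarrow> real) \<Rightarrow> real) \<Rightarrow> bool" where
  "C1_on_Rd d g \<longleftrightarrow> continuous_on (Rd d) g \<and>
     (\<forall>i<d. (\<forall>x\<in>Rd d. has_partial i g x) \<and> continuous_on (Rd d) (partial i g))"

definition C2_on_Rd :: "nat \<Rightarrow> ((nat \<Rightarrow> real) \<Rightarrow> real) \<Rightarrow> bool" where
  "C2_on_Rd d g \<longleftrightarrow> C1_on_Rd d g \<and> (\<forall>i<d. C1_on_Rd d (partial i g))"

definition hessian :: "((nat \<Rightarrow> real) \<Rightarrow> real) \<Rightarrow> (nat \<Rightarrow> real) \<Rightarrow> nat \<Rightarrow> nat \<Rightarrow> real" where
  "hessian g x i j = partial i (partial j g) x"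

definition psd :: "nat \<Rightarrow> (nat \<Rightarrow> nat \<Rightarrow> real) \<Rightarrow> bool" where
  "psd d A \<longleftrightarrow> (\<forall>v :: nat \<Rightarrow> real. 0 \<le> (\<Sum>i<d. \<Sum>j<d. v i * A i j * v j))"

definition loewner_le :: "nat \<Rightarrow> (nat \<Rightarrow> nat \<Rightarrow> real) \<Rightarrow> (nat \<Rightarrow> nat \<Rightarrow> real) \<Rightarrow> bool" where
  "loewner_le d A B \<longleftrightarrow> psd d (\<lambda>i j. B i j - A i j)"

definition id_mat :: "nat \<Rightarrow> nat \<Rightarrow> real" where
  "id_mat i j = (if i = j then 1 else 0)"


section \<open>The spike-and-slab posterior\<close>

type_synonym state = "(nat \<Rightarrow> real) \<times> (nat \<Rightarrow> nat) \<times> real"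

definition beta_space :: "nat \<Rightarrow> (nat \<Rightarrow> real) measure" where
  "beta_space d = (\<Pi>\<^sub>M j\<in>{..<d}. lborel)"

definition z_space :: "nat \<Rightarrow> (nat \<Rightarrow> nat) measure" where
  "z_space d = (\<Pi>\<^sub>M j\<in>{..<d}. count_space {0, 1})"

definition q_space :: "real measure" where
  "q_space = restrict_space lborel {0<..<1}"

definition state_space :: "nat \<Rightarrow> state measure" where
  "state_space d = beta_space d \<Otimes>\<^sub>M (z_space d \<Otimes>\<^sub>M q_space)"

definition prob_density_01 :: "(real \<Rightarrow> real) \<Rightarrow> bool" where
  "prob_density_01 f \<longleftrightarrow> f \<in> borel_measurable q_space \<and> (\<forall>q\<in>{0<..<1}. 0 \<le> f q) \<and>
     (\<integral>\<^sup>+q. ennreal (f q) \<partial>q_space) = 1"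

definition slab_var :: "real \<Rightarrow> real \<Rightarrow> nat \<Rightarrow> real" where
  "slab_var a b zj = real zj * b + (1 - real zj) * a"

text \<open>The unnormalized posterior density without its last factor, the density of \<open>q\<close>.\<close>

definition weight :: "nat \<Rightarrow> real \<Rightarrow> real \<Rightarrow> ((nat \<Rightarrow> real) \<Rightarrow> real)
    \<Rightarrow> (nat \<Rightarrow> real) \<Rightarrow> (nat \<Rightarrow> nat) \<Rightarrow> real \<Rightarrow> real" where
  "weight d a b l \<beta> z q = exp (l \<beta>) *
     (\<Prod>j<d. 1 / sqrt (slab_var a b (z j)) * exp (- (\<beta> j)\<^sup>2 / (2 * slab_var a b (z j)))
             * q ^ z j * (1 - q) ^ (1 - z j))"

definition posterior :: "nat \<Rightarrow> real \<Rightarrow> real \<Rightarrow> ((nat \<Rightarrow> real) \<Rightarrow> real) \<Rightarrow> (real \<Rightarrow> real)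
    \<Rightarrow> state measure" where
  "posterior d a b l f = normalized (state_space d) (\<lambda>(\<beta>, z, q). weight d a b l \<beta> z q * f q)"

text \<open>Conditional distributions are normalized sections of the joint density. In those of \<open>\<beta>\<close> and of
  \<open>z\<close> the factor \<open>f q\<close> cancels; leaving it out gives a probability measure also where \<open>f q = 0\<close>.\<close>

definition cond_beta :: "nat \<Rightarrow> real \<Rightarrow> real \<Rightarrow> ((nat \<Rightarrow> real) \<Rightarrow> real)
    \<Rightarrow> (nat \<Rightarrow> nat) \<Rightarrow> real \<Rightarrow> (nat \<Rightarrow> real) measure" where
  "cond_beta d a b l z q = normalized (beta_space d) (\<lambda>\<beta>. weight d a b l \<beta> z q)"

definition cond_z :: "nat \<Rightarrow> real \<Rightarrow> real \<Rightarrow> ((nat \<Rightarrow> real) \<Rightarrow> real)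
    \<Rightarrow> (nat \<Rightarrow> real) \<Rightarrow> real \<Rightarrow> (nat \<Rightarrow> nat) measure" where
  "cond_z d a b l \<beta> q = normalized (z_space d) (\<lambda>z. weight d a b l \<beta> z q)"

definition cond_q :: "nat \<Rightarrow> real \<Rightarrow> real \<Rightarrow> ((nat \<Rightarrow> real) \<Rightarrow> real) \<Rightarrow> (real \<Rightarrow> real)
    \<Rightarrow> (nat \<Rightarrow> real) \<Rightarrow> (nat \<Rightarrow> nat) \<Rightarrow> real measure" where
  "cond_q d a b l f \<beta> z = normalized q_space (\<lambda>q. weight d a b l \<beta> z q * f q)"


section \<open>The exact Gibbs kernel and the hybrid kernel\<close>

text \<open>The second argument of \<^const>\<open>normal_density\<close> is the standard deviation.\<close>

definition proposal :: "nat \<Rightarrow> real \<Rightarrow> real \<Rightarrow> real \<Rightarrow> (nat \<Rightarrow> nat) \<Rightarrow> (nat \<Rightarrow> real)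
    \<Rightarrow> (nat \<Rightarrow> real) measure" where
  "proposal d a b \<sigma> z \<beta> =
     (\<Pi>\<^sub>M j\<in>{..<d}. density lborel (normal_density (\<beta> j) (sqrt (slab_var a b (z j) * \<sigma>\<^sup>2))))"

definition mh_kernel :: "nat \<Rightarrow> real \<Rightarrow> real \<Rightarrow> ((nat \<Rightarrow> real) \<Rightarrow> real) \<Rightarrow> real
    \<Rightarrow> (nat \<Rightarrow> nat) \<Rightarrow> real \<Rightarrow> (nat \<Rightarrow> real) \<Rightarrow> (nat \<Rightarrow> real) measure" where
  "mh_kernel d a b l \<sigma> z q \<beta> =
     (let dens = normalized_density (beta_space d) (\<lambda>\<beta>. weight d a b l \<beta> z q)
      in proposal d a b \<sigma> z \<beta> \<bind> (\<lambda>\<beta>'.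
           distr (measure_pmf (bernoulli_pmf (min 1 (dens \<beta>' / dens \<beta>)))) (beta_space d)
             (\<lambda>accept. if accept then \<beta>' else \<beta>)))"

definition mixture3 :: "'a measure \<Rightarrow> real \<Rightarrow> real \<Rightarrow> real \<Rightarrow> 'a measure \<Rightarrow> 'a measure \<Rightarrow> 'a measure
    \<Rightarrow> 'a measure" where
  "mixture3 M p1 p2 p3 \<mu>1 \<mu>2 \<mu>3 = measure_of (space M) (sets M)
     (\<lambda>A. ennreal p1 * emeasure \<mu>1 A + ennreal p2 * emeasure \<mu>2 A + ennreal p3 * emeasure \<mu>3 A)"

text \<open>The product of a measure with a point mass is written as an image measure.\<close>

definition random_scan :: "nat \<Rightarrow> real \<Rightarrow> real \<Rightarrow> real
    \<Rightarrow> (state \<Rightarrow> (nat \<Rightarrow> real) measure) \<Rightarrow> (state \<Rightarrow> (nat \<Rightarrow> nat) measure) \<Rightarrow> (state \<Rightarrow> real measure)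
    \<Rightarrow> state \<Rightarrow> state measure" where
  "random_scan d p1 p2 p3 K1 K2 K3 = (\<lambda>(\<beta>, z, q).
     mixture3 (state_space d) p1 p2 p3
       (distr (K1 (\<beta>, z, q)) (state_space d) (\<lambda>\<beta>'. (\<beta>', z, q)))
       (distr (K2 (\<beta>, z, q)) (state_space d) (\<lambda>z'. (\<beta>, z', q)))
       (distr (K3 (\<beta>, z, q)) (state_space d) (\<lambda>q'. (\<beta>, z, q'))))"

definition gibbs_kernel :: "nat \<Rightarrow> real \<Rightarrow> real \<Rightarrow> ((nat \<Rightarrow> real) \<Rightarrow> real) \<Rightarrow> (real \<Rightarrow> real)
    \<Rightarrow> real \<Rightarrow> real \<Rightarrow> real \<Rightarrow> state \<Rightarrow> state measure" where
  "gibbs_kernel d a b l f p1 p2 p3 = random_scan d p1 p2 p3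
     (\<lambda>(\<beta>, z, q). cond_beta d a b l z q)
     (\<lambda>(\<beta>, z, q). cond_z d a b l \<beta> q)
     (\<lambda>(\<beta>, z, q). cond_q d a b l f \<beta> z)"

definition hybrid_kernel :: "nat \<Rightarrow> real \<Rightarrow> real \<Rightarrow> ((nat \<Rightarrow> real) \<Rightarrow> real) \<Rightarrow> (real \<Rightarrow> real) \<Rightarrow> real
    \<Rightarrow> real \<Rightarrow> real \<Rightarrow> real \<Rightarrow> state \<Rightarrow> state measure" where
  "hybrid_kernel d a b l f \<sigma> p1 p2 p3 = random_scan d p1 p2 p3
     (\<lambda>(\<beta>, z, q). mh_kernel d a b l \<sigma> z q \<beta>)
     (\<lambda>(\<beta>, z, q). cond_z d a b l \<beta> q)
     (\<lambda>(\<beta>, z, q). cond_q d a b l f \<beta> z)"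

end

theory Submission
  imports Defs
begin

text \<open>Both kernels are reversible and positive, so \<open>1 - kernel_norm\<close> is the infimum of a Rayleigh quotient
  and the asymptotic variance a supremum over test functions (approached by partial Neumann sums);
  both are monotone in the Dirichlet form. The Dirichlet forms differ only in the update of \<open>\<beta>\<close>, so it
  suffices to bound, for fixed \<open>(z, q)\<close>, the variance under the conditional law \<open>exp (- U)\<close> of \<open>\<beta>\<close> by
  the Dirichlet form of the random walk Metropolis kernel. In the norm with square
  \<open>\<Sum>j. \<beta> j ^ 2 / \<tau> j\<close> the potential \<open>U\<close> is 1-strongly convex and \<open>(b * L + 1)\<close>-smooth.

  Given \<open>g\<close>, let \<open>h x\<close> be the mean of \<open>g\<close> over the Gaussian proposals \<open>w\<close> from \<open>x\<close>, with weights
  \<open>max 0 (1 + U x - U w)\<close>. The local energy of \<open>g\<close> at \<open>x\<close>, its mean squared increment over accepted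
  proposals, controls both \<open>h x - g x\<close> and the oscillation of \<open>h\<close> near \<open>x\<close>. The variance of \<open>h\<close> is then
  bounded by a Poincare inequality derived from the Prekopa--Leindler inequality in the manner of
  Maurey, which only needs to see \<open>h\<close> at small distances.\<close>

section \<open>Reversible kernels, operator norm and asymptotic variance\<close>

text \<open>The gap must be of order \<open>\<sigma>\<^sup>2\<close> uniformly, although the
  gradient of the potential is unbounded. The weights \<open>max 0 (1 + U x - U w)\<close> are made
  for this. By convexity they lie below the modulus of an affine function of \<open>w\<close>, so
  their second moments are explicit Gaussian integrals. They grow linearly downhill, so their mean
  is at least a multiple of one plus the slope of \<open>U\<close>, which cancels the slope in the
  change of \<open>U x\<close> when \<open>x\<close> moves. They vanish once \<open>U w\<close>
  exceeds \<open>U x\<close> by 1, so only proposals with acceptance probability bounded below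
  contribute. Moving \<open>x\<close> by \<open>q * \<sigma>\<close> then changes the normalized
  weights by \<open>O(q)\<close>, which turns local energy into a squared Lipschitz constant of
  order \<open>1 / \<sigma>\<^sup>2\<close>. This holds only for \<open>q\<close> at most about the
  inverse of one plus the slope; hence a Poincare inequality that accepts arbitrarily small
  distances, used on growing balls. Numerical constants are rounded generously. No resolvent enters:
  bounded partial sums replace it, so kernels without a spectral gap are covered too.\<close>

lemma integral_bind_kernel:
  fixes F :: "'b \<Rightarrow> real"
  assumes k[measurable]: "\<kappa> \<in> M \<rightarrow>\<^sub>M subprob_algebra N" and ne: "space M \<noteq> {}"
    and F: "integrable (M \<bind> \<kappa>) F"
  shows "AE x in M. integrable (\<kappa> x) F"
    and "integrable M (\<lambda>x. \<integral>y. F y \<partial>\<kappa> x)"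
    and "(\<integral>y. F y \<partial>(M \<bind> \<kappa>)) = (\<integral>x. (\<integral>y. F y \<partial>\<kappa> x) \<partial>M)"
proof -
  have sb: "sets (M \<bind> \<kappa>) = sets N"
    by (rule sets_bind) (use sets_kernel[OF k] ne in auto)
  have Fm[measurable]: "F \<in> borel_measurable N"
    using F sb by (metis borel_measurable_integrable measurable_cong_sets)
  note nn_integral_measurable_subprob_algebra[measurable]
  have Fm2: "F \<in> borel_measurable (\<kappa> x)" if "x \<in> space M" for x
    using that Fm sets_kernel[OF k that] by (metis measurable_cong_sets)
  \<comment> \<open>The two signs go through \<open>nn_integral_bind\<close> separately;
    integrability of \<open>F\<close> makes both iterated integrals finite, so both parts are finite
    for almost every \<open>x\<close> and may be subtracted.\<close>
  define p where "p x = (\<integral>\<^sup>+y. ennreal (F y) \<partial>\<kappa> x)" for x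
  define n where "n x = (\<integral>\<^sup>+y. ennreal (- F y) \<partial>\<kappa> x)" for x
  have [measurable]: "p \<in> borel_measurable M" "n \<in> borel_measurable M"
    unfolding p_def n_def by measurable
  have P: "(\<integral>\<^sup>+y. ennreal (F y) \<partial>(M \<bind> \<kappa>)) = (\<integral>\<^sup>+x. p x \<partial>M)"
    unfolding p_def by (rule nn_integral_bind[OF _ k]) simp
  have Nn: "(\<integral>\<^sup>+y. ennreal (- F y) \<partial>(M \<bind> \<kappa>)) = (\<integral>\<^sup>+x. n x \<partial>M)"
    unfolding n_def by (rule nn_integral_bind[OF _ k]) simp
  have fp: "(\<integral>\<^sup>+x. p x \<partial>M) \<noteq> \<infinity>" "(\<integral>\<^sup>+x. n x \<partial>M) \<noteq> \<infinity>"
    using F unfolding P[symmetric] Nn[symmetric] real_integrable_def by auto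
  have ap: "AE x in M. p x \<noteq> \<infinity>" "AE x in M. n x \<noteq> \<infinity>"
    by (rule nn_integral_noteq_infinite, simp, rule fp)+
  show ai: "AE x in M. integrable (\<kappa> x) F"
    using ap AE_space by eventually_elim (auto simp: real_integrable_def p_def n_def Fm2)
  have ip: "integrable M (\<lambda>x. enn2real (p x))" "(\<integral>x. enn2real (p x) \<partial>M) = enn2real (\<integral>\<^sup>+x. p x \<partial>M)"
  proof -
    have e: "(\<integral>\<^sup>+x. ennreal (enn2real (p x)) \<partial>M) = (\<integral>\<^sup>+x. p x \<partial>M)"
      using ap(1) by (intro nn_integral_cong_AE) (auto elim!: eventually_mono simp: less_top)
    show "integrable M (\<lambda>x. enn2real (p x))"
      using fp(1) by (intro integrableI_nonneg) (auto simp: e less_top)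
    show "(\<integral>x. enn2real (p x) \<partial>M) = enn2real (\<integral>\<^sup>+x. p x \<partial>M)"
      by (subst integral_eq_nn_integral) (auto simp: e)
  qed
  have inn: "integrable M (\<lambda>x. enn2real (n x))" "(\<integral>x. enn2real (n x) \<partial>M) = enn2real (\<integral>\<^sup>+x. n x \<partial>M)"
  proof -
    have e: "(\<integral>\<^sup>+x. ennreal (enn2real (n x)) \<partial>M) = (\<integral>\<^sup>+x. n x \<partial>M)"
      using ap(2) by (intro nn_integral_cong_AE) (auto elim!: eventually_mono simp: less_top)
    show "integrable M (\<lambda>x. enn2real (n x))"
      using fp(2) by (intro integrableI_nonneg) (auto simp: e less_top)
    show "(\<integral>x. enn2real (n x) \<partial>M) = enn2real (\<integral>\<^sup>+x. n x \<partial>M)"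
      by (subst integral_eq_nn_integral) (auto simp: e)
  qed
  have eq: "AE x in M. (\<integral>y. F y \<partial>\<kappa> x) = enn2real (p x) - enn2real (n x)"
    using ai by eventually_elim (simp add: real_lebesgue_integral_def p_def n_def)
  have mi: "(\<lambda>x. \<integral>y. F y \<partial>\<kappa> x) \<in> borel_measurable M"
    by (rule measurable_compose[OF k integral_measurable_subprob_algebra[OF Fm]])
  show "integrable M (\<lambda>x. \<integral>y. F y \<partial>\<kappa> x)"
    using integrable_cong_AE[OF mi _ eq] ip inn by simp
  have "(\<integral>x. (\<integral>y. F y \<partial>\<kappa> x) \<partial>M) = (\<integral>x. enn2real (p x) - enn2real (n x) \<partial>M)"
    by (rule integral_cong_AE[OF mi _ eq]) measurable
  also have "\<dots> = enn2real (\<integral>\<^sup>+x. p x \<partial>M) - enn2real (\<integral>\<^sup>+x. n x \<partial>M)"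
    using ip inn by simp
  also have "\<dots> = (\<integral>y. F y \<partial>(M \<bind> \<kappa>))"
    using real_lebesgue_integral_def[OF F] P Nn by simp
  finally show "(\<integral>y. F y \<partial>(M \<bind> \<kappa>)) = (\<integral>x. (\<integral>y. F y \<partial>\<kappa> x) \<partial>M)" by simp
qed

text \<open>The algebra behind Cauchy--Schwarz for any positive semi-definite form, applied to
  \<open>ip\<close> and to the form of a positive kernel. The leading coefficient \<open>c\<close>
  may vanish, and then \<open>b\<close> has to vanish too.\<close>

lemma quadratic_nonneg_discriminant:
  fixes a b c :: real
  assumes "\<And>t. 0 \<le> a + 2 * t * b + t\<^sup>2 * c"
  shows "b\<^sup>2 \<le> a * c"
proof -
  have a: "0 \<le> a" using assms[of 0] by simp
  show ?thesis
  proof (cases "c = 0")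
    case True
    have "b = 0"
    proof (rule ccontr)
      assume "b \<noteq> 0"
      with assms[of "- (a + 1) / (2 * b)"] True show False by (simp add: field_simps)
    qed
    with True show ?thesis by simp
  next
    case False
    have c: "0 < c"
    proof (rule ccontr)
      assume "\<not> 0 < c"
      with False have "c < 0" by simp
      \<comment> \<open>Adding the inequalities at \<open>s\<close> and \<open>- s\<close> removes
        the linear term, and this \<open>s \<ge> 1\<close> makes \<open>s\<^sup>2 * c\<close>
        smaller than \<open>- a\<close>.\<close>
      define s where "s = (a + \<bar>b\<bar> + 1) / (- c) + 1"
      have s1: "s \<ge> 1" using a \<open>c < 0\<close> unfolding s_def by (simp add: divide_nonneg_neg)
      have sc: "- c * s = a + \<bar>b\<bar> + 1 - c" using \<open>c < 0\<close> unfolding s_def by (simp add: field_simps)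
      have "0 \<le> a + 2 * s * b + s\<^sup>2 * c" "0 \<le> a + 2 * (-s) * b + (-s)\<^sup>2 * c" using assms by blast+
      then have "0 \<le> a + s\<^sup>2 * c" by simp
      moreover have "s\<^sup>2 * c = - (s * (a + \<bar>b\<bar> + 1 - c))" unfolding sc[symmetric] by (simp add: power2_eq_square)
      moreover have "s * (a + \<bar>b\<bar> + 1 - c) \<ge> 1 * (a + \<bar>b\<bar> + 1 - c)"
        using s1 a \<open>c < 0\<close> by (intro mult_right_mono) auto
      ultimately show False using \<open>c < 0\<close> by simp
    qed
    have "0 \<le> a + 2 * (- b / c) * b + (- b / c)\<^sup>2 * c" by (rule assms)
    also have "\<dots> = a - b\<^sup>2 / c" using c by (simp add: field_simps power2_eq_square)
    finally show ?thesis using c by (simp add: field_simps)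
  qed
qed

section \<open>Square-integrable functions and their semi-inner product\<close>

definition L2 :: "'a measure \<Rightarrow> ('a \<Rightarrow> real) set" where
  "L2 M = {f \<in> borel_measurable M. integrable M (\<lambda>x. (f x)\<^sup>2)}"

text \<open>Functions are not identified up to null sets, so this form is only positive
  semi-definite.\<close>

definition ip :: "'a measure \<Rightarrow> ('a \<Rightarrow> real) \<Rightarrow> ('a \<Rightarrow> real) \<Rightarrow> real" where
  "ip M f g = (\<integral>x. f x * g x \<partial>M)"

lemma L2_measurable: "f \<in> L2 M \<Longrightarrow> f \<in> borel_measurable M"
  by (simp add: L2_def)

lemma L2_integrable_mult:
  assumes "f \<in> L2 M" "g \<in> L2 M" shows "integrable M (\<lambda>x. f x * g x)"
proof (rule Bochner_Integration.integrable_bound)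
  show "integrable M (\<lambda>x. (f x)\<^sup>2 + (g x)\<^sup>2)" using assms by (simp add: L2_def)
  show "(\<lambda>x. f x * g x) \<in> borel_measurable M" using assms by (auto simp: L2_def)
  have "\<bar>a * b\<bar> \<le> a\<^sup>2 + b\<^sup>2" for a b :: real
  proof -
    have "0 \<le> (\<bar>a\<bar> - \<bar>b\<bar>)\<^sup>2" by simp
    then have "2 * \<bar>a * b\<bar> \<le> a\<^sup>2 + b\<^sup>2" by (simp add: power2_diff abs_mult)
    then show ?thesis using abs_ge_zero[of "a*b"] by linarith
  qed
  then show "AE x in M. norm (f x * g x) \<le> norm ((f x)\<^sup>2 + (g x)\<^sup>2)" by simp
qed

lemma L2_scale: "f \<in> L2 M \<Longrightarrow> (\<lambda>x. c * f x) \<in> L2 M"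
  by (auto simp: L2_def power_mult_distrib)

lemma L2_add:
  assumes "f \<in> L2 M" "g \<in> L2 M" shows "(\<lambda>x. f x + g x) \<in> L2 M"
  using assms L2_integrable_mult[OF assms] by (auto simp: L2_def power2_sum mult.assoc)

lemma L2_zero: "(\<lambda>x. 0) \<in> L2 M" by (simp add: L2_def)

lemma L2_sum: "(\<And>i. i \<in> A \<Longrightarrow> f i \<in> L2 M) \<Longrightarrow> (\<lambda>x. \<Sum>i\<in>A. f i x) \<in> L2 M"
  by (induction A rule: infinite_finite_induct) (auto intro!: L2_add L2_zero)

lemma ip_commute: "ip M f g = ip M g f"
  by (simp add: ip_def mult.commute)

lemma ip_add_right: "f \<in> L2 M \<Longrightarrow> g \<in> L2 M \<Longrightarrow> h \<in> L2 M \<Longrightarrow>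
  ip M f (\<lambda>x. g x + h x) = ip M f g + ip M f h"
  by (simp add: ip_def distrib_left L2_integrable_mult)

lemma ip_scale_right: "ip M f (\<lambda>x. c * g x) = c * ip M f g"
  unfolding ip_def by (simp add: mult.left_commute)

lemma ip_sum_right: "f \<in> L2 M \<Longrightarrow> (\<And>i. i \<in> A \<Longrightarrow> g i \<in> L2 M) \<Longrightarrow>
  ip M f (\<lambda>x. \<Sum>i\<in>A. g i x) = (\<Sum>i\<in>A. ip M f (g i))"
  by (induction A rule: infinite_finite_induct)
     (simp_all add: ip_add_right L2_sum, simp_all add: ip_def)

lemma ip_self_nonneg: "0 \<le> ip M f f" by (simp add: ip_def)

lemma ip_Cauchy_Schwarz:
  assumes "f \<in> L2 M" "g \<in> L2 M" shows "(ip M f g)\<^sup>2 \<le> ip M f f * ip M g g"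
proof (rule quadratic_nonneg_discriminant)
  fix t
  let ?h = "\<lambda>x. f x + t * g x"
  have L: "?h \<in> L2 M" "(\<lambda>x. t * g x) \<in> L2 M" using assms by (simp_all add: L2_add L2_scale)
  have e: "ip M u ?h = ip M u f + t * ip M u g" if "u \<in> L2 M" for u
    using ip_add_right[OF that assms(1) L(2)] ip_scale_right[of M u t g] by simp
  have "0 \<le> ip M ?h ?h" by (rule ip_self_nonneg)
  also have "\<dots> = ip M f ?h + t * ip M g ?h"
    using e[OF L(1)] ip_commute[of M ?h f] ip_commute[of M ?h g] by simp
  also have "\<dots> = ip M f f + 2 * t * ip M f g + t\<^sup>2 * ip M g g"
    using e[OF assms(1)] e[OF assms(2)] ip_commute[of M g f] by (simp add: algebra_simps power2_eq_square)
  finally show "0 \<le> ip M f f + 2 * t * ip M f g + t\<^sup>2 * ip M g g" .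
qed

text \<open>Detailed balance tested on nonnegative measurable functions rather than on sets: no
  integrability conditions arise, and the property passes directly to mixtures of kernels and to
  fibres.\<close>

definition reversible :: "'a measure \<Rightarrow> ('a \<Rightarrow> 'a measure) \<Rightarrow> bool" where
  "reversible M K \<longleftrightarrow> (\<forall>u\<in>borel_measurable M. \<forall>v\<in>borel_measurable M.
     (\<integral>\<^sup>+x. u x * (\<integral>\<^sup>+y. v y \<partial>K x) \<partial>M) = (\<integral>\<^sup>+x. v x * (\<integral>\<^sup>+y. u y \<partial>K x) \<partial>M))"

text \<open>Twice the Dirichlet form.\<close>

definition dform :: "'a measure \<Rightarrow> ('a \<Rightarrow> 'a measure) \<Rightarrow> ('a \<Rightarrow> real) \<Rightarrow> ennreal" where
  "dform M K f = (\<integral>\<^sup>+x. (\<integral>\<^sup>+y. ennreal ((f y - f x)\<^sup>2) \<partial>K x) \<partial>M)"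

text \<open>Jensen's inequality. With a nonnegative integral on the right no integrability has to be
  assumed, since that side is infinite when \<open>f\<close> is not square-integrable.\<close>

lemma (in prob_space) square_integral_le:
  fixes f :: "'a \<Rightarrow> real"
  assumes "f \<in> borel_measurable M"
  shows "ennreal ((\<integral>x. f x \<partial>M)\<^sup>2) \<le> (\<integral>\<^sup>+x. ennreal ((f x)\<^sup>2) \<partial>M)"
proof (cases "integrable M (\<lambda>x. (f x)\<^sup>2)")
  case True
  have "integrable M f" by (rule square_integrable_imp_integrable[OF assms True])
  then have "0 \<le> expectation (\<lambda>x. (f x)\<^sup>2) - (expectation f)\<^sup>2"
    using variance_positive[of f] variance_eq[OF _ True] by simp
  then show ?thesis using True by (simp add: nn_integral_eq_integral)
next
  case False
  then have "(\<integral>\<^sup>+x. ennreal ((f x)\<^sup>2) \<partial>M) = \<infinity>"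
    using assms by (auto simp: integrable_iff_bounded not_less top_unique)
  then show ?thesis by simp
qed

section \<open>Reversible kernels as self-adjoint contractions\<close>

locale reversible_kernel = prob_space M for M :: "'a measure" +
  fixes K :: "'a \<Rightarrow> 'a measure"
  assumes K_prob: "K \<in> M \<rightarrow>\<^sub>M prob_algebra M"
    and rev: "reversible M K"
begin

lemma K_meas[measurable]: "K \<in> M \<rightarrow>\<^sub>M subprob_algebra M"
  by (rule measurable_prob_algebraD[OF K_prob])

lemma K_space: assumes "x \<in> space M"
  shows "prob_space (K x)" "sets (K x) = sets M" "space (K x) = space M"
  using measurable_space[OF K_prob assms] by (auto simp: space_prob_algebra dest: sets_eq_imp_space_eq)

lemma emeasure_K_space[simp]: "x \<in> space M \<Longrightarrow> emeasure (K x) (space M) = 1"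
  using prob_space.emeasure_space_1[OF K_space(1)] by (simp add: K_space(3))

lemma measure_K_space[simp]: "x \<in> space M \<Longrightarrow> Sigma_Algebra.measure (K x) (space M) = 1"
  using prob_space.prob_space[OF K_space(1)] by (simp add: K_space(3))

lemma reversibleD: "u \<in> borel_measurable M \<Longrightarrow> v \<in> borel_measurable M \<Longrightarrow>
  (\<integral>\<^sup>+x. u x * (\<integral>\<^sup>+y. v y \<partial>K x) \<partial>M) = (\<integral>\<^sup>+x. v x * (\<integral>\<^sup>+y. u y \<partial>K x) \<partial>M)"
  using rev unfolding reversible_def by blast

lemma nn_integral_invariant:
  assumes [measurable]: "v \<in> borel_measurable M"
  shows "(\<integral>\<^sup>+x. (\<integral>\<^sup>+y. v y \<partial>K x) \<partial>M) = (\<integral>\<^sup>+x. v x \<partial>M)"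
proof -
  have "(\<integral>\<^sup>+x. (\<integral>\<^sup>+y. v y \<partial>K x) \<partial>M) = (\<integral>\<^sup>+x. v x * (\<integral>\<^sup>+y. 1 \<partial>K x) \<partial>M)"
    using reversibleD[of "\<lambda>_. 1" v] by simp
  also have "\<dots> = (\<integral>\<^sup>+x. v x \<partial>M)"
    by (intro nn_integral_cong) (simp add: K_space(3))
  finally show ?thesis .
qed

text \<open>The joint law of two consecutive states of the stationary chain. Under \<open>J\<close>
  the product \<open>u (fst z) * v (snd z)\<close> is integrable for all square-integrable
  \<open>u\<close> and \<open>v\<close>, so bilinearity is clean; \<open>kernel_op\<close> itself
  takes the default value 0 wherever its integral does not exist.\<close>

definition J :: "('a \<times> 'a) measure" where
  "J = M \<bind> (\<lambda>x. distr (K x) (M \<Otimes>\<^sub>M M) (Pair x))"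

lemma J_kernel[measurable]: "(\<lambda>x. distr (K x) (M \<Otimes>\<^sub>M M) (Pair x)) \<in> M \<rightarrow>\<^sub>M subprob_algebra (M \<Otimes>\<^sub>M M)"
  by (rule measurable_distr2[where M=M]) auto

lemma sets_J[measurable_cong]: "sets J = sets (M \<Otimes>\<^sub>M M)"
  unfolding J_def by (rule sets_bind) (auto simp: not_empty)

lemma Pair_measurable_K: "x \<in> space M \<Longrightarrow> Pair x \<in> K x \<rightarrow>\<^sub>M M \<Otimes>\<^sub>M M"
  using K_space(2)[of x] by (subst measurable_cong_sets[OF _ refl]) auto

lemma nn_integral_J:
  assumes [measurable]: "F \<in> borel_measurable (M \<Otimes>\<^sub>M M)"
  shows "(\<integral>\<^sup>+z. F z \<partial>J) = (\<integral>\<^sup>+x. (\<integral>\<^sup>+y. F (x, y) \<partial>K x) \<partial>M)"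
  unfolding J_def
  by (subst nn_integral_bind[OF _ J_kernel]) (auto simp: nn_integral_distr Pair_measurable_K intro!: nn_integral_cong)

lemma J_marginals:
  assumes [measurable]: "v \<in> borel_measurable M"
  shows "(\<integral>\<^sup>+z. v (fst z) \<partial>J) = (\<integral>\<^sup>+x. v x \<partial>M)" "(\<integral>\<^sup>+z. v (snd z) \<partial>J) = (\<integral>\<^sup>+x. v x \<partial>M)"
proof -
  show "(\<integral>\<^sup>+z. v (fst z) \<partial>J) = (\<integral>\<^sup>+x. v x \<partial>M)"
    by (subst nn_integral_J)
       (auto intro!: nn_integral_cong simp: K_space(3))
  show "(\<integral>\<^sup>+z. v (snd z) \<partial>J) = (\<integral>\<^sup>+x. v x \<partial>M)"
    by (subst nn_integral_J) (auto simp: nn_integral_invariant)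
qed

lemma L2_J:
  assumes "f \<in> L2 M"
  shows "(\<lambda>z. f (fst z)) \<in> L2 J" "(\<lambda>z. f (snd z)) \<in> L2 J"
    and "(\<integral>z. (f (fst z))\<^sup>2 \<partial>J) = ip M f f" "(\<integral>z. (f (snd z))\<^sup>2 \<partial>J) = ip M f f"
proof -
  have [measurable]: "f \<in> borel_measurable M" using assms by (simp add: L2_def)
  have i: "(\<integral>\<^sup>+x. ennreal ((f x)\<^sup>2) \<partial>M) = ennreal (ip M f f)"
    using assms by (subst nn_integral_eq_integral) (auto simp: L2_def ip_def power2_eq_square)
  have 1: "(\<integral>\<^sup>+z. ennreal ((f (fst z))\<^sup>2) \<partial>J) = ennreal (ip M f f)"
    using J_marginals(1)[of "\<lambda>x. ennreal ((f x)\<^sup>2)"] i by simp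
  have 2: "(\<integral>\<^sup>+z. ennreal ((f (snd z))\<^sup>2) \<partial>J) = ennreal (ip M f f)"
    using J_marginals(2)[of "\<lambda>x. ennreal ((f x)\<^sup>2)"] i by simp
  show "(\<lambda>z. f (fst z)) \<in> L2 J" "(\<lambda>z. f (snd z)) \<in> L2 J"
    using 1 2 by (auto simp: L2_def intro!: integrableI_nonneg)
  show "(\<integral>z. (f (fst z))\<^sup>2 \<partial>J) = ip M f f" "(\<integral>z. (f (snd z))\<^sup>2 \<partial>J) = ip M f f"
    using 1 2 by (auto simp: integral_eq_nn_integral ip_self_nonneg)
qed

lemma kernel_op_measurable[measurable]:
  "f \<in> borel_measurable M \<Longrightarrow> kernel_op K f \<in> borel_measurable M"
  unfolding kernel_op_def[abs_def]
  by (rule measurable_compose[OF K_meas integral_measurable_subprob_algebra])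

text \<open>Jensen under each \<open>K x\<close>, followed by invariance of
  \<open>M\<close>.\<close>

lemma kernel_op_L2:
  assumes "f \<in> L2 M" shows "kernel_op K f \<in> L2 M"
proof -
  have [measurable]: "f \<in> borel_measurable M" using assms by (simp add: L2_def)
  have "(\<integral>\<^sup>+x. ennreal ((kernel_op K f x)\<^sup>2) \<partial>M) \<le> (\<integral>\<^sup>+x. (\<integral>\<^sup>+y. ennreal ((f y)\<^sup>2) \<partial>K x) \<partial>M)"
    unfolding kernel_op_def
    by (intro nn_integral_mono prob_space.square_integral_le)
       (auto simp: K_space measurable_cong_sets[OF K_space(2) refl])
  also have "\<dots> = (\<integral>\<^sup>+x. ennreal ((f x)\<^sup>2) \<partial>M)"
    by (rule nn_integral_invariant) simp
  also have "\<dots> < \<infinity>" using assms by (simp add: L2_def integrable_iff_bounded)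
  finally show ?thesis by (auto simp: L2_def intro!: integrableI_nonneg)
qed

definition bf :: "('a \<Rightarrow> real) \<Rightarrow> ('a \<Rightarrow> real) \<Rightarrow> real" where
  "bf u v = (\<integral>z. u (fst z) * v (snd z) \<partial>J)"

lemma bf_ip:
  assumes "u \<in> L2 M" "v \<in> L2 M" shows "bf u v = ip M u (kernel_op K v)"
proof -
  have [measurable]: "u \<in> borel_measurable M" "v \<in> borel_measurable M" using assms by (simp_all add: L2_def)
  have i: "integrable J (\<lambda>z. u (fst z) * v (snd z))"
    by (rule L2_integrable_mult[OF L2_J(1)[OF assms(1)] L2_J(2)[OF assms(2)]])
  have "bf u v = (\<integral>x. (\<integral>z. u (fst z) * v (snd z) \<partial>distr (K x) (M \<Otimes>\<^sub>M M) (Pair x)) \<partial>M)"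
    unfolding bf_def J_def by (rule integral_bind_kernel[OF J_kernel]) (use i not_empty in \<open>auto simp: J_def\<close>)
  also have "\<dots> = ip M u (kernel_op K v)"
    unfolding ip_def kernel_op_def
    by (intro Bochner_Integration.integral_cong refl, subst integral_distr) (auto intro: Pair_measurable_K)
  finally show ?thesis .
qed

lemma bf_add_left:
  assumes "u \<in> L2 M" "u' \<in> L2 M" "v \<in> L2 M"
  shows "bf (\<lambda>x. u x + c * u' x) v = bf u v + c * bf u' v"
proof -
  have i: "integrable J (\<lambda>z. u (fst z) * v (snd z))" "integrable J (\<lambda>z. u' (fst z) * v (snd z))"
    using L2_integrable_mult[OF L2_J(1)[OF assms(1)] L2_J(2)[OF assms(3)]]
      L2_integrable_mult[OF L2_J(1)[OF assms(2)] L2_J(2)[OF assms(3)]] by simp_all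
  have "bf (\<lambda>x. u x + c * u' x) v = (\<integral>z. u (fst z) * v (snd z) + c * (u' (fst z) * v (snd z)) \<partial>J)"
    unfolding bf_def by (simp add: distrib_right mult.assoc)
  also have "\<dots> = bf u v + c * bf u' v" unfolding bf_def using i by simp
  finally show ?thesis .
qed

lemma bf_add_right:
  assumes "u \<in> L2 M" "u' \<in> L2 M" "v \<in> L2 M"
  shows "bf v (\<lambda>x. u x + c * u' x) = bf v u + c * bf v u'"
proof -
  have i: "integrable J (\<lambda>z. v (fst z) * u (snd z))" "integrable J (\<lambda>z. v (fst z) * u' (snd z))"
    using L2_integrable_mult[OF L2_J(1)[OF assms(3)] L2_J(2)[OF assms(1)]]
      L2_integrable_mult[OF L2_J(1)[OF assms(3)] L2_J(2)[OF assms(2)]] by simp_all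
  have "bf v (\<lambda>x. u x + c * u' x) = (\<integral>z. v (fst z) * u (snd z) + c * (v (fst z) * u' (snd z)) \<partial>J)"
    unfolding bf_def by (simp add: algebra_simps)
  also have "\<dots> = bf v u + c * bf v u'" unfolding bf_def using i by simp
  finally show ?thesis .
qed

lemma bf_sym_nonneg:
  assumes "u \<in> borel_measurable M" "v \<in> borel_measurable M" "\<And>x. 0 \<le> u x" "\<And>x. 0 \<le> v x"
  shows "bf u v = bf v u"
proof -
  note assms[measurable]
  have *: "(\<integral>\<^sup>+z. ennreal (u (fst z) * v (snd z)) \<partial>J) = (\<integral>\<^sup>+x. ennreal (u x) * (\<integral>\<^sup>+y. ennreal (v y) \<partial>K x) \<partial>M)"
    if m: "u \<in> borel_measurable M" "v \<in> borel_measurable M" and nn: "\<And>x. 0 \<le> u x" "\<And>x. 0 \<le> v x" for u v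
  proof -
    note m[measurable]
    have "(\<integral>\<^sup>+z. ennreal (u (fst z) * v (snd z)) \<partial>J) = (\<integral>\<^sup>+x. (\<integral>\<^sup>+y. ennreal (u x) * ennreal (v y) \<partial>K x) \<partial>M)"
      by (subst nn_integral_J) (simp_all add: ennreal_mult nn)
    also have "\<dots> = (\<integral>\<^sup>+x. ennreal (u x) * (\<integral>\<^sup>+y. ennreal (v y) \<partial>K x) \<partial>M)"
      by (intro nn_integral_cong nn_integral_cmult) (simp add: measurable_cong_sets[OF K_space(2) refl])
    finally show ?thesis .
  qed
  have e: "bf a b = enn2real (\<integral>\<^sup>+z. ennreal (a (fst z) * b (snd z)) \<partial>J)"
    if "a \<in> borel_measurable M" "b \<in> borel_measurable M" "\<And>x. 0 \<le> a x" "\<And>x. 0 \<le> b x" for a b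
    unfolding bf_def using that by (intro integral_eq_nn_integral) (auto intro!: AE_I2)
  have "(\<integral>\<^sup>+x. ennreal (u x) * (\<integral>\<^sup>+y. ennreal (v y) \<partial>K x) \<partial>M)
      = (\<integral>\<^sup>+x. ennreal (v x) * (\<integral>\<^sup>+y. ennreal (u y) \<partial>K x) \<partial>M)"
    by (rule reversibleD) simp_all
  then show ?thesis
    unfolding e[OF assms(1,2,3,4)] e[OF assms(2,1,4,3)] *[OF assms(1,2,3,4)] *[OF assms(2,1,4,3)] by simp
qed

lemma L2_pos_part: "f \<in> L2 M \<Longrightarrow> (\<lambda>x. max 0 (f x)) \<in> L2 M"
  unfolding L2_def by (auto elim!: Bochner_Integration.integrable_bound simp: max_def)

text \<open>Reversibility speaks of nonnegative functions only. Both arguments are therefore split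
  into positive and negative parts and the form is expanded bilinearly.\<close>

lemma bf_sym:
  assumes "u \<in> L2 M" "v \<in> L2 M" shows "bf u v = bf v u"
proof -
  have neg: "(\<lambda>x. - f x) \<in> L2 M" if "f \<in> L2 M" for f using L2_scale[OF that, of "-1"] by simp
  define p where "p f x = max 0 (f x)" for f :: "'a \<Rightarrow> real" and x
  define n where "n f x = max 0 (- f x)" for f :: "'a \<Rightarrow> real" and x
  have pn: "f = (\<lambda>x. p f x + (-1) * n f x)" for f by (auto simp: p_def n_def)
  have L: "p f \<in> L2 M" "n f \<in> L2 M" if "f \<in> L2 M" for f
    using L2_pos_part[OF that] L2_pos_part[OF neg[OF that]] by (simp_all add: p_def[abs_def] n_def[abs_def])
  have nn: "0 \<le> p f x" "0 \<le> n f x" for f x by (auto simp: p_def n_def)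
  have s: "bf a b = bf b a" if "a \<in> {p u, n u}" "b \<in> {p v, n v}" for a b
    using that L[OF assms(1)] L[OF assms(2)] nn
    by (intro bf_sym_nonneg) (auto simp: L2_def)
  have e: "bf u v = bf (p u) (p v) - bf (n u) (p v) - (bf (p u) (n v) - bf (n u) (n v))"
    using L[OF assms(1)] L[OF assms(2)]
    by (subst pn[of u], subst pn[of v]) (simp only: bf_add_left bf_add_right L2_add L2_scale, simp add: algebra_simps)
  have e': "bf v u = bf (p v) (p u) - bf (p v) (n u) - (bf (n v) (p u) - bf (n v) (n u))"
    using L[OF assms(1)] L[OF assms(2)]
    by (subst pn[of u], subst pn[of v]) (simp only: bf_add_left bf_add_right L2_add L2_scale, simp add: algebra_simps)
  show ?thesis unfolding e e' using s[of "p u" "p v"] s[of "n u" "p v"] s[of "p u" "n v"] s[of "n u" "n v"] by simp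
qed

lemma self_adjoint:
  assumes "u \<in> L2 M" "v \<in> L2 M"
  shows "ip M u (kernel_op K v) = ip M (kernel_op K u) v"
  using bf_ip[OF assms] bf_ip[OF assms(2,1)] bf_sym[OF assms] by (simp add: ip_commute)

text \<open>Expand the square under \<open>J\<close>, both of whose marginals are
  \<open>M\<close>.\<close>

lemma dform_eq:
  assumes "f \<in> L2 M"
  shows "dform M K f = ennreal (2 * (ip M f f - ip M f (kernel_op K f)))"
proof -
  have [measurable]: "f \<in> borel_measurable M" using assms by (simp add: L2_def)
  have i: "integrable J (\<lambda>z. (f (fst z))\<^sup>2)" "integrable J (\<lambda>z. (f (snd z))\<^sup>2)"
     "integrable J (\<lambda>z. f (fst z) * f (snd z))"
    using L2_J(1,2)[OF assms] L2_integrable_mult[OF L2_J(1)[OF assms] L2_J(2)[OF assms]]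
    by (simp_all add: L2_def)
  have e: "(\<lambda>z. (f (snd z) - f (fst z))\<^sup>2) = (\<lambda>z. (f (snd z))\<^sup>2 + (f (fst z))\<^sup>2 - 2 * (f (fst z) * f (snd z)))"
    by (auto simp: power2_diff)
  have "dform M K f = (\<integral>\<^sup>+z. ennreal ((f (snd z) - f (fst z))\<^sup>2) \<partial>J)"
    by (subst nn_integral_J) (simp_all add: dform_def)
  also have "\<dots> = ennreal (\<integral>z. (f (snd z) - f (fst z))\<^sup>2 \<partial>J)"
    by (rule nn_integral_eq_integral) (simp_all add: e i)
  also have "(\<integral>z. (f (snd z) - f (fst z))\<^sup>2 \<partial>J) = 2 * (ip M f f - bf f f)"
    unfolding e using i by (simp add: L2_J[OF assms] bf_def)
  finally show ?thesis using bf_ip[OF assms assms] by simp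
qed

lemma ip_kernel_le:
  assumes "f \<in> L2 M" shows "ip M f (kernel_op K f) \<le> ip M f f"
proof -
  have "0 \<le> (\<integral>z. (f (snd z) - f (fst z))\<^sup>2 \<partial>J)" by simp
  also have e: "(\<lambda>z. (f (snd z) - f (fst z))\<^sup>2) = (\<lambda>z. (f (snd z))\<^sup>2 + (f (fst z))\<^sup>2 - 2 * (f (fst z) * f (snd z)))"
    by (auto simp: power2_diff)
  have i: "integrable J (\<lambda>z. (f (fst z))\<^sup>2)" "integrable J (\<lambda>z. (f (snd z))\<^sup>2)"
     "integrable J (\<lambda>z. f (fst z) * f (snd z))"
    using L2_J(1,2)[OF assms] L2_integrable_mult[OF L2_J(1)[OF assms] L2_J(2)[OF assms]]
    by (simp_all add: L2_def)
  have "(\<integral>z. (f (snd z) - f (fst z))\<^sup>2 \<partial>J) = 2 * (ip M f f - bf f f)"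
    unfolding e using i by (simp add: L2_J[OF assms] bf_def)
  finally show ?thesis using bf_ip[OF assms assms] by simp
qed

text \<open>Self-adjointness tested against the constant 1, which \<open>K\<close> fixes. Hence
  \<open>kernel_op K\<close> preserves mean zero.\<close>

lemma integral_kernel_op:
  assumes "f \<in> L2 M" shows "(\<integral>x. kernel_op K f x \<partial>M) = (\<integral>x. f x \<partial>M)"
proof -
  have 1: "(\<lambda>_. 1) \<in> L2 M" by (simp add: L2_def)
  have "ip M (\<lambda>_. 1) (kernel_op K f) = ip M (kernel_op K (\<lambda>_. 1)) f" by (rule self_adjoint[OF 1 assms])
  moreover have "ip M (kernel_op K (\<lambda>_. 1)) f = (\<integral>x. f x \<partial>M)"
    unfolding ip_def by (intro Bochner_Integration.integral_cong) (auto simp: kernel_op_def K_space(3))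
  ultimately show ?thesis by (simp add: ip_def)
qed

definition Kn :: "nat \<Rightarrow> ('a \<Rightarrow> real) \<Rightarrow> 'a \<Rightarrow> real" where "Kn n = (kernel_op K ^^ n)"

lemma Kn_0[simp]: "Kn 0 f = f" and Kn_Suc: "Kn (Suc n) f = kernel_op K (Kn n f)"
  by (simp_all add: Kn_def)

lemma Kn_L2: "f \<in> L2 M \<Longrightarrow> Kn n f \<in> L2 M"
  by (induction n) (auto simp: Kn_Suc kernel_op_L2)

text \<open>For \<open>f\<close> of mean zero this is the autocovariance of the stationary chain at
  lag \<open>n\<close>.\<close>

definition cc :: "('a \<Rightarrow> real) \<Rightarrow> nat \<Rightarrow> real" where "cc f n = ip M f (Kn n f)"

lemma ip_Kn: assumes "f \<in> L2 M" shows "ip M (Kn i f) (Kn j f) = cc f (i + j)"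
proof (induction i arbitrary: j)
  case 0 show ?case by (simp add: cc_def)
next
  case (Suc i)
  have "ip M (Kn (Suc i) f) (Kn j f) = ip M (Kn i f) (Kn (Suc j) f)"
    unfolding Kn_Suc by (rule self_adjoint[symmetric]) (auto intro: Kn_L2 assms)
  with Suc.IH[of "Suc j"] show ?case by simp
qed

end

text \<open>As \<open>dform\<close> is twice \<open>ip M f f - ip M f (kernel_op K f)\<close>, the
  assumption says that \<open>kernel_op K\<close> is a positive operator. Phrased through
  \<open>dform\<close> it makes sense for every measurable function and adds up over mixtures of
  kernels.\<close>

locale positive_kernel = reversible_kernel +
  assumes pos: "\<And>f. f \<in> borel_measurable M \<Longrightarrow> dform M K f \<le> 2 * (\<integral>\<^sup>+x. ennreal ((f x)\<^sup>2) \<partial>M)"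
begin

lemma ip_kernel_nonneg:
  assumes "f \<in> L2 M" shows "0 \<le> ip M f (kernel_op K f)"
proof -
  have "(\<integral>\<^sup>+x. ennreal ((f x)\<^sup>2) \<partial>M) = ennreal (ip M f f)"
    using assms by (subst nn_integral_eq_integral) (auto simp: L2_def ip_def power2_eq_square)
  then have "ennreal (2 * (ip M f f - ip M f (kernel_op K f))) \<le> ennreal (2 * ip M f f)"
    using pos[of f] dform_eq[OF assms] assms by (simp add: L2_def ennreal_mult')
  then show ?thesis using ip_self_nonneg[of M f] by (simp add: ennreal_le_iff)
qed

lemma bf_Cauchy_Schwarz:
  assumes "f \<in> L2 M" "g \<in> L2 M"
  shows "(ip M f (kernel_op K g))\<^sup>2 \<le> ip M f (kernel_op K f) * ip M g (kernel_op K g)"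
  unfolding bf_ip[symmetric, OF assms] bf_ip[symmetric, OF assms(1,1)] bf_ip[symmetric, OF assms(2,2)]
proof (rule quadratic_nonneg_discriminant)
  fix t
  have L: "(\<lambda>x. f x + t * g x) \<in> L2 M" using assms by (simp add: L2_add L2_scale)
  have "0 \<le> bf (\<lambda>x. f x + t * g x) (\<lambda>x. f x + t * g x)"
    using ip_kernel_nonneg[OF L] bf_ip[OF L L] by simp
  also have "\<dots> = bf f f + 2 * t * bf f g + t\<^sup>2 * bf g g"
    using assms L bf_sym[of g f] by (simp add: bf_add_left bf_add_right algebra_simps power2_eq_square)
  finally show "0 \<le> bf f f + 2 * t * bf f g + t\<^sup>2 * bf g g" .
qed

text \<open>Even lags give the squared norm of \<open>Kn k f\<close>, odd lags the positive form of
  \<open>K\<close> at \<open>Kn k f\<close>.\<close>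

lemma cc_nonneg: assumes "f \<in> L2 M" shows "0 \<le> cc f n"
proof (cases "even n")
  case True
  then obtain k where "n = k + k" by (auto elim!: evenE simp: mult_2)
  then show ?thesis using ip_Kn[OF assms, of k k] ip_self_nonneg[of M "Kn k f"] by simp
next
  case False
  then obtain k where "n = k + Suc k" by (auto elim!: oddE simp: mult_2)
  then show ?thesis using ip_Kn[OF assms, of k "Suc k"] ip_kernel_nonneg[OF Kn_L2[OF assms], of k]
    by (simp add: Kn_Suc)
qed

end

section \<open>The operator norm and Rayleigh quotients\<close>

context reversible_kernel begin

lemma L20_L2: "f \<in> L20 M \<Longrightarrow> f \<in> L2 M" by (simp add: L20_def L2_def)

lemma L2_norm_sq: "(L2_norm M f)\<^sup>2 = ip M f f"
  by (simp add: L2_norm_def ip_def power2_eq_square)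

lemma L2_norm_eq: "L2_norm M f = sqrt (ip M f f)"
  by (simp add: L2_norm_def ip_def power2_eq_square)

lemma kernel_op_L20: "f \<in> L20 M \<Longrightarrow> kernel_op K f \<in> L20 M"
  using kernel_op_L2[OF L20_L2, of f] integral_kernel_op[OF L20_L2, of f]
  by (auto simp: L20_def L2_def)

lemma ip_kernel_op_self_le:
  assumes "f \<in> L2 M" shows "ip M (kernel_op K f) (kernel_op K f) \<le> ip M f f"
proof -
  have [measurable]: "f \<in> borel_measurable M" using assms by (simp add: L2_def)
  have nn: "(\<integral>\<^sup>+x. ennreal ((h x)\<^sup>2) \<partial>M) = ennreal (ip M h h)" if "h \<in> L2 M" for h
    using that by (subst nn_integral_eq_integral) (auto simp: L2_def ip_def power2_eq_square)
  have "(\<integral>\<^sup>+x. ennreal ((kernel_op K f x)\<^sup>2) \<partial>M) \<le> (\<integral>\<^sup>+x. (\<integral>\<^sup>+y. ennreal ((f y)\<^sup>2) \<partial>K x) \<partial>M)"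
    unfolding kernel_op_def
    by (intro nn_integral_mono prob_space.square_integral_le)
       (auto simp: K_space measurable_cong_sets[OF K_space(2) refl])
  also have "\<dots> = (\<integral>\<^sup>+x. ennreal ((f x)\<^sup>2) \<partial>M)"
    by (rule nn_integral_invariant) simp
  finally show ?thesis
    using nn[OF assms] nn[OF kernel_op_L2[OF assms]] by (simp add: ip_self_nonneg)
qed

text \<open>The real supremum in \<open>kernel_norm\<close> carries information only for a bounded
  set; contractivity bounds it by 1.\<close>

lemma kernel_norm_bdd: "bdd_above ((\<lambda>f. L2_norm M (kernel_op K f)) ` {f \<in> L20 M. L2_norm M f \<le> 1})"
proof (rule bdd_aboveI2)
  fix f assume "f \<in> {f \<in> L20 M. L2_norm M f \<le> 1}"
  then have "L2_norm M f \<le> 1" "f \<in> L2 M" by (auto simp: L20_L2)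
  then show "L2_norm M (kernel_op K f) \<le> 1"
    using ip_kernel_op_self_le[of f] unfolding L2_norm_eq by (meson order_trans real_sqrt_le_mono)
qed

lemma zero_L20: "(\<lambda>_. 0) \<in> {f \<in> L20 M. L2_norm M f \<le> 1}"
  by (simp add: L20_def L2_norm_def)

lemma kernel_norm_nonneg: "0 \<le> kernel_norm M K"
  unfolding kernel_norm_def
  by (rule cSUP_upper2[OF kernel_norm_bdd zero_L20]) (simp add: L2_norm_def)

lemma L2_norm_kernel_op_le:
  assumes "f \<in> L20 M" shows "L2_norm M (kernel_op K f) \<le> kernel_norm M K * L2_norm M f"
proof (cases "L2_norm M f = 0")
  \<comment> \<open>A function of norm 0 cannot be normalized, but the contraction sends it to a
    function of norm 0.\<close>
  case True
  then have "ip M f f = 0" by (simp add: L2_norm_eq ip_self_nonneg)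
  then have "ip M (kernel_op K f) (kernel_op K f) \<le> 0"
    using ip_kernel_op_self_le[OF L20_L2[OF assms]] by simp
  then show ?thesis using True by (simp add: L2_norm_eq)
next
  case False
  then have p: "0 < L2_norm M f" using ip_self_nonneg[of M f] by (simp add: L2_norm_eq less_le)
  define c where "c = 1 / L2_norm M f"
  let ?g = "\<lambda>x. c * f x"
  have c: "0 < c" using p by (simp add: c_def)
  have ns: "L2_norm M (\<lambda>x. c * h x) = c * L2_norm M h" for h
  proof -
    have "ip M (\<lambda>x. c * h x) (\<lambda>x. c * h x) = c\<^sup>2 * ip M h h"
      using ip_scale_right[of M "\<lambda>x. c * h x" c h] ip_scale_right[of M h c h]
        ip_commute[of M "\<lambda>x. c * h x" h] by (simp add: power2_eq_square)
    then show ?thesis using c by (simp add: L2_norm_eq real_sqrt_mult)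
  qed
  have "L2_norm M ?g = 1" using ns[of f] p by (simp add: c_def)
  then have g: "?g \<in> {f \<in> L20 M. L2_norm M f \<le> 1}"
    using assms L2_scale[OF L20_L2[OF assms], of c] by (simp add: L20_def L2_def)
  have k: "kernel_op K ?g = (\<lambda>x. c * kernel_op K f x)" by (simp add: kernel_op_def fun_eq_iff)
  have "L2_norm M (kernel_op K ?g) \<le> kernel_norm M K"
    unfolding kernel_norm_def by (rule cSUP_upper[OF g kernel_norm_bdd])
  then show ?thesis unfolding k ns using p by (simp add: c_def field_simps)
qed

lemma ip_kernel_le_norm:
  assumes "f \<in> L20 M" shows "ip M f (kernel_op K f) \<le> kernel_norm M K * ip M f f"
proof -
  note L = L20_L2[OF assms]
  have "\<bar>ip M f (kernel_op K f)\<bar> \<le> L2_norm M f * L2_norm M (kernel_op K f)"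
    using real_sqrt_le_mono[OF ip_Cauchy_Schwarz[OF L kernel_op_L2[OF L]]]
    by (simp add: L2_norm_eq real_sqrt_mult)
  also have "\<dots> \<le> L2_norm M f * (kernel_norm M K * L2_norm M f)"
    by (intro mult_left_mono L2_norm_kernel_op_le assms) (simp add: L2_norm_def)
  also have "\<dots> = kernel_norm M K * ip M f f"
    using L2_norm_sq[of f] by (simp add: power2_eq_square)
  finally show ?thesis by simp
qed

end

context positive_kernel begin

text \<open>For a positive operator the Rayleigh quotients control the norm. Cauchy--Schwarz for the
  form of \<open>K\<close>, applied to \<open>f\<close> and \<open>?g = K f\<close>, bounds the
  fourth power of the norm of \<open>?g\<close> by the product of the two quadratic forms, hence by
  \<open>s\<^sup>2\<close> times the squared norms of \<open>f\<close> and
  \<open>?g\<close>.\<close>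

lemma kernel_norm_le:
  assumes s: "0 \<le> s" and le: "\<And>f. f \<in> L20 M \<Longrightarrow> ip M f (kernel_op K f) \<le> s * ip M f f"
  shows "kernel_norm M K \<le> s"
  unfolding kernel_norm_def
proof (rule cSUP_least)
  show "{f \<in> L20 M. L2_norm M f \<le> 1} \<noteq> {}" using zero_L20 by blast
next
  fix f assume "f \<in> {f \<in> L20 M. L2_norm M f \<le> 1}"
  then have f: "f \<in> L20 M" and n: "L2_norm M f \<le> 1" by auto
  let ?g = "kernel_op K f"
  have f1: "ip M f f \<le> 1"
    using n by (simp add: L2_norm_eq)
  have g: "?g \<in> L20 M" by (rule kernel_op_L20[OF f])
  have "(ip M ?g ?g)\<^sup>2 = (ip M f (kernel_op K ?g))\<^sup>2"
    using self_adjoint[OF L20_L2[OF f] L20_L2[OF g]] by simp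
  also have "\<dots> \<le> ip M f ?g * ip M ?g (kernel_op K ?g)"
    by (rule bf_Cauchy_Schwarz[OF L20_L2[OF f] L20_L2[OF g]])
  also have "\<dots> \<le> (s * ip M f f) * (s * ip M ?g ?g)"
    using s ip_kernel_nonneg[OF L20_L2[OF f]] ip_kernel_nonneg[OF L20_L2[OF g]]
    by (intro mult_mono le f g) (auto simp: ip_self_nonneg)
  also have "\<dots> = s\<^sup>2 * (ip M f f * ip M ?g ?g)" by (simp add: power2_eq_square)
  also have "\<dots> \<le> s\<^sup>2 * (1 * ip M ?g ?g)"
    using f1 by (intro mult_left_mono mult_right_mono) (auto simp: ip_self_nonneg)
  finally have "ip M ?g ?g * ip M ?g ?g \<le> s\<^sup>2 * ip M ?g ?g" by (simp add: power2_eq_square)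
  then have "ip M ?g ?g \<le> s\<^sup>2"
    using ip_self_nonneg[of M ?g] by (cases "ip M ?g ?g = 0") (auto simp: mult_le_cancel_right)
  then show "L2_norm M ?g \<le> s" using s by (simp add: L2_norm_eq real_le_lsqrt)
qed

section \<open>Partial Neumann sums and a variational formula\<close>

definition gs :: "('a \<Rightarrow> real) \<Rightarrow> nat \<Rightarrow> 'a \<Rightarrow> real" where "gs f n x = (\<Sum>k<n. Kn k f x)"

definition S :: "('a \<Rightarrow> real) \<Rightarrow> nat \<Rightarrow> real" where "S f n = (\<Sum>k<n. cc f k)"

lemma gs_L2: "f \<in> L2 M \<Longrightarrow> gs f n \<in> L2 M"
  unfolding gs_def[abs_def] by (intro L2_sum Kn_L2)

lemma ip_gs: "f \<in> L2 M \<Longrightarrow> g \<in> L2 M \<Longrightarrow> ip M g (gs f n) = (\<Sum>k<n. ip M g (Kn k f))"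
  unfolding gs_def[abs_def] by (intro ip_sum_right Kn_L2)

lemma S_mono: "f \<in> L2 M \<Longrightarrow> m \<le> n \<Longrightarrow> S f m \<le> S f n"
  unfolding S_def by (intro sum_mono2) (auto intro: cc_nonneg)

lemma ip_f_gs: "f \<in> L2 M \<Longrightarrow> ip M f (gs f n) = S f n"
  by (simp add: ip_gs S_def cc_def)

text \<open>The weak form of \<open>(I - K) (I + K + ... + K^(n-1)) = I - K^n\<close>.\<close>

lemma telescope_gs:
  assumes f: "f \<in> L2 M" and h: "h \<in> L2 M"
  shows "ip M h (gs f n) - ip M h (kernel_op K (gs f n)) = ip M h f - ip M h (Kn n f)"
proof -
  have "ip M h (kernel_op K (gs f n)) = ip M (kernel_op K h) (gs f n)"
    by (rule self_adjoint[OF h gs_L2[OF f]])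
  also have "\<dots> = (\<Sum>k<n. ip M (kernel_op K h) (Kn k f))"
    by (rule ip_gs[OF f kernel_op_L2[OF h]])
  also have "\<dots> = (\<Sum>k<n. ip M h (Kn (Suc k) f))"
    by (intro sum.cong refl) (simp add: Kn_Suc self_adjoint[OF h Kn_L2[OF f]])
  finally have 1: "ip M h (kernel_op K (gs f n)) = (\<Sum>k<n. ip M h (Kn (Suc k) f))" .
  have "(\<Sum>k<n. ip M h (Kn k f)) - (\<Sum>k<n. ip M h (Kn (Suc k) f)) = ip M h (Kn 0 f) - ip M h (Kn n f)"
    using sum_lessThan_telescope'[of "\<lambda>k. ip M h (Kn k f)" n] by (simp add: sum_subtractf)
  then show ?thesis using 1 ip_gs[OF f h, of n] by simp
qed

text \<open>On \<open>L2\<close> this is half of \<open>dform\<close>, as a real number.\<close>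

definition en :: "('a \<Rightarrow> real) \<Rightarrow> real" where "en g = ip M g g - ip M g (kernel_op K g)"

lemma en_gs_le:
  assumes f: "f \<in> L2 M" shows "en (gs f n) = S f n - (\<Sum>k<n. cc f (n + k))"
proof -
  have "en (gs f n) = ip M (gs f n) f - ip M (gs f n) (Kn n f)"
    unfolding en_def by (rule telescope_gs[OF f gs_L2[OF f]])
  also have "\<dots> = S f n - ip M (Kn n f) (gs f n)"
    using ip_f_gs[OF f] by (simp add: ip_commute)
  also have "ip M (Kn n f) (gs f n) = (\<Sum>k<n. cc f (n + k))"
    using ip_gs[OF f Kn_L2[OF f]] by (simp add: ip_Kn[OF f])
  finally show ?thesis .
qed

text \<open>The partial Neumann sums nearly attain the supremum of
  \<open>\<lambda>g. 2 * ip M f g - en g\<close>, which is the value of the full Neumann sum.\<close>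

lemma S_le_variational:
  assumes f: "f \<in> L2 M" shows "S f n \<le> 2 * ip M f (gs f n) - en (gs f n)"
  using en_gs_le[OF f, of n] ip_f_gs[OF f, of n] cc_nonneg[OF f] by (simp add: sum_nonneg)

text \<open>Expand the nonnegative energy of \<open>gs f n - h\<close>: telescoping evaluates the
  cross term as \<open>ip M h f\<close> up to the error \<open>ip M h (Kn n f)\<close>. Since the
  partial sums \<open>S f n\<close> are bounded, this error tends to 0.\<close>

lemma variational_le:
  assumes f: "f \<in> L2 M" and h: "h \<in> L2 M" and b: "\<And>n. S f n \<le> s"
  shows "2 * ip M f h - en h \<le> s"
proof -
  have e_nn: "0 \<le> en g" if "g \<in> L2 M" for g using ip_kernel_le[OF that] by (simp add: en_def)
  have key: "2 * ip M f h - en h \<le> s + 2 * \<bar>ip M h (Kn n f)\<bar>" for n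
  proof -
    let ?g = "gs f n"
    note g = gs_L2[OF f, of n]
    let ?d = "\<lambda>x. ?g x + (-1) * h x"
    have d: "?d \<in> L2 M" using g L2_scale[OF h, of "-1"] by (rule L2_add)
    have 1: "ip M u ?d = ip M u ?g - ip M u h" if "u \<in> L2 M" for u
      using ip_add_right[OF that g L2_scale[OF h, of "-1"]] ip_scale_right[of M u "-1" h] by simp
    have 2: "ip M ?d (kernel_op K ?d) = ip M ?g (kernel_op K ?g) - 2 * ip M h (kernel_op K ?g) + ip M h (kernel_op K h)"
      using bf_add_left[OF g h d, of "-1"] bf_add_right[OF g h g, of "-1"] bf_add_right[OF g h h, of "-1"]
        bf_sym[OF g h] bf_ip[OF d d] bf_ip[OF g g] bf_ip[OF g h] bf_ip[OF h g] bf_ip[OF h h]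
      by simp
    have "0 \<le> en ?d" by (rule e_nn[OF d])
    also have "en ?d = en ?g - 2 * (ip M h ?g - ip M h (kernel_op K ?g)) + en h"
      using 1[OF d] 1[OF g] 1[OF h] ip_commute[of M ?d ?g] ip_commute[of M ?d h] ip_commute[of M ?g h] 2
      by (simp add: en_def)
    also have "\<dots> = en ?g - 2 * (ip M h f - ip M h (Kn n f)) + en h"
      by (simp add: telescope_gs[OF f h])
    finally have "2 * ip M h f - en h \<le> en ?g + 2 * ip M h (Kn n f)" by simp
    moreover have "en ?g \<le> s"
      using en_gs_le[OF f, of n] b[of n] sum_nonneg[of "{..<n}" "\<lambda>k. cc f (n + k)"] cc_nonneg[OF f] by simp
    ultimately show ?thesis by (simp add: ip_commute[of M f h])
  qed
  \<comment> \<open>Nonnegative terms with bounded partial sums: so \<open>cc f n\<close> tends to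
    0, and with it \<open>cc f (n + n)\<close>, the squared norm of \<open>Kn n f\<close>.\<close>
  have "summable (cc f)"
    by (rule summableI_nonneg_bounded[where x=s]) (use b cc_nonneg[OF f] in \<open>auto simp: S_def\<close>)
  then have "cc f \<longlonglongrightarrow> 0" by (rule summable_LIMSEQ_zero)
  then have z: "(\<lambda>n. cc f (n + n)) \<longlonglongrightarrow> 0"
    by (rule LIMSEQ_subseq_LIMSEQ[of "cc f" 0 "\<lambda>n. n + n", unfolded comp_def]) (simp add: strict_mono_def)
  have "(\<lambda>n. sqrt (ip M h h * cc f (n + n))) \<longlonglongrightarrow> sqrt (ip M h h * 0)"
    by (intro tendsto_intros z)
  then have "(\<lambda>n. s + 2 * sqrt (ip M h h * cc f (n + n))) \<longlonglongrightarrow> s + 2 * sqrt (ip M h h * 0)"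
    by (intro tendsto_add tendsto_mult tendsto_const)
  moreover have "2 * ip M f h - en h \<le> s + 2 * sqrt (ip M h h * cc f (n + n))" for n
  proof -
    have "\<bar>ip M h (Kn n f)\<bar> \<le> sqrt (ip M h h * cc f (n + n))"
      using real_sqrt_le_mono[OF ip_Cauchy_Schwarz[OF h Kn_L2[OF f, of n]]] by (simp add: ip_Kn[OF f])
    with key[of n] show ?thesis by linarith
  qed
  ultimately have "2 * ip M f h - en h \<le> s + 2 * sqrt (ip M h h * 0)"
    by (intro tendsto_lowerbound[where F=sequentially]) auto
  then show ?thesis by simp
qed

end

text \<open>The near-maximizer for \<open>B\<close>, divided by \<open>\<kappa>\<close>, is the test
  function for \<open>A\<close>. The division makes the linear and the quadratic term scale alike,
  so that a common factor \<open>\<kappa>\<close> comes out.\<close>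

lemma Neumann_sum_comparison:
  assumes A: "positive_kernel M A" and B: "positive_kernel M B" and \<kappa>: "0 < \<kappa>"
    and le: "\<And>g. g \<in> L2 M \<Longrightarrow> positive_kernel.en M A g \<le> \<kappa> * positive_kernel.en M B g"
    and f: "f \<in> L2 M" and s: "\<And>n. positive_kernel.S M A f n \<le> s"
  shows "positive_kernel.S M B f n \<le> \<kappa> * s"
proof -
  interpret A: positive_kernel M A by fact
  interpret B: positive_kernel M B by fact
  let ?h = "\<lambda>x. (1 / \<kappa>) * B.gs f n x"
  note g = B.gs_L2[OF f, of n]
  have h: "?h \<in> L2 M" using g by (rule L2_scale)
  have sc: "A.en (\<lambda>x. c * u x) = c\<^sup>2 * A.en u" if "u \<in> L2 M" for u c
  proof -
    have k: "kernel_op A (\<lambda>x. c * u x) = (\<lambda>x. c * kernel_op A u x)" by (simp add: kernel_op_def fun_eq_iff)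
    have q: "ip M (\<lambda>x. c * u x) (\<lambda>x. c * v x) = c\<^sup>2 * ip M u v" for v
      using ip_scale_right[of M "\<lambda>x. c * u x" c v] ip_scale_right[of M v c u]
        ip_commute[of M "\<lambda>x. c * u x" v] ip_commute[of M u v] by (simp add: power2_eq_square)
    show ?thesis unfolding A.en_def k q by (simp add: algebra_simps)
  qed
  have "B.S f n \<le> 2 * ip M f (B.gs f n) - B.en (B.gs f n)" by (rule B.S_le_variational[OF f])
  also have "\<dots> \<le> 2 * ip M f (B.gs f n) - A.en (B.gs f n) / \<kappa>"
    using le[OF g] \<kappa> by (simp add: field_simps)
  also have "\<dots> = \<kappa> * (2 * ip M f ?h - A.en ?h)"
    unfolding sc[OF g] ip_scale_right using \<kappa> by (simp add: field_simps power2_eq_square)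
  also have "\<dots> \<le> \<kappa> * s"
    using A.variational_le[OF f h s] \<kappa> by simp
  finally show ?thesis .
qed

section \<open>The stationary chain and its autocovariances\<close>

context reversible_kernel begin

lemma chain_step_kernel: "chain_step M K i \<in> PiM {0..<i} (\<lambda>_. M) \<rightarrow>\<^sub>M subprob_algebra M"
proof (cases i)
  case 0
  have "chain_step M K 0 = (\<lambda>_. M)" by (auto simp: chain_step_def)
  then show ?thesis using 0 by (simp add: M_in_subprob)
next
  case (Suc m)
  have "(\<lambda>x. K (x m)) \<in> PiM {0..<i} (\<lambda>_. M) \<rightarrow>\<^sub>M subprob_algebra M"
    by (rule measurable_compose[of "\<lambda>x. x m" _ M K, OF _ K_meas]) (simp add: Suc)
  then show ?thesis using Suc by (simp add: chain_step_def[abs_def])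
qed

lemma Ionescu_Tulcea_chain: "Ionescu_Tulcea (chain_step M K) (\<lambda>_. M)"
proof -
  have "prob_space (chain_step M K i x)" if "x \<in> space (PiM {0..<i} (\<lambda>_. M))" for i x
    using that by (cases i) (auto simp: chain_step_def prob_space_axioms space_PiM intro!: K_space(1))
  then show ?thesis unfolding Ionescu_Tulcea_def using chain_step_kernel by blast
qed

interpretation IT: Ionescu_Tulcea "chain_step M K" "\<lambda>_. M" by (rule Ionescu_Tulcea_chain)

lemma chain_law_lim: "chain_law M K = IT.PF.lim" by (simp add: chain_law_def)

lemma sets_chain_law[measurable_cong]: "sets (chain_law M K) = sets (PiM UNIV (\<lambda>_. M))"
  unfolding chain_law_lim by (rule IT.PF.sets_lim)

text \<open>Reduces statements about finitely many times to the finite-dimensional law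
  \<open>IT.C 0 n\<close>. On an initial segment of times the restriction inside
  \<open>IT.CI\<close> is the identity.\<close>

lemma nn_integral_chain_prefix:
  assumes [measurable]: "G \<in> borel_measurable (PiM {0..<n} (\<lambda>_. M))"
  shows "(\<integral>\<^sup>+X. G (restrict X {0..<n}) \<partial>chain_law M K) = (\<integral>\<^sup>+x. G x \<partial>IT.C 0 n (\<lambda>_. undefined))"
proof -
  have u: "IT.up_to {0..<n} = n"
    by (rule antisym) (use IT.up_to_iff[of "{0..<n}" n] IT.up_to[of "{0..<n}"] in auto)
  have [simp]: "(\<lambda>_. undefined) \<in> space (PiM {0..<0::nat} (\<lambda>_. M))" by (simp add: space_PiM)
  have r: "(\<lambda>X. restrict X {0..<n}) \<in> chain_law M K \<rightarrow>\<^sub>M PiM {0..<n} (\<lambda>_. M)"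
    by (subst measurable_cong_sets[OF sets_chain_law refl]) (auto intro!: measurable_restrict)
  have C: "IT.CI {0..<n} = IT.C 0 n (\<lambda>_. undefined)"
  proof -
    have "IT.CI {0..<n} = distr (IT.C 0 n (\<lambda>_. undefined)) (IT.C 0 n (\<lambda>_. undefined)) (\<lambda>x. x)"
      unfolding IT.CI_def u
      by (rule distr_cong) (auto simp: IT.sets_C IT.space_C space_PiM)
    then show ?thesis by (simp add: distr_id2)
  qed
  have "(\<integral>\<^sup>+X. G (restrict X {0..<n}) \<partial>chain_law M K)
      = (\<integral>\<^sup>+x. G x \<partial>distr (chain_law M K) (PiM {0..<n} (\<lambda>_. M)) (\<lambda>X. restrict X {0..<n}))"
    by (subst nn_integral_distr[OF r]) simp_all
  also have "\<dots> = (\<integral>\<^sup>+x. G x \<partial>IT.C 0 n (\<lambda>_. undefined))"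
    unfolding chain_law_lim IT.distr_lim[OF finite_atLeastLessThan] C ..
  finally show ?thesis .
qed

lemma prob_space_chain: "prob_space (chain_law M K)"
proof -
  have "prob_space (IT.C 0 0 (\<lambda>_. undefined))" by (rule IT.prob_space_C) (simp add: space_PiM)
  then have "(\<integral>\<^sup>+x. 1 \<partial>IT.C 0 0 (\<lambda>_. undefined)) = 1"
    using prob_space.emeasure_space_1 by (simp del: IT.C.simps)
  then have "(\<integral>\<^sup>+X. 1 \<partial>chain_law M K) = 1"
    using nn_integral_chain_prefix[of "\<lambda>_. 1" 0] by (simp del: IT.C.simps nn_integral_const)
  then show ?thesis by (intro prob_spaceI) simp
qed

lemma chain_component[measurable]: "(\<lambda>X. X n) \<in> chain_law M K \<rightarrow>\<^sub>M M"
  by (subst measurable_cong_sets[OF sets_chain_law refl]) simp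

text \<open>The Markov property for the pair of times \<open>s\<close> and \<open>Suc t\<close>: the
  last kernel of the construction is integrated out, and it depends on the past only through the
  coordinate \<open>t\<close>.\<close>

lemma nn_integral_chain_step:
  assumes F[measurable]: "F \<in> borel_measurable (M \<Otimes>\<^sub>M M)" and st: "s \<le> t"
  shows "(\<integral>\<^sup>+X. F (X s, X (Suc t)) \<partial>chain_law M K)
       = (\<integral>\<^sup>+X. (\<integral>\<^sup>+y. F (X s, y) \<partial>K (X t)) \<partial>chain_law M K)"
proof -
  let ?P = "\<lambda>n. PiM {0..<n} (\<lambda>_. M)"
  let ?u = "\<lambda>_::nat. undefined :: 'a"
  have u[simp]: "?u \<in> space (?P 0)" by (simp add: space_PiM)
  have m1[measurable]: "(\<lambda>x. F (x s, x (Suc t))) \<in> borel_measurable (?P (Suc (Suc t)))"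
    by (rule measurable_compose[OF measurable_Pair F]) (use st in \<open>auto intro!: measurable_component_singleton\<close>)
  have km: "(\<lambda>x. K (x t)) \<in> ?P (Suc t) \<rightarrow>\<^sub>M subprob_algebra M"
    by (rule measurable_compose[of "\<lambda>x. x t" _ M K, OF _ K_meas]) simp
  have m2: "(\<lambda>x. \<integral>\<^sup>+y. F (x s, y) \<partial>K (x t)) \<in> borel_measurable (?P (Suc t))"
  proof (rule nn_integral_measurable_subprob_algebra2[OF _ km])
    show "(\<lambda>(x, y). F (x s, y)) \<in> borel_measurable (?P (Suc t) \<Otimes>\<^sub>M M)"
      unfolding split_beta'
      by (rule measurable_compose[OF measurable_Pair F])
         (use st in \<open>auto intro!: measurable_compose[OF measurable_fst measurable_component_singleton]\<close>)
  qed
  have "(\<integral>\<^sup>+X. F (X s, X (Suc t)) \<partial>chain_law M K) = (\<integral>\<^sup>+x. F (x s, x (Suc t)) \<partial>IT.C 0 (Suc (Suc t)) ?u)"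
    using nn_integral_chain_prefix[OF m1] st by simp
  also have "\<dots> = (\<integral>\<^sup>+x. (\<integral>\<^sup>+z. F (z s, z (Suc t)) \<partial>IT.eP (Suc t) x) \<partial>IT.C 0 (Suc t) ?u)"
  proof -
    have e: "IT.eP (Suc t) \<in> IT.C 0 (Suc t) ?u \<rightarrow>\<^sub>M subprob_algebra (?P (Suc (Suc t)))"
      by (subst measurable_cong_sets[OF IT.sets_C[OF u] refl]) (use IT.measurable_eP[of "Suc t"] in simp)
    show ?thesis using nn_integral_bind[OF m1 e] by simp
  qed
  also have "\<dots> = (\<integral>\<^sup>+x. (\<integral>\<^sup>+y. F (x s, y) \<partial>K (x t)) \<partial>IT.C 0 (Suc t) ?u)"
  proof (rule nn_integral_cong)
    fix x assume "x \<in> space (IT.C 0 (Suc t) ?u)"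
    then have x: "x \<in> space (?P (Suc t))" using IT.space_C[OF u, of "Suc t"] by simp
    show "(\<integral>\<^sup>+z. F (z s, z (Suc t)) \<partial>IT.eP (Suc t) x) = (\<integral>\<^sup>+y. F (x s, y) \<partial>K (x t))"
      using IT.nn_integral_eP[OF x m1] st by (simp add: chain_step_def)
  qed
  also have "\<dots> = (\<integral>\<^sup>+X. (\<integral>\<^sup>+y. F (X s, y) \<partial>K (X t)) \<partial>chain_law M K)"
    using nn_integral_chain_prefix[OF m2] st by simp
  finally show ?thesis .
qed

lemma nn_integral_chain_marginal:
  assumes v[measurable]: "v \<in> borel_measurable M"
  shows "(\<integral>\<^sup>+X. v (X n) \<partial>chain_law M K) = (\<integral>\<^sup>+x. v x \<partial>M)"
  using v
proof (induction n arbitrary: v)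
  case (0 v)
  note v[measurable] = 0
  let ?u = "\<lambda>_::nat. undefined :: 'a"
  have u[simp]: "?u \<in> space (PiM {0..<0} (\<lambda>_. M))" by (simp add: space_PiM)
  have m1[measurable]: "(\<lambda>x. v (x 0)) \<in> borel_measurable (PiM {0..<Suc 0} (\<lambda>_. M))"
    by (rule measurable_compose[of "\<lambda>x. x 0" _ M v, OF _ v]) simp
  have "(\<integral>\<^sup>+X. v (X 0) \<partial>chain_law M K) = (\<integral>\<^sup>+x. v (x 0) \<partial>IT.C 0 (Suc 0) ?u)"
    using nn_integral_chain_prefix[OF m1] by simp
  also have "\<dots> = (\<integral>\<^sup>+z. v (z 0) \<partial>IT.eP 0 ?u)"
    using bind_return[OF IT.measurable_eP u] by (simp add: atLeastLessThan0)
  also have "\<dots> = (\<integral>\<^sup>+x. v x \<partial>M)"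
    using IT.nn_integral_eP[OF u m1] by (simp add: chain_step_def)
  finally show ?case .
next
  case (Suc n v)
  note v[measurable] = Suc.prems
  have K1: "(\<lambda>x. \<integral>\<^sup>+y. v y \<partial>K x) \<in> borel_measurable M"
    by (rule measurable_compose[OF K_meas nn_integral_measurable_subprob_algebra[OF v]])
  have "(\<integral>\<^sup>+X. v (X (Suc n)) \<partial>chain_law M K) = (\<integral>\<^sup>+X. (\<integral>\<^sup>+y. v y \<partial>K (X n)) \<partial>chain_law M K)"
    using nn_integral_chain_step[of "\<lambda>z. v (snd z)" n n] by simp
  also have "\<dots> = (\<integral>\<^sup>+x. (\<integral>\<^sup>+y. v y \<partial>K x) \<partial>M)"
    by (rule Suc.IH[OF K1])
  finally show ?case by (simp add: nn_integral_invariant)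
qed

lemma distr_chain: "distr (chain_law M K) M (\<lambda>X. X n) = M"
proof (rule measure_eqI)
  fix A assume "A \<in> sets (distr (chain_law M K) M (\<lambda>X. X n))"
  then have A[measurable]: "A \<in> sets M" by simp
  have "emeasure (distr (chain_law M K) M (\<lambda>X. X n)) A = (\<integral>\<^sup>+X. indicator A (X n) \<partial>chain_law M K)"
    by (simp add: nn_integral_distr flip: nn_integral_indicator)
  also have "\<dots> = emeasure M A" by (subst nn_integral_chain_marginal) simp_all
  finally show "emeasure (distr (chain_law M K) M (\<lambda>X. X n)) A = emeasure M A" .
qed simp

lemma integral_chain_marginal:
  fixes f :: "'a \<Rightarrow> real"
  assumes [measurable]: "f \<in> borel_measurable M"
  shows "(\<integral>X. f (X n) \<partial>chain_law M K) = (\<integral>x. f x \<partial>M)"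
    and "integrable M f \<Longrightarrow> integrable (chain_law M K) (\<lambda>X. f (X n))"
  using integral_distr[of "\<lambda>X. X n" "chain_law M K" M f] integrable_distr_eq[of "\<lambda>X. X n" "chain_law M K" M f]
  by (simp_all add: distr_chain)

lemma L2_chain:
  assumes "f \<in> L2 M" shows "(\<lambda>X. f (X n)) \<in> L2 (chain_law M K)"
proof -
  have m[measurable]: "f \<in> borel_measurable M" using assms by (simp add: L2_def)
  show ?thesis
    using assms integral_chain_marginal(2)[of "\<lambda>x. (f x)\<^sup>2" n]
      measurable_compose[OF chain_component m] by (simp add: L2_def)
qed

text \<open>The Markov property above concerns nonnegative integrands. For signed ones it is recast
  as a composition \<open>R (Suc t) = R t \<bind> \<kappa>\<close> of joint laws, to which
  \<open>integral_bind_kernel\<close> applies.\<close>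

lemma integral_chain_step:
  assumes u: "u \<in> L2 M" and v: "v \<in> L2 M" and st: "s \<le> t"
  shows "(\<integral>X. u (X s) * v (X (Suc t)) \<partial>chain_law M K)
       = (\<integral>X. u (X s) * kernel_op K v (X t) \<partial>chain_law M K)"
proof -
  have [measurable]: "u \<in> borel_measurable M" "v \<in> borel_measurable M" using u v by (simp_all add: L2_def)
  let ?c = "chain_law M K"
  define R where "R t = distr ?c (M \<Otimes>\<^sub>M M) (\<lambda>X. (X s, X t))" for t
  define \<kappa> where "\<kappa> z = distr (K (snd z)) (M \<Otimes>\<^sub>M M) (Pair (fst z))" for z
  have pm[measurable]: "(\<lambda>X. (X s, X t)) \<in> ?c \<rightarrow>\<^sub>M M \<Otimes>\<^sub>M M" for t by simp
  have km[measurable]: "(\<lambda>z. K (snd z)) \<in> M \<Otimes>\<^sub>M M \<rightarrow>\<^sub>M subprob_algebra M"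
    by (rule measurable_compose[OF measurable_snd K_meas])
  have k: "\<kappa> \<in> M \<Otimes>\<^sub>M M \<rightarrow>\<^sub>M subprob_algebra (M \<Otimes>\<^sub>M M)"
    unfolding \<kappa>_def[abs_def] by (rule measurable_distr2[OF _ km]) simp
  have kR: "\<kappa> \<in> R t \<rightarrow>\<^sub>M subprob_algebra (M \<Otimes>\<^sub>M M)"
    using k by (simp add: R_def)
  have neR: "space (R t) \<noteq> {}" using not_empty by (simp add: R_def space_pair_measure)
  have int_k: "(\<integral>\<^sup>+w. F w \<partial>\<kappa> z) = (\<integral>\<^sup>+y. F (fst z, y) \<partial>K (snd z))"
    if "F \<in> borel_measurable (M \<Otimes>\<^sub>M M)" "z \<in> space (M \<Otimes>\<^sub>M M)" for F z
    using that unfolding \<kappa>_def by (subst nn_integral_distr) (auto simp: space_pair_measure Pair_measurable_K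
        measurable_cong_sets[OF K_space(2) refl])
  have RR: "R (Suc t) = R t \<bind> \<kappa>"
  proof (rule measure_eqI)
    show sb: "sets (R (Suc t)) = sets (R t \<bind> \<kappa>)"
      by (subst sets_bind[OF _ neR, where N="M \<Otimes>\<^sub>M M"]) (auto simp: \<kappa>_def R_def)
    fix A assume "A \<in> sets (R (Suc t))"
    then have A[measurable]: "A \<in> sets (M \<Otimes>\<^sub>M M)" by (simp add: R_def)
    have km2: "(\<lambda>z. \<integral>\<^sup>+w. indicator A w \<partial>\<kappa> z) \<in> borel_measurable (M \<Otimes>\<^sub>M M)"
      by (rule measurable_compose[OF k nn_integral_measurable_subprob_algebra]) simp
    have "emeasure (R (Suc t)) A = (\<integral>\<^sup>+X. indicator A (X s, X (Suc t)) \<partial>?c)"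
      unfolding R_def by (simp add: nn_integral_distr[OF pm] flip: nn_integral_indicator)
    also have "\<dots> = (\<integral>\<^sup>+X. (\<integral>\<^sup>+y. indicator A (X s, y) \<partial>K (X t)) \<partial>?c)"
      by (rule nn_integral_chain_step[OF _ st]) simp
    also have "\<dots> = (\<integral>\<^sup>+X. (\<integral>\<^sup>+w. indicator A w \<partial>\<kappa> (X s, X t)) \<partial>?c)"
      using measurable_space[OF pm[of t]] by (intro nn_integral_cong) (simp add: int_k del: nn_integral_indicator)
    also have "\<dots> = (\<integral>\<^sup>+z. (\<integral>\<^sup>+w. indicator A w \<partial>\<kappa> z) \<partial>R t)"
      unfolding R_def using km2 by (subst nn_integral_distr[OF pm]) simp_all
    also have "\<dots> = (\<integral>\<^sup>+w. indicator A w \<partial>(R t \<bind> \<kappa>))"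
      by (rule nn_integral_bind[OF _ kR, symmetric]) simp
    also have "\<dots> = emeasure (R t \<bind> \<kappa>) A"
      using sb A by (subst nn_integral_indicator) (auto simp: R_def)
    finally show "emeasure (R (Suc t)) A = emeasure (R t \<bind> \<kappa>) A" .
  qed
  let ?F = "\<lambda>z. u (fst z) * v (snd z)"
  have "integrable (R (Suc t)) ?F"
    unfolding R_def using L2_integrable_mult[OF L2_chain[OF u, of s] L2_chain[OF v, of "Suc t"]]
    by (subst integrable_distr_eq[OF pm]) simp_all
  then have i: "integrable (R t \<bind> \<kappa>) ?F" unfolding RR .
  have "(\<integral>X. u (X s) * v (X (Suc t)) \<partial>?c) = (\<integral>z. ?F z \<partial>R (Suc t))"
    unfolding R_def by (subst integral_distr[OF pm]) simp_all
  also have "\<dots> = (\<integral>z. (\<integral>w. ?F w \<partial>\<kappa> z) \<partial>R t)"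
    unfolding RR by (rule integral_bind_kernel(3)[OF kR neR i])
  also have "\<dots> = (\<integral>z. u (fst z) * kernel_op K v (snd z) \<partial>R t)"
  proof (intro Bochner_Integration.integral_cong refl)
    fix z assume "z \<in> space (R t)"
    then have z: "fst z \<in> space M" "snd z \<in> space M" by (auto simp: R_def space_pair_measure)
    have "Pair (fst z) \<in> K (snd z) \<rightarrow>\<^sub>M M \<Otimes>\<^sub>M M"
      using z by (subst measurable_cong_sets[OF K_space(2) refl]) simp_all
    from integral_distr[OF this, of ?F]
    have "(\<integral>w. ?F w \<partial>\<kappa> z) = (\<integral>y. ?F (fst z, y) \<partial>K (snd z))"
      unfolding \<kappa>_def by measurable
    then show "(\<integral>w. ?F w \<partial>\<kappa> z) = u (fst z) * kernel_op K v (snd z)"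
      by (simp add: kernel_op_def)
  qed
  also have "\<dots> = (\<integral>X. u (X s) * kernel_op K v (X t) \<partial>?c)"
    unfolding R_def by (subst integral_distr[OF pm]) simp_all
  finally show ?thesis .
qed

lemma integral_chain_product:
  assumes u: "u \<in> L2 M" and v: "v \<in> L2 M"
  shows "(\<integral>X. u (X s) * v (X (s + k)) \<partial>chain_law M K) = ip M u (Kn k v)"
  using v
proof (induction k arbitrary: v)
  case (0 v)
  then show ?case
    using integral_chain_marginal(1)[OF borel_measurable_times[OF L2_measurable[OF u] L2_measurable[of v]], of s]
    by (simp add: ip_def)
next
  case (Suc k v)
  have "Kn k (kernel_op K v) = Kn (Suc k) v" for k
    by (simp add: Kn_def funpow_swap1)
  then show ?case
    using integral_chain_step[OF u Suc.prems, of s "s + k"] Suc.IH[OF kernel_op_L2[OF Suc.prems]] by simp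
qed

end

lemma sum_upto_Suc: "(\<Sum>s=1..Suc t. g s) = (\<Sum>s=1..t. g s) + (g (Suc t) :: real)"
  by simp

text \<open>The supremum may be infinite. For the lower bound the first \<open>n\<close> terms are
  discarded and the others replaced by \<open>b n\<close>, at the cost of the factor
  \<open>1 - n / t\<close>, which tends to 1.\<close>

lemma Cesaro_mono:
  fixes b :: "nat \<Rightarrow> real"
  assumes b: "incseq b" and nn: "\<And>n. 0 \<le> b n"
  shows "(\<lambda>t. ereal ((\<Sum>j<t. b j) / real t)) \<longlonglongrightarrow> (SUP n. ereal (b n))"
proof (rule order_tendstoI)
  fix y assume "y > (SUP n. ereal (b n))"
  moreover have "ereal ((\<Sum>j<t. b j) / real t) \<le> (SUP n. ereal (b n))" for t
  proof (cases "t = 0")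
    case True
    then show ?thesis by (intro SUP_upper2[of 0]) (auto simp: nn)
  next
    case False
    have "(\<Sum>j<t. b j) \<le> (\<Sum>j<t. b t)" by (intro sum_mono) (auto intro: incseqD[OF b])
    then have "(\<Sum>j<t. b j) / real t \<le> b t" using False by (simp add: field_simps)
    then show ?thesis by (intro SUP_upper2[of t]) auto
  qed
  ultimately show "\<forall>\<^sub>F t in sequentially. ereal ((\<Sum>j<t. b j) / real t) < y"
    by (intro always_eventually allI) (rule le_less_trans)
next
  fix y assume "y < (SUP n. ereal (b n))"
  then obtain n where n: "y < ereal (b n)" by (auto simp: less_SUP_iff)
  have "(\<lambda>t. (1 - real n / real t) * b n) \<longlonglongrightarrow> (1 - 0) * b n"
    by (intro tendsto_intros lim_const_over_n)
  then have "(\<lambda>t. ereal ((1 - real n / real t) * b n)) \<longlonglongrightarrow> ereal (b n)" by simp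
  from order_tendstoD(1)[OF this n]
  have "\<forall>\<^sub>F t in sequentially. y < ereal ((1 - real n / real t) * b n)" .
  moreover have "\<forall>\<^sub>F t in sequentially. n < t" by (rule eventually_gt_at_top)
  ultimately show "\<forall>\<^sub>F t in sequentially. y < ereal ((\<Sum>j<t. b j) / real t)"
  proof eventually_elim
    fix t assume y: "y < ereal ((1 - real n / real t) * b n)" and t: "n < t"
    have "(real t - real n) * b n = (\<Sum>j\<in>{n..<t}. b n)" using t by (simp add: of_nat_diff)
    also have "\<dots> \<le> (\<Sum>j\<in>{n..<t}. b j)" by (intro sum_mono) (auto intro: incseqD[OF b])
    also have "\<dots> \<le> (\<Sum>j<t. b j)" by (intro sum_mono2) (auto simp: nn)
    finally have "(real t - real n) * b n / real t \<le> (\<Sum>j<t. b j) / real t"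
      by (rule divide_right_mono) simp
    moreover have "(1 - real n / real t) * b n = (real t - real n) * b n / real t"
      using t by (simp add: field_simps)
    ultimately have "(1 - real n / real t) * b n \<le> (\<Sum>j<t. b j) / real t" by simp
    then show "y < ereal ((\<Sum>j<t. b j) / real t)" using y by (meson ereal_less_eq(3) less_le_trans)
  qed
qed

context positive_kernel begin

text \<open>Appending time \<open>Suc t\<close> adds one variance \<open>cc f 0\<close> and twice
  the covariances at lags \<open>1\<close> to \<open>t\<close>, which together make
  \<open>2 * S f (Suc t) - cc f 0\<close>.\<close>

lemma variance_chain_sum:
  assumes f: "f \<in> L20 M"
  shows "prob_space.variance (chain_law M K) (\<lambda>X. \<Sum>s=1..t. f (X s)) = (\<Sum>j<t. 2 * S f (Suc j) - cc f 0)"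
proof -
  interpret C: prob_space "chain_law M K" by (rule prob_space_chain)
  note L = L20_L2[OF f]
  have m[measurable]: "f \<in> borel_measurable M" using L by (simp add: L2_def)
  have i1: "integrable M f" by (rule square_integrable_imp_integrable[OF m]) (use L in \<open>simp add: L2_def\<close>)
  have f0: "C.expectation (\<lambda>X. f (X s)) = 0" for s
    using integral_chain_marginal(1)[OF m] f by (simp add: L20_def)
  have E0: "C.expectation (\<lambda>X. \<Sum>s=1..t. f (X s)) = 0"
    by (subst Bochner_Integration.integral_sum) (simp_all add: f0 integral_chain_marginal(2)[OF m i1])
  have i: "integrable (chain_law M K) (\<lambda>X. f (X a) * f (X b))" for a b
    by (rule L2_integrable_mult[OF L2_chain[OF L] L2_chain[OF L]])
  have SL: "(\<lambda>X. \<Sum>s=1..t. f (X s)) \<in> L2 (chain_law M K)" for t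
    by (intro L2_sum L2_chain L)
  have cross: "C.expectation (\<lambda>X. (\<Sum>s=1..t. f (X s)) * f (X (Suc t))) = S f (Suc t) - cc f 0" for t
  proof -
    have "C.expectation (\<lambda>X. (\<Sum>s=1..t. f (X s)) * f (X (Suc t)))
        = (\<Sum>s=1..t. C.expectation (\<lambda>X. f (X s) * f (X (Suc t))))"
      by (simp add: sum_distrib_right i)
    also have "\<dots> = (\<Sum>s=1..t. cc f (Suc t - s))"
    proof (rule sum.cong[OF refl])
      fix s assume "s \<in> {1..t}"
      then have "Suc t = s + (Suc t - s)" by simp
      then show "C.expectation (\<lambda>X. f (X s) * f (X (Suc t))) = cc f (Suc t - s)"
        using integral_chain_product[OF L L, of s "Suc t - s"] by (simp add: cc_def)
    qed
    \<comment> \<open>By stationarity only the lag \<open>k = Suc t - s\<close> matters; as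
      \<open>s\<close> runs through \<open>1..t\<close>, so does the lag.\<close>
    also have "\<dots> = (\<Sum>k=1..t. cc f k)"
      by (rule sum.reindex_bij_witness[of _ "\<lambda>k. Suc t - k" "\<lambda>k. Suc t - k"]) auto
    also have "\<dots> = S f (Suc t) - cc f 0"
      unfolding S_def by (subst sum.lessThan_Suc_shift)
        (simp add: sum.atLeast1_atMost_eq)
    finally show ?thesis .
  qed
  have sq: "(a + b)\<^sup>2 = a\<^sup>2 + (2 * (a * b) + b * b)" for a b :: real
    by (simp add: power2_eq_square algebra_simps)
  have "C.expectation (\<lambda>X. (\<Sum>s=1..t. f (X s))\<^sup>2) = (\<Sum>j<t. 2 * S f (Suc j) - cc f 0)"
  proof (induction t)
    case (Suc t)
    have "(\<lambda>X. (\<Sum>s=1..Suc t. f (X s))\<^sup>2)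
        = (\<lambda>X. (\<Sum>s=1..t. f (X s))\<^sup>2 + (2 * ((\<Sum>s=1..t. f (X s)) * f (X (Suc t))) + f (X (Suc t)) * f (X (Suc t))))"
      by (rule ext, subst sum_upto_Suc, rule sq)
    then have "C.expectation (\<lambda>X. (\<Sum>s=1..Suc t. f (X s))\<^sup>2)
        = C.expectation (\<lambda>X. (\<Sum>s=1..t. f (X s))\<^sup>2) + (2 * (S f (Suc t) - cc f 0) + cc f 0)"
      using L2_integrable_mult[OF SL L2_chain[OF L]] SL i integral_chain_product[OF L L, of "Suc t" 0] cross[of t]
      by (simp add: L2_def cc_def)
    then show ?case using Suc.IH by simp
  qed simp
  then show ?thesis unfolding E0 by simp
qed

text \<open>By positivity the autocovariances are nonnegative, so the increments of the variance
  increase and their averages have a limit in every case, possibly infinite. Thus the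
  \<open>lim\<close> in \<open>asymp_var\<close> is a true limit.\<close>

lemma asymp_var_eq:
  assumes f: "f \<in> L20 M"
  shows "asymp_var M K f = (SUP n. ereal (2 * S f (Suc n) - cc f 0))"
proof -
  note L = L20_L2[OF f]
  have "(\<lambda>t. ereal ((\<Sum>j<t. 2 * S f (Suc j) - cc f 0) / real t)) \<longlonglongrightarrow> (SUP n. ereal (2 * S f (Suc n) - cc f 0))"
  proof (rule Cesaro_mono)
    show "incseq (\<lambda>n. 2 * S f (Suc n) - cc f 0)"
      by (intro incseq_SucI) (use S_mono[OF L] in auto)
    fix n
    have "cc f 0 \<le> S f (Suc n)"
      using S_mono[OF L, of 1 "Suc n"] by (simp add: S_def)
    then show "0 \<le> 2 * S f (Suc n) - cc f 0" using cc_nonneg[OF L, of 0] by simp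
  qed
  then show ?thesis
    unfolding asymp_var_def variance_chain_sum[OF f] by (rule limI)
qed

end

section \<open>Comparison of kernels through their Dirichlet forms\<close>

lemma energy_le_of_dform:
  assumes A: "positive_kernel M A" and B: "positive_kernel M B" and \<kappa>: "0 \<le> \<kappa>"
    and le: "\<And>g. g \<in> borel_measurable M \<Longrightarrow> dform M A g \<le> ennreal \<kappa> * dform M B g"
    and g: "g \<in> L2 M"
  shows "positive_kernel.en M A g \<le> \<kappa> * positive_kernel.en M B g"
proof -
  interpret A: positive_kernel M A by fact
  interpret B: positive_kernel M B by fact
  have nn: "0 \<le> 2 * B.en g" using B.ip_kernel_le[OF g] by (simp add: B.en_def)
  have "ennreal (2 * A.en g) \<le> ennreal \<kappa> * ennreal (2 * B.en g)"
    using le[OF L2_measurable[OF g]] unfolding A.dform_eq[OF g] B.dform_eq[OF g] A.en_def B.en_def .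
  then have "ennreal (2 * A.en g) \<le> ennreal (\<kappa> * (2 * B.en g))"
    unfolding ennreal_mult[OF \<kappa> nn] .
  then have "2 * A.en g \<le> \<kappa> * (2 * B.en g)"
    using \<kappa> nn by (subst (asm) ennreal_le_iff) (auto simp: zero_le_mult_iff)
  then show ?thesis by (simp only: mult.left_commute[of \<kappa> 2])
qed

text \<open>The asymptotic variance is \<open>2 * S - ip M f f\<close> in the limit. The sums
  compare with factor \<open>\<kappa>\<close>, the subtracted norm does not scale, and the
  difference is the term with \<open>\<kappa> - 1\<close>.\<close>

lemma asymp_var_comparison:
  assumes A: "positive_kernel M A" and B: "positive_kernel M B" and \<kappa>: "0 < \<kappa>"
    and le: "\<And>g. g \<in> borel_measurable M \<Longrightarrow> dform M A g \<le> ennreal \<kappa> * dform M B g"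
    and f: "f \<in> L20 M"
  shows "asymp_var M B f \<le> ereal \<kappa> * asymp_var M A f + ereal ((\<kappa> - 1) * (L2_norm M f)\<^sup>2)"
proof -
  interpret A: positive_kernel M A by fact
  interpret B: positive_kernel M B by fact
  note L = A.L20_L2[OF f]
  have le': "A.en g \<le> \<kappa> * B.en g" if "g \<in> L2 M" for g
    by (rule energy_le_of_dform[OF A B less_imp_le[OF \<kappa>] _ that]) (rule le)
  have c0: "A.cc f 0 = ip M f f" "B.cc f 0 = ip M f f" by (simp_all add: A.cc_def B.cc_def)
  let ?c = "ip M f f"
  show ?thesis
  proof (cases "asymp_var M A f")
    case (real r)
    have "A.S f n \<le> (r + ?c) / 2" for n
    proof -
      have "ereal (2 * A.S f (Suc n) - A.cc f 0) \<le> asymp_var M A f"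
        unfolding A.asymp_var_eq[OF f] by (rule SUP_upper) simp
      then have "A.S f (Suc n) \<le> (r + ?c) / 2" using real by (simp add: c0)
      then show ?thesis using A.S_mono[OF L, of n "Suc n"] by simp
    qed
    then have S: "B.S f n \<le> \<kappa> * ((r + ?c) / 2)" for n
      by (intro Neumann_sum_comparison[OF A B \<kappa> _ L] le')
    have "asymp_var M B f \<le> ereal (\<kappa> * r + (\<kappa> - 1) * ?c)"
      unfolding B.asymp_var_eq[OF f]
    proof (rule SUP_least)
      fix n
      show "ereal (2 * B.S f (Suc n) - B.cc f 0) \<le> ereal (\<kappa> * r + (\<kappa> - 1) * ?c)"
        using S[of "Suc n"] by (simp add: c0 algebra_simps)
    qed
    then show ?thesis using real by (simp add: A.L2_norm_sq)
  next
    case PInf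
    then show ?thesis using \<kappa> by simp
  next
    case MInf
    have "ereal (2 * A.S f (Suc 0) - A.cc f 0) \<le> asymp_var M A f"
      unfolding A.asymp_var_eq[OF f] by (rule SUP_upper) simp
    with MInf show ?thesis by simp
  qed
qed

text \<open>The bound on the Rayleigh quotients of \<open>B\<close> follows from that of
  \<open>A\<close> divided by \<open>\<kappa>\<close>; \<open>1 \<le> \<kappa>\<close> keeps the
  resulting bound on the norm nonnegative, as \<open>kernel_norm_le\<close> requires.\<close>

lemma kernel_norm_comparison:
  assumes A: "positive_kernel M A" and B: "positive_kernel M B" and \<kappa>: "1 \<le> \<kappa>"
    and le: "\<And>g. g \<in> borel_measurable M \<Longrightarrow> dform M A g \<le> ennreal \<kappa> * dform M B g"
  shows "(1 - kernel_norm M A) / \<kappa> \<le> 1 - kernel_norm M B"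
proof -
  interpret A: positive_kernel M A by fact
  interpret B: positive_kernel M B by fact
  have \<kappa>0: "0 < \<kappa>" using \<kappa> by simp
  have le': "A.en g \<le> \<kappa> * B.en g" if "g \<in> L2 M" for g
    by (rule energy_le_of_dform[OF A B less_imp_le[OF \<kappa>0] _ that]) (rule le)
  have "kernel_norm M B \<le> 1 - (1 - kernel_norm M A) / \<kappa>"
  proof (rule B.kernel_norm_le)
    have "1 / \<kappa> \<le> 1" using \<kappa> by simp
    moreover have "(1 - kernel_norm M A) / \<kappa> \<le> 1 / \<kappa>"
      using A.kernel_norm_nonneg \<kappa>0 by (intro divide_right_mono) auto
    ultimately show "0 \<le> 1 - (1 - kernel_norm M A) / \<kappa>" by linarith
  next
    fix f assume f: "f \<in> L20 M"
    have "A.en f \<ge> (1 - kernel_norm M A) * ip M f f"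
      using A.ip_kernel_le_norm[OF f] by (simp add: A.en_def algebra_simps)
    then have "(1 - kernel_norm M A) * ip M f f \<le> \<kappa> * B.en f"
      using le'[OF A.L20_L2[OF f]] by simp
    then have "(1 - kernel_norm M A) / \<kappa> * ip M f f \<le> B.en f"
      using \<kappa>0 by (simp add: field_simps)
    then show "ip M f (kernel_op B f) \<le> (1 - (1 - kernel_norm M A) / \<kappa>) * ip M f f"
      by (simp add: B.en_def algebra_simps)
  qed
  then show ?thesis by simp
qed

section \<open>The Prekopa--Leindler inequality\<close>

text \<open>\<open>A\<close> may be unbounded or may lack a maximum, so an extreme point is replaced
  by a point of \<open>A\<close> beyond which little mass is left. A sequence cofinal in
  \<open>A\<close> exhausts the measure; the cases are an attained, an unattained finite and an
  infinite supremum.\<close>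

lemma emeasure_le_initial_segment:
  fixes A :: "real set"
  assumes A[measurable]: "A \<in> sets borel" and y: "y < emeasure lborel A"
  shows "\<exists>a\<in>A. y < emeasure lborel (A \<inter> {..a})"
proof (rule ccontr)
  assume "\<not> ?thesis"
  then have le: "a \<in> A \<Longrightarrow> emeasure lborel (A \<inter> {..a}) \<le> y" for a by (auto simp: not_less)
  obtain t :: "nat \<Rightarrow> real" where t: "incseq t" "\<And>n. \<exists>a\<in>A. t n \<le> a" "\<And>a. a \<in> A \<Longrightarrow> \<exists>n. a \<le> t n"
  proof (cases "\<exists>s\<in>A. \<forall>a\<in>A. a \<le> s")
    case True
    then obtain s where "s \<in> A" "\<forall>a\<in>A. a \<le> s" by blast
    then show ?thesis by (intro that[of "\<lambda>_. s"]) auto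
  next
    case nomax: False
    have ne: "A \<noteq> {}" using y by auto
    show ?thesis
    proof (cases "bdd_above A")
      case True
      let ?s = "Sup A"
      show ?thesis
      proof (rule that[of "\<lambda>n. ?s - 1 / real (Suc n)"])
        show "incseq (\<lambda>n. ?s - 1 / real (Suc n))" by (intro incseq_SucI) (simp add: field_simps)
        fix n
        have "?s - 1 / real (Suc n) < ?s" by simp
        then show "\<exists>a\<in>A. ?s - 1 / real (Suc n) \<le> a"
          using less_cSup_iff[OF ne True] by (meson less_imp_le)
      next
        fix a assume a: "a \<in> A"
        have "?s \<notin> A" using nomax cSup_upper[OF _ True] by blast
        then have "a < ?s" using cSup_upper[OF a True] a by (metis less_le)
        then obtain n where "inverse (real (Suc n)) < ?s - a"
          using reals_Archimedean[of "?s - a"] by auto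
        then show "\<exists>n. a \<le> ?s - 1 / real (Suc n)" by (intro exI[of _ n]) (simp add: inverse_eq_divide)
      qed
    next
      case False
      show ?thesis
      proof (rule that[of real])
        show "incseq real" by (simp add: incseq_def)
        show "\<exists>a\<in>A. real n \<le> a" for n using False by (meson bdd_above.I linear)
        show "\<exists>n. a \<le> real n" for a by (rule real_arch_simple)
      qed
    qed
  qed
  have "A = (\<Union>n. A \<inter> {..t n})" using t(3) by auto
  then have "emeasure lborel A = (SUP n. emeasure lborel (A \<inter> {..t n}))"
    using SUP_emeasure_incseq[of "\<lambda>n. A \<inter> {..t n}" lborel] incseqD[OF t(1)]
    by (force simp: incseq_def)
  also have "\<dots> \<le> y"
  proof (rule SUP_least)
    fix n
    obtain a where a: "a \<in> A" "t n \<le> a" using t(2) by blast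
    have "emeasure lborel (A \<inter> {..t n}) \<le> emeasure lborel (A \<inter> {..a})"
      using a by (intro emeasure_mono) auto
    with le[OF a(1)] show "emeasure lborel (A \<inter> {..t n}) \<le> y" by simp
  qed
  finally show False using y by simp
qed

text \<open>Reflection preserves \<open>lborel\<close> and exchanges initial and final
  segments.\<close>

lemma emeasure_le_final_segment:
  fixes A :: "real set"
  assumes A[measurable]: "A \<in> sets borel" and y: "y < emeasure lborel A"
  shows "\<exists>a\<in>A. y < emeasure lborel (A \<inter> {a..})"
proof -
  have ref: "emeasure lborel (uminus -` S) = emeasure lborel S" if [measurable]: "S \<in> sets borel" for S :: "real set"
    using nn_integral_real_affine[of "indicator S" "-1" 0] that
    by (simp add: nn_integral_indicator[symmetric] indicator_vimage[symmetric] del: nn_integral_indicator)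
       (simp add: indicator_def vimage_def)
  have "\<exists>a\<in>uminus -` A. y < emeasure lborel ((uminus -` A) \<inter> {..a})"
  proof (rule emeasure_le_initial_segment)
    show "uminus -` A \<in> sets borel" using measurable_sets[of uminus borel borel A] by simp
  qed (use y in \<open>simp add: ref\<close>)
  then obtain a where a: "- a \<in> A" "y < emeasure lborel ((uminus -` A) \<inter> {..a})" by auto
  have "(uminus -` A) \<inter> {..a} = uminus -` (A \<inter> {- a..})" by auto
  then have "y < emeasure lborel (A \<inter> {- a..})" using a(2) by (simp add: ref del: vimage_Int)
  with a(1) show ?thesis by blast
qed

text \<open>The one-dimensional Brunn--Minkowski inequality for midpoints: translates of \<open>A\<close> and \<open>B\<close> by
  extreme points of the other set overlap in at most one point.\<close>

lemma emeasure_midpoints: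
  fixes A B C :: "real set"
  assumes [measurable]: "A \<in> sets borel" "B \<in> sets borel" "C \<in> sets borel"
    and ne: "A \<noteq> {}" "B \<noteq> {}" and mid: "\<And>a b. a \<in> A \<Longrightarrow> b \<in> B \<Longrightarrow> (a + b) / 2 \<in> C"
  shows "emeasure lborel A + emeasure lborel B \<le> 2 * emeasure lborel C"
proof -
  have main: "emeasure lborel (A \<inter> {..a}) + emeasure lborel (B \<inter> {b..}) \<le> 2 * emeasure lborel C"
    if ab: "a \<in> A" "b \<in> B" for a b
  proof -
    let ?A = "A \<inter> {..a}" and ?B = "B \<inter> {b..}"
    \<comment> \<open>The substitution turns \<open>S\<close> into the halved translate
      \<open>(S + c) / 2\<close>, which has half the measure.\<close>
    have sc: "emeasure lborel S = 2 * (\<integral>\<^sup>+x. indicator S (- c + 2 * x) \<partial>lborel)"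
      if "S \<in> sets borel" for S :: "real set" and c
      using nn_integral_real_affine[of "indicator S" 2 "- c"] that by simp
    have "emeasure lborel ?A + emeasure lborel ?B
        = 2 * (\<integral>\<^sup>+x. indicator ?A (- b + 2 * x) + indicator ?B (- a + 2 * x) \<partial>lborel)"
      using sc[of ?A b] sc[of ?B a] by (simp add: nn_integral_add distrib_left)
    also have "(\<integral>\<^sup>+x. indicator ?A (- b + 2 * x) + indicator ?B (- a + 2 * x) \<partial>lborel)
        \<le> (\<integral>\<^sup>+x. indicator C x \<partial>lborel)"
    proof (rule nn_integral_mono_AE)
      have 1: "x \<in> C" if "- b + 2 * x \<in> ?A" for x
        using mid[of "- b + 2 * x" b] that ab by auto
      have 2: "x \<in> C" if "- a + 2 * x \<in> ?B" for x
        using mid[of a "- a + 2 * x"] that ab by auto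
      have 3: "x = (a + b) / 2" if "- b + 2 * x \<in> ?A" "- a + 2 * x \<in> ?B" for x
        using that by auto
      show "AE x in lborel. indicator ?A (- b + 2 * x) + indicator ?B (- a + 2 * x) \<le> (indicator C x :: ennreal)"
        using AE_lborel_singleton[of "(a + b) / 2"]
      proof eventually_elim
        fix x :: real assume "x \<noteq> (a + b) / 2"
        then show "indicator ?A (- b + 2 * x) + indicator ?B (- a + 2 * x) \<le> (indicator C x :: ennreal)"
          using 1[of x] 2[of x] 3[of x]
          by (cases "- b + 2 * x \<in> ?A"; cases "- a + 2 * x \<in> ?B") (simp_all only: indicator_simps, auto)
      qed
    qed
    finally show ?thesis by (simp add: mult_left_mono)
  qed
  \<comment> \<open>Extreme points need not exist; the mass lost by cutting at points of the sets
    disappears in the supremum.\<close>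
  have A: "emeasure lborel A = (SUP a\<in>A. emeasure lborel (A \<inter> {..a}))"
  proof (rule antisym)
    show "emeasure lborel A \<le> (SUP a\<in>A. emeasure lborel (A \<inter> {..a}))"
      by (rule dense_le) (use emeasure_le_initial_segment in \<open>meson assms(1) less_imp_le SUP_upper2\<close>)
  qed (auto intro!: SUP_least emeasure_mono)
  have B: "emeasure lborel B = (SUP a\<in>B. emeasure lborel (B \<inter> {a..}))"
  proof (rule antisym)
    show "emeasure lborel B \<le> (SUP a\<in>B. emeasure lborel (B \<inter> {a..}))"
      by (rule dense_le) (use emeasure_le_final_segment in \<open>meson assms(2) less_imp_le SUP_upper2\<close>)
  qed (auto intro!: SUP_least emeasure_mono)
  show ?thesis
    unfolding A B ennreal_SUP_add_left[OF ne(1), symmetric] ennreal_SUP_add_right[OF ne(2)]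
    by (intro SUP_least main)
qed

text \<open>Integrating only over levels in the unit interval truncates at 1. This is harmless for
  functions bounded by 1 and goes in the right direction for the larger function
  \<open>h\<close>.\<close>

lemma layer_cake:
  fixes f :: "real \<Rightarrow> real"
  assumes [measurable]: "f \<in> borel_measurable borel" and f: "\<And>x. 0 \<le> f x"
  shows "(\<integral>\<^sup>+t. indicator {0<..<1} t * emeasure lborel {x. t < f x} \<partial>lborel) = (\<integral>\<^sup>+x. ennreal (min 1 (f x)) \<partial>lborel)"
proof -
  have "(\<integral>\<^sup>+t. indicator {0<..<1} t * emeasure lborel {x. t < f x} \<partial>lborel)
      = (\<integral>\<^sup>+t. (\<integral>\<^sup>+x. indicator {0<..<1} t * indicator {x. t < f x} x \<partial>lborel) \<partial>lborel)"
    by (simp add: nn_integral_cmult)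
  also have "\<dots> = (\<integral>\<^sup>+x. (\<integral>\<^sup>+t. indicator {0<..<1} t * indicator {x. t < f x} x \<partial>lborel) \<partial>lborel)"
    by (rule lborel_pair.Fubini') (simp add: indicator_def, measurable)
  also have "\<dots> = (\<integral>\<^sup>+x. ennreal (min 1 (f x)) \<partial>lborel)"
  proof (rule nn_integral_cong)
    fix x
    have "(\<integral>\<^sup>+t. indicator {0<..<1} t * indicator {x. t < f x} x \<partial>lborel)
        = (\<integral>\<^sup>+t. indicator {0<..<min 1 (f x)} t \<partial>lborel)"
      by (intro nn_integral_cong) (auto simp: indicator_def)
    also have "\<dots> = ennreal (min 1 (f x))" using f[of x] by simp
    finally show "(\<integral>\<^sup>+t. indicator {0<..<1} t * indicator {x. t < f x} x \<partial>lborel) = ennreal (min 1 (f x))" .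
  qed
  finally show ?thesis .
qed

text \<open>With both suprema equal to 1 the level sets of \<open>f\<close> and \<open>g\<close> are
  nonempty at every level below 1, so the midpoint inequality for sets applies level by level. The
  outcome is an arithmetic mean, stronger than the geometric one needed later.\<close>

lemma Prekopa_Leindler_normalized:
  fixes f g h :: "real \<Rightarrow> real"
  assumes [measurable]: "f \<in> borel_measurable borel" "g \<in> borel_measurable borel" "h \<in> borel_measurable borel"
    and nn: "\<And>x. 0 \<le> f x" "\<And>x. 0 \<le> g x" "\<And>x. 0 \<le> h x"
    and le1: "\<And>x. f x \<le> 1" "\<And>x. g x \<le> 1"
    and sup: "\<And>t. t < 1 \<Longrightarrow> \<exists>x. t < f x" "\<And>t. t < 1 \<Longrightarrow> \<exists>x. t < g x"
    and mid: "\<And>a b t. 0 < t \<Longrightarrow> t < f a \<Longrightarrow> t < g b \<Longrightarrow> t < h ((a + b) / 2)"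
  shows "(\<integral>\<^sup>+x. ennreal (f x) \<partial>lborel) + (\<integral>\<^sup>+x. ennreal (g x) \<partial>lborel) \<le> 2 * (\<integral>\<^sup>+x. ennreal (h x) \<partial>lborel)"
proof -
  have m: "(\<lambda>t. emeasure lborel {x. t < u x}) \<in> borel_measurable borel"
    if [measurable]: "u \<in> borel_measurable borel" for u :: "real \<Rightarrow> real"
  proof -
    have "(\<lambda>t. emeasure lborel (Pair t -` {z. fst z < u (snd z)})) \<in> borel_measurable lborel"
    proof (rule lborel.measurable_emeasure_Pair)
      have "{z \<in> space (borel \<Otimes>\<^sub>M borel). fst z < u (snd z)} \<in> sets (borel \<Otimes>\<^sub>M borel)" by measurable
      then show "{z. fst z < u (snd z)} \<in> sets (lborel \<Otimes>\<^sub>M lborel)"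
        by (simp add: space_pair_measure sets_pair_measure_cong[of lborel borel lborel borel])
    qed
    then show ?thesis by (simp add: vimage_def)
  qed
  note [measurable] = m[OF assms(1)] m[OF assms(2)] m[OF assms(3)]
  have "(\<integral>\<^sup>+x. ennreal (f x) \<partial>lborel) + (\<integral>\<^sup>+x. ennreal (g x) \<partial>lborel)
     = (\<integral>\<^sup>+t. indicator {0<..<1} t * emeasure lborel {x. t < f x} + indicator {0<..<1} t * emeasure lborel {x. t < g x} \<partial>lborel)"
    using layer_cake[of f] layer_cake[of g] nn le1
    by (simp add: nn_integral_add min.absorb2)
  also have "\<dots> \<le> (\<integral>\<^sup>+t. 2 * (indicator {0<..<1} t * emeasure lborel {x. t < h x}) \<partial>lborel)"
  proof (rule nn_integral_mono)
    fix t :: real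
    have "emeasure lborel {x. t < f x} + emeasure lborel {x. t < g x} \<le> 2 * emeasure lborel {x. t < h x}"
      if "0 < t" "t < 1"
      by (rule emeasure_midpoints) (use that mid sup in auto)
    then show "indicator {0<..<1} t * emeasure lborel {x. t < f x} + indicator {0<..<1} t * emeasure lborel {x. t < g x}
      \<le> 2 * (indicator {0<..<1} t * emeasure lborel {x. t < h x})"
      by (auto simp: indicator_def)
  qed
  also have "\<dots> = 2 * (\<integral>\<^sup>+x. ennreal (min 1 (h x)) \<partial>lborel)"
    using layer_cake[of h] nn by (simp add: nn_integral_cmult)
  also have "\<dots> \<le> 2 * (\<integral>\<^sup>+x. ennreal (h x) \<partial>lborel)"
    by (intro mult_left_mono nn_integral_mono) (auto simp: ennreal_leI)
  finally show ?thesis .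
qed

text \<open>Divide \<open>f\<close> and \<open>g\<close> by their suprema \<open>M\<close> and
  \<open>N\<close>, and \<open>h\<close> by \<open>sqrt (M * N)\<close>; then pass from the
  arithmetic to the geometric mean.\<close>

lemma Prekopa_Leindler_bounded:
  fixes f g :: "real \<Rightarrow> real" and h :: "real \<Rightarrow> ennreal"
  assumes [measurable]: "f \<in> borel_measurable borel" "g \<in> borel_measurable borel" "h \<in> borel_measurable borel"
    and nn: "\<And>x. 0 \<le> f x" "\<And>x. 0 \<le> g x" and bd: "\<And>x. f x \<le> m" "\<And>x. g x \<le> n"
    and mid: "\<And>a b. ennreal (f a * g b) \<le> (h ((a + b) / 2))\<^sup>2"
  shows "(\<integral>\<^sup>+x. ennreal (f x) \<partial>lborel) * (\<integral>\<^sup>+x. ennreal (g x) \<partial>lborel) \<le> (\<integral>\<^sup>+x. h x \<partial>lborel)\<^sup>2"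
proof (cases "(\<forall>x. f x = 0) \<or> (\<forall>x. g x = 0)")
  case True then show ?thesis by auto
next
  case False
  have bdd: "bdd_above (range f)" "bdd_above (range g)" using bd by (auto intro!: bdd_aboveI2)
  define M where "M = Sup (range f)"
  define N where "N = Sup (range g)"
  have fM: "f x \<le> M" and gN: "g x \<le> N" for x
    unfolding M_def N_def using bdd by (auto intro: cSUP_upper)
  have "0 < M" "0 < N"
  proof -
    from False obtain x y where "f x \<noteq> 0" "g y \<noteq> 0" by auto
    then show "0 < M" "0 < N" using nn fM[of x] gN[of y] by (metis less_le_trans less_le)+
  qed
  define s where "s = sqrt (M * N)"
  have s: "0 < s" "s\<^sup>2 = M * N" using \<open>0 < M\<close> \<open>0 < N\<close> by (auto simp: s_def)
  \<comment> \<open>Cutting \<open>h\<close> at \<open>s\<close> makes it real-valued and preserves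
    the hypothesis, because \<open>f a * g b\<close> never exceeds \<open>s\<^sup>2\<close>.\<close>
  define H where "H x = enn2real (min (h x) (ennreal s))" for x
  have [measurable]: "H \<in> borel_measurable borel" unfolding H_def by measurable
  have Hs: "ennreal (H x) = min (h x) (ennreal s)" for x
    unfolding H_def by (intro ennreal_enn2real) (simp add: min_less_iff_disj)
  have H0: "0 \<le> H x" for x by (simp add: H_def)
  have H: "f a * g b \<le> (H ((a + b) / 2))\<^sup>2" for a b
  proof -
    have 1: "ennreal (f a * g b) \<le> (ennreal s)\<^sup>2"
      unfolding ennreal_power[OF less_imp_le[OF s(1)]] s(2)
      using nn fM gN \<open>0 < M\<close> by (intro ennreal_leI mult_mono) auto
    have "ennreal (f a * g b) \<le> (min (h ((a + b) / 2)) (ennreal s))\<^sup>2"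
      using 1 mid[of a b] by (simp add: min_def)
    then show ?thesis unfolding Hs[symmetric] using H0 by (simp add: ennreal_power)
  qed
  have "(\<integral>\<^sup>+x. ennreal (f x / M) \<partial>lborel) + (\<integral>\<^sup>+x. ennreal (g x / N) \<partial>lborel) \<le> 2 * (\<integral>\<^sup>+x. ennreal (H x / s) \<partial>lborel)"
  proof (rule Prekopa_Leindler_normalized)
    fix t :: real
    assume t: "t < 1"
    have "\<exists>x. t * M < f x"
      using less_cSup_iff[of "range f" "t * M"] bdd \<open>0 < M\<close> t by (auto simp: M_def[symmetric])
    then show "\<exists>x. t < f x / M" using \<open>0 < M\<close> by (simp add: pos_less_divide_eq)
    have "\<exists>x. t * N < g x"
      using less_cSup_iff[of "range g" "t * N"] bdd \<open>0 < N\<close> t by (auto simp: N_def[symmetric])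
    then show "\<exists>x. t < g x / N" using \<open>0 < N\<close> by (simp add: pos_less_divide_eq)
  next
    fix a b t :: real
    assume t: "0 < t" "t < f a / M" "t < g b / N"
    then have "t * M < f a" "t * N < g b" using \<open>0 < M\<close> \<open>0 < N\<close> by (simp_all add: pos_less_divide_eq)
    moreover have "0 < t * M" "0 < t * N" using t \<open>0 < M\<close> \<open>0 < N\<close> by simp_all
    ultimately have "(t * M) * (t * N) < f a * g b" by (intro mult_strict_mono) linarith+
    moreover have "(t * s)\<^sup>2 = (t * M) * (t * N)"
      unfolding power_mult_distrib s(2) by (simp add: power2_eq_square)
    ultimately have "(t * s)\<^sup>2 < (H ((a + b) / 2))\<^sup>2" using H[of a b] by simp
    then have "t * s < H ((a + b) / 2)" using H0 by (rule power2_less_imp_less)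
    then show "t < H ((a + b) / 2) / s" using s by (simp add: pos_less_divide_eq)
  qed (use nn fM gN \<open>0 < M\<close> \<open>0 < N\<close> s H0 in auto)
  also have "(\<integral>\<^sup>+x. ennreal (H x / s) \<partial>lborel) = (\<integral>\<^sup>+x. ennreal (H x) \<partial>lborel) / ennreal s"
    using s H0 by (simp add: divide_ennreal[symmetric] nn_integral_divide)
  also have "(\<integral>\<^sup>+x. ennreal (f x / M) \<partial>lborel) = (\<integral>\<^sup>+x. ennreal (f x) \<partial>lborel) / ennreal M"
    using \<open>0 < M\<close> nn by (simp add: divide_ennreal[symmetric] nn_integral_divide)
  also have "(\<integral>\<^sup>+x. ennreal (g x / N) \<partial>lborel) = (\<integral>\<^sup>+x. ennreal (g x) \<partial>lborel) / ennreal N"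
    using \<open>0 < N\<close> nn by (simp add: divide_ennreal[symmetric] nn_integral_divide)
  finally have le: "(\<integral>\<^sup>+x. ennreal (f x) \<partial>lborel) / ennreal M + (\<integral>\<^sup>+x. ennreal (g x) \<partial>lborel) / ennreal N
    \<le> 2 * ((\<integral>\<^sup>+x. ennreal (H x) \<partial>lborel) / ennreal s)" .
  have "(\<integral>\<^sup>+x. ennreal (f x) \<partial>lborel) * (\<integral>\<^sup>+x. ennreal (g x) \<partial>lborel) \<le> (\<integral>\<^sup>+x. ennreal (H x) \<partial>lborel)\<^sup>2"
  proof (cases "(\<integral>\<^sup>+x. ennreal (H x) \<partial>lborel)")
    case (real k)
    have "(\<integral>\<^sup>+x. ennreal (f x) \<partial>lborel) / ennreal M < \<top>" "(\<integral>\<^sup>+x. ennreal (g x) \<partial>lborel) / ennreal N < \<top>"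
    proof -
      have "2 * (ennreal k / ennreal s) < \<top>" using s real by (simp add: divide_ennreal ennreal_mult_less_top)
      from le_less_trans[OF le[unfolded real] this]
      show "(\<integral>\<^sup>+x. ennreal (f x) \<partial>lborel) / ennreal M < \<top>" "(\<integral>\<^sup>+x. ennreal (g x) \<partial>lborel) / ennreal N < \<top>"
        by simp_all
    qed
    then have "(\<integral>\<^sup>+x. ennreal (f x) \<partial>lborel) \<noteq> \<top>" "(\<integral>\<^sup>+x. ennreal (g x) \<partial>lborel) \<noteq> \<top>"
      using \<open>0 < M\<close> \<open>0 < N\<close> by (auto simp: ennreal_top_divide)
    then obtain x y where x: "(\<integral>\<^sup>+x. ennreal (f x) \<partial>lborel) = ennreal x" "0 \<le> x"
      and y: "(\<integral>\<^sup>+x. ennreal (g x) \<partial>lborel) = ennreal y" "0 \<le> y"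
      by (metis ennreal_cases)
    have xy: "x / M + y / N \<le> 2 * (k / s)"
    proof -
      have e1: "ennreal (x / M + y / N) = ennreal x / ennreal M + ennreal y / ennreal N"
        using \<open>0 < M\<close> \<open>0 < N\<close> x y by (simp add: divide_ennreal)
      have e2: "ennreal (2 * (k / s)) = 2 * (ennreal k / ennreal s)"
        using s real by (subst ennreal_mult) (simp_all add: divide_ennreal)
      have "ennreal (x / M + y / N) \<le> ennreal (2 * (k / s))"
        using le unfolding e1 e2 x(1) y(1) real .
      then show ?thesis using s real by (simp add: ennreal_le_iff)
    qed
    \<comment> \<open>The inequality between the arithmetic and the geometric mean.\<close>
    have "4 * p * q \<le> (p + q)\<^sup>2" for p q :: real
      using zero_le_power2[of "p - q"] by (simp add: power2_eq_square algebra_simps)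
    then have "4 * (x / M) * (y / N) \<le> (x / M + y / N)\<^sup>2" .
    also have "\<dots> \<le> (2 * (k / s))\<^sup>2"
      using xy x y \<open>0 < M\<close> \<open>0 < N\<close> by (intro power_mono) auto
    also have "\<dots> = 4 * k\<^sup>2 / (M * N)" using s by (simp add: power_mult_distrib power_divide)
    finally have "x * y \<le> k\<^sup>2" using \<open>0 < M\<close> \<open>0 < N\<close> by (simp add: field_simps)
    then show ?thesis unfolding x(1) y(1) real using x y real by (simp add: ennreal_mult[symmetric] ennreal_power)
  qed simp
  also have "\<dots> \<le> (\<integral>\<^sup>+x. h x \<partial>lborel)\<^sup>2"
    by (intro power_mono nn_integral_mono) (simp_all add: Hs)
  finally show ?thesis .
qed

text \<open>Truncations of \<open>f\<close> and \<open>g\<close> at integer heights still satisfy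
  the hypothesis with the same \<open>h\<close>; monotone convergence removes them.\<close>

lemma Prekopa_Leindler_real:
  fixes f g h :: "real \<Rightarrow> ennreal"
  assumes [measurable]: "f \<in> borel_measurable borel" "g \<in> borel_measurable borel" "h \<in> borel_measurable borel"
    and mid: "\<And>a b. f a * g b \<le> (h ((a + b) / 2))\<^sup>2"
  shows "(\<integral>\<^sup>+x. f x \<partial>lborel) * (\<integral>\<^sup>+x. g x \<partial>lborel) \<le> (\<integral>\<^sup>+x. h x \<partial>lborel)\<^sup>2"
proof -
  define tr where "tr u n x = enn2real (min (u x) (of_nat n))" for u :: "real \<Rightarrow> ennreal" and n :: nat and x
  have tr: "ennreal (tr u n x) = min (u x) (of_nat n)" for u n x
    unfolding tr_def by (intro ennreal_enn2real) (simp add: min_less_iff_disj of_nat_less_top)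
  have trm[measurable]: "tr u n \<in> borel_measurable borel" if [measurable]: "u \<in> borel_measurable borel" for u n
    unfolding tr_def by measurable
  have lim: "(\<integral>\<^sup>+x. u x \<partial>lborel) = (SUP n. \<integral>\<^sup>+x. ennreal (tr u n x) \<partial>lborel)"
    if [measurable]: "u \<in> borel_measurable borel" for u
  proof -
    have "(SUP n. min (u x) (of_nat n)) = u x" for x
    proof -
      have "(SUP n. min (u x) (of_nat n)) = min (u x) (SUP n. of_nat n)"
        by (simp add: inf_min[symmetric] inf_SUP)
      then show ?thesis by (simp add: ennreal_SUP_of_nat_eq_top)
    qed
    then have "(\<integral>\<^sup>+x. u x \<partial>lborel) = (\<integral>\<^sup>+x. (SUP n. ennreal (tr u n x)) \<partial>lborel)" by (simp add: tr)
    also have "\<dots> = (SUP n. \<integral>\<^sup>+x. ennreal (tr u n x) \<partial>lborel)"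
      by (rule nn_integral_monotone_convergence_SUP)
         (auto simp: incseq_def le_fun_def tr intro: min.coboundedI2 min.mono)
    finally show ?thesis .
  qed
  have b: "(\<integral>\<^sup>+x. ennreal (tr f m x) \<partial>lborel) * (\<integral>\<^sup>+x. ennreal (tr g n x) \<partial>lborel) \<le> (\<integral>\<^sup>+x. h x \<partial>lborel)\<^sup>2" for m n
  proof (rule Prekopa_Leindler_bounded)
    show "tr f m x \<le> real m" "tr g n x \<le> real n" for x
      unfolding tr_def by (auto intro!: enn2real_leI simp flip: ennreal_of_nat_eq_real_of_nat)
    fix a b
    have "ennreal (tr f m a * tr g n b) = min (f a) (of_nat m) * min (g b) (of_nat n)"
      by (simp add: tr_def ennreal_mult tr[unfolded tr_def])
    also have "\<dots> \<le> f a * g b" by (intro mult_mono) auto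
    also note mid
    finally show "ennreal (tr f m a * tr g n b) \<le> (h ((a + b) / 2))\<^sup>2" .
  qed (auto simp: tr_def)
  show ?thesis
    unfolding lim[OF assms(1)] lim[OF assms(2)] SUP_mult_right_ennreal SUP_mult_left_ennreal
    by (intro SUP_least b)
qed

interpretation lborel_product: product_sigma_finite "\<lambda>_. lborel :: real measure"
  by standard

abbreviation midp :: "'i set \<Rightarrow> ('i \<Rightarrow> real) \<Rightarrow> ('i \<Rightarrow> real) \<Rightarrow> 'i \<Rightarrow> real" where
  "midp I x y \<equiv> (\<lambda>i\<in>I. (x i + y i) / 2)"

text \<open>Tensorization. For fixed values of the new coordinate the sections satisfy the
  hypothesis in the other coordinates, so by induction the marginals in the new coordinate satisfy
  the one-dimensional hypothesis.\<close>

theorem Prekopa_Leindler: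
  fixes f g h :: "('i \<Rightarrow> real) \<Rightarrow> ennreal"
  assumes "finite I"
    and "f \<in> borel_measurable (PiM I (\<lambda>_. lborel))" "g \<in> borel_measurable (PiM I (\<lambda>_. lborel))"
      "h \<in> borel_measurable (PiM I (\<lambda>_. lborel))"
    and "\<And>x y. x \<in> PiE I (\<lambda>_. UNIV) \<Longrightarrow> y \<in> PiE I (\<lambda>_. UNIV) \<Longrightarrow> f x * g y \<le> (h (midp I x y))\<^sup>2"
  shows "(\<integral>\<^sup>+x. f x \<partial>PiM I (\<lambda>_. lborel)) * (\<integral>\<^sup>+x. g x \<partial>PiM I (\<lambda>_. lborel))
    \<le> (\<integral>\<^sup>+x. h x \<partial>PiM I (\<lambda>_. lborel))\<^sup>2"
  using assms
proof (induction I arbitrary: f g h rule: finite_induct)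
  \<comment> \<open>The empty product is a one-point space, and the claim is the hypothesis at that
    point.\<close>
  case empty
  have e: "(\<lambda>i\<in>{}. (undefined i + undefined i) / 2) = (\<lambda>_. undefined :: real)" by auto
  show ?case
    using empty(4)[of "\<lambda>_. undefined" "\<lambda>_. undefined"]
    by (simp add: PiM_empty nn_integral_count_space_finite restrict_def)
next
  case (insert i I)
  note [measurable] = insert.prems(1-3)
  let ?P = "PiM I (\<lambda>_. lborel :: real measure)"
  interpret P: sigma_finite_measure ?P by (rule lborel_product.sigma_finite[OF insert.hyps(1)])
  have upd: "(\<lambda>(y, x). x(i := y)) \<in> lborel \<Otimes>\<^sub>M ?P \<rightarrow>\<^sub>M PiM (insert i I) (\<lambda>_. lborel)"
    using measurable_add_dim[of i I "\<lambda>_. lborel :: real measure"]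
      measurable_compose[OF measurable_pair_swap' measurable_add_dim[of i I "\<lambda>_. lborel :: real measure"]]
    by (simp add: split_beta' comp_def)
  have m: "(\<lambda>y. \<integral>\<^sup>+x. u (x(i := y)) \<partial>?P) \<in> borel_measurable borel"
    if "u \<in> borel_measurable (PiM (insert i I) (\<lambda>_. lborel))" for u :: "('i \<Rightarrow> real) \<Rightarrow> ennreal"
  proof -
    have "(\<lambda>(y, x). u (x(i := y))) \<in> borel_measurable (lborel \<Otimes>\<^sub>M ?P)"
      using measurable_compose[OF upd that] by (simp add: split_beta')
    from P.borel_measurable_nn_integral[OF this] show ?thesis by simp
  qed
  have sect: "(\<lambda>x. u (x(i := y))) \<in> borel_measurable ?P"
    if "u \<in> borel_measurable (PiM (insert i I) (\<lambda>_. lborel))" for u :: "('i \<Rightarrow> real) \<Rightarrow> ennreal" and y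
    by (rule measurable_compose[OF _ that]) (rule measurable_fun_upd[where J=I], auto)
  have e: "(\<integral>\<^sup>+x. u x \<partial>PiM (insert i I) (\<lambda>_. lborel)) = (\<integral>\<^sup>+y. (\<integral>\<^sup>+x. u (x(i := y)) \<partial>?P) \<partial>lborel)"
    if "u \<in> borel_measurable (PiM (insert i I) (\<lambda>_. lborel))" for u :: "('i \<Rightarrow> real) \<Rightarrow> ennreal"
    by (rule lborel_product.product_nn_integral_insert_rev[OF insert.hyps that])
  show ?case
    unfolding e[OF insert.prems(1)] e[OF insert.prems(2)] e[OF insert.prems(3)]
  proof (rule Prekopa_Leindler_real)
    fix a b :: real
    show "(\<integral>\<^sup>+x. f (x(i := a)) \<partial>?P) * (\<integral>\<^sup>+x. g (x(i := b)) \<partial>?P) \<le> (\<integral>\<^sup>+x. h (x(i := (a + b) / 2)) \<partial>?P)\<^sup>2"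
    proof (rule insert.IH)
      fix x y :: "'i \<Rightarrow> real"
      assume "x \<in> PiE I (\<lambda>_. UNIV)" "y \<in> PiE I (\<lambda>_. UNIV)"
      then have "x(i := a) \<in> PiE (insert i I) (\<lambda>_. UNIV)" "y(i := b) \<in> PiE (insert i I) (\<lambda>_. UNIV)"
        using PiE_fun_upd[of a "\<lambda>_. UNIV" i x I] PiE_fun_upd[of b "\<lambda>_. UNIV" i y I] by simp_all
      from insert.prems(4)[OF this]
      have "f (x(i := a)) * g (y(i := b)) \<le> (h (midp (insert i I) (x(i := a)) (y(i := b))))\<^sup>2" .
      moreover have "midp (insert i I) (x(i := a)) (y(i := b)) = (midp I x y)(i := (a + b) / 2)"
        using insert.hyps(2) by (auto simp: fun_eq_iff restrict_def)
      ultimately show "f (x(i := a)) * g (y(i := b)) \<le> (h ((midp I x y)(i := (a + b) / 2)))\<^sup>2" by simp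
    qed (intro sect insert.prems)+
  qed (intro m insert.prems)+
qed

section \<open>Gibbs measures and Gaussian kernels\<close>

lemma (in prob_space) nn_integral_pairwise_square:
  fixes f :: "'a \<Rightarrow> real"
  assumes "f \<in> L2 M"
  shows "(\<integral>\<^sup>+x. (\<integral>\<^sup>+y. ennreal ((f y - f x)\<^sup>2) \<partial>M) \<partial>M) = ennreal (2 * (\<integral>x. (f x - expectation f)\<^sup>2 \<partial>M))"
proof -
  have [measurable]: "f \<in> borel_measurable M" and i2: "integrable M (\<lambda>x. (f x)\<^sup>2)" using assms by (simp_all add: L2_def)
  have i1: "integrable M f" by (rule square_integrable_imp_integrable[OF _ i2]) simp
  have e: "(f y - c)\<^sup>2 = (f y)\<^sup>2 - 2 * c * f y + c\<^sup>2" for y c by (simp add: power2_diff)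
  have i3: "integrable M (\<lambda>y. (f y - c)\<^sup>2)" for c unfolding e using i1 i2 by simp
  have E: "expectation (\<lambda>y. (f y - c)\<^sup>2) = expectation (\<lambda>x. (f x)\<^sup>2) - 2 * c * expectation f + c\<^sup>2" for c
    using i1 i2 by (simp add: e prob_space)
  have inner: "(\<integral>\<^sup>+y. ennreal ((f y - c)\<^sup>2) \<partial>M) = ennreal (expectation (\<lambda>x. (f x)\<^sup>2) - 2 * c * expectation f + c\<^sup>2)" for c
    unfolding E[symmetric] by (rule nn_integral_eq_integral[OF i3]) simp
  have nn: "0 \<le> expectation (\<lambda>x. (f x)\<^sup>2) - 2 * c * expectation f + c\<^sup>2" for c
    unfolding E[symmetric] by simp
  have "(\<integral>\<^sup>+x. (\<integral>\<^sup>+y. ennreal ((f y - f x)\<^sup>2) \<partial>M) \<partial>M)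
    = (\<integral>\<^sup>+x. ennreal (expectation (\<lambda>x. (f x)\<^sup>2) - 2 * f x * expectation f + (f x)\<^sup>2) \<partial>M)"
    by (simp add: inner)
  also have "\<dots> = ennreal (expectation (\<lambda>x. expectation (\<lambda>x. (f x)\<^sup>2) - 2 * f x * expectation f + (f x)\<^sup>2))"
    by (rule nn_integral_eq_integral) (use i1 i2 nn in auto)
  also have "expectation (\<lambda>x. expectation (\<lambda>x. (f x)\<^sup>2) - 2 * f x * expectation f + (f x)\<^sup>2)
     = 2 * (expectation (\<lambda>x. (f x)\<^sup>2) - (expectation f)\<^sup>2)"
  proof -
    have "expectation (\<lambda>x. expectation (\<lambda>x. (f x)\<^sup>2) - 2 * f x * expectation f + (f x)\<^sup>2)
        = expectation (\<lambda>x. expectation (\<lambda>x. (f x)\<^sup>2) - 2 * expectation f * f x + (f x)\<^sup>2)"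
      by (simp add: ac_simps)
    then show ?thesis using i1 i2 by (simp add: prob_space power2_eq_square[of "expectation f"])
  qed
  also have "expectation (\<lambda>x. (f x)\<^sup>2) - (expectation f)\<^sup>2 = expectation (\<lambda>x. (f x - expectation f)\<^sup>2)"
    using variance_eq[OF i1 i2] by simp
  finally show ?thesis .
qed

text \<open>The square of a weighted Euclidean distance. Keeping the square makes it additive over
  coordinates; roots appear only in Lipschitz bounds.\<close>

definition nd :: "'i set \<Rightarrow> ('i \<Rightarrow> real) \<Rightarrow> ('i \<Rightarrow> real) \<Rightarrow> ('i \<Rightarrow> real) \<Rightarrow> real" where
  "nd I \<tau> x y = (\<Sum>j\<in>I. (x j - y j)\<^sup>2 / \<tau> j)"

lemma nd_nonneg: "(\<And>j. j \<in> I \<Longrightarrow> 0 < \<tau> j) \<Longrightarrow> 0 \<le> nd I \<tau> x y"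
  unfolding nd_def by (intro sum_nonneg) (auto simp: less_imp_le)

abbreviation LB :: "'i set \<Rightarrow> ('i \<Rightarrow> real) measure" where "LB I \<equiv> PiM I (\<lambda>_. lborel)"

abbreviation RR :: "'i set \<Rightarrow> ('i \<Rightarrow> real) set" where "RR I \<equiv> PiE I (\<lambda>_. UNIV)"

lemma space_LB: "space (LB I) = RR I" by (simp add: space_PiM)

definition gibbs :: "'i set \<Rightarrow> (('i \<Rightarrow> real) \<Rightarrow> real) \<Rightarrow> ('i \<Rightarrow> real) measure" where
  "gibbs I W = density (LB I) (\<lambda>y. ennreal (exp (- W y) / (\<integral>y. exp (- W y) \<partial>LB I)))"

lemma sets_gibbs[measurable_cong, simp]: "sets (gibbs I W) = sets (LB I)" by (simp add: gibbs_def)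

lemma space_gibbs[simp]: "space (gibbs I W) = RR I" by (simp add: gibbs_def space_LB)

lemma LB_space_not_null: "finite I \<Longrightarrow> emeasure (LB I) (space (LB I)) \<noteq> 0"
proof -
  assume I: "finite I"
  have "emeasure (LB I) (PiE I (\<lambda>_. {0..1})) = 1"
    using I by (subst lborel_product.emeasure_PiM) simp_all
  moreover have "emeasure (LB I) (PiE I (\<lambda>_. {0..1})) \<le> emeasure (LB I) (space (LB I))"
    by (rule emeasure_space)
  ultimately show ?thesis by auto
qed

lemma gibbs_normalizer_pos:
  fixes W :: "('i \<Rightarrow> real) \<Rightarrow> real"
  assumes "finite I" "integrable (LB I) (\<lambda>y. exp (- W y))"
  shows "0 < (\<integral>y. exp (- W y) \<partial>LB I)"
proof -
  have "(\<integral>y. exp (- W y) \<partial>LB I) \<noteq> 0"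
  proof
    assume "(\<integral>y. exp (- W y) \<partial>LB I) = 0"
    then have "AE y in LB I. exp (- W y) = 0"
      using integral_nonneg_eq_0_iff_AE[of "LB I" "\<lambda>y. exp (- W y)"] assms(2) by simp
    then have "AE y in LB I. False" by simp
    then show False using LB_space_not_null[OF assms(1)] by (simp add: ae_filter_eq_bot_iff[symmetric] trivial_limit_def)
  qed
  moreover have "0 \<le> (\<integral>y. exp (- W y) \<partial>LB I)" by simp
  ultimately show ?thesis by linarith
qed

locale gibbs_potential =
  fixes I :: "'i set" and W :: "('i \<Rightarrow> real) \<Rightarrow> real"
  assumes fin: "finite I" and W_meas[measurable]: "W \<in> borel_measurable (LB I)"
    and W_int: "integrable (LB I) (\<lambda>y. exp (- W y))"
begin

definition Z :: real where "Z = (\<integral>y. exp (- W y) \<partial>LB I)"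

lemma Z_pos: "0 < Z" unfolding Z_def by (rule gibbs_normalizer_pos[OF fin W_int])

lemma nn_integral_exp: "(\<integral>\<^sup>+y. ennreal (exp (- W y)) \<partial>LB I) = ennreal Z"
  unfolding Z_def by (rule nn_integral_eq_integral[OF W_int]) simp

lemma nn_integral_gibbs:
  assumes [measurable]: "u \<in> borel_measurable (LB I)"
  shows "(\<integral>\<^sup>+y. u y \<partial>gibbs I W) = (\<integral>\<^sup>+y. ennreal (exp (- W y) / Z) * u y \<partial>LB I)"
    and "(\<integral>\<^sup>+y. u y \<partial>gibbs I W) = ennreal (1 / Z) * (\<integral>\<^sup>+y. ennreal (exp (- W y)) * u y \<partial>LB I)"
proof -
  show "(\<integral>\<^sup>+y. u y \<partial>gibbs I W) = (\<integral>\<^sup>+y. ennreal (exp (- W y) / Z) * u y \<partial>LB I)"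
    unfolding gibbs_def Z_def[symmetric] by (rule nn_integral_density) simp_all
  also have "\<dots> = (\<integral>\<^sup>+y. ennreal (1 / Z) * (ennreal (exp (- W y)) * u y) \<partial>LB I)"
    using Z_pos by (intro nn_integral_cong) (simp add: ennreal_mult[symmetric] mult.assoc[symmetric])
  also have "\<dots> = ennreal (1 / Z) * (\<integral>\<^sup>+y. ennreal (exp (- W y)) * u y \<partial>LB I)"
    by (rule nn_integral_cmult) simp
  finally show "(\<integral>\<^sup>+y. u y \<partial>gibbs I W) = ennreal (1 / Z) * (\<integral>\<^sup>+y. ennreal (exp (- W y)) * u y \<partial>LB I)" .
qed

lemma prob_space_gibbs: "prob_space (gibbs I W)"
proof (rule prob_spaceI)
  have "(\<integral>\<^sup>+y. 1 \<partial>gibbs I W) = 1"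
    using nn_integral_gibbs(2)[of "\<lambda>_. 1"] nn_integral_exp Z_pos by (simp add: ennreal_mult[symmetric] del: nn_integral_const)
  then show "emeasure (gibbs I W) (space (gibbs I W)) = 1" by simp
qed

end

lemma density_kernel:
  assumes N: "sigma_finite_measure N" and ne: "space N \<noteq> {}"
    and k[measurable]: "(\<lambda>(x, y). k x y) \<in> borel_measurable (M \<Otimes>\<^sub>M N)"
    and one: "\<And>x. x \<in> space M \<Longrightarrow> (\<integral>\<^sup>+y. k x y \<partial>N) = 1"
  shows "(\<lambda>x. density N (k x)) \<in> M \<rightarrow>\<^sub>M prob_algebra N"
proof -
  interpret N: sigma_finite_measure N by fact
  have p: "prob_space (density N (k x))" if x: "x \<in> space M" for x
  proof (rule prob_spaceI)
    have [measurable]: "k x \<in> borel_measurable N" using measurable_Pair2[OF k x] by simp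
    show "emeasure (density N (k x)) (space (density N (k x))) = 1"
      using one[OF x] by (simp add: emeasure_density cong: nn_integral_cong)
  qed
  show ?thesis
  proof (rule measurable_prob_algebraI[OF p])
    show "(\<lambda>x. density N (k x)) \<in> M \<rightarrow>\<^sub>M subprob_algebra N"
    proof (rule measurable_subprob_algebra)
      show "subprob_space (density N (k x))" if "x \<in> space M" for x
        using p[OF that] by (rule prob_space_imp_subprob_space)
      fix A assume A[measurable]: "A \<in> sets N"
      have "(\<lambda>x. \<integral>\<^sup>+y. k x y * indicator A y \<partial>N) \<in> borel_measurable M"
        by (rule N.borel_measurable_nn_integral) measurable
      then show "(\<lambda>x. emeasure (density N (k x)) A) \<in> borel_measurable M"
      proof (rule measurable_cong[THEN iffD1, rotated])
        fix x assume x: "x \<in> space M"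
        have [measurable]: "k x \<in> borel_measurable N" using measurable_Pair2[OF k x] by simp
        show "(\<integral>\<^sup>+y. k x y * indicator A y \<partial>N) = emeasure (density N (k x)) A"
          by (simp add: emeasure_density)
      qed
    qed simp
  qed simp
qed

lemma sigma_finite_LB: "finite I \<Longrightarrow> sigma_finite_measure (LB I)"
  by (rule lborel_product.sigma_finite)

lemma RR_not_empty: "RR I \<noteq> {}" by (simp add: PiE_eq_empty_iff)

lemma nd_measurable[measurable]: "nd I \<tau> x \<in> borel_measurable (LB I)"
  unfolding nd_def[abs_def] by (intro borel_measurable_sum borel_measurable_divide borel_measurable_power
      borel_measurable_diff borel_measurable_const) simp

section \<open>Product Gaussian laws and their densities\<close>

definition gauss :: "'i set \<Rightarrow> ('i \<Rightarrow> real) \<Rightarrow> ('i \<Rightarrow> real) \<Rightarrow> ('i \<Rightarrow> real) measure" where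
  "gauss I s y = PiM I (\<lambda>j. density lborel (normal_density (y j) (s j)))"

definition gdens :: "'i set \<Rightarrow> ('i \<Rightarrow> real) \<Rightarrow> ('i \<Rightarrow> real) \<Rightarrow> ('i \<Rightarrow> real) \<Rightarrow> real" where
  "gdens I s y x = (\<Prod>j\<in>I. normal_density (y j) (s j) (x j))"

lemma gdens_nonneg[simp]: "0 \<le> gdens I s y x" by (simp add: gdens_def prod_nonneg)

lemma normal_density_sym: "normal_density a s b = normal_density b s a"
  by (simp add: normal_density_def power2_commute)

lemma gdens_sym: "gdens I s y x = gdens I s x y" by (simp add: gdens_def normal_density_sym[of "y _"])

lemma gdens_measurable2[measurable]: "(\<lambda>z. gdens I s (fst z) (snd z)) \<in> borel_measurable (LB I \<Otimes>\<^sub>M LB I)"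
proof -
  have "(\<lambda>z. normal_density (fst z j) (s j) (snd z j)) \<in> borel_measurable (LB I \<Otimes>\<^sub>M LB I)" if [simp]: "j \<in> I" for j
    unfolding normal_density_def by measurable
  then show ?thesis unfolding gdens_def by (rule borel_measurable_prod)
qed

lemma gdens_measurable[measurable]: "gdens I s y \<in> borel_measurable (LB I)"
  unfolding gdens_def[abs_def] by (rule borel_measurable_prod) simp

lemma gauss_eq_density:
  assumes I: "finite I" and s: "\<And>j. j \<in> I \<Longrightarrow> 0 < s j"
  shows "gauss I s y = density (LB I) (\<lambda>x. ennreal (gdens I s y x))"
proof -
  \<comment> \<open>The product locale asks for a probability measure at every index, so the
    deviations are set to 1 outside \<open>I\<close>.\<close>
  define s' where "s' j = (if j \<in> I then s j else 1)" for j
  have s': "0 < s' j" for j using s by (simp add: s'_def)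
  interpret G: product_prob_space "\<lambda>j. density lborel (normal_density (y j) (s' j))"
    by (intro product_prob_spaceI prob_space_normal_density s')
  have "gauss I s y = PiM I (\<lambda>j. density lborel (normal_density (y j) (s' j)))"
    unfolding gauss_def by (intro PiM_cong refl) (simp add: s'_def)
  also have "\<dots> = density (LB I) (\<lambda>x. ennreal (gdens I s y x))"
  proof (rule G.PiM_eqI[OF I, symmetric])
    show "sets (density (LB I) (\<lambda>x. ennreal (gdens I s y x))) = sets (PiM I (\<lambda>j. density lborel (normal_density (y j) (s' j))))"
      by (simp, intro sets_PiM_cong) auto
    fix A :: "'a \<Rightarrow> real set" assume "\<And>i. i \<in> I \<Longrightarrow> A i \<in> sets (density lborel (normal_density (y i) (s' i)))"
    then have A: "A i \<in> sets borel" if "i \<in> I" for i using that by simp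
    have "emeasure (density (LB I) (\<lambda>x. ennreal (gdens I s y x))) (PiE I A)
        = (\<integral>\<^sup>+x. ennreal (gdens I s y x) * indicator (PiE I A) x \<partial>LB I)"
      using A I by (intro emeasure_density sets_PiM_I_finite) auto
    also have "\<dots> = (\<integral>\<^sup>+x. (\<Prod>j\<in>I. ennreal (normal_density (y j) (s' j) (x j)) * indicator (A j) (x j)) \<partial>LB I)"
    proof (rule nn_integral_cong)
      fix x assume "x \<in> space (LB I)"
      then have "indicator (PiE I A) x = (\<Prod>j\<in>I. indicator (A j) (x j) :: ennreal)"
        using I by (auto simp: space_LB indicator_def PiE_iff prod_zero_iff)
      then show "ennreal (gdens I s y x) * indicator (PiE I A) x
          = (\<Prod>j\<in>I. ennreal (normal_density (y j) (s' j) (x j)) * indicator (A j) (x j))"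
        by (simp add: gdens_def prod.distrib s'_def prod_ennreal cong: prod.cong)
    qed
    also have "\<dots> = (\<Prod>j\<in>I. \<integral>\<^sup>+x. ennreal (normal_density (y j) (s' j) x) * indicator (A j) x \<partial>lborel)"
      using A by (intro lborel_product.product_nn_integral_prod I) auto
    also have "\<dots> = (\<Prod>j\<in>I. emeasure (density lborel (normal_density (y j) (s' j))) (A j))"
      using A by (intro prod.cong refl emeasure_density[symmetric]) auto
    finally show "emeasure (density (LB I) (\<lambda>x. ennreal (gdens I s y x))) (PiE I A)
      = (\<Prod>j\<in>I. emeasure (density lborel (normal_density (y j) (s' j))) (A j))" .
  qed
  finally show ?thesis .
qed

locale gaussian_steps =
  fixes I :: "'i set" and s :: "'i \<Rightarrow> real"
  assumes fin: "finite I" and s_pos: "\<And>j. j \<in> I \<Longrightarrow> 0 < s j"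
begin

lemma gauss_density: "gauss I s y = density (LB I) (\<lambda>x. ennreal (gdens I s y x))"
  by (rule gauss_eq_density[OF fin]) (rule s_pos)

lemma prob_space_gauss: "prob_space (gauss I s y)"
proof -
  have "gauss I s y = PiM I (\<lambda>j. density lborel (normal_density (y j) (if j \<in> I then s j else 1)))"
    unfolding gauss_def by (intro PiM_cong refl) simp
  then show ?thesis using s_pos by (auto intro!: prob_space_PiM prob_space_normal_density)
qed

lemma sets_gauss[measurable_cong, simp]: "sets (gauss I s y) = sets (LB I)"
  unfolding gauss_def by (intro sets_PiM_cong) auto

lemma space_gauss[simp]: "space (gauss I s y) = RR I"
  unfolding gauss_def by (simp add: space_PiM)

lemma nn_integral_gauss:
  assumes [measurable]: "u \<in> borel_measurable (LB I)"
  shows "(\<integral>\<^sup>+x. u x \<partial>gauss I s y) = (\<integral>\<^sup>+x. ennreal (gdens I s y x) * u x \<partial>LB I)"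
  unfolding gauss_density by (rule nn_integral_density) simp_all

lemma nn_integral_gdens: "(\<integral>\<^sup>+x. ennreal (gdens I s y x) \<partial>LB I) = 1"
  using nn_integral_gauss[of "\<lambda>_. 1" y] prob_space.emeasure_space_1[OF prob_space_gauss] by simp

end

section \<open>A Poincare inequality for strongly convex potentials\<close>

text \<open>The quadratic term must be exact, since the Poincare inequality is read off from
  second-order coefficients; the cubic error may be crude, and \<open>exp t \<le> 3\<close> is below
  \<open>fact 3\<close>.\<close>

lemma exp_ge_Taylor2:
  fixes a :: real assumes "\<bar>a\<bar> \<le> 1" shows "1 + a + a\<^sup>2 / 2 - \<bar>a\<bar> ^ 3 \<le> exp a"
proof -
  obtain t where t: "\<bar>t\<bar> \<le> \<bar>a\<bar>" "exp a = (\<Sum>m<3. a ^ m / fact m) + exp t / fact 3 * a ^ 3"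
    using Maclaurin_exp_le[of a 3] by blast
  have "t \<le> 1" using t(1) assms by linarith
  then have e: "exp t \<le> 3" using exp_le order_trans[of "exp t" "exp 1" 3] by simp
  have "\<bar>exp t / fact 3 * a ^ 3\<bar> = exp t / fact 3 * \<bar>a\<bar> ^ 3" by (simp add: abs_mult power_abs)
  also have "\<dots> \<le> 1 * \<bar>a\<bar> ^ 3" using e by (intro mult_right_mono) (simp_all add: fact_numeral)
  finally have "- (\<bar>a\<bar> ^ 3) \<le> exp t / fact 3 * a ^ 3" by linarith
  moreover have "(\<Sum>m<3. a ^ m / fact m) = 1 + a + a\<^sup>2 / 2"
    by (simp add: eval_nat_numeral)
  ultimately show ?thesis using t(2) by linarith
qed

context gibbs_potential
begin

text \<open>Maurey's argument. Prekopa--Leindler is applied, on \<open>B\<close>, to the density of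
  the Gibbs measure times \<open>exp (t * h - t\<^sup>2 * G\<^sup>2 / m)\<close>, times
  \<open>exp (- t * h)\<close> and times 1. The subtracted term is the maximum over \<open>r\<close>
  of \<open>t * G * r - m / 4 * r\<^sup>2\<close>, so the gain from strong convexity pays for the
  increment of \<open>h\<close>. As \<open>t\<close> tends to 0 the orders 0 and 1 cancel and the
  second order is the claim. Since the relevant distances shrink with \<open>t\<close>, the
  Lipschitz bound may be confined to any \<open>\<rho> > 0\<close>; \<open>B\<close> only has to be
  closed under midpoints.\<close>

lemma local_Poincare:
  assumes \<tau>: "\<And>j. j \<in> I \<Longrightarrow> 0 < \<tau> j" and m: "0 < m"
    and conv: "\<And>x y. x \<in> RR I \<Longrightarrow> y \<in> RR I \<Longrightarrow> 2 * W (midp I x y) + m / 4 * nd I \<tau> x y \<le> W x + W y"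
    and B[measurable]: "B \<in> sets (LB I)" and B_mid: "\<And>x y. x \<in> B \<Longrightarrow> y \<in> B \<Longrightarrow> midp I x y \<in> B"
    and h[measurable]: "h \<in> borel_measurable (LB I)" and G[measurable]: "G \<in> borel_measurable (LB I)"
    and h_bd: "\<And>x. x \<in> B \<Longrightarrow> \<bar>h x\<bar> \<le> M" and G_bd: "\<And>x. x \<in> B \<Longrightarrow> 0 \<le> G x \<and> G x \<le> M"
    and \<rho>: "0 < \<rho>"
    and Lip: "\<And>x y. x \<in> B \<Longrightarrow> y \<in> B \<Longrightarrow> nd I \<tau> x y \<le> \<rho> \<Longrightarrow> \<bar>h x - h y\<bar> \<le> G x * sqrt (nd I \<tau> x y)"
  shows "measure (gibbs I W) B * (\<integral>x. indicator B x * (h x)\<^sup>2 \<partial>gibbs I W) - (\<integral>x. indicator B x * h x \<partial>gibbs I W)\<^sup>2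
    \<le> measure (gibbs I W) B * (\<integral>x. indicator B x * (G x)\<^sup>2 \<partial>gibbs I W) / m"
proof -
  interpret P: prob_space "gibbs I W" by (rule prob_space_gibbs)
  define b where "b = measure (gibbs I W) B"
  define H1 where "H1 = (\<integral>x. indicator B x * h x \<partial>gibbs I W)"
  define H2 where "H2 = (\<integral>x. indicator B x * (h x)\<^sup>2 \<partial>gibbs I W)"
  define G2 where "G2 = (\<integral>x. indicator B x * (G x)\<^sup>2 \<partial>gibbs I W)"
  have b0: "0 \<le> b" "b \<le> 1" by (simp_all add: b_def)
  show ?thesis
  proof (cases "b = 0")
    case True then show ?thesis by (simp add: b_def)
  next
    case False
    then have bpos: "0 < b" using b0 by simp
    have "B \<noteq> {}" using False by (auto simp: b_def)
    then have M0: "0 \<le> M" using h_bd by (meson abs_ge_zero ex_in_conv order_trans)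
    \<comment> \<open>\<open>M1\<close> bounds \<open>\<bar>k t x\<bar> / t\<close> for
      \<open>0 < t \<le> 1\<close>. The constant \<open>c\<close> collects the cubic errors:
      \<open>M ^ 3 / m\<close> from the cross term in the square of \<open>k\<close>,
      \<open>M1 ^ 3\<close> from the Taylor remainder.\<close>
    define M1 where "M1 = M + M\<^sup>2 / m"
    define c where "c = M ^ 3 / m + M1 ^ 3"
    have M1: "M \<le> M1" using m by (simp add: M1_def)
    define k where "k t x = t * h x - t\<^sup>2 * (G x)\<^sup>2 / m" for t x
    have [measurable]: "k t \<in> borel_measurable (LB I)" for t unfolding k_def[abs_def] by measurable
    have iB: "integrable (gibbs I W) (\<lambda>x. indicator B x * u x)"
      if [measurable]: "u \<in> borel_measurable (LB I)" and "\<And>x. x \<in> B \<Longrightarrow> \<bar>u x\<bar> \<le> D" for D and u :: "_ \<Rightarrow> real"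
      by (rule P.integrable_const_bound[where B="\<bar>D\<bar>"]) (use that in \<open>auto simp: indicator_def intro!: AE_I2 order_trans[OF that(2)]\<close>)
    have ih: "integrable (gibbs I W) (\<lambda>x. indicator B x * h x)" by (rule iB) (use h_bd in auto)
    have ih2: "integrable (gibbs I W) (\<lambda>x. indicator B x * (h x)\<^sup>2)"
      by (rule iB[of _ "M\<^sup>2"]) (use h_bd M0 in \<open>auto simp: abs_le_square_iff[symmetric]\<close>)
    have iG2: "integrable (gibbs I W) (\<lambda>x. indicator B x * (G x)\<^sup>2)"
      by (rule iB[of _ "M\<^sup>2"]) (use G_bd M0 in \<open>auto simp: abs_le_square_iff[symmetric]\<close>)
    have i1: "integrable (gibbs I W) (\<lambda>x. indicator B x :: real)"
      using iB[of "\<lambda>_. 1" 1] by simp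
    have bI: "measure (gibbs I W) (B \<inter> RR I) = b"
      using sets.sets_into_space[OF B] by (simp add: b_def space_LB Int_absorb2)
    have Ib: "(\<integral>x. indicator B x \<partial>gibbs I W) = b" using sets.sets_into_space[OF B] by (simp add: b_def space_LB Int_absorb2)
    \<comment> \<open>The inequality \<open>A * C \<le> b * b\<close> with both factors replaced by
      their second-order lower bounds and the difference divided by
      \<open>t\<^sup>2\<close>.\<close>
    have small: "b * (H2 - G2 / m - 2 * c * t) + (H1 + t * (H2 / 2 - G2 / m) - c * t\<^sup>2) * (- H1 + t * (H2 / 2) - c * t\<^sup>2) \<le> 0"
      if t0: "0 < t" and t1: "t \<le> 1" and tM1: "t * M1 \<le> 1" and t\<rho>: "8 * t * M \<le> m * \<rho>"
        and pA: "0 \<le> b + t * H1 + t\<^sup>2 * (H2 / 2 - G2 / m) - c * t ^ 3" and pC: "0 \<le> b - t * H1 + t\<^sup>2 * (H2 / 2) - c * t ^ 3" for t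
    proof -
      have kb: "\<bar>k t x\<bar> \<le> t * M1" if x: "x \<in> B" for x
      proof -
        have g: "(G x)\<^sup>2 \<le> M\<^sup>2" using G_bd[OF x] by (intro power_mono) auto
        have tt: "t\<^sup>2 \<le> t" using t0 t1 by (simp add: power2_eq_square mult_le_one)
        have "\<bar>k t x\<bar> \<le> t * \<bar>h x\<bar> + t\<^sup>2 * (G x)\<^sup>2 / m"
          unfolding k_def using t0 m by (intro order_trans[OF abs_triangle_ineq4]) (simp add: abs_mult)
        also have "\<dots> \<le> t * M + t * M\<^sup>2 / m"
          using h_bd[OF x] t0 m g tt by (intro add_mono mult_left_mono divide_right_mono mult_mono) auto
        finally show ?thesis by (simp add: M1_def algebra_simps)
      qed
      have ik: "integrable (gibbs I W) (\<lambda>x. indicator B x * exp (k t x))"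
        by (rule iB[of _ "exp (t * M1)"]) (use kb in \<open>auto simp: abs_le_iff\<close>)
      have ith: "integrable (gibbs I W) (\<lambda>x. indicator B x * exp (- (t * h x)))"
      proof (rule iB[of _ "exp (t * M)"])
        fix x assume x: "x \<in> B"
        have "- (t * h x) \<le> t * M" using mult_left_mono[of "- h x" M t] h_bd[OF x] t0 by simp
        then show "\<bar>exp (- (t * h x))\<bar> \<le> exp (t * M)" by simp
      qed simp
      define A where "A = (\<integral>x. indicator B x * exp (k t x) \<partial>gibbs I W)"
      define C where "C = (\<integral>x. indicator B x * exp (- (t * h x)) \<partial>gibbs I W)"
      have A0: "0 \<le> A" "0 \<le> C" unfolding A_def C_def by (auto intro!: Bochner_Integration.integral_nonneg)
      have AC: "A * C \<le> b * b"
      proof -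
        let ?f = "\<lambda>x. ennreal (exp (- W x)) * ennreal (indicator B x * exp (k t x))"
        let ?g = "\<lambda>x. ennreal (exp (- W x)) * ennreal (indicator B x * exp (- (t * h x)))"
        let ?h = "\<lambda>x. ennreal (exp (- W x)) * ennreal (indicator B x)"
        have "(\<integral>\<^sup>+x. ?f x \<partial>LB I) * (\<integral>\<^sup>+x. ?g x \<partial>LB I) \<le> (\<integral>\<^sup>+x. ?h x \<partial>LB I)\<^sup>2"
        proof (rule Prekopa_Leindler[OF fin])
          fix x y assume xy: "x \<in> RR I" "y \<in> RR I"
          show "?f x * ?g y \<le> (?h (midp I x y))\<^sup>2"
          proof (cases "x \<in> B \<and> y \<in> B")
            case False then show ?thesis by (auto simp: indicator_def)
          next
            case True
            then have x: "x \<in> B" and y: "y \<in> B" by auto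
            define s where "s = sqrt (nd I \<tau> x y)"
            have s: "0 \<le> s" "s\<^sup>2 = nd I \<tau> x y" using nd_nonneg[OF \<tau>] by (simp_all add: s_def)
            \<comment> \<open>Near pairs are handled by completing the square. For far pairs
              \<open>8 * t * M \<le> m * \<rho>\<close> lets the convexity gain absorb the whole
              oscillation \<open>2 * t * M\<close>.\<close>
            have key: "t * (h x - h y) - t\<^sup>2 * (G x)\<^sup>2 / m \<le> m / 4 * nd I \<tau> x y"
            proof (cases "nd I \<tau> x y \<le> \<rho>")
              case True
              have "t * (h x - h y) \<le> t * (G x * s)"
                using Lip[OF x y True] t0 by (intro mult_left_mono) (auto simp: s_def)
              moreover have "0 \<le> (t * G x - m * s / 2)\<^sup>2 / m" using m by simp
              moreover have "(t * G x - m * s / 2)\<^sup>2 / m = t\<^sup>2 * (G x)\<^sup>2 / m + m / 4 * s\<^sup>2 - t * (G x * s)"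
                using m by (simp add: power2_eq_square field_simps)
              ultimately show ?thesis unfolding s(2)[symmetric] by argo
            next
              case False
              have "t * (h x - h y) \<le> t * (2 * M)"
                using h_bd[OF x] h_bd[OF y] t0 by (intro mult_left_mono) auto
              moreover have "m * \<rho> \<le> m * nd I \<tau> x y" using False m by simp
              moreover have "0 \<le> t\<^sup>2 * (G x)\<^sup>2 / m" using m by simp
              ultimately show ?thesis using t\<rho> by argo
            qed
            have "- W x + k t x + (- W y + - (t * h y)) \<le> - W (midp I x y) + - W (midp I x y)"
              using key conv[OF xy] unfolding k_def by argo
            then have "exp (- W x) * exp (k t x) * (exp (- W y) * exp (- (t * h y))) \<le> exp (- W (midp I x y)) * exp (- W (midp I x y))"
              unfolding exp_add[symmetric] by simp
            then show ?thesis using x y B_mid[OF x y]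
              by (simp add: ennreal_mult[symmetric] power2_eq_square ennreal_leI)
          qed
        qed measurable
        then have "(ennreal (1/Z) * (\<integral>\<^sup>+x. ?f x \<partial>LB I)) * (ennreal (1/Z) * (\<integral>\<^sup>+x. ?g x \<partial>LB I)) \<le> (ennreal (1/Z) * (\<integral>\<^sup>+x. ?h x \<partial>LB I))\<^sup>2"
          by (simp add: power2_eq_square mult_ac mult_left_mono)
        then have "(\<integral>\<^sup>+x. ennreal (indicator B x * exp (k t x)) \<partial>gibbs I W) * (\<integral>\<^sup>+x. ennreal (indicator B x * exp (- (t * h x))) \<partial>gibbs I W)
           \<le> (\<integral>\<^sup>+x. ennreal (indicator B x) \<partial>gibbs I W)\<^sup>2"
          by (subst (1 2 3) nn_integral_gibbs(2)) simp_all
        then have "ennreal A * ennreal C \<le> (ennreal b)\<^sup>2"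
          unfolding A_def C_def Ib[symmetric] using ik ith i1
          by (subst (asm) (1 2 3) nn_integral_eq_integral) auto
        then show ?thesis using b0 A0 by (simp add: ennreal_mult[symmetric] power2_eq_square ennreal_le_iff)
      qed
      have Alow: "b + t * H1 + t\<^sup>2 * (H2 / 2 - G2 / m) - c * t ^ 3 \<le> A"
      proof -
        have "b + t * H1 + t\<^sup>2 * (H2 / 2 - G2 / m) - c * t ^ 3 \<le> b + t * H1 + t\<^sup>2 * (H2 / 2 - G2 / m) - c * t ^ 3 * b"
          using b0 t0 M0 m M1 mult_left_le[of b "c * t ^ 3"] by (simp add: c_def)
        also have "\<dots> = (\<integral>x. indicator B x + t * (indicator B x * h x) + t\<^sup>2 * (indicator B x * (h x)\<^sup>2 / 2 - indicator B x * (G x)\<^sup>2 / m) - c * t ^ 3 * indicator B x \<partial>gibbs I W)"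
          using i1 ih ih2 iG2 by (simp add: bI H1_def H2_def G2_def)
        also have "\<dots> \<le> A" unfolding A_def
        proof (rule integral_mono[OF _ ik])
          show "integrable (gibbs I W) (\<lambda>x. indicator B x + t * (indicator B x * h x) + t\<^sup>2 * (indicator B x * (h x)\<^sup>2 / 2 - indicator B x * (G x)\<^sup>2 / m) - c * t ^ 3 * indicator B x)"
            using i1 ih ih2 iG2 by simp
          fix x
          show "indicator B x + t * (indicator B x * h x) + t\<^sup>2 * (indicator B x * (h x)\<^sup>2 / 2 - indicator B x * (G x)\<^sup>2 / m) - c * t ^ 3 * indicator B x \<le> indicator B x * exp (k t x)"
          proof (cases "x \<in> B")
            case x: True
            have "1 + k t x + (k t x)\<^sup>2 / 2 - \<bar>k t x\<bar> ^ 3 \<le> exp (k t x)"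
              using kb[OF x] tM1 by (intro exp_ge_Taylor2) linarith
            moreover have "\<bar>k t x\<bar> ^ 3 \<le> M1 ^ 3 * t ^ 3"
              using power_mono[OF kb[OF x], of 3] by (simp add: power_mult_distrib mult.commute)
            moreover have "t\<^sup>2 * (h x)\<^sup>2 - 2 * (M ^ 3 / m * t ^ 3) \<le> (k t x)\<^sup>2"
            proof -
              have "h x * (G x)\<^sup>2 \<le> M * M\<^sup>2"
                using h_bd[OF x] G_bd[OF x] M0 by (intro mult_mono power_mono) auto
              then have "h x * (G x)\<^sup>2 * (2 * t ^ 3 / m) \<le> M * M\<^sup>2 * (2 * t ^ 3 / m)"
                using t0 m by (intro mult_right_mono) auto
              moreover have "(k t x)\<^sup>2 = t\<^sup>2 * (h x)\<^sup>2 - h x * (G x)\<^sup>2 * (2 * t ^ 3 / m) + (t\<^sup>2 * (G x)\<^sup>2 / m)\<^sup>2"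
                unfolding k_def power2_diff by (simp add: power2_eq_square power3_eq_cube mult_ac)
              moreover have "M * M\<^sup>2 * (2 * t ^ 3 / m) = 2 * (M ^ 3 / m * t ^ 3)"
                by (simp add: power2_eq_square power3_eq_cube mult_ac)
              moreover have "0 \<le> (t\<^sup>2 * (G x)\<^sup>2 / m)\<^sup>2" by simp
              ultimately show ?thesis by linarith
            qed
            ultimately have "1 + k t x + t\<^sup>2 * (h x)\<^sup>2 / 2 - (M ^ 3 / m * t ^ 3) - M1 ^ 3 * t ^ 3 \<le> exp (k t x)" by linarith
            then show ?thesis using x by (simp add: k_def c_def algebra_simps)
          qed simp
        qed
        finally show ?thesis .
      qed
      have Clow: "b - t * H1 + t\<^sup>2 * (H2 / 2) - c * t ^ 3 \<le> C"
      proof -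
        have "b - t * H1 + t\<^sup>2 * (H2 / 2) - c * t ^ 3 \<le> b - t * H1 + t\<^sup>2 * (H2 / 2) - c * t ^ 3 * b"
          using b0 t0 M0 m M1 mult_left_le[of b "c * t ^ 3"] by (simp add: c_def)
        also have "\<dots> = (\<integral>x. indicator B x - t * (indicator B x * h x) + t\<^sup>2 * (indicator B x * (h x)\<^sup>2 / 2) - c * t ^ 3 * indicator B x \<partial>gibbs I W)"
          using i1 ih ih2 by (simp add: bI H1_def H2_def)
        also have "\<dots> \<le> C" unfolding C_def
        proof (rule integral_mono[OF _ ith])
          show "integrable (gibbs I W) (\<lambda>x. indicator B x - t * (indicator B x * h x) + t\<^sup>2 * (indicator B x * (h x)\<^sup>2 / 2) - c * t ^ 3 * indicator B x)"
            using i1 ih ih2 by simp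
          fix x
          show "indicator B x - t * (indicator B x * h x) + t\<^sup>2 * (indicator B x * (h x)\<^sup>2 / 2) - c * t ^ 3 * indicator B x \<le> indicator B x * exp (- (t * h x))"
          proof (cases "x \<in> B")
            case x: True
            have th: "\<bar>- (t * h x)\<bar> \<le> t * M1"
              using h_bd[OF x] M1 t0 by (simp add: abs_mult)
            have "1 + - (t * h x) + (- (t * h x))\<^sup>2 / 2 - \<bar>- (t * h x)\<bar> ^ 3 \<le> exp (- (t * h x))"
              using th tM1 by (intro exp_ge_Taylor2) linarith
            moreover have "\<bar>- (t * h x)\<bar> ^ 3 \<le> M1 ^ 3 * t ^ 3"
              using power_mono[OF th, of 3] by (simp add: power_mult_distrib mult.commute)
            moreover have "M1 ^ 3 * t ^ 3 \<le> c * t ^ 3" using t0 m M0 by (intro mult_right_mono) (auto simp: c_def)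
            moreover have "(- (t * h x))\<^sup>2 = t\<^sup>2 * (h x)\<^sup>2" by (simp add: power_mult_distrib)
            ultimately show ?thesis using x by simp
          qed simp
        qed
        finally show ?thesis .
      qed
      have "(b + t * H1 + t\<^sup>2 * (H2 / 2 - G2 / m) - c * t ^ 3) * (b - t * H1 + t\<^sup>2 * (H2 / 2) - c * t ^ 3) \<le> b * b"
        using mult_mono[OF Alow Clow A0(1) pC] AC by linarith
      moreover have "(b + t * H1 + t\<^sup>2 * (H2 / 2 - G2 / m) - c * t ^ 3) * (b - t * H1 + t\<^sup>2 * (H2 / 2) - c * t ^ 3) - b * b
        = t\<^sup>2 * (b * (H2 - G2 / m - 2 * c * t) + (H1 + t * (H2 / 2 - G2 / m) - c * t\<^sup>2) * (- H1 + t * (H2 / 2) - c * t\<^sup>2))"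
      proof -
        define P where "P = H2 / 2 - G2 / m" define Q where "Q = H2 / 2"
        have e: "H2 - G2 / m - 2 * c * t = P + Q - 2 * c * t" by (simp add: P_def Q_def)
        show ?thesis unfolding e P_def[symmetric] unfolding Q_def[symmetric] by (simp add: power2_eq_square power3_eq_cube algebra_simps)
      qed
      ultimately have "t\<^sup>2 * (b * (H2 - G2 / m - 2 * c * t) + (H1 + t * (H2 / 2 - G2 / m) - c * t\<^sup>2) * (- H1 + t * (H2 / 2) - c * t\<^sup>2)) \<le> 0"
        by linarith
      then show ?thesis using t0 by (simp add: mult_le_0_iff not_le)
    qed
    let ?F = "\<lambda>t. b * (H2 - G2 / m - 2 * c * t) + (H1 + t * (H2 / 2 - G2 / m) - c * t\<^sup>2) * (- H1 + t * (H2 / 2) - c * t\<^sup>2)"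
    \<comment> \<open>Every smallness condition on \<open>t\<close> is continuous and strict at 0,
      so all hold for small positive \<open>t\<close>.\<close>
    have ev: "eventually (\<lambda>t. ?F t \<le> 0) (at_right 0)"
    proof -
      have small0: "\<forall>\<^sub>F t in at_right 0. g t < e" if "(g \<longlongrightarrow> g 0) (at_right 0)" "g 0 < e" for g :: "real \<Rightarrow> real" and e
        using order_tendstoD(2)[OF that] .
      have e1: "\<forall>\<^sub>F t::real in at_right 0. t < 1" by (rule small0[of "\<lambda>t. t"]) (auto intro!: tendsto_intros)
      have e2: "\<forall>\<^sub>F t in at_right 0. t * M1 < 1" by (rule small0[of "\<lambda>t. t * M1"]) (auto intro!: tendsto_eq_intros)
      have e3: "\<forall>\<^sub>F t in at_right 0. 8 * t * M < m * \<rho>" by (rule small0[of "\<lambda>t. 8 * t * M"]) (use m \<rho> in \<open>auto intro!: tendsto_eq_intros\<close>)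
      have e4: "\<forall>\<^sub>F t in at_right 0. - (b + t * H1 + t\<^sup>2 * (H2 / 2 - G2 / m) - c * t ^ 3) < 0"
        by (rule small0[of "\<lambda>t. - (b + t * H1 + t\<^sup>2 * (H2 / 2 - G2 / m) - c * t ^ 3)"]) (use bpos m in \<open>auto intro!: tendsto_eq_intros\<close>)
      have e5: "\<forall>\<^sub>F t in at_right 0. - (b - t * H1 + t\<^sup>2 * (H2 / 2) - c * t ^ 3) < 0"
        by (rule small0[of "\<lambda>t. - (b - t * H1 + t\<^sup>2 * (H2 / 2) - c * t ^ 3)"]) (use bpos in \<open>auto intro!: tendsto_eq_intros\<close>)
      show ?thesis using e1 e2 e3 e4 e5 eventually_at_right_less[of "0::real"]
      proof eventually_elim
        case (elim t) then show ?case by (intro small) auto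
      qed
    qed
    \<comment> \<open>At \<open>t = 0\<close> the bracket equals
      \<open>b * (H2 - G2 / m) - H1\<^sup>2\<close>.\<close>
    have "(?F \<longlongrightarrow> ?F 0) (at_right 0)" by (intro tendsto_intros)
    from tendsto_upperbound[OF this ev] have "?F 0 \<le> 0" by simp
    then have "b * H2 - H1\<^sup>2 \<le> b * (G2 / m)" by (simp add: power2_eq_square algebra_simps)
    then show ?thesis by (simp add: b_def H1_def H2_def G2_def)
  qed
qed

end

section \<open>The spectral gap of the random walk Metropolis kernel\<close>

context gaussian_steps
begin

section \<open>Linear functionals and shifts of a Gaussian vector\<close>

definition lin :: "('i \<Rightarrow> real) \<Rightarrow> ('i \<Rightarrow> real) \<Rightarrow> ('i \<Rightarrow> real) \<Rightarrow> real" where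
  "lin v c w = (\<Sum>j\<in>I. v j * (w j - c j))"

definition lin_sd :: "('i \<Rightarrow> real) \<Rightarrow> real" where
  "lin_sd v = sqrt (\<Sum>j\<in>I. (v j * s j)\<^sup>2)"

lemma lin_sd_nonneg: "0 \<le> lin_sd v" by (simp add: lin_sd_def sum_nonneg)

lemma lin_measurable[measurable]: "lin v c \<in> borel_measurable (LB I)"
  unfolding lin_def[abs_def] by (intro borel_measurable_sum) simp

lemma lin_distributed:
  assumes pos: "0 < lin_sd v"
  shows "distributed (gauss I s c) lborel (lin v c) (normal_density 0 (lin_sd v))"
proof -
  interpret G: prob_space "gauss I s c" by (rule prob_space_gauss)
  \<comment> \<open>Coordinates with \<open>v j = 0\<close> are dropped because the affine image of
    a normal law is normal only for a nonzero factor.\<close>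
  define J where "J = {j\<in>I. v j \<noteq> 0}"
  have J: "J \<subseteq> I" "finite J" using fin by (auto simp: J_def)
  have ne: "J \<noteq> {}"
  proof
    assume "J = {}"
    then have "\<And>j. j \<in> I \<Longrightarrow> v j = 0" by (auto simp: J_def)
    then show False using pos by (simp add: lin_sd_def)
  qed
  define N where "N j = density lborel (normal_density (c j) (if j \<in> I then s j else 1))" for j
  have N: "prob_space (N j)" for j unfolding N_def using s_pos by (auto intro: prob_space_normal_density)
  have gN: "gauss I s c = PiM I N" unfolding gauss_def N_def by (intro PiM_cong refl) simp
  have "prob_space.indep_vars (PiM I N) N (\<lambda>i f. f i) I"
  proof (subst prob_space.indep_vars_iff_distr_eq_PiM')
    have "distr (PiM I N) (PiM I N) (\<lambda>x. \<lambda>i\<in>I. x i) = distr (PiM I N) (PiM I N) (\<lambda>x. x)"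
      by (intro distr_cong refl) (auto simp: space_PiM)
    also have "\<dots> = PiM I N" by (rule distr_id2) simp
    also have "\<dots> = PiM I (\<lambda>i. distr (PiM I N) (N i) (\<lambda>f. f i))"
      by (intro PiM_cong refl distr_PiM_component[symmetric] N)
    finally show "distr (PiM I N) (PiM I N) (\<lambda>x. \<lambda>i\<in>I. x i) = PiM I (\<lambda>i. distr (PiM I N) (N i) (\<lambda>f. f i))" .
    show "prob_space (PiM I N)" by (intro prob_space_PiM N)
    show "I \<noteq> {}" using ne J(1) by auto
  qed simp
  then have "G.indep_vars N (\<lambda>i f. f i) J" unfolding gN[symmetric] using J(1) by (rule G.indep_vars_subset)
  then have "G.indep_vars (\<lambda>_. borel) (\<lambda>i f. v i * (f i - c i)) J"
    by (rule G.indep_vars_compose2) (simp add: N_def)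
  moreover have "distributed (gauss I s c) lborel (\<lambda>f. v j * (f j - c j)) (normal_density 0 (\<bar>v j\<bar> * s j))" if j: "j \<in> J" for j
  proof -
    have jI: "j \<in> I" and vj: "v j \<noteq> 0" using j by (auto simp: J_def)
    have "distr (PiM I N) (N j) (\<lambda>f. f j) = N j" by (rule distr_PiM_component[OF N jI])
    then have "distr (gauss I s c) lborel (\<lambda>f. f j) = density lborel (normal_density (c j) (s j))"
      unfolding gN using jI by (simp add: N_def cong: distr_cong)
    then have d: "distributed (gauss I s c) lborel (\<lambda>f. f j) (normal_density (c j) (s j))"
      using jI unfolding distributed_def by simp
    have "(\<lambda>f. v j * (f j - c j)) = (\<lambda>f. - v j * c j + v j * f j)" by (auto simp: algebra_simps)
    then show ?thesis using G.normal_density_affine[OF d s_pos[OF jI] vj, of "- v j * c j"] by simp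
  qed
  ultimately have "distributed (gauss I s c) lborel (\<lambda>f. \<Sum>j\<in>J. v j * (f j - c j)) (normal_density (\<Sum>j\<in>J. 0) (sqrt (\<Sum>j\<in>J. (\<bar>v j\<bar> * s j)\<^sup>2)))"
    by (intro G.sum_indep_normal J ne) (use J s_pos in \<open>auto simp: J_def\<close>)
  moreover have "(\<Sum>j\<in>J. v j * (f j - c j)) = lin v c f" for f
    unfolding lin_def using fin by (intro sum.mono_neutral_left) (auto simp: J_def)
  moreover have "(\<Sum>j\<in>J. (\<bar>v j\<bar> * s j)\<^sup>2) = (\<Sum>j\<in>I. (v j * s j)\<^sup>2)"
    using fin by (intro sum.mono_neutral_cong_left) (auto simp: J_def power_mult_distrib)
  ultimately show ?thesis by (simp add: lin_sd_def)
qed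

lemma lin_zero: assumes "lin_sd v = 0" shows "lin v c w = 0"
proof -
  have "(\<Sum>j\<in>I. (v j * s j)\<^sup>2) = 0" using assms by (simp add: lin_sd_def)
  then have "\<And>j. j \<in> I \<Longrightarrow> (v j * s j)\<^sup>2 = 0" using fin by (subst (asm) sum_nonneg_eq_0_iff) auto
  then have "\<And>j. j \<in> I \<Longrightarrow> v j = 0" using s_pos by fastforce
  then show ?thesis by (simp add: lin_def)
qed

lemma lin_moments:
  shows "integrable (gauss I s c) (lin v c)" "(\<integral>w. lin v c w \<partial>gauss I s c) = 0"
    and "integrable (gauss I s c) (\<lambda>w. (lin v c w)\<^sup>2)" "(\<integral>w. (lin v c w)\<^sup>2 \<partial>gauss I s c) = (lin_sd v)\<^sup>2"
    and "3 / 4 * lin_sd v \<le> (\<integral>w. \<bar>lin v c w\<bar> \<partial>gauss I s c)"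
proof -
  have "integrable (gauss I s c) (lin v c) \<and> (\<integral>w. lin v c w \<partial>gauss I s c) = 0 \<and>
    integrable (gauss I s c) (\<lambda>w. (lin v c w)\<^sup>2) \<and> (\<integral>w. (lin v c w)\<^sup>2 \<partial>gauss I s c) = (lin_sd v)\<^sup>2 \<and>
    3 / 4 * lin_sd v \<le> (\<integral>w. \<bar>lin v c w\<bar> \<partial>gauss I s c)"
  proof (cases "lin_sd v = 0")
    case True
    have "lin v c = (\<lambda>w. 0)" by (rule ext) (rule lin_zero[OF True])
    then show ?thesis using True by simp
  next
    case False
    then have pos: "0 < lin_sd v" using lin_sd_nonneg[of v] by simp
    note d = lin_distributed[OF pos, of c]
    have I1: "integrable (gauss I s c) (\<lambda>w. g (lin v c w)) \<longleftrightarrow> integrable lborel (\<lambda>x. normal_density 0 (lin_sd v) x * g x)"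
      if "g \<in> borel_measurable borel" for g :: "real \<Rightarrow> real"
      by (rule distributed_integrable[OF d, symmetric]) (use that in simp_all)
    have I2: "(\<integral>w. g (lin v c w) \<partial>gauss I s c) = (\<integral>x. normal_density 0 (lin_sd v) x * g x \<partial>lborel)"
      if "g \<in> borel_measurable borel" for g :: "real \<Rightarrow> real"
      by (rule distributed_integral[OF d, symmetric]) (use that in simp_all)
    have n1: "has_bochner_integral lborel (\<lambda>x. normal_density 0 (lin_sd v) x * x) 0"
      using normal_moment_odd[OF pos, of 0 0] by simp
    have n2: "has_bochner_integral lborel (\<lambda>x. normal_density 0 (lin_sd v) x * x\<^sup>2) ((lin_sd v)\<^sup>2)"
      using normal_moment_even[OF pos, of 0 1] by (simp add: fact_numeral)
    have n3: "has_bochner_integral lborel (\<lambda>x. normal_density 0 (lin_sd v) x * \<bar>x\<bar>) (lin_sd v * sqrt (2 / pi))"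
      using normal_moment_abs_odd[OF pos, of 0 0] by simp
    have 1: "integrable (gauss I s c) (lin v c)" "(\<integral>w. lin v c w \<partial>gauss I s c) = 0"
      using I1[of "\<lambda>x. x"] I2[of "\<lambda>x. x"] n1 unfolding has_bochner_integral_iff by simp_all
    have 2: "integrable (gauss I s c) (\<lambda>w. (lin v c w)\<^sup>2)" "(\<integral>w. (lin v c w)\<^sup>2 \<partial>gauss I s c) = (lin_sd v)\<^sup>2"
      using I1[of "\<lambda>x. x\<^sup>2"] I2[of "\<lambda>x. x\<^sup>2"] n2 unfolding has_bochner_integral_iff by simp_all
    have "(\<integral>w. \<bar>lin v c w\<bar> \<partial>gauss I s c) = lin_sd v * sqrt (2 / pi)"
      using I2[of "\<lambda>x. \<bar>x\<bar>"] n3 unfolding has_bochner_integral_iff by simp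
    \<comment> \<open>The first absolute moment of the standard normal law is
      \<open>sqrt (2 / pi)\<close>, about 0.798.\<close>
    moreover have "3 / 4 \<le> sqrt (2 / pi)"
    proof (rule real_le_rsqrt)
      have "pi < 3.2" using pi_approx(2) by simp
      then show "(3 / 4)\<^sup>2 \<le> 2 / pi" by (simp add: field_simps power2_eq_square)
    qed
    ultimately have "3 / 4 * lin_sd v \<le> (\<integral>w. \<bar>lin v c w\<bar> \<partial>gauss I s c)"
      using mult_right_mono[of "3/4" "sqrt (2/pi)" "lin_sd v"] pos by (simp add: mult.commute)
    then show ?thesis using 1 2 by blast
  qed
  then show "integrable (gauss I s c) (lin v c)" "(\<integral>w. lin v c w \<partial>gauss I s c) = 0"
    and "integrable (gauss I s c) (\<lambda>w. (lin v c w)\<^sup>2)" "(\<integral>w. (lin v c w)\<^sup>2 \<partial>gauss I s c) = (lin_sd v)\<^sup>2"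
    and "3 / 4 * lin_sd v \<le> (\<integral>w. \<bar>lin v c w\<bar> \<partial>gauss I s c)" by auto
qed

lemma gauss_nd:
  shows "integrable (gauss I s c) (\<lambda>w. nd I \<tau> w c)" "(\<integral>w. nd I \<tau> w c \<partial>gauss I s c) = (\<Sum>j\<in>I. (s j)\<^sup>2 / \<tau> j)"
proof -
  \<comment> \<open>Coordinate vectors recover the variances of the single coordinates from
    \<open>lin_moments\<close>.\<close>
  have e: "lin (\<lambda>i. if i = j then 1 else 0) c w = w j - c j" and e2: "(lin_sd (\<lambda>i. if i = j then 1 else 0))\<^sup>2 = (s j)\<^sup>2" if "j \<in> I" for j w
    using fin that by (simp_all add: lin_def lin_sd_def if_distrib[of "\<lambda>a. a * _"] if_distrib[of "\<lambda>a. a ^ 2"] sum_nonneg cong: if_cong)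
  have *: "integrable (gauss I s c) (\<lambda>w. (w j - c j)\<^sup>2)" "(\<integral>w. (w j - c j)\<^sup>2 \<partial>gauss I s c) = (s j)\<^sup>2" if j: "j \<in> I" for j
    using lin_moments(3,4)[of c "\<lambda>i. if i = j then 1 else 0"] unfolding e[OF j] e2[OF j] by simp_all
  show "integrable (gauss I s c) (\<lambda>w. nd I \<tau> w c)" unfolding nd_def using * by auto
  show "(\<integral>w. nd I \<tau> w c \<partial>gauss I s c) = (\<Sum>j\<in>I. (s j)\<^sup>2 / \<tau> j)"
    unfolding nd_def using * by (subst Bochner_Integration.integral_sum) auto
qed

lemma lin_shift: "lin v c w = lin v c' w + lin v c c'"
proof -
  have "lin v c' w + lin v c c' = (\<Sum>j\<in>I. v j * (w j - c' j) + v j * (c' j - c j))" by (simp add: lin_def sum.distrib)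
  then show ?thesis by (simp add: lin_def algebra_simps)
qed

lemma lin_Cauchy_Schwarz: "(lin v c c')\<^sup>2 \<le> (lin_sd v)\<^sup>2 * nd I (\<lambda>j. (s j)\<^sup>2) c' c"
proof -
  have "lin v c c' = (\<Sum>j\<in>I. (v j * s j) * ((c' j - c j) / s j))"
    unfolding lin_def
  proof (intro sum.cong refl)
    fix j assume "j \<in> I"
    from s_pos[OF this] show "v j * (c' j - c j) = v j * s j * ((c' j - c j) / s j)" by simp
  qed
  then have "(lin v c c')\<^sup>2 \<le> (\<Sum>j\<in>I. (v j * s j)\<^sup>2) * (\<Sum>j\<in>I. ((c' j - c j) / s j)\<^sup>2)"
    using Cauchy_Schwarz_ineq_sum[of "\<lambda>j. v j * s j" "\<lambda>j. (c' j - c j) / s j" I] by simp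
  then show ?thesis by (simp add: lin_sd_def nd_def power_divide sum_nonneg)
qed

text \<open>The second moment of the shifted likelihood ratio is again a Gaussian integral, with the opposite
  point \<open>2 c' - c\<close> as centre.\<close>

lemma gdens_shift_square:
  assumes "w \<in> RR I"
  shows "(gdens I s c' w)\<^sup>2 / gdens I s c w = exp (nd I (\<lambda>j. (s j)\<^sup>2) c' c) * gdens I s (\<lambda>j\<in>I. 2 * c' j - c j) w"
proof -
  have "(\<Prod>j\<in>I. (normal_density (c' j) (s j) (w j))\<^sup>2 / normal_density (c j) (s j) (w j))
    = (\<Prod>j\<in>I. exp ((c' j - c j)\<^sup>2 / (s j)\<^sup>2) * normal_density (2 * c' j - c j) (s j) (w j))"
  proof (rule prod.cong[OF refl])
    fix j assume j: "j \<in> I"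
    define K where "K = 1 / sqrt (2 * pi * (s j)\<^sup>2)"
    have K: "0 < K" using s_pos[OF j] by (simp add: K_def)
    have n: "normal_density m (s j) x = K * exp (- (x - m)\<^sup>2 / (2 * (s j)\<^sup>2))" for m x by (simp add: normal_density_def K_def)
    have "(normal_density (c' j) (s j) (w j))\<^sup>2 / normal_density (c j) (s j) (w j)
      = K * exp (2 * (- (w j - c' j)\<^sup>2 / (2 * (s j)\<^sup>2)) - - (w j - c j)\<^sup>2 / (2 * (s j)\<^sup>2))"
    proof -
      have "(K * exp a)\<^sup>2 / (K * exp b) = K * exp (2 * a - b)" for a b
        using K by (simp add: exp_diff exp_double power2_eq_square)
      then show ?thesis unfolding n .
    qed
    also have "2 * (- (w j - c' j)\<^sup>2 / (2 * (s j)\<^sup>2)) - - (w j - c j)\<^sup>2 / (2 * (s j)\<^sup>2) = (c' j - c j)\<^sup>2 / (s j)\<^sup>2 + - (w j - (2 * c' j - c j))\<^sup>2 / (2 * (s j)\<^sup>2)"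
      using s_pos[OF j] by (simp add: field_simps power2_eq_square)
    finally show "(normal_density (c' j) (s j) (w j))\<^sup>2 / normal_density (c j) (s j) (w j)
       = exp ((c' j - c j)\<^sup>2 / (s j)\<^sup>2) * normal_density (2 * c' j - c j) (s j) (w j)"
      unfolding n exp_add by simp
  qed
  then show ?thesis
    unfolding gdens_def nd_def exp_sum[OF fin] prod.distrib prod_dividef prod_power_distrib[symmetric]
    by (simp cong: prod.cong)
qed

lemma gdens_pos: "0 < gdens I s c w"
  unfolding gdens_def using s_pos by (intro prod_pos ballI normal_density_pos) auto

lemma lin_self[simp]: "lin v c c = 0" by (simp add: lin_def)

lemma gauss_space_1[simp]: "measure (gauss I s c) (RR I) = 1"
  using prob_space.prob_space[OF prob_space_gauss[of c]] by simp

lemma lin_square_moment: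
  shows "(\<lambda>w. B - lin v c w) \<in> L2 (gauss I s c')"
    and "(\<integral>w. (B - lin v c w)\<^sup>2 \<partial>gauss I s c') = (B - lin v c c')\<^sup>2 + (lin_sd v)\<^sup>2"
proof -
  interpret G: prob_space "gauss I s c'" by (rule prob_space_gauss)
  define b where "b = B - lin v c c'"
  have e: "B - lin v c w = b - lin v c' w" for w unfolding b_def lin_shift[of v c w c'] by simp
  have i: "integrable (gauss I s c') (\<lambda>w. b\<^sup>2 + (lin v c' w)\<^sup>2 - 2 * b * lin v c' w)"
    using lin_moments(1,3)[of c' v] by simp
  show "(\<lambda>w. B - lin v c w) \<in> L2 (gauss I s c')"
    unfolding e L2_def using i by (simp add: power2_diff)
  show "(\<integral>w. (B - lin v c w)\<^sup>2 \<partial>gauss I s c') = (B - lin v c c')\<^sup>2 + (lin_sd v)\<^sup>2"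
    unfolding e b_def[symmetric] power2_diff using lin_moments(1-4)[of c' v] by simp
qed

lemma integral_gauss_shift:
  fixes u :: "_ \<Rightarrow> real"
  assumes [measurable]: "u \<in> borel_measurable (LB I)"
  shows "integrable (gauss I s c') u \<longleftrightarrow> integrable (gauss I s c) (\<lambda>w. gdens I s c' w / gdens I s c w * u w)"
    and "(\<integral>w. u w \<partial>gauss I s c') = (\<integral>w. gdens I s c' w / gdens I s c w * u w \<partial>gauss I s c)"
proof -
  have n: "gdens I s c w \<noteq> 0" for w using gdens_pos[of c w] by simp
  show "integrable (gauss I s c') u \<longleftrightarrow> integrable (gauss I s c) (\<lambda>w. gdens I s c' w / gdens I s c w * u w)"
    unfolding gauss_density by (subst (1 2) integrable_density) (simp_all add: n)
  show "(\<integral>w. u w \<partial>gauss I s c') = (\<integral>w. gdens I s c' w / gdens I s c w * u w \<partial>gauss I s c)"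
    unfolding gauss_density by (subst (1 2) integral_density) (simp_all add: n)
qed

text \<open>\<open>E\<close> is the likelihood ratio of the Gaussian at \<open>c'\<close> to that at
  \<open>c\<close>. Expanding \<open>(1 - E)\<^sup>2\<close> leaves three second moments of an
  affine function, under Gaussians centred at \<open>c\<close>, \<open>c'\<close> and
  \<open>2 c' - c\<close>, the last with the exponential factor. The result is exact and vanishes
  quadratically as \<open>c'\<close> approaches \<open>c\<close>.\<close>

lemma likelihood_ratio_moment:
  fixes v c c' B
  defines "E \<equiv> \<lambda>w. gdens I s c' w / gdens I s c w"
  shows "(\<lambda>w. (1 - E w) * (B - lin v c w)) \<in> L2 (gauss I s c)"
    and "(\<integral>w. ((1 - E w) * (B - lin v c w))\<^sup>2 \<partial>gauss I s c)
      = 2 * (lin v c c')\<^sup>2 + (exp (nd I (\<lambda>j. (s j)\<^sup>2) c' c) - 1) * ((B - 2 * lin v c c')\<^sup>2 + (lin_sd v)\<^sup>2)"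
proof -
  define c2 where "c2 = (\<lambda>j\<in>I. 2 * c' j - c j)"
  define R where "R = exp (nd I (\<lambda>j. (s j)\<^sup>2) c' c)"
  define q where "q w = (B - lin v c w)\<^sup>2" for w
  have [measurable]: "E \<in> borel_measurable (LB I)" "q \<in> borel_measurable (LB I)" unfolding E_def q_def[abs_def] by measurable
  have lc2: "lin v c c2 = 2 * lin v c c'"
    unfolding lin_def sum_distrib_left c2_def by (intro sum.cong refl) (simp add: algebra_simps)
  have i0: "integrable (gauss I s c'') q" and v0: "(\<integral>w. q w \<partial>gauss I s c'') = (B - lin v c c'')\<^sup>2 + (lin_sd v)\<^sup>2" for c''
    using lin_square_moment[where B=B and v=v and c=c and c'=c''] by (simp_all add: q_def[abs_def] L2_def)
  have i1: "integrable (gauss I s c) (\<lambda>w. E w * q w)" and v1: "(\<integral>w. E w * q w \<partial>gauss I s c) = (B - lin v c c')\<^sup>2 + (lin_sd v)\<^sup>2"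
    using integral_gauss_shift[of q c' c] i0[of c'] v0[of c'] by (simp_all add: E_def)
  have E2: "gdens I s c2 w / gdens I s c w * q w = (E w)\<^sup>2 * q w / R" if "w \<in> RR I" for w
    using gdens_shift_square[OF that, of c' c] gdens_pos[of c w]
    by (simp add: E_def c2_def R_def power_divide power2_eq_square field_simps)
  have "integrable (gauss I s c) (\<lambda>w. gdens I s c2 w / gdens I s c w * q w)"
    and v2': "(\<integral>w. gdens I s c2 w / gdens I s c w * q w \<partial>gauss I s c) = (B - 2 * lin v c c')\<^sup>2 + (lin_sd v)\<^sup>2"
    using integral_gauss_shift[of q c2 c] i0[of c2] v0[of c2] by (simp_all add: lc2)
  moreover have "integrable (gauss I s c) (\<lambda>w. gdens I s c2 w / gdens I s c w * q w) \<longleftrightarrow> integrable (gauss I s c) (\<lambda>w. (E w)\<^sup>2 * q w / R)"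
    by (rule Bochner_Integration.integrable_cong[OF refl]) (rule E2, simp)
  moreover have "(\<integral>w. gdens I s c2 w / gdens I s c w * q w \<partial>gauss I s c) = (\<integral>w. (E w)\<^sup>2 * q w / R \<partial>gauss I s c)"
    by (rule Bochner_Integration.integral_cong[OF refl]) (rule E2, simp)
  ultimately have iR: "integrable (gauss I s c) (\<lambda>w. (E w)\<^sup>2 * q w / R)"
    and vR: "(\<integral>w. (E w)\<^sup>2 * q w / R \<partial>gauss I s c) = (B - 2 * lin v c c')\<^sup>2 + (lin_sd v)\<^sup>2"
    by simp_all
  have R: "0 < R" by (simp add: R_def)
  have m: "R * ((E w)\<^sup>2 * q w / R) = (E w)\<^sup>2 * q w" for w using R by simp
  have i2: "integrable (gauss I s c) (\<lambda>w. (E w)\<^sup>2 * q w)"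
    using integrable_mult_right[OF iR, of R] unfolding m .
  have v2: "(\<integral>w. (E w)\<^sup>2 * q w \<partial>gauss I s c) = R * ((B - 2 * lin v c c')\<^sup>2 + (lin_sd v)\<^sup>2)"
    unfolding vR[symmetric] integral_mult_right_zero[symmetric] m ..
  have sq: "((1 - e) * y)\<^sup>2 = y\<^sup>2 - 2 * (e * y\<^sup>2) + e\<^sup>2 * y\<^sup>2" for e y :: real
    by (simp add: power2_eq_square algebra_simps)
  have e: "((1 - E w) * (B - lin v c w))\<^sup>2 = q w - 2 * (E w * q w) + (E w)\<^sup>2 * q w" for w
    unfolding q_def by (rule sq)
  show "(\<lambda>w. (1 - E w) * (B - lin v c w)) \<in> L2 (gauss I s c)"
    unfolding L2_def using i0[of c] i1 i2 by (simp add: e)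
  have "(\<integral>w. ((1 - E w) * (B - lin v c w))\<^sup>2 \<partial>gauss I s c) = (B\<^sup>2 + (lin_sd v)\<^sup>2) - 2 * ((B - lin v c c')\<^sup>2 + (lin_sd v)\<^sup>2) + R * ((B - 2 * lin v c c')\<^sup>2 + (lin_sd v)\<^sup>2)"
    unfolding e using i0[of c] i1 i2 v0[of c] v1 v2 by (simp add: lin_def)
  also have "\<dots> = 2 * (lin v c c')\<^sup>2 + (R - 1) * ((B - 2 * lin v c c')\<^sup>2 + (lin_sd v)\<^sup>2)"
    by (simp add: power2_eq_square algebra_simps)
  finally show "(\<integral>w. ((1 - E w) * (B - lin v c w))\<^sup>2 \<partial>gauss I s c)
      = 2 * (lin v c c')\<^sup>2 + (exp (nd I (\<lambda>j. (s j)\<^sup>2) c' c) - 1) * ((B - 2 * lin v c c')\<^sup>2 + (lin_sd v)\<^sup>2)"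
    by (simp add: R_def)
qed

end

text \<open>Derivatives are replaced by what the argument consumes: strong convexity at midpoints,
  the form in which Prekopa--Leindler uses it, and at each point a supporting affine function with a
  quadratic upper bound. \<open>L\<close> measures smoothness relative to \<open>nd\<close>, so in
  the application it is \<open>b * L + 1\<close>. The product condition in \<open>step_small\<close>
  bounds the mean quadratic excess of \<open>U\<close> over a proposal by
  \<open>1 / 4\<close>.\<close>

locale smooth_target = gibbs_potential I U for I :: "'i set" and U +
  fixes \<tau> :: "'i \<Rightarrow> real" and \<sigma> L :: real
  assumes \<tau>_pos: "\<And>j. j \<in> I \<Longrightarrow> 0 < \<tau> j" and \<sigma>_pos: "0 < \<sigma>" and L: "0 \<le> L"
    and step_small: "L * \<sigma>\<^sup>2 * real (card I) \<le> 1 / 2" and I_ne: "I \<noteq> {}"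
    and conv: "\<And>x y. x \<in> RR I \<Longrightarrow> y \<in> RR I \<Longrightarrow> 2 * U (midp I x y) + 1 / 4 * nd I \<tau> x y \<le> U x + U y"
    and smooth: "\<And>x. x \<in> RR I \<Longrightarrow> \<exists>v. \<forall>u\<in>RR I. (\<Sum>j\<in>I. v j * (u j - x j)) \<le> U u - U x \<and>
        U u - U x \<le> (\<Sum>j\<in>I. v j * (u j - x j)) + L / 2 * nd I \<tau> u x"
begin

abbreviation "s \<equiv> \<lambda>j. \<sigma> * sqrt (\<tau> j)"

sublocale gaussian_steps I s
  by unfold_locales (simp_all add: fin \<sigma>_pos \<tau>_pos)

abbreviation "\<gamma> \<equiv> gauss I s"

lemma step_small1: "L * \<sigma>\<^sup>2 \<le> 1 / 2"
proof -
  have "1 \<le> real (card I)" using fin I_ne by (simp add: Suc_leI card_gt_0_iff)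
  then have "L * \<sigma>\<^sup>2 * 1 \<le> L * \<sigma>\<^sup>2 * real (card I)" using L by (intro mult_left_mono) auto
  then show ?thesis using step_small by simp
qed

lemma s_sq: "j \<in> I \<Longrightarrow> (s j)\<^sup>2 = \<sigma>\<^sup>2 * \<tau> j" using \<tau>_pos[of j] by (simp add: power_mult_distrib)

lemma nd_s: "nd I (\<lambda>j. (s j)\<^sup>2) x y = nd I \<tau> x y / \<sigma>\<^sup>2"
proof -
  have "(\<Sum>j\<in>I. (x j - y j)\<^sup>2 / (s j)\<^sup>2) = (\<Sum>j\<in>I. (x j - y j)\<^sup>2 / \<tau> j / \<sigma>\<^sup>2)"
    by (intro sum.cong refl) (simp only: s_sq, simp add: mult.commute)
  then show ?thesis unfolding nd_def sum_divide_distrib .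
qed

lemma gauss_nd_\<tau>:
  shows "integrable (\<gamma> x) (\<lambda>w. nd I \<tau> w x)" "(\<integral>w. nd I \<tau> w x \<partial>\<gamma> x) = \<sigma>\<^sup>2 * real (card I)"
proof -
  have "(\<Sum>j\<in>I. (s j)\<^sup>2 / \<tau> j) = (\<Sum>j\<in>I. \<sigma>\<^sup>2)"
  proof (rule sum.cong[OF refl])
    fix j assume j: "j \<in> I" show "(s j)\<^sup>2 / \<tau> j = \<sigma>\<^sup>2" unfolding s_sq[OF j] using \<tau>_pos[OF j] by simp
  qed
  then show "integrable (\<gamma> x) (\<lambda>w. nd I \<tau> w x)" "(\<integral>w. nd I \<tau> w x \<partial>\<gamma> x) = \<sigma>\<^sup>2 * real (card I)"
    using gauss_nd[of x \<tau>] by simp_all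
qed

section \<open>Weighted local averages and local energy\<close>

definition grad :: "('i \<Rightarrow> real) \<Rightarrow> 'i \<Rightarrow> real" where
  "grad x = (SOME v. \<forall>u\<in>RR I. lin v x u \<le> U u - U x \<and> U u - U x \<le> lin v x u + L / 2 * nd I \<tau> u x)"

lemma grad:
  assumes "x \<in> RR I" "u \<in> RR I"
  shows "lin (grad x) x u \<le> U u - U x" "U u - U x \<le> lin (grad x) x u + L / 2 * nd I \<tau> u x"
proof -
  have "\<forall>u\<in>RR I. lin (grad x) x u \<le> U u - U x \<and> U u - U x \<le> lin (grad x) x u + L / 2 * nd I \<tau> u x"
    using someI_ex[OF smooth[OF assms(1)]] unfolding grad_def lin_def .
  then show "lin (grad x) x u \<le> U u - U x" "U u - U x \<le> lin (grad x) x u + L / 2 * nd I \<tau> u x"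
    using assms(2) by auto
qed

text \<open>The standard deviation of the linearized increment of \<open>U\<close> over one proposal
  from \<open>x\<close>, that is, \<open>\<sigma>\<close> times the dual norm of the
  gradient.\<close>

definition slope :: "('i \<Rightarrow> real) \<Rightarrow> real" where "slope x = lin_sd (grad x)"

lemma slope_nonneg: "0 \<le> slope x" by (simp add: slope_def lin_sd_nonneg)

text \<open>Compared with the acceptance probability, this weight is 1-Lipschitz in
  \<open>U x\<close>, has bounded support in the energy difference on the uphill side, and grows
  without bound downhill. The growth makes its mean proportional to one plus the slope, the same
  factor by which \<open>U x\<close> varies with \<open>x\<close>.\<close>

definition acc :: "('i \<Rightarrow> real) \<Rightarrow> ('i \<Rightarrow> real) \<Rightarrow> real" where "acc x w = max 0 (1 + U x - U w)"

definition nrm :: "('i \<Rightarrow> real) \<Rightarrow> real" where "nrm x = (\<integral>w. acc x w \<partial>\<gamma> x)"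

definition avg :: "(('i \<Rightarrow> real) \<Rightarrow> real) \<Rightarrow> ('i \<Rightarrow> real) \<Rightarrow> real" where
  "avg g x = (\<integral>w. acc x w * g w \<partial>\<gamma> x) / nrm x"

definition energy :: "(('i \<Rightarrow> real) \<Rightarrow> real) \<Rightarrow> ('i \<Rightarrow> real) \<Rightarrow> real" where
  "energy g x = (\<integral>w. min 1 (exp (U x - U w)) * (g w - g x)\<^sup>2 \<partial>\<gamma> x)"

lemma acc_nonneg[simp]: "0 \<le> acc x w" by (simp add: acc_def)

lemma acc_measurable[measurable]: "acc x \<in> borel_measurable (LB I)" unfolding acc_def[abs_def] by measurable

text \<open>The tangent is taken at \<open>x\<close>, where the Gaussian sits, although the weight
  belongs to \<open>x'\<close>. So averages at two points can be compared under a single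
  Gaussian.\<close>

lemma acc_le:
  assumes "x \<in> RR I" "w \<in> RR I"
  shows "acc x' w \<le> \<bar>1 + (U x' - U x) - lin (grad x) x w\<bar>"
  using grad(1)[OF assms] by (simp add: acc_def)

lemma acc_L2:
  assumes x: "x \<in> RR I"
  shows "acc x' \<in> L2 (\<gamma> x)" "(\<integral>w. (acc x' w)\<^sup>2 \<partial>\<gamma> x) \<le> (1 + (U x' - U x))\<^sup>2 + (slope x)\<^sup>2"
proof -
  define B where "B = 1 + (U x' - U x)"
  note m = lin_square_moment[where B=B and v="grad x" and c=x and c'=x]
  have i: "integrable (\<gamma> x) (\<lambda>w. (B - lin (grad x) x w)\<^sup>2)" using m(1) by (simp add: L2_def)
  have le: "(acc x' w)\<^sup>2 \<le> (B - lin (grad x) x w)\<^sup>2" if "w \<in> RR I" for w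
    using power_mono[OF acc_le[OF x that, of x'], of 2] by (simp add: B_def)
  have i2: "integrable (\<gamma> x) (\<lambda>w. (acc x' w)\<^sup>2)"
    by (rule Bochner_Integration.integrable_bound[OF i]) (auto simp: le)
  then show "acc x' \<in> L2 (\<gamma> x)" by (simp add: L2_def)
  have "(\<integral>w. (acc x' w)\<^sup>2 \<partial>\<gamma> x) \<le> (\<integral>w. (B - lin (grad x) x w)\<^sup>2 \<partial>\<gamma> x)"
    by (rule integral_mono[OF i2 i]) (simp add: le)
  then show "(\<integral>w. (acc x' w)\<^sup>2 \<partial>\<gamma> x) \<le> (1 + (U x' - U x))\<^sup>2 + (slope x)\<^sup>2"
    unfolding m(2) by (simp add: B_def slope_def lin_def)
qed

lemma acc_integrable: "x \<in> RR I \<Longrightarrow> integrable (\<gamma> x) (acc x')"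
  by (rule finite_measure.square_integrable_imp_integrable[OF prob_space.finite_measure[OF prob_space_gauss]])
     (use acc_L2(1)[of x x'] in \<open>auto simp: L2_def\<close>)

text \<open>Two lower bounds for the weight, both valid because \<open>U\<close> exceeds its tangent
  by at most \<open>e\<close>, whose mean is at most \<open>1 / 4\<close>. The affine one gives
  \<open>3 / 4\<close>; the negative part of the linear term, with \<open>3 / 4\<close> of the slope
  as lower bound for the absolute moment, gives linear growth in the slope. Their maximum dominates
  \<open>(1 + slope x) / 6\<close>.\<close>

lemma nrm_ge: assumes x: "x \<in> RR I" shows "(1 + slope x) / 6 \<le> nrm x"
proof -
  interpret G: prob_space "\<gamma> x" by (rule prob_space_gauss)
  define Y where "Y = lin (grad x) x"
  define e where "e w = L / 2 * nd I \<tau> w x" for w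
  have ie: "integrable (\<gamma> x) e" unfolding e_def[abs_def] using gauss_nd_\<tau>[of x] by simp
  have "(\<integral>w. e w \<partial>\<gamma> x) = L / 2 * (\<sigma>\<^sup>2 * real (card I))" unfolding e_def using gauss_nd_\<tau>[of x] by simp
  then have Ie: "(\<integral>w. e w \<partial>\<gamma> x) \<le> 1 / 4" using step_small by (simp add: mult.assoc)
  have iY: "integrable (\<gamma> x) Y" "(\<integral>w. Y w \<partial>\<gamma> x) = 0" "3 / 4 * slope x \<le> (\<integral>w. \<bar>Y w\<bar> \<partial>\<gamma> x)"
    using lin_moments[where c=x and v="grad x"] by (simp_all add: Y_def slope_def)
  have up: "1 - Y w - e w \<le> 1 + U x - U w" if "w \<in> RR I" for w
    using grad(2)[OF x that] by (simp add: Y_def e_def)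
  have "3 / 4 \<le> nrm x"
  proof -
    have "(\<integral>w. 1 - Y w - e w \<partial>\<gamma> x) \<le> nrm x" unfolding nrm_def
      by (rule integral_mono) (use iY ie acc_integrable[OF x] up in \<open>auto simp: acc_def intro: max.coboundedI2\<close>)
    then show ?thesis using iY ie Ie by (simp add: G.prob_space)
  qed
  moreover have "(3 / 4 * slope x - 1 / 2) / 2 \<le> nrm x"
  proof -
    have "(\<integral>w. (\<bar>Y w\<bar> - Y w - 2 * e w) / 2 \<partial>\<gamma> x) \<le> nrm x" unfolding nrm_def
    proof (rule integral_mono)
      fix w assume "w \<in> space (\<gamma> x)"
      then have "1 - Y w - e w \<le> 1 + U x - U w" using up by simp
      moreover have "0 \<le> e w" unfolding e_def using L nd_nonneg[of I \<tau> w x] \<tau>_pos by simp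
      ultimately show "(\<bar>Y w\<bar> - Y w - 2 * e w) / 2 \<le> acc x w" by (simp add: acc_def max_def abs_if field_simps)
    qed (use iY ie acc_integrable[OF x] in auto)
    then show ?thesis using iY ie Ie by simp
  qed
  ultimately show ?thesis by argo
qed

lemma nrm_pos: "x \<in> RR I \<Longrightarrow> 0 < nrm x"
  using nrm_ge[of x] slope_nonneg[of x] by argo

text \<open>The margin is 2 and not 1 because weights of a neighbouring point \<open>x'\<close> are
  covered too: they vanish beyond \<open>U x' + 1\<close>, and \<open>U x'\<close> will differ from
  \<open>U x\<close> by at most 1.\<close>

lemma accept_ratio_ge: "U w \<le> U x + 2 \<Longrightarrow> 1 \<le> 9 * min 1 (exp (U x - U w))"
proof -
  assume "U w \<le> U x + 2"
  then have "exp (- 2) \<le> exp (U x - U w)" by simp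
  moreover have "1 / 9 \<le> exp (- 2 :: real)"
  proof -
    have "exp (2::real) = exp 1 * exp 1" by (simp add: exp_add[symmetric])
    also have "\<dots> \<le> 3 * 3" by (intro mult_mono exp_le) auto
    finally show ?thesis by (simp add: exp_minus field_simps)
  qed
  ultimately have "1 \<le> 9 * exp (U x - U w)" by linarith
  then show ?thesis by (simp add: min_def)
qed

end

section \<open>Bounded test functions and their local averages\<close>

locale smooth_target_bounded = smooth_target +
  fixes g :: "('a \<Rightarrow> real) \<Rightarrow> real" and M :: real
  assumes g_meas[measurable]: "g \<in> borel_measurable (LB I)" and g_bd: "\<And>x. x \<in> RR I \<Longrightarrow> \<bar>g x\<bar> \<le> M"
begin

lemma g_diff_sq_le: assumes "x \<in> RR I" "w \<in> RR I" shows "(g w - g x)\<^sup>2 \<le> (2 * M)\<^sup>2"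
  using g_bd[OF assms(1)] g_bd[OF assms(2)] by (intro power2_le_iff_abs_le[THEN iffD2]) auto

lemma energy_integrable:
  assumes x: "x \<in> RR I" shows "integrable (\<gamma> x) (\<lambda>w. min 1 (exp (U x - U w)) * (g w - g x)\<^sup>2)"
proof -
  interpret G: prob_space "\<gamma> x" by (rule prob_space_gauss)
  show ?thesis
  proof (rule G.integrable_const_bound[where B="1 * (2 * M)\<^sup>2"])
    show "AE w in \<gamma> x. norm (min 1 (exp (U x - U w)) * (g w - g x)\<^sup>2) \<le> 1 * (2 * M)\<^sup>2"
    proof (rule AE_I2)
      fix w assume "w \<in> space (\<gamma> x)"
      then have "min 1 (exp (U x - U w)) * (g w - g x)\<^sup>2 \<le> 1 * (2 * M)\<^sup>2"
        using g_diff_sq_le[OF x] by (intro mult_mono) auto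
      then show "norm (min 1 (exp (U x - U w)) * (g w - g x)\<^sup>2) \<le> 1 * (2 * M)\<^sup>2" by (simp add: abs_mult)
    qed
  qed simp
qed

lemma energy_nonneg: "0 \<le> energy g x" unfolding energy_def by (rule Bochner_Integration.integral_nonneg) simp

lemma energy_le: assumes x: "x \<in> RR I" shows "energy g x \<le> (2 * M)\<^sup>2"
proof -
  interpret G: prob_space "\<gamma> x" by (rule prob_space_gauss)
  have "energy g x \<le> (\<integral>w. 1 * (2 * M)\<^sup>2 \<partial>\<gamma> x)" unfolding energy_def
  proof (rule integral_mono[OF energy_integrable[OF x]])
    fix w assume "w \<in> space (\<gamma> x)"
    then show "min 1 (exp (U x - U w)) * (g w - g x)\<^sup>2 \<le> 1 * (2 * M)\<^sup>2"
      using g_diff_sq_le[OF x] by (intro mult_mono) auto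
  qed simp
  then show ?thesis by simp
qed

text \<open>Where \<open>b\<close> does not vanish a proposal is accepted with probability at least
  \<open>1 / 9\<close>, so the plain squared increment of \<open>g\<close> costs at most nine times
  the increment counted in \<open>energy\<close>.\<close>

lemma energy_Cauchy_Schwarz:
  assumes x: "x \<in> RR I" and b: "b \<in> L2 (\<gamma> x)" and supp: "\<And>w. w \<in> RR I \<Longrightarrow> U x + 2 < U w \<Longrightarrow> b w = 0"
  shows "(\<integral>w. (g w - g x) * b w \<partial>\<gamma> x)\<^sup>2 \<le> 9 * energy g x * (\<integral>w. (b w)\<^sup>2 \<partial>\<gamma> x)"
proof -
  define ph where "ph w = (if U w \<le> U x + 2 then g w - g x else 0)" for w
  have [measurable]: "ph \<in> borel_measurable (LB I)" unfolding ph_def[abs_def] by measurable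
  have le: "(ph w)\<^sup>2 \<le> 9 * (min 1 (exp (U x - U w)) * (g w - g x)\<^sup>2)" for w
  proof (cases "U w \<le> U x + 2")
    case True
    have "1 * (g w - g x)\<^sup>2 \<le> 9 * min 1 (exp (U x - U w)) * (g w - g x)\<^sup>2"
      using accept_ratio_ge[OF True] by (intro mult_right_mono) auto
    then show ?thesis using True by (simp add: ph_def)
  qed (simp add: ph_def)
  have i: "integrable (\<gamma> x) (\<lambda>w. 9 * (min 1 (exp (U x - U w)) * (g w - g x)\<^sup>2))" using energy_integrable[OF x] by simp
  have i2: "integrable (\<gamma> x) (\<lambda>w. (ph w)\<^sup>2)"
  proof (rule Bochner_Integration.integrable_bound[OF i])
    show "AE w in \<gamma> x. norm ((ph w)\<^sup>2) \<le> norm (9 * (min 1 (exp (U x - U w)) * (g w - g x)\<^sup>2))"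
    proof (rule AE_I2)
      fix w
      show "norm ((ph w)\<^sup>2) \<le> norm (9 * (min 1 (exp (U x - U w)) * (g w - g x)\<^sup>2))"
        using order_trans[OF le[of w] abs_ge_self] by (simp only: real_norm_def abs_power2)
    qed
  qed simp
  have phL: "ph \<in> L2 (\<gamma> x)" using i2 by (simp add: L2_def)
  have "(\<integral>w. (g w - g x) * b w \<partial>\<gamma> x) = ip (\<gamma> x) ph b"
    unfolding ip_def by (rule Bochner_Integration.integral_cong) (auto simp: ph_def supp)
  then have "(\<integral>w. (g w - g x) * b w \<partial>\<gamma> x)\<^sup>2 \<le> ip (\<gamma> x) ph ph * ip (\<gamma> x) b b"
    using ip_Cauchy_Schwarz[OF phL b] by simp
  also have "\<dots> \<le> (9 * energy g x) * ip (\<gamma> x) b b"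
  proof (rule mult_right_mono)
    have "ip (\<gamma> x) ph ph = (\<integral>w. (ph w)\<^sup>2 \<partial>\<gamma> x)" by (simp add: ip_def power2_eq_square)
    also have "\<dots> \<le> (\<integral>w. 9 * (min 1 (exp (U x - U w)) * (g w - g x)\<^sup>2) \<partial>\<gamma> x)"
      by (rule integral_mono[OF i2 i le])
    finally show "ip (\<gamma> x) ph ph \<le> 9 * energy g x" by (simp add: energy_def)
  qed (rule ip_self_nonneg)
  finally show ?thesis by (simp add: ip_def power2_eq_square)
qed

lemma acc_g_integrable: assumes x: "x \<in> RR I" shows "integrable (\<gamma> x) (\<lambda>w. acc x' w * g w)"
proof (rule Bochner_Integration.integrable_bound)
  show "integrable (\<gamma> x) (\<lambda>w. acc x' w * M)" using acc_integrable[OF x] by simp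
  show "AE w in \<gamma> x. norm (acc x' w * g w) \<le> norm (acc x' w * M)"
    using g_bd by (intro AE_I2) (auto simp: abs_mult intro!: mult_left_mono order_trans[OF g_bd abs_ge_self])
qed simp

text \<open>The weight has second moment at most \<open>36 * (nrm x)\<^sup>2\<close>, uniformly in
  the slope: both the root of the second moment and the mean are comparable to one plus the slope.
  The product \<open>9 * 36 = 324\<close> is rounded up.\<close>

lemma avg_diff_sq: assumes x: "x \<in> RR I" shows "(avg g x - g x)\<^sup>2 \<le> 400 * energy g x"
proof -
  have n: "0 < nrm x" by (rule nrm_pos[OF x])
  have "(\<integral>w. (g w - g x) * acc x w \<partial>\<gamma> x) = (\<integral>w. acc x w * g w - g x * acc x w \<partial>\<gamma> x)" by (simp add: algebra_simps)
  also have "\<dots> = nrm x * (avg g x - g x)"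
    using acc_g_integrable[OF x, of x] acc_integrable[OF x, of x] n by (simp add: avg_def nrm_def[symmetric] algebra_simps)
  finally have e: "(\<integral>w. (g w - g x) * acc x w \<partial>\<gamma> x) = nrm x * (avg g x - g x)" .
  have "(nrm x)\<^sup>2 * (avg g x - g x)\<^sup>2 \<le> 9 * energy g x * (\<integral>w. (acc x w)\<^sup>2 \<partial>\<gamma> x)"
    using energy_Cauchy_Schwarz[OF x acc_L2(1)[OF x, of x]] unfolding e by (auto simp: acc_def power_mult_distrib)
  also have "\<dots> \<le> 9 * energy g x * (36 * (nrm x)\<^sup>2)"
  proof (intro mult_left_mono)
    have "(\<integral>w. (acc x w)\<^sup>2 \<partial>\<gamma> x) \<le> 1 + (slope x)\<^sup>2" using acc_L2(2)[OF x, of x] by simp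
    also have "\<dots> \<le> (1 + slope x)\<^sup>2" using slope_nonneg[of x] by (simp add: power2_eq_square algebra_simps)
    also have "\<dots> \<le> (6 * nrm x)\<^sup>2" using nrm_ge[OF x] slope_nonneg[of x] by (intro power_mono) auto
    finally show "(\<integral>w. (acc x w)\<^sup>2 \<partial>\<gamma> x) \<le> 36 * (nrm x)\<^sup>2" by (simp add: power_mult_distrib)
  qed (use energy_nonneg in auto)
  finally have "(nrm x)\<^sup>2 * (avg g x - g x)\<^sup>2 \<le> (nrm x)\<^sup>2 * (324 * energy g x)" by (simp add: mult_ac)
  then have "(avg g x - g x)\<^sup>2 \<le> 324 * energy g x" using n by simp
  then show ?thesis using energy_nonneg[of x] by linarith
qed

end

lemma (in prob_space) integral_sq_le:
  fixes f :: "'a \<Rightarrow> real" assumes "f \<in> L2 M" shows "(\<integral>x. f x \<partial>M)\<^sup>2 \<le> (\<integral>x. (f x)\<^sup>2 \<partial>M)"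
proof -
  have 1: "(\<lambda>_. 1) \<in> L2 M" by (simp add: L2_def)
  show ?thesis using ip_Cauchy_Schwarz[OF assms 1] by (simp add: ip_def power2_eq_square prob_space)
qed

context smooth_target_bounded
begin

text \<open>Both averages are written under the Gaussian at \<open>x\<close>. Their difference is
  the integral of \<open>g w - g x\<close> against a function \<open>b\<close> with
  \<open>L2\<close> norm of order \<open>q\<close>, made of the change of the weight, of its
  normalization and of the Gaussian. The condition \<open>(1 + slope x) * q \<le> 1\<close> keeps
  \<open>U x'\<close> within 1 of \<open>U x\<close>, hence \<open>b\<close> supported where
  proposals are accepted.\<close>

lemma avg_near:
  assumes x: "x \<in> RR I" and x': "x' \<in> RR I"
    and r: "nd I \<tau> x' x / \<sigma>\<^sup>2 = q\<^sup>2" and q: "0 \<le> q" "q \<le> 1 / 60" and Sq: "(1 + slope x) * q \<le> 1"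
  shows "(avg g x - avg g x')\<^sup>2 \<le> 20000000 * energy g x * q\<^sup>2"
proof -
  interpret G: prob_space "\<gamma> x" by (rule prob_space_gauss)
  define k where "k = slope x"
  define S where "S = 1 + k"
  define v where "v = grad x"
  define \<theta> where "\<theta> = lin v x x'"
  define \<beta> where "\<beta> = U x' - U x"
  define N where "N = nrm x"
  define N' where "N' = nrm x'"
  define E where "E w = gdens I s x' w / gdens I s x w" for w
  define F where "F w = (1 - E w) * acc x' w" for w
  have k: "0 \<le> k" by (simp add: k_def slope_nonneg)
  have S: "1 \<le> S" "k \<le> S" using k by (simp_all add: S_def)
  have q1: "q \<le> 1" using q by simp
  have qq: "q\<^sup>2 \<le> q" "q\<^sup>2 \<le> 1" using q q1 by (simp_all add: power2_eq_square mult_left_le mult_le_one)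
  have [measurable]: "E \<in> borel_measurable (LB I)" unfolding E_def[abs_def] by measurable
  have [measurable]: "F \<in> borel_measurable (LB I)" unfolding F_def[abs_def] by measurable
  have \<theta>2: "\<theta>\<^sup>2 \<le> (k * q)\<^sup>2"
    using lin_Cauchy_Schwarz[of v x x'] unfolding nd_s r by (simp add: \<theta>_def k_def slope_def v_def power_mult_distrib)
  then have \<theta>: "\<bar>\<theta>\<bar> \<le> k * q" using k q by (simp add: abs_le_square_iff[symmetric])
  \<comment> \<open>The linear part contributes at most \<open>k * q\<close>, the quadratic excess
    at most \<open>q\<close>.\<close>
  have \<beta>: "\<bar>\<beta>\<bar> \<le> S * q"
  proof -
    have "L / 2 * nd I \<tau> x' x = L * \<sigma>\<^sup>2 / 2 * q\<^sup>2" using r \<sigma>_pos by (simp add: field_simps)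
    also have "\<dots> \<le> 1 * q" using step_small1 L q qq by (intro mult_mono) auto
    finally have "\<theta> \<le> \<beta>" "\<beta> \<le> \<theta> + q" using grad[OF x x'] by (simp_all add: \<theta>_def \<beta>_def v_def)
    then show ?thesis using \<theta> by (simp add: S_def distrib_right abs_le_iff)
  qed
  have \<beta>1: "\<bar>\<beta>\<bar> \<le> 1" using \<beta> Sq by (simp add: S_def k_def)
  have Ng: "S / 6 \<le> N" using nrm_ge[OF x] by (simp add: N_def S_def k_def)
  have accx': "acc x' \<in> L2 (\<gamma> x)" by (rule acc_L2(1)[OF x])
  have accx: "acc x \<in> L2 (\<gamma> x)" by (rule acc_L2(1)[OF x])
  have acc'2: "(\<integral>w. (acc x' w)\<^sup>2 \<partial>\<gamma> x) \<le> 4 * S\<^sup>2"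
  proof -
    have "(1 + \<beta>)\<^sup>2 \<le> 2\<^sup>2" using \<beta>1 by (intro power_mono) auto
    moreover have "4 + k\<^sup>2 \<le> 4 * S\<^sup>2" using k by (simp add: S_def power2_eq_square algebra_simps)
    ultimately show ?thesis using acc_L2(2)[OF x, of x'] by (simp add: \<beta>_def k_def)
  qed
  \<comment> \<open>\<open>F\<close> is the error made by moving the Gaussian, dominated through
    \<open>acc_le\<close> by the integrand of \<open>likelihood_ratio_moment\<close>. The constant
    is \<open>12 = 2 + 2 * 5\<close>.\<close>
  have F: "F \<in> L2 (\<gamma> x)" "(\<integral>w. (F w)\<^sup>2 \<partial>\<gamma> x) \<le> 12 * S\<^sup>2 * q\<^sup>2"
  proof -
    let ?B = "1 + \<beta>"
    note m = likelihood_ratio_moment[where v=v and c=x and c'=x' and B="?B", folded E_def, unfolded nd_s r, folded \<theta>_def]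
    have i: "integrable (\<gamma> x) (\<lambda>w. ((1 - E w) * (?B - lin v x w))\<^sup>2)" using m(1) by (simp add: L2_def)
    have le: "(F w)\<^sup>2 \<le> ((1 - E w) * (?B - lin v x w))\<^sup>2" if "w \<in> RR I" for w
    proof -
      have "\<bar>F w\<bar> \<le> \<bar>1 - E w\<bar> * \<bar>?B - lin v x w\<bar>"
        unfolding F_def abs_mult using acc_le[OF x that, of x'] by (intro mult_left_mono) (auto simp: \<beta>_def v_def)
      then show ?thesis by (simp add: abs_le_square_iff[symmetric] abs_mult)
    qed
    have i2: "integrable (\<gamma> x) (\<lambda>w. (F w)\<^sup>2)"
      by (rule Bochner_Integration.integrable_bound[OF i]) (auto simp: le)
    then show "F \<in> L2 (\<gamma> x)" by (simp add: L2_def)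
    have "(\<integral>w. (F w)\<^sup>2 \<partial>\<gamma> x) \<le> (\<integral>w. ((1 - E w) * (?B - lin v x w))\<^sup>2 \<partial>\<gamma> x)"
      by (rule integral_mono[OF i2 i]) (simp add: le)
    also have "\<dots> = 2 * \<theta>\<^sup>2 + (exp (q\<^sup>2) - 1) * ((?B - 2 * \<theta>)\<^sup>2 + k\<^sup>2)"
      using m(2) by (simp add: k_def slope_def v_def)
    also have "\<dots> \<le> 2 * (S\<^sup>2 * q\<^sup>2) + (2 * q\<^sup>2) * (5 * S\<^sup>2)"
    proof (intro add_mono mult_mono mult_left_mono)
      show "\<theta>\<^sup>2 \<le> S\<^sup>2 * q\<^sup>2"
      proof -
        have "(k * q)\<^sup>2 \<le> (S * q)\<^sup>2" using S k q by (intro power_mono mult_right_mono) auto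
        then show ?thesis using \<theta>2 unfolding power_mult_distrib by (rule order_trans[rotated])
      qed
      have "exp (q\<^sup>2) \<le> 1 + q\<^sup>2 + (q\<^sup>2)\<^sup>2" by (rule exp_bound) (use qq in auto)
      moreover have "(q\<^sup>2)\<^sup>2 \<le> q\<^sup>2 * 1" unfolding power2_eq_square[of "q\<^sup>2"] using qq by (intro mult_left_mono) auto
      ultimately show "exp (q\<^sup>2) - 1 \<le> 2 * q\<^sup>2" by linarith
      have "k * q \<le> k * (1 / 60)" using q k by (intro mult_left_mono) auto
      then have "\<bar>?B - 2 * \<theta>\<bar> \<le> 2 * S" using \<beta>1 \<theta> k by (simp add: S_def abs_le_iff)
      then have "(?B - 2 * \<theta>)\<^sup>2 \<le> (2 * S)\<^sup>2" using S by (intro power2_le_iff_abs_le[THEN iffD2]) auto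
      moreover have "k\<^sup>2 \<le> S\<^sup>2" using S k by (intro power_mono) auto
      ultimately show "(?B - 2 * \<theta>)\<^sup>2 + k\<^sup>2 \<le> 5 * S\<^sup>2" by (simp add: power_mult_distrib)
    qed auto
    finally show "(\<integral>w. (F w)\<^sup>2 \<partial>\<gamma> x) \<le> 12 * S\<^sup>2 * q\<^sup>2" by simp
  qed
  have iF: "integrable (\<gamma> x) F"
    by (rule G.square_integrable_imp_integrable) (use F(1) in \<open>auto simp: L2_def\<close>)
  have EF: "E w * acc x' w = acc x' w - F w" for w by (simp add: F_def algebra_simps)
  have N'e: "N' = (\<integral>w. acc x' w - F w \<partial>\<gamma> x)"
    unfolding N'_def nrm_def EF[symmetric] E_def by (rule integral_gauss_shift) simp
  \<comment> \<open>One unit comes from the change of the weight, four from the change of the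
    Gaussian, as \<open>sqrt 12 \<le> 4\<close>.\<close>
  have NN: "\<bar>N - N'\<bar> \<le> 5 * (S * q)"
  proof -
    have e: "N - N' = (\<integral>w. acc x w - acc x' w \<partial>\<gamma> x) + (\<integral>w. F w \<partial>\<gamma> x)"
      unfolding N'e N_def nrm_def using acc_integrable[OF x] iF by simp
    have "\<bar>\<integral>w. acc x w - acc x' w \<partial>\<gamma> x\<bar> \<le> (\<integral>w. \<bar>acc x w - acc x' w\<bar> \<partial>\<gamma> x)" by (rule integral_abs_bound)
    also have "\<dots> \<le> (\<integral>w. \<bar>\<beta>\<bar> \<partial>\<gamma> x)"
    proof (rule integral_mono)
      show "\<bar>acc x w - acc x' w\<bar> \<le> \<bar>\<beta>\<bar>" for w by (auto simp: acc_def \<beta>_def)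
    qed (use acc_integrable[OF x] in auto)
    finally have 1: "\<bar>\<integral>w. acc x w - acc x' w \<partial>\<gamma> x\<bar> \<le> S * q" using \<beta> by simp
    have "(\<integral>w. F w \<partial>\<gamma> x)\<^sup>2 \<le> 12 * S\<^sup>2 * q\<^sup>2" using G.integral_sq_le[OF F(1)] F(2) by linarith
    also have "\<dots> \<le> (4 * (S * q))\<^sup>2" by (simp add: power_mult_distrib)
    finally have "\<bar>\<integral>w. F w \<partial>\<gamma> x\<bar> \<le> 4 * (S * q)" using S q by (intro power2_le_iff_abs_le[THEN iffD1]) auto
    then show ?thesis using 1 unfolding e by linarith
  qed
  \<comment> \<open>With \<open>q \<le> 1 / 60\<close> the normalizations differ by at most
    \<open>S / 12\<close>, half of the lower bound \<open>S / 6\<close> for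
    \<open>N\<close>.\<close>
  have "S * q \<le> S * (1 / 60)" using S q by (intro mult_left_mono) auto
  then have N'g: "S / 12 \<le> N'" using NN Ng by argo
  have Np: "0 < N" "0 < N'" using Ng N'g S by auto
  define b where "b w = (acc x w - acc x' w) / N + (1 / N - 1 / N') * acc x' w + F w / N'" for w
  have be: "b w = acc x w / N - E w * acc x' w / N'" for w
    unfolding b_def EF using Np by (simp add: field_simps)
  have bL: "b \<in> L2 (\<gamma> x)"
  proof -
    have "(\<lambda>w. (1 / N) * acc x w + ((- 1 / N') * acc x' w + (1 / N') * F w)) \<in> L2 (\<gamma> x)"
      by (intro L2_add L2_scale accx accx' F)
    moreover have "b = (\<lambda>w. (1 / N) * acc x w + ((- 1 / N') * acc x' w + (1 / N') * F w))"
      unfolding b_def using Np by (auto simp: field_simps)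
    ultimately show ?thesis by simp
  qed
  have b2: "(\<integral>w. (b w)\<^sup>2 \<partial>\<gamma> x) \<le> 1600000 * q\<^sup>2"
  proof -
    have i3: "integrable (\<gamma> x) (\<lambda>w. (b w)\<^sup>2)" "integrable (\<gamma> x) (\<lambda>w. (acc x' w)\<^sup>2)" "integrable (\<gamma> x) (\<lambda>w. (F w)\<^sup>2)"
      using bL accx' F(1) by (simp_all add: L2_def)
    have sq3: "(a + b + c)\<^sup>2 \<le> 3 * (a\<^sup>2 + b\<^sup>2 + c\<^sup>2)" for a b c :: real
    proof -
      have "3 * (a\<^sup>2 + b\<^sup>2 + c\<^sup>2) - (a + b + c)\<^sup>2 = (a - b)\<^sup>2 + (b - c)\<^sup>2 + (a - c)\<^sup>2"
        by (simp add: power2_eq_square algebra_simps)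
      moreover have "0 \<le> (a - b)\<^sup>2 + (b - c)\<^sup>2 + (a - c)\<^sup>2" by simp
      ultimately show ?thesis by linarith
    qed
    have "(\<integral>w. (b w)\<^sup>2 \<partial>\<gamma> x) \<le> (\<integral>w. 3 * (\<beta>\<^sup>2 / N\<^sup>2 + (1 / N - 1 / N')\<^sup>2 * (acc x' w)\<^sup>2 + (F w)\<^sup>2 / N'\<^sup>2) \<partial>\<gamma> x)"
    proof (rule integral_mono)
      fix w
      have "\<bar>acc x w - acc x' w\<bar> \<le> \<bar>\<beta>\<bar>" by (auto simp: acc_def \<beta>_def)
      then have "(acc x w - acc x' w)\<^sup>2 \<le> \<beta>\<^sup>2" by (simp add: abs_le_square_iff)
      then have "((acc x w - acc x' w) / N)\<^sup>2 \<le> \<beta>\<^sup>2 / N\<^sup>2" by (simp add: power_divide divide_right_mono)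
      then show "(b w)\<^sup>2 \<le> 3 * (\<beta>\<^sup>2 / N\<^sup>2 + (1 / N - 1 / N')\<^sup>2 * (acc x' w)\<^sup>2 + (F w)\<^sup>2 / N'\<^sup>2)"
        using sq3[of "(acc x w - acc x' w) / N" "(1 / N - 1 / N') * acc x' w" "F w / N'"]
        by (simp add: b_def power_mult_distrib power_divide)
    qed (use i3 in auto)
    also have "\<dots> = 3 * (\<beta>\<^sup>2 / N\<^sup>2 + (1 / N - 1 / N')\<^sup>2 * (\<integral>w. (acc x' w)\<^sup>2 \<partial>\<gamma> x) + (\<integral>w. (F w)\<^sup>2 \<partial>\<gamma> x) / N'\<^sup>2)"
      using i3 by simp
    \<comment> \<open>Here \<open>36 = 6\<^sup>2\<close>, \<open>518400 = 4 * 360\<^sup>2\<close>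
      and \<open>1728 = 12 * 12\<^sup>2\<close>. In each term the powers of \<open>S\<close> cancel
      against the normalizations.\<close>
    also have "\<dots> \<le> 3 * (36 * q\<^sup>2 + 518400 * q\<^sup>2 + 1728 * q\<^sup>2)"
    proof (intro mult_left_mono add_mono)
      have "\<bar>\<beta> / N\<bar> \<le> 6 * q"
      proof -
        have "S * q \<le> 6 * N * q" using Ng q by (intro mult_right_mono) auto
        then show ?thesis using \<beta> Np by (simp add: abs_divide pos_divide_le_eq mult_ac)
      qed
      then have "(\<beta> / N)\<^sup>2 \<le> (6 * q)\<^sup>2" using q by (intro power2_le_iff_abs_le[THEN iffD2]) auto
      then show "\<beta>\<^sup>2 / N\<^sup>2 \<le> 36 * q\<^sup>2" by (simp add: power_divide power_mult_distrib)
      have "\<bar>1 / N - 1 / N'\<bar> * S \<le> 360 * q"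
      proof -
        have 1: "\<bar>1 / N - 1 / N'\<bar> = \<bar>N - N'\<bar> / (N * N')" using Np by (simp add: diff_divide_eq_iff abs_divide abs_minus_commute mult.commute divide_simps)
        have "\<bar>N - N'\<bar> * S \<le> 5 * (S * q) * S" using NN S by (intro mult_right_mono) auto
        also have "\<dots> = 360 * q * ((S / 6) * (S / 12))" by simp
        also have "\<dots> \<le> 360 * q * (N * N')" using Ng N'g Np S q by (intro mult_left_mono mult_mono) auto
        finally show ?thesis unfolding 1 using Np by (simp add: pos_divide_le_eq)
      qed
      then have "(\<bar>1 / N - 1 / N'\<bar> * S)\<^sup>2 \<le> (360 * q)\<^sup>2" using S by (intro power_mono) auto
      then have 2: "(1 / N - 1 / N')\<^sup>2 * S\<^sup>2 \<le> 129600 * q\<^sup>2" by (simp add: power_mult_distrib)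
      have "(1 / N - 1 / N')\<^sup>2 * (\<integral>w. (acc x' w)\<^sup>2 \<partial>\<gamma> x) \<le> (1 / N - 1 / N')\<^sup>2 * (4 * S\<^sup>2)"
        using acc'2 by (intro mult_left_mono) auto
      then show "(1 / N - 1 / N')\<^sup>2 * (\<integral>w. (acc x' w)\<^sup>2 \<partial>\<gamma> x) \<le> 518400 * q\<^sup>2" using 2 by linarith
      have "S\<^sup>2 \<le> (12 * N')\<^sup>2" using N'g S by (intro power_mono) auto
      then have "12 * S\<^sup>2 * q\<^sup>2 \<le> 1728 * q\<^sup>2 * N'\<^sup>2"
        using mult_left_mono[of "S\<^sup>2" "(12 * N')\<^sup>2" "12 * q\<^sup>2"] by (simp add: power_mult_distrib mult_ac)
      then show "(\<integral>w. (F w)\<^sup>2 \<partial>\<gamma> x) / N'\<^sup>2 \<le> 1728 * q\<^sup>2"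
        using order_trans[OF F(2)] Np by (simp only: pos_divide_le_eq zero_less_power)
    qed simp
    also have "\<dots> \<le> 1600000 * q\<^sup>2" by simp
    finally show ?thesis .
  qed
  have ig: "integrable (\<gamma> x) (\<lambda>w. acc x w * g w)" by (rule acc_g_integrable[OF x])
  have igE: "integrable (\<gamma> x) (\<lambda>w. E w * (acc x' w * g w))" "(\<integral>w. acc x' w * g w \<partial>\<gamma> x') = (\<integral>w. E w * (acc x' w * g w) \<partial>\<gamma> x)"
    using integral_gauss_shift[of "\<lambda>w. acc x' w * g w" x' x] acc_g_integrable[OF x', of x'] by (simp_all add: E_def)
  have iE: "integrable (\<gamma> x) (\<lambda>w. E w * acc x' w)" unfolding EF using acc_integrable[OF x] iF by simp
  have IE: "(\<integral>w. E w * acc x' w \<partial>\<gamma> x) = N'" unfolding EF N'e ..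
  \<comment> \<open>Both normalized weights have total mass 1, so the constant \<open>g x\<close>
    drops out.\<close>
  have "(\<integral>w. (g w - g x) * b w \<partial>\<gamma> x) = (\<integral>w. (1 / N) * (acc x w * g w) - (1 / N') * (E w * (acc x' w * g w)) - g x / N * acc x w + g x / N' * (E w * acc x' w) \<partial>\<gamma> x)"
  proof (rule Bochner_Integration.integral_cong[OF refl])
    fix w
    have "(G - h) * (A / a - e * A' / a') = (1 / a) * (A * G) - (1 / a') * (e * (A' * G)) - h / a * A + h / a' * (e * A')"
      for G h A a e A' a' :: real by (simp add: left_diff_distrib right_diff_distrib diff_divide_distrib mult_ac)
    then show "(g w - g x) * b w = (1 / N) * (acc x w * g w) - (1 / N') * (E w * (acc x' w * g w)) - g x / N * acc x w + g x / N' * (E w * acc x' w)"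
      unfolding be .
  qed
  also have "\<dots> = avg g x - avg g x'"
    using ig igE iE acc_integrable[OF x, of x] Np
    by (simp add: IE avg_def N_def[symmetric] N'_def[symmetric] nrm_def[of x, symmetric])
  finally have e: "(\<integral>w. (g w - g x) * b w \<partial>\<gamma> x) = avg g x - avg g x'" .
  have "(avg g x - avg g x')\<^sup>2 \<le> 9 * energy g x * (\<integral>w. (b w)\<^sup>2 \<partial>\<gamma> x)"
    unfolding e[symmetric]
  proof (rule energy_Cauchy_Schwarz[OF x bL])
    fix w assume "U x + 2 < U w"
    then have "acc x w = 0" "acc x' w = 0" using \<beta>1 by (auto simp: acc_def \<beta>_def)
    then show "b w = 0" by (simp add: be)
  qed
  also have "\<dots> \<le> 9 * energy g x * (1600000 * q\<^sup>2)" using b2 energy_nonneg by (intro mult_left_mono) auto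
  also have "\<dots> \<le> 20000000 * energy g x * q\<^sup>2" using energy_nonneg by simp
  finally show ?thesis .
qed

end

context smooth_target
begin

lemma nd_sym: "nd I \<tau> x y = nd I \<tau> y x" unfolding nd_def by (simp add: power2_commute)

text \<open>The triangle inequality for a squared distance, at the price of factors 2.\<close>

lemma nd_triangle: "nd I \<tau> x z \<le> 2 * nd I \<tau> x y + 2 * nd I \<tau> y z"
proof -
  have "(x j - z j)\<^sup>2 / \<tau> j \<le> 2 * ((x j - y j)\<^sup>2 / \<tau> j) + 2 * ((y j - z j)\<^sup>2 / \<tau> j)" if j: "j \<in> I" for j
  proof -
    have "0 \<le> ((x j - y j) - (y j - z j))\<^sup>2" by simp
    then have "(x j - z j)\<^sup>2 \<le> 2 * (x j - y j)\<^sup>2 + 2 * (y j - z j)\<^sup>2" by (simp add: power2_eq_square algebra_simps)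
    from divide_right_mono[OF this, of "\<tau> j"] show ?thesis using \<tau>_pos[OF j] by (simp add: add_divide_distrib)
  qed
  then have "nd I \<tau> x z \<le> (\<Sum>j\<in>I. 2 * ((x j - y j)\<^sup>2 / \<tau> j) + 2 * ((y j - z j)\<^sup>2 / \<tau> j))" unfolding nd_def by (rule sum_mono)
  then show ?thesis by (simp add: nd_def sum.distrib sum_distrib_left)
qed

text \<open>Makes the slope bounded on balls. A step of length \<open>\<sigma>\<close> in the
  steepest direction raises \<open>U\<close> by at least \<open>slope x\<close>, whereas the
  quadratic upper bound at \<open>z\<close> limits the rise.\<close>

lemma slope_le:
  assumes x: "x \<in> RR I" and z: "z \<in> RR I"
  shows "slope x \<le> slope z + L * (\<sigma>\<^sup>2 + nd I \<tau> x z)"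
proof (cases "slope x = 0")
  case True
  then show ?thesis using slope_nonneg[of z] L nd_nonneg[of I \<tau> x z] \<tau>_pos by (simp add: add_nonneg_nonneg)
next
  case False
  then have k: "0 < slope x" using slope_nonneg[of x] by simp
  define v where "v = grad x"
  define k where "k = slope x"
  have k0: "0 < k" using k by (simp add: k_def)
  have k2: "(\<Sum>j\<in>I. (v j * s j)\<^sup>2) = k\<^sup>2" by (simp add: k_def slope_def lin_sd_def v_def sum_nonneg)
  \<comment> \<open>The maximizer of the linear part at fixed length: it gives
    \<open>lin v x u = k\<close> and \<open>nd I \<tau> u x = \<sigma>\<^sup>2\<close>.\<close>
  define u where "u = (\<lambda>j\<in>I. x j + v j * (s j)\<^sup>2 / k)"
  have u: "u \<in> RR I" by (simp add: u_def)
  have sp: "s j \<noteq> 0" if "j \<in> I" for j using s_pos[OF that] by (rule less_imp_neq[symmetric])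
  have "lin v x u = (\<Sum>j\<in>I. (v j * s j)\<^sup>2 / k)"
    unfolding lin_def by (intro sum.cong refl) (simp add: u_def power2_eq_square)
  then have l: "lin v x u = k" unfolding sum_divide_distrib[symmetric] k2 using k0 by (simp add: power2_eq_square)
  have "nd I (\<lambda>j. (s j)\<^sup>2) u x = (\<Sum>j\<in>I. (v j * s j)\<^sup>2 / k\<^sup>2)"
    unfolding nd_def
  proof (intro sum.cong refl)
    fix j assume j: "j \<in> I"
    define t where "t = s j"
    have "t \<noteq> 0" using sp[OF j] by (simp add: t_def)
    then show "(u j - x j)\<^sup>2 / (s j)\<^sup>2 = (v j * s j)\<^sup>2 / k\<^sup>2"
      unfolding t_def[symmetric] using j k0 by (simp add: u_def t_def[symmetric] power2_eq_square)
  qed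
  then have n1: "nd I (\<lambda>j. (s j)\<^sup>2) u x = 1" unfolding sum_divide_distrib[symmetric] k2 using k0 by simp
  then have n: "nd I \<tau> u x = \<sigma>\<^sup>2" unfolding nd_s using \<sigma>_pos by (simp add: divide_eq_1_iff)
  have "(lin (grad z) x u)\<^sup>2 \<le> (slope z)\<^sup>2" using lin_Cauchy_Schwarz[of "grad z" x u] unfolding n1 by (simp add: slope_def)
  then have l2: "lin (grad z) x u \<le> slope z" using slope_nonneg[of z] by (simp add: abs_le_square_iff[symmetric])
  have "L / 2 * nd I \<tau> u z \<le> L / 2 * (2 * \<sigma>\<^sup>2 + 2 * nd I \<tau> x z)"
    using nd_triangle[of u z x] L n by (intro mult_left_mono) auto
  then have "L / 2 * nd I \<tau> u z \<le> L * (\<sigma>\<^sup>2 + nd I \<tau> x z)" by argo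
  moreover have "k \<le> U u - U x" using grad(1)[OF x u] l by (simp add: v_def)
  moreover have "U u - U z \<le> lin (grad z) z u + L / 2 * nd I \<tau> u z" by (rule grad(2)[OF z u])
  moreover have "lin (grad z) z x \<le> U x - U z" by (rule grad(1)[OF z x])
  moreover have "lin (grad z) z u = lin (grad z) x u + lin (grad z) z x" by (rule lin_shift)
  ultimately have "k \<le> slope z + L * (\<sigma>\<^sup>2 + nd I \<tau> x z)" using l2 by linarith
  then show ?thesis by (simp add: k_def)
qed

end

section \<open>Global forms and the spectral gap\<close>

definition pairs :: "'a measure \<Rightarrow> ('a \<Rightarrow> real) \<Rightarrow> ennreal" where
  "pairs M f = (\<integral>\<^sup>+x. (\<integral>\<^sup>+y. ennreal ((f y - f x)\<^sup>2) \<partial>M) \<partial>M)"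

text \<open>Twice the Dirichlet form of the Metropolis kernel, without the factor
  \<open>1 / Z\<close>. The minimum is \<open>exp (- U y)\<close> times the acceptance probability,
  in a visibly symmetric form.\<close>

definition rw_form :: "'i set \<Rightarrow> (('i \<Rightarrow> real) \<Rightarrow> real) \<Rightarrow> ('i \<Rightarrow> real) \<Rightarrow> (('i \<Rightarrow> real) \<Rightarrow> real) \<Rightarrow> ennreal" where
  "rw_form I U s f = (\<integral>\<^sup>+y. (\<integral>\<^sup>+y'. ennreal ((f y' - f y)\<^sup>2) *
      ennreal (min (exp (- U y)) (exp (- U y')) * gdens I s y y') \<partial>LB I) \<partial>LB I)"

context smooth_target_bounded
begin

abbreviation "\<pi> \<equiv> gibbs I U"

lemma gauss_integral_measurable:
  fixes F :: "('a \<Rightarrow> real) \<Rightarrow> ('a \<Rightarrow> real) \<Rightarrow> real"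
  assumes F[measurable]: "(\<lambda>z. F (fst z) (snd z)) \<in> borel_measurable (LB I \<Otimes>\<^sub>M LB I)"
  shows "(\<lambda>x. \<integral>w. F x w \<partial>\<gamma> x) \<in> borel_measurable (LB I)"
proof -
  interpret S: sigma_finite_measure "LB I" by (rule sigma_finite_LB[OF fin])
  have "(\<lambda>x. \<integral>w. gdens I s x w * F x w \<partial>LB I) \<in> borel_measurable (LB I)"
    by (rule S.borel_measurable_lebesgue_integral) (simp add: split_beta')
  moreover have "(\<integral>w. F x w \<partial>\<gamma> x) = (\<integral>w. gdens I s x w * F x w \<partial>LB I)" if x: "x \<in> space (LB I)" for x
  proof -
    have [measurable]: "F x \<in> borel_measurable (LB I)"
      using measurable_compose[OF measurable_Pair1'[OF x] F] by simp
    show ?thesis unfolding gauss_density by (subst integral_density) simp_all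
  qed
  ultimately show ?thesis by (simp cong: measurable_cong)
qed

lemma avg_measurable[measurable]: "avg g \<in> borel_measurable (LB I)"
  unfolding avg_def[abs_def] nrm_def
  by (intro borel_measurable_divide gauss_integral_measurable; unfold acc_def) measurable

lemma energy_measurable[measurable]: "energy g \<in> borel_measurable (LB I)"
  unfolding energy_def[abs_def] by (rule gauss_integral_measurable) measurable

lemma M_nonneg: "0 \<le> M"
  using g_bd RR_not_empty[of I] by (meson abs_ge_zero ex_in_conv order_trans)

lemma avg_bd: assumes x: "x \<in> RR I" shows "\<bar>avg g x\<bar> \<le> M"
proof -
  have "\<bar>\<integral>w. acc x w * g w \<partial>\<gamma> x\<bar> \<le> (\<integral>w. \<bar>acc x w * g w\<bar> \<partial>\<gamma> x)" by (rule integral_abs_bound)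
  also have "\<dots> \<le> (\<integral>w. acc x w * M \<partial>\<gamma> x)"
  proof (rule integral_mono)
    show "integrable (\<gamma> x) (\<lambda>w. \<bar>acc x w * g w\<bar>)" using acc_g_integrable[OF x, of x] by (rule integrable_abs)
  qed (use acc_integrable[OF x, of x] g_bd in \<open>auto simp: abs_mult intro!: mult_left_mono\<close>)
  also have "\<dots> = nrm x * M" by (simp add: nrm_def)
  finally show ?thesis using nrm_pos[OF x] by (simp add: avg_def abs_divide pos_divide_le_eq mult.commute)
qed

text \<open>The radius in \<open>avg_near\<close> depends on the slope, which is unbounded. On the
  ball \<open>B n\<close> the slope is bounded, so one radius serves all pairs there and
  \<open>local_Poincare\<close> applies with a constant independent of \<open>n\<close>; then
  \<open>n\<close> tends to infinity by dominated convergence.\<close>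

lemma variance_avg:
  shows "(\<integral>x. (avg g x)\<^sup>2 \<partial>\<pi>) - (\<integral>x. avg g x \<partial>\<pi>)\<^sup>2 \<le> 20000000 / \<sigma>\<^sup>2 * (\<integral>x. energy g x \<partial>\<pi>)"
proof -
  interpret P: prob_space \<pi> by (rule prob_space_gibbs)
  define z where "z = (\<lambda>j\<in>I. 0 :: real)"
  have z: "z \<in> RR I" by (simp add: z_def)
  define B where "B n = {x \<in> space (LB I). nd I \<tau> z x \<le> real n}" for n :: nat
  have B[measurable]: "B n \<in> sets (LB I)" for n unfolding B_def by measurable
  have BR: "x \<in> RR I" if "x \<in> B n" for x n using that by (simp add: B_def space_LB)
  \<comment> \<open>The local Lipschitz constant furnished by \<open>avg_near\<close>: with
    \<open>nd = \<sigma>\<^sup>2 * q\<^sup>2\<close> the factor \<open>q\<^sup>2\<close> becomes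
    \<open>nd / \<sigma>\<^sup>2\<close>.\<close>
  define G where "G x = sqrt (20000000 * energy g x / \<sigma>\<^sup>2)" for x
  have [measurable]: "G \<in> borel_measurable (LB I)" unfolding G_def[abs_def] by measurable
  have G2: "(G x)\<^sup>2 = 20000000 * energy g x / \<sigma>\<^sup>2" for x using energy_nonneg[of x] by (simp add: G_def)
  define M' where "M' = M + sqrt (20000000 * (2 * M)\<^sup>2 / \<sigma>\<^sup>2)"
  define C where "C = 20000000 / \<sigma>\<^sup>2 * (\<integral>x. energy g x \<partial>\<pi>)"
  have ien: "integrable \<pi> (energy g)"
    by (rule P.integrable_const_bound[where B="(2 * M)\<^sup>2"]) (use energy_le energy_nonneg in auto)
  have bound: "measure \<pi> (B n) * (\<integral>x. indicator (B n) x * (avg g x)\<^sup>2 \<partial>\<pi>) - (\<integral>x. indicator (B n) x * avg g x \<partial>\<pi>)\<^sup>2 \<le> C" for n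
  proof -
    define K where "K = slope z + L * (\<sigma>\<^sup>2 + real n)"
    have K0: "0 \<le> K" unfolding K_def using L slope_nonneg[of z] by (intro add_nonneg_nonneg mult_nonneg_nonneg) auto
    have slopeK: "slope x \<le> K" if "x \<in> B n" for x
    proof -
      have "nd I \<tau> x z \<le> real n" using that nd_sym[of x z] by (simp add: B_def)
      then have "L * (\<sigma>\<^sup>2 + nd I \<tau> x z) \<le> L * (\<sigma>\<^sup>2 + real n)" using L by (intro mult_left_mono) auto
      then show ?thesis using slope_le[OF BR[OF that] z] by (simp add: K_def)
    qed
    \<comment> \<open>Largest \<open>q\<close> admissible in \<open>avg_near\<close> for all points
      of the ball.\<close>
    define c where "c = min (1 / 60) (1 / (1 + K))"
    have c: "0 < c" "c \<le> 1 / 60" "(1 + K) * c \<le> 1"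
    proof -
      show "0 < c" "c \<le> 1 / 60" using K0 by (simp_all add: c_def)
      have "(1 + K) * c \<le> (1 + K) * (1 / (1 + K))" using K0 by (intro mult_left_mono) (auto simp: c_def)
      then show "(1 + K) * c \<le> 1" using K0 by simp
    qed
    have "measure \<pi> (B n) * (\<integral>x. indicator (B n) x * (avg g x)\<^sup>2 \<partial>\<pi>) - (\<integral>x. indicator (B n) x * avg g x \<partial>\<pi>)\<^sup>2
      \<le> measure \<pi> (B n) * (\<integral>x. indicator (B n) x * (G x)\<^sup>2 \<partial>\<pi>) / 1"
    proof (rule local_Poincare[where \<tau>=\<tau> and M=M' and \<rho>="\<sigma>\<^sup>2 * c\<^sup>2"])
      show "0 < \<tau> j" if "j \<in> I" for j by (rule \<tau>_pos[OF that])
      show "2 * U (midp I x y) + 1 / 4 * nd I \<tau> x y \<le> U x + U y" if "x \<in> RR I" "y \<in> RR I" for x y by (rule conv[OF that])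
      show "midp I x y \<in> B n" if x: "x \<in> B n" and y: "y \<in> B n" for x y
      proof -
        have "2 * nd I \<tau> z (midp I x y) \<le> nd I \<tau> z x + nd I \<tau> z y"
        proof -
          have "2 * ((z j - midp I x y j)\<^sup>2 / \<tau> j) \<le> (z j - x j)\<^sup>2 / \<tau> j + (z j - y j)\<^sup>2 / \<tau> j" if j: "j \<in> I" for j
          proof -
            have "0 \<le> (x j - y j)\<^sup>2" by simp
            then have "2 * (z j - midp I x y j)\<^sup>2 \<le> (z j - x j)\<^sup>2 + (z j - y j)\<^sup>2"
              using j by (simp add: power2_eq_square field_simps)
            from divide_right_mono[OF this, of "\<tau> j"] show ?thesis using \<tau>_pos[OF j] by (simp add: add_divide_distrib)
          qed
          then have "(\<Sum>j\<in>I. 2 * ((z j - midp I x y j)\<^sup>2 / \<tau> j)) \<le> (\<Sum>j\<in>I. (z j - x j)\<^sup>2 / \<tau> j + (z j - y j)\<^sup>2 / \<tau> j)" by (rule sum_mono)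
          then show ?thesis unfolding nd_def sum.distrib sum_distrib_left .
        qed
        then show ?thesis using x y by (simp add: B_def space_LB)
      qed
      show "\<bar>avg g x\<bar> \<le> M'" if "x \<in> B n" for x
        using avg_bd[OF BR[OF that]] by (simp add: M'_def add_increasing2)
      show "0 \<le> G x \<and> G x \<le> M'" if "x \<in> B n" for x
      proof -
        have "G x \<le> sqrt (20000000 * (2 * M)\<^sup>2 / \<sigma>\<^sup>2)"
          unfolding G_def by (intro real_sqrt_le_mono divide_right_mono mult_left_mono energy_le BR[OF that]) auto
        moreover have "0 \<le> G x" using energy_nonneg[of x] by (simp add: G_def)
        ultimately show ?thesis using M_nonneg unfolding M'_def by linarith
      qed
      show "0 < \<sigma>\<^sup>2 * c\<^sup>2" using \<sigma>_pos c by simp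
      show "\<bar>avg g x - avg g y\<bar> \<le> G x * sqrt (nd I \<tau> x y)" if x: "x \<in> B n" and y: "y \<in> B n" and le: "nd I \<tau> x y \<le> \<sigma>\<^sup>2 * c\<^sup>2" for x y
      proof -
        define q where "q = sqrt (nd I \<tau> y x / \<sigma>\<^sup>2)"
        have nn: "0 \<le> nd I \<tau> y x" using nd_nonneg[of I \<tau> y x] \<tau>_pos by auto
        have q2: "nd I \<tau> y x / \<sigma>\<^sup>2 = q\<^sup>2" using nn by (simp add: q_def)
        have q0: "0 \<le> q" using nn by (simp add: q_def)
        have "nd I \<tau> y x / \<sigma>\<^sup>2 \<le> c\<^sup>2" using le \<sigma>_pos nd_sym[of y x] by (simp add: pos_divide_le_eq mult.commute)
        then have qc: "q \<le> c" unfolding q2 using c q0 by (simp add: power2_le_iff_abs_le)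
        have "(avg g x - avg g y)\<^sup>2 \<le> 20000000 * energy g x * q\<^sup>2"
        proof (rule avg_near[OF BR[OF x] BR[OF y] q2 q0])
          show "q \<le> 1 / 60" using qc c by simp
          have "(1 + slope x) * q \<le> (1 + K) * c" using slopeK[OF x] slope_nonneg[of x] qc q0 K0 by (intro mult_mono) auto
          then show "(1 + slope x) * q \<le> 1" using c by simp
        qed
        also have "\<dots> = (G x * sqrt (nd I \<tau> x y))\<^sup>2"
          unfolding power_mult_distrib G2 q2[symmetric] using nn by (simp add: nd_sym[of x y])
        finally show ?thesis
          by (rule power2_le_iff_abs_le[THEN iffD1, rotated]) (use energy_nonneg[of x] nn in \<open>auto simp: G_def nd_sym[of x y]\<close>)
      qed
    qed measurable
    also have "\<dots> \<le> 1 * C"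
    proof -
      have "(\<integral>x. indicator (B n) x * (G x)\<^sup>2 \<partial>\<pi>) \<le> (\<integral>x. (G x)\<^sup>2 \<partial>\<pi>)"
      proof (rule integral_mono)
        show i: "integrable \<pi> (\<lambda>x. (G x)\<^sup>2)" unfolding G2 using ien by simp
        show "integrable \<pi> (\<lambda>x. indicator (B n) x * (G x)\<^sup>2)"
          by (rule Bochner_Integration.integrable_bound[OF i]) (auto simp: indicator_def)
      qed (simp add: indicator_def)
      also have "\<dots> = C" by (simp add: G2 C_def)
      finally have le: "(\<integral>x. indicator (B n) x * (G x)\<^sup>2 \<partial>\<pi>) \<le> C" .
      have "measure \<pi> (B n) * (\<integral>x. indicator (B n) x * (G x)\<^sup>2 \<partial>\<pi>) \<le> 1 * C"
        by (intro mult_mono le) (auto intro!: Bochner_Integration.integral_nonneg)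
      then show ?thesis by simp
    qed
    finally show ?thesis by simp
  qed
  have ind: "(\<lambda>n. indicator (B n) x :: real) \<longlonglongrightarrow> 1" if "x \<in> RR I" for x
  proof -
    obtain N where N: "nd I \<tau> z x \<le> real N" using real_arch_simple by blast
    have "\<forall>\<^sub>F n in sequentially. indicator (B n) x = (1 :: real)"
      using eventually_ge_at_top[of N] by eventually_elim (use N that in \<open>auto simp: B_def space_LB indicator_def\<close>)
    then show ?thesis by (rule tendsto_eventually)
  qed
  have lim: "(\<lambda>n. \<integral>x. indicator (B n) x * u x \<partial>\<pi>) \<longlonglongrightarrow> (\<integral>x. u x \<partial>\<pi>)"
    if [measurable]: "u \<in> borel_measurable (LB I)" and bd: "\<And>x. x \<in> RR I \<Longrightarrow> \<bar>u x\<bar> \<le> D" for u :: "_ \<Rightarrow> real" and D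
  proof (rule integral_dominated_convergence[where w="\<lambda>_. D"])
    show "AE x in \<pi>. (\<lambda>n. indicator (B n) x * u x) \<longlonglongrightarrow> u x"
    proof (rule AE_I2)
      fix x assume "x \<in> space \<pi>"
      then have "(\<lambda>n. indicator (B n) x * u x) \<longlonglongrightarrow> 1 * u x" by (intro tendsto_mult ind tendsto_const) simp
      then show "(\<lambda>n. indicator (B n) x * u x) \<longlonglongrightarrow> u x" by simp
    qed
    show "AE x in \<pi>. norm (indicator (B n) x * u x) \<le> D" for n
    proof (rule AE_I2)
      fix x assume "x \<in> space \<pi>"
      then show "norm (indicator (B n) x * u x) \<le> D" using bd[of x] by (auto simp: indicator_def split: if_splits intro: order_trans[OF abs_ge_zero])
    qed
  qed (auto cong: measurable_cong_sets)
  have l1: "(\<lambda>n. measure \<pi> (B n)) \<longlonglongrightarrow> 1"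
  proof -
    have "measure \<pi> (B n) = (\<integral>x. indicator (B n) x * 1 \<partial>\<pi>)" for n
      using sets.sets_into_space[OF B[of n]] by (simp add: space_LB Int_absorb2)
    then show ?thesis using lim[of "\<lambda>_. 1" 1] P.prob_space by simp
  qed
  have "(\<lambda>n. measure \<pi> (B n) * (\<integral>x. indicator (B n) x * (avg g x)\<^sup>2 \<partial>\<pi>) - (\<integral>x. indicator (B n) x * avg g x \<partial>\<pi>)\<^sup>2)
    \<longlonglongrightarrow> 1 * (\<integral>x. (avg g x)\<^sup>2 \<partial>\<pi>) - (\<integral>x. avg g x \<partial>\<pi>)\<^sup>2"
  proof (intro tendsto_diff tendsto_mult tendsto_power l1)
    show "(\<lambda>n. \<integral>x. indicator (B n) x * avg g x \<partial>\<pi>) \<longlonglongrightarrow> (\<integral>x. avg g x \<partial>\<pi>)"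
      by (rule lim[OF _ avg_bd]) simp
    show "(\<lambda>n. \<integral>x. indicator (B n) x * (avg g x)\<^sup>2 \<partial>\<pi>) \<longlonglongrightarrow> (\<integral>x. (avg g x)\<^sup>2 \<partial>\<pi>)"
      by (rule lim[of _ "M\<^sup>2"]) (use avg_bd M_nonneg in \<open>auto simp: power2_le_iff_abs_le\<close>)
  qed
  then have "1 * (\<integral>x. (avg g x)\<^sup>2 \<partial>\<pi>) - (\<integral>x. avg g x \<partial>\<pi>)\<^sup>2 \<le> C"
    by (rule LIMSEQ_le_const2) (use bound in auto)
  then show ?thesis by (simp add: C_def)
qed

lemma nn_integral_energy: "(\<integral>\<^sup>+x. ennreal (energy g x) \<partial>\<pi>) = ennreal (1 / Z) * rw_form I U s g"
proof -
  have "(\<integral>\<^sup>+x. ennreal (energy g x) \<partial>\<pi>) = ennreal (1 / Z) * (\<integral>\<^sup>+x. ennreal (exp (- U x)) * ennreal (energy g x) \<partial>LB I)"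
    by (rule nn_integral_gibbs(2)) simp
  also have "(\<integral>\<^sup>+x. ennreal (exp (- U x)) * ennreal (energy g x) \<partial>LB I) = rw_form I U s g"
    unfolding rw_form_def
  proof (rule nn_integral_cong)
    fix x assume "x \<in> space (LB I)"
    then have x: "x \<in> RR I" by (simp add: space_LB)
    have "ennreal (energy g x) = (\<integral>\<^sup>+w. ennreal (min 1 (exp (U x - U w)) * (g w - g x)\<^sup>2) \<partial>\<gamma> x)"
      unfolding energy_def by (rule nn_integral_eq_integral[symmetric, OF energy_integrable[OF x]]) simp
    also have "\<dots> = (\<integral>\<^sup>+w. ennreal (gdens I s x w) * ennreal (min 1 (exp (U x - U w)) * (g w - g x)\<^sup>2) \<partial>LB I)"
      by (rule nn_integral_gauss) simp
    finally have "ennreal (exp (- U x)) * ennreal (energy g x) = (\<integral>\<^sup>+w. ennreal (exp (- U x)) * (ennreal (gdens I s x w) * ennreal (min 1 (exp (U x - U w)) * (g w - g x)\<^sup>2)) \<partial>LB I)"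
      by (simp add: nn_integral_cmult)
    also have "\<dots> = (\<integral>\<^sup>+w. ennreal ((g w - g x)\<^sup>2) * ennreal (min (exp (- U x)) (exp (- U w)) * gdens I s x w) \<partial>LB I)"
    proof (rule nn_integral_cong)
      fix w
      have "exp (- U x) * min 1 (exp (U x - U w)) = min (exp (- U x)) (exp (- U w))"
        by (simp add: min_mult_distrib_left exp_add[symmetric])
      then have "exp (- U x) * (gdens I s x w * (min 1 (exp (U x - U w)) * (g w - g x)\<^sup>2)) = (g w - g x)\<^sup>2 * (min (exp (- U x)) (exp (- U w)) * gdens I s x w)"
        by (metis mult.assoc mult.commute)
      then show "ennreal (exp (- U x)) * (ennreal (gdens I s x w) * ennreal (min 1 (exp (U x - U w)) * (g w - g x)\<^sup>2)) = ennreal ((g w - g x)\<^sup>2) * ennreal (min (exp (- U x)) (exp (- U w)) * gdens I s x w)"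
        by (simp add: ennreal_mult[symmetric])
    qed
    finally show "ennreal (exp (- U x)) * ennreal (energy g x) = (\<integral>\<^sup>+w. ennreal ((g w - g x)\<^sup>2) * ennreal (min (exp (- U x)) (exp (- U w)) * gdens I s x w) \<partial>LB I)" .
  qed
  finally show ?thesis .
qed

text \<open>The variance of \<open>g\<close> is at most its mean squared distance to the mean
  \<open>m\<close> of \<open>h\<close>, which splits into the distance to \<open>h\<close>, bounded
  by the energy, and the variance of \<open>h\<close>.\<close>

lemma spectral_gap_bounded:
  assumes \<sigma>1: "\<sigma>\<^sup>2 \<le> 1"
  shows "pairs \<pi> g \<le> ennreal (90000000 / \<sigma>\<^sup>2 / Z) * rw_form I U s g"
proof -
  interpret P: prob_space \<pi> by (rule prob_space_gibbs)
  define h where "h = avg g"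
  define m where "m = (\<integral>x. h x \<partial>\<pi>)"
  define e where "e = (\<integral>x. energy g x \<partial>\<pi>)"
  have [measurable]: "h \<in> borel_measurable (LB I)" by (simp add: h_def)
  have ien: "integrable \<pi> (energy g)"
    by (rule P.integrable_const_bound[where B="(2 * M)\<^sup>2"]) (use energy_le energy_nonneg in auto)
  have e0: "0 \<le> e" unfolding e_def using energy_nonneg by (auto intro!: Bochner_Integration.integral_nonneg)
  have bdL: "u \<in> L2 \<pi>" if [measurable]: "u \<in> borel_measurable (LB I)" and "\<And>x. x \<in> RR I \<Longrightarrow> \<bar>u x\<bar> \<le> D" for u :: "_ \<Rightarrow> real" and D
  proof -
    have "integrable \<pi> (\<lambda>x. (u x)\<^sup>2)"
    proof (rule P.integrable_const_bound[where B="D\<^sup>2"])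
      show "AE x in \<pi>. norm ((u x)\<^sup>2) \<le> D\<^sup>2"
      proof (rule AE_I2)
        fix x assume "x \<in> space \<pi>"
        then have "\<bar>u x\<bar> \<le> D" using that(2) by simp
        then have "(u x)\<^sup>2 \<le> D\<^sup>2" by (intro power2_le_iff_abs_le[THEN iffD2]) auto
        then show "norm ((u x)\<^sup>2) \<le> D\<^sup>2" by simp
      qed
    qed measurable
    then show ?thesis by (simp add: L2_def)
  qed
  have hL: "h \<in> L2 \<pi>" by (rule bdL[of _ M]) (use avg_bd in \<open>auto simp: h_def\<close>)
  have gL: "g \<in> L2 \<pi>" by (rule bdL[of _ M]) (use g_bd in auto)
  have cL: "(\<lambda>_. c) \<in> L2 \<pi>" for c :: real by (rule bdL[of _ "\<bar>c\<bar>"]) auto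
  have ih: "integrable \<pi> h" "integrable \<pi> (\<lambda>x. (h x)\<^sup>2)" and ig: "integrable \<pi> g" "integrable \<pi> (\<lambda>x. (g x)\<^sup>2)"
    using hL gL by (auto simp: L2_def intro: P.square_integrable_imp_integrable)
  have i1: "integrable \<pi> (\<lambda>x. (g x - c)\<^sup>2)" for c using L2_add[OF gL cL[of "- c"]] by (simp add: L2_def)
  have i2: "integrable \<pi> (\<lambda>x. (h x - c)\<^sup>2)" for c using L2_add[OF hL cL[of "- c"]] by (simp add: L2_def)
  have i3: "integrable \<pi> (\<lambda>x. (h x - g x)\<^sup>2)" using L2_add[OF hL L2_scale[OF gL, of "- 1"]] by (simp add: L2_def)
  have vh: "(\<integral>x. (h x - m)\<^sup>2 \<partial>\<pi>) \<le> 20000000 / \<sigma>\<^sup>2 * e"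
    using P.variance_eq[OF ih] variance_avg by (simp add: m_def h_def e_def)
  have dh: "(\<integral>x. (h x - g x)\<^sup>2 \<partial>\<pi>) \<le> 400 * e"
  proof -
    have "(\<integral>x. (h x - g x)\<^sup>2 \<partial>\<pi>) \<le> (\<integral>x. 400 * energy g x \<partial>\<pi>)"
      by (rule integral_mono[OF i3]) (use ien avg_diff_sq in \<open>auto simp: h_def\<close>)
    then show ?thesis by (simp add: e_def)
  qed
  have "(\<integral>x. (g x - P.expectation g)\<^sup>2 \<partial>\<pi>) = (\<integral>x. (g x - m)\<^sup>2 \<partial>\<pi>) - (P.expectation g - m)\<^sup>2"
  proof -
    have "(\<integral>x. (g x - m)\<^sup>2 \<partial>\<pi>) = (\<integral>x. (g x)\<^sup>2 \<partial>\<pi>) - 2 * m * P.expectation g + m\<^sup>2"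
    proof -
      have "(\<integral>x. (g x - m)\<^sup>2 \<partial>\<pi>) = (\<integral>x. (g x)\<^sup>2 - 2 * m * g x + m\<^sup>2 \<partial>\<pi>)"
        by (rule Bochner_Integration.integral_cong) (simp_all add: power2_diff mult_ac)
      then show ?thesis using ig P.prob_space by simp
    qed
    then show ?thesis using P.variance_eq[OF ig] by (simp add: power2_diff)
  qed
  also have "\<dots> \<le> (\<integral>x. (g x - m)\<^sup>2 \<partial>\<pi>)" by simp
  also have "\<dots> \<le> (\<integral>x. 2 * (h x - g x)\<^sup>2 + 2 * (h x - m)\<^sup>2 \<partial>\<pi>)"
  proof (rule integral_mono[OF i1])
    fix x
    have "0 \<le> ((h x - g x) + (h x - m))\<^sup>2" by simp
    then show "(g x - m)\<^sup>2 \<le> 2 * (h x - g x)\<^sup>2 + 2 * (h x - m)\<^sup>2" by (simp add: power2_eq_square algebra_simps)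
  qed (use i2 i3 in auto)
  also have "\<dots> = 2 * (\<integral>x. (h x - g x)\<^sup>2 \<partial>\<pi>) + 2 * (\<integral>x. (h x - m)\<^sup>2 \<partial>\<pi>)" using i2 i3 by simp
  also have "\<dots> \<le> 800 * e + 40000000 / \<sigma>\<^sup>2 * e" using vh dh by argo
  \<comment> \<open>The summand 800 is absorbed because \<open>1 \<le> 1 / \<sigma>\<^sup>2\<close>.
    Passing from the variance to \<open>pairs\<close> doubles the constant.\<close>
  also have "\<dots> \<le> 45000000 / \<sigma>\<^sup>2 * e"
  proof -
    have "1 \<le> 1 / \<sigma>\<^sup>2" using \<sigma>1 \<sigma>_pos by (simp add: pos_le_divide_eq)
    then have "800 * e \<le> 800 * (1 / \<sigma>\<^sup>2) * e" using e0 by (intro mult_right_mono) auto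
    moreover have "0 \<le> 1 / \<sigma>\<^sup>2 * e" using e0 by simp
    ultimately show ?thesis by argo
  qed
  finally have v: "(\<integral>x. (g x - P.expectation g)\<^sup>2 \<partial>\<pi>) \<le> 45000000 / \<sigma>\<^sup>2 * e" .
  have "pairs \<pi> g = ennreal (2 * (\<integral>x. (g x - P.expectation g)\<^sup>2 \<partial>\<pi>))"
    unfolding pairs_def by (rule P.nn_integral_pairwise_square[OF gL])
  also have "\<dots> \<le> ennreal (90000000 / \<sigma>\<^sup>2 * e)" by (rule ennreal_leI) (use v in argo)
  also have "\<dots> = ennreal (90000000 / \<sigma>\<^sup>2) * ennreal e" using e0 by (intro ennreal_mult) auto
  also have "ennreal e = (\<integral>\<^sup>+x. ennreal (energy g x) \<partial>\<pi>)"
    unfolding e_def by (rule nn_integral_eq_integral[symmetric, OF ien]) (simp add: energy_nonneg)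
  also have "\<dots> = ennreal (1 / Z) * rw_form I U s g" by (rule nn_integral_energy)
  also have "ennreal (90000000 / \<sigma>\<^sup>2) * \<dots> = ennreal (90000000 / \<sigma>\<^sup>2 / Z) * rw_form I U s g"
    using Z_pos by (simp add: mult.assoc[symmetric] ennreal_mult[symmetric])
  finally show ?thesis .
qed

end

context smooth_target
begin

text \<open>Clipping is a contraction, so it cannot increase \<open>rw_form\<close>. For each pair
  of points the clipped increment is eventually the true one, and Fatou's lemma carries the bound to
  \<open>pairs\<close> even when it is infinite.\<close>

lemma spectral_gap:
  assumes \<sigma>1: "\<sigma>\<^sup>2 \<le> 1" and f[measurable]: "f \<in> borel_measurable (LB I)"
  shows "pairs (gibbs I U) f \<le> ennreal (90000000 / \<sigma>\<^sup>2 / Z) * rw_form I U s f"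
proof -
  let ?\<pi> = "gibbs I U"
  interpret pp: prob_space ?\<pi> by (rule prob_space_gibbs)
  interpret PP: pair_prob_space ?\<pi> ?\<pi> ..
  let ?C = "ennreal (90000000 / \<sigma>\<^sup>2 / Z)"
  define t where "t n x = max (- real n) (min (real n) (f x))" for n x
  have tm[measurable]: "t n \<in> borel_measurable (LB I)" for n unfolding t_def by measurable
  have contr: "(t n y - t n x)\<^sup>2 \<le> (f y - f x)\<^sup>2" for n x y
  proof -
    have "\<bar>max (- c) (min c a) - max (- c) (min c b)\<bar> \<le> \<bar>a - b\<bar>" for a b c :: real
      by (smt (verit) max_def min_def)
    then show ?thesis unfolding t_def by (rule abs_le_square_iff[THEN iffD1])
  qed
  have tb: "pairs ?\<pi> (t n) \<le> ?C * rw_form I U s f" for n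
  proof -
    interpret b: smooth_target_bounded I U \<tau> \<sigma> L "t n" "real n"
      by unfold_locales (auto simp: t_def)
    have "pairs ?\<pi> (t n) \<le> ?C * rw_form I U s (t n)" by (rule b.spectral_gap_bounded[OF \<sigma>1])
    also have "\<dots> \<le> ?C * rw_form I U s f"
      unfolding rw_form_def by (intro mult_left_mono nn_integral_mono mult_right_mono ennreal_leI contr) auto
    finally show ?thesis .
  qed
  have pm: "pairs ?\<pi> g = (\<integral>\<^sup>+q. ennreal ((g (snd q) - g (fst q))\<^sup>2) \<partial>(?\<pi> \<Otimes>\<^sub>M ?\<pi>))"
    if [measurable]: "g \<in> borel_measurable (LB I)" for g
    unfolding pairs_def by (subst pp.nn_integral_fst[symmetric]) simp_all
  have "pairs ?\<pi> f = (\<integral>\<^sup>+q. liminf (\<lambda>n. ennreal ((t n (snd q) - t n (fst q))\<^sup>2)) \<partial>(?\<pi> \<Otimes>\<^sub>M ?\<pi>))"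
    unfolding pm[OF f]
  proof (rule nn_integral_cong)
    fix q :: "('i \<Rightarrow> real) \<times> ('i \<Rightarrow> real)"
    obtain N where N: "\<bar>f (fst q)\<bar> + \<bar>f (snd q)\<bar> \<le> real N" using real_arch_simple by blast
    have "\<forall>\<^sub>F n in sequentially. ennreal ((t n (snd q) - t n (fst q))\<^sup>2) = ennreal ((f (snd q) - f (fst q))\<^sup>2)"
      using eventually_ge_at_top[of N]
    proof eventually_elim
      fix n assume "N \<le> n"
      then have "t n (snd q) = f (snd q)" "t n (fst q) = f (fst q)" using N by (auto simp: t_def)
      then show "ennreal ((t n (snd q) - t n (fst q))\<^sup>2) = ennreal ((f (snd q) - f (fst q))\<^sup>2)" by simp
    qed
    then have "(\<lambda>n. ennreal ((t n (snd q) - t n (fst q))\<^sup>2)) \<longlonglongrightarrow> ennreal ((f (snd q) - f (fst q))\<^sup>2)"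
      by (rule tendsto_eventually)
    then show "ennreal ((f (snd q) - f (fst q))\<^sup>2) = liminf (\<lambda>n. ennreal ((t n (snd q) - t n (fst q))\<^sup>2))"
      by (intro lim_imp_Liminf[symmetric]) auto
  qed
  also have "\<dots> \<le> liminf (\<lambda>n. \<integral>\<^sup>+q. ennreal ((t n (snd q) - t n (fst q))\<^sup>2) \<partial>(?\<pi> \<Otimes>\<^sub>M ?\<pi>))"
    by (rule nn_integral_liminf) measurable
  also have "\<dots> = liminf (\<lambda>n. pairs ?\<pi> (t n))" by (simp add: pm)
  also have "\<dots> \<le> ?C * rw_form I U s f"
    using tb by (intro Liminf_le) (auto intro: always_eventually)
  finally show ?thesis .
qed

end

section \<open>Positivity of the Metropolis form\<close>

lemma (in finite_measure) nn_integral_pairwise_square_le: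
  fixes f :: "'a \<Rightarrow> real"
  assumes [measurable]: "f \<in> borel_measurable M"
  shows "(\<integral>\<^sup>+x. (\<integral>\<^sup>+y. ennreal ((f y - f x)\<^sup>2) \<partial>M) \<partial>M) \<le> 2 * emeasure M (space M) * (\<integral>\<^sup>+x. ennreal ((f x)\<^sup>2) \<partial>M)"
proof (cases "(\<integral>\<^sup>+x. ennreal ((f x)\<^sup>2) \<partial>M) = \<top>")
  case True
  show ?thesis
  proof (cases "emeasure M (space M) = 0")
    case True
    then have bot: "ae_filter M = bot" by (simp only: ae_filter_eq_bot_iff)
    have "AE x in M. False" unfolding bot by (rule eventually_bot)
    then have "(\<integral>\<^sup>+x. (\<integral>\<^sup>+y. ennreal ((f y - f x)\<^sup>2) \<partial>M) \<partial>M) = (\<integral>\<^sup>+x. 0 \<partial>M)"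
      by (intro nn_integral_cong_AE) (auto elim: eventually_mono)
    then show ?thesis by simp
  next
    case False
    then show ?thesis using True by (simp add: ennreal_mult_top)
  qed
next
  case False
  have i2: "integrable M (\<lambda>x. (f x)\<^sup>2)"
    using False by (intro integrableI_nonneg) (auto simp: top.not_eq_extremum)
  have i1: "integrable M f"
    by (rule square_integrable_imp_integrable[OF _ i2]) simp
  define m where "m = measure M (space M)"
  define a where "a = (\<integral>x. (f x)\<^sup>2 \<partial>M)"
  define b where "b = (\<integral>x. f x \<partial>M)"
  have e: "(f y - c)\<^sup>2 = (f y)\<^sup>2 - 2 * c * f y + c\<^sup>2" for y c by (simp add: power2_diff)
  have i3: "integrable M (\<lambda>y. (f y - c)\<^sup>2)" for c unfolding e using i1 i2 by simp
  have E: "(\<integral>y. (f y - c)\<^sup>2 \<partial>M) = a - 2 * c * b + m * c\<^sup>2" for c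
    using i1 i2 by (simp add: e a_def b_def m_def)
  have inner: "(\<integral>\<^sup>+y. ennreal ((f y - c)\<^sup>2) \<partial>M) = ennreal (a - 2 * c * b + m * c\<^sup>2)" for c
    unfolding E[symmetric] by (rule nn_integral_eq_integral[OF i3]) simp
  have nn: "0 \<le> a - 2 * c * b + m * c\<^sup>2" for c
    unfolding E[symmetric] by simp
  have "(\<integral>\<^sup>+x. (\<integral>\<^sup>+y. ennreal ((f y - f x)\<^sup>2) \<partial>M) \<partial>M) = (\<integral>\<^sup>+x. ennreal (a - 2 * f x * b + m * (f x)\<^sup>2) \<partial>M)"
    by (simp add: inner)
  also have "\<dots> = ennreal (\<integral>x. a - 2 * f x * b + m * (f x)\<^sup>2 \<partial>M)"
    by (rule nn_integral_eq_integral) (use i1 i2 nn in auto)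
  also have "(\<integral>x. a - 2 * f x * b + m * (f x)\<^sup>2 \<partial>M) = 2 * m * a - 2 * b\<^sup>2"
  proof -
    have "(\<integral>x. a - 2 * f x * b + m * (f x)\<^sup>2 \<partial>M) = (\<integral>x. a - (2 * b) * f x + m * (f x)\<^sup>2 \<partial>M)"
      by (simp add: ac_simps)
    also have "\<dots> = a * m - 2 * b * b + m * a"
      using i1 i2 by (simp add: a_def[symmetric] b_def[symmetric] m_def[symmetric] mult.commute)
    finally show ?thesis by (simp add: power2_eq_square algebra_simps)
  qed
  also have "ennreal (2 * m * a - 2 * b\<^sup>2) \<le> ennreal (2 * m * a)" by (intro ennreal_leI) simp
  also have "\<dots> = 2 * ennreal m * ennreal a"
    by (simp add: ennreal_mult m_def a_def)
  also have "ennreal a = (\<integral>\<^sup>+x. ennreal ((f x)\<^sup>2) \<partial>M)"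
    unfolding a_def by (rule nn_integral_eq_integral[OF i2, symmetric]) simp
  also have "ennreal m = emeasure M (space M)" unfolding m_def by (rule emeasure_eq_measure[symmetric])
  finally show ?thesis .
qed

lemma nn_integral_triple_swap:
  assumes A: "sigma_finite_measure A" and N: "sigma_finite_measure N"
    and \<Psi>[measurable]: "(\<lambda>q. \<Psi> (fst q) (fst (snd q)) (snd (snd q))) \<in> borel_measurable (A \<Otimes>\<^sub>M (N \<Otimes>\<^sub>M N))"
  shows "(\<integral>\<^sup>+y. (\<integral>\<^sup>+y'. (\<integral>\<^sup>+p. \<Psi> p y y' \<partial>A) \<partial>N) \<partial>N) = (\<integral>\<^sup>+p. (\<integral>\<^sup>+y. (\<integral>\<^sup>+y'. \<Psi> p y y' \<partial>N) \<partial>N) \<partial>A)"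
proof -
  interpret A: sigma_finite_measure A by fact
  interpret N: sigma_finite_measure N by fact
  interpret NN: pair_sigma_finite N N ..
  interpret T: pair_sigma_finite A "N \<Otimes>\<^sub>M N" ..
  have "(\<lambda>z. \<integral>\<^sup>+p. \<Psi> p (fst z) (snd z) \<partial>A) \<in> borel_measurable (N \<Otimes>\<^sub>M N)"
  proof (rule A.borel_measurable_nn_integral)
    show "(\<lambda>(z, p). \<Psi> p (fst z) (snd z)) \<in> borel_measurable ((N \<Otimes>\<^sub>M N) \<Otimes>\<^sub>M A)"
      using measurable_compose[OF measurable_pair_swap' \<Psi>] by (simp add: split_beta')
  qed
  then have "(\<integral>\<^sup>+y. (\<integral>\<^sup>+y'. (\<integral>\<^sup>+p. \<Psi> p y y' \<partial>A) \<partial>N) \<partial>N) = (\<integral>\<^sup>+z. (\<integral>\<^sup>+p. \<Psi> p (fst z) (snd z) \<partial>A) \<partial>(N \<Otimes>\<^sub>M N))"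
    by (subst N.nn_integral_fst[symmetric]) simp_all
  also have "\<dots> = (\<integral>\<^sup>+p. (\<integral>\<^sup>+z. \<Psi> p (fst z) (snd z) \<partial>(N \<Otimes>\<^sub>M N)) \<partial>A)"
    by (rule T.Fubini') (use \<Psi> in \<open>simp add: split_beta'\<close>)
  also have "\<dots> = (\<integral>\<^sup>+p. (\<integral>\<^sup>+y. (\<integral>\<^sup>+y'. \<Psi> p y y' \<partial>N) \<partial>N) \<partial>A)"
  proof (rule nn_integral_cong)
    fix p assume "p \<in> space A"
    then have "(\<lambda>z. \<Psi> p (fst z) (snd z)) \<in> borel_measurable (N \<Otimes>\<^sub>M N)"
      using measurable_compose[OF measurable_Pair1' \<Psi>, of p] by simp
    then show "(\<integral>\<^sup>+z. \<Psi> p (fst z) (snd z) \<partial>(N \<Otimes>\<^sub>M N)) = (\<integral>\<^sup>+y. (\<integral>\<^sup>+y'. \<Psi> p y y' \<partial>N) \<partial>N)"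
      by (subst N.nn_integral_fst[symmetric]) simp_all
  qed
  finally show ?thesis .
qed

text \<open>Two Gaussian steps of variance \<open>s\<^sup>2 / 2\<close> compose to one of variance
  \<open>s\<^sup>2\<close>.\<close>

lemma normal_density_semigroup:
  assumes "0 < s"
  shows "(\<integral>\<^sup>+x. ennreal (normal_density y (s / sqrt 2) x * normal_density y' (s / sqrt 2) x) \<partial>lborel) = ennreal (normal_density y s y')"
proof -
  define t where "t = s / sqrt 2"
  have t: "0 < t" using assms by (simp add: t_def)
  have st: "sqrt (t\<^sup>2 + t\<^sup>2) = s" using assms by (simp add: t_def power_divide)
  have "(\<integral>\<^sup>+x. ennreal (normal_density y t x * normal_density y' t x) \<partial>lborel)
    = (\<integral>\<^sup>+x. ennreal (normal_density y t x * normal_density y' t x) \<partial>distr lborel borel ((+) y))"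
    by (simp add: lborel_distr_plus)
  also have "\<dots> = (\<integral>\<^sup>+x. ennreal (normal_density 0 t ((y' - y) - x) * normal_density 0 t x) \<partial>lborel)"
    by (subst nn_integral_distr) (auto intro!: nn_integral_cong simp: normal_density_def power2_commute algebra_simps)
  also have "\<dots> = ennreal (normal_density 0 s (y' - y))"
    using fun_cong[OF conv_normal_density_zero_mean[OF t t], of "y' - y"] unfolding st by simp
  also have "normal_density 0 s (y' - y) = normal_density y s y'" by (simp add: normal_density_def)
  finally show ?thesis by (simp add: t_def)
qed

context gaussian_steps
begin

lemma gdens_semigroup:
  "(\<integral>\<^sup>+x. ennreal (gdens I (\<lambda>j. s j / sqrt 2) x y * gdens I (\<lambda>j. s j / sqrt 2) x y') \<partial>LB I) = ennreal (gdens I s y y')"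
proof -
  have "(\<integral>\<^sup>+x. ennreal (gdens I (\<lambda>j. s j / sqrt 2) x y * gdens I (\<lambda>j. s j / sqrt 2) x y') \<partial>LB I)
    = (\<integral>\<^sup>+x. (\<Prod>j\<in>I. ennreal (normal_density (y j) (s j / sqrt 2) (x j) * normal_density (y' j) (s j / sqrt 2) (x j))) \<partial>LB I)"
    by (intro nn_integral_cong) (simp add: gdens_def prod_ennreal prod.distrib normal_density_sym[of _ _ "y _"] normal_density_sym[of _ _ "y' _"])
  also have "\<dots> = (\<Prod>j\<in>I. \<integral>\<^sup>+t. ennreal (normal_density (y j) (s j / sqrt 2) t * normal_density (y' j) (s j / sqrt 2) t) \<partial>lborel)"
    by (rule lborel_product.product_nn_integral_prod[OF fin]) measurable
  also have "\<dots> = (\<Prod>j\<in>I. ennreal (normal_density (y j) (s j) (y' j)))"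
    by (intro prod.cong refl normal_density_semigroup s_pos)
  also have "\<dots> = ennreal (gdens I s y y')" by (simp add: gdens_def prod_ennreal)
  finally show ?thesis .
qed

text \<open>Positivity: \<open>min (exp (- U y)) (exp (- U y')) * gdens I s y y'\<close> is a mixture of products
  \<open>k p y * k p y'\<close>, by the layer cake formula for the minimum and the Gaussian semigroup property.\<close>

lemma rw_form_le:
  assumes U[measurable]: "U \<in> borel_measurable (LB I)" and f[measurable]: "f \<in> borel_measurable (LB I)"
  shows "rw_form I U s f \<le> 2 * (\<integral>\<^sup>+y. ennreal ((f y)\<^sup>2) * ennreal (exp (- U y)) \<partial>LB I)"
proof -
  define s' where "s' j = s j / sqrt 2" for j
  interpret G': gaussian_steps I s' by unfold_locales (simp_all add: fin s'_def s_pos)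
  interpret N: sigma_finite_measure "LB I" by (rule sigma_finite_LB[OF fin])
  define A where "A = (lborel :: real measure) \<Otimes>\<^sub>M LB I"
  interpret TL: pair_sigma_finite "lborel :: real measure" "LB I" ..
  have sA: "sigma_finite_measure A" unfolding A_def by (rule TL.sigma_finite_measure_axioms)
  interpret A: sigma_finite_measure A by (rule sA)
  interpret AN: pair_sigma_finite A "LB I" ..
  \<comment> \<open>The mixing parameter \<open>p\<close> consists of a level below the minimum and
    the point reached after a half step.\<close>
  define k where "k p y = (if 0 < fst p \<and> fst p < exp (- U y) then gdens I s' (snd p) y else 0)" for p y
  have k0[simp]: "0 \<le> k p y" for p y by (simp add: k_def)
  have U2[measurable]: "(\<lambda>z. U (snd z)) \<in> borel_measurable (N' \<Otimes>\<^sub>M LB I)" for N' :: "'x measure"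
    by (rule measurable_compose[OF measurable_snd]) measurable
  have g2: "(\<lambda>z. gdens I s' (snd (fst z)) (snd z)) \<in> borel_measurable (A \<Otimes>\<^sub>M LB I)"
    using measurable_compose[OF measurable_Pair[OF measurable_compose[OF measurable_fst measurable_snd] measurable_snd] gdens_measurable2[of I s']]
    unfolding A_def by simp
  have f2: "(\<lambda>z. fst (fst z)) \<in> borel_measurable (A \<Otimes>\<^sub>M LB I)" unfolding A_def by measurable
  have k2[measurable]: "(\<lambda>z. k (fst z) (snd z)) \<in> borel_measurable (A \<Otimes>\<^sub>M LB I)"
    unfolding k_def by (intro measurable_If g2 borel_measurable_const) (use f2 in measurable)
  have kp[measurable]: "k p \<in> borel_measurable (LB I)" for p unfolding k_def[abs_def] by measurable
  have mass: "(\<integral>\<^sup>+y. ennreal (k p y) \<partial>LB I) \<le> 1" for p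
  proof -
    have "(\<integral>\<^sup>+y. ennreal (k p y) \<partial>LB I) \<le> (\<integral>\<^sup>+y. ennreal (gdens I s' (snd p) y) \<partial>LB I)"
      by (intro nn_integral_mono ennreal_leI) (simp add: k_def)
    then show ?thesis by (simp add: G'.nn_integral_gdens)
  qed
  have min_int: "(\<integral>\<^sup>+t. (if 0 < t \<and> t < a \<and> t < b then 1 else 0) \<partial>lborel) = ennreal (min a b)" if "0 \<le> a" "0 \<le> b" for a b :: real
  proof -
    have "(\<integral>\<^sup>+t. (if 0 < t \<and> t < a \<and> t < b then 1 else 0) \<partial>lborel) = (\<integral>\<^sup>+t. indicator {0<..<min a b} t \<partial>lborel)"
      by (intro nn_integral_cong) (auto simp: indicator_def)
    then show ?thesis using that by simp
  qed
  have kk: "(\<integral>\<^sup>+p. ennreal (k p y * k p y') \<partial>A) = ennreal (min (exp (- U y)) (exp (- U y')) * gdens I s y y')"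
    if y: "y \<in> RR I" "y' \<in> RR I" for y y'
  proof -
    have [measurable]: "(\<lambda>z. k z y) \<in> borel_measurable A" "(\<lambda>z. k z y') \<in> borel_measurable A"
      using measurable_compose[OF measurable_Pair2' k2, of y] measurable_compose[OF measurable_Pair2' k2, of y'] y by (simp_all add: space_LB)
    have "(\<integral>\<^sup>+p. ennreal (k p y * k p y') \<partial>A) = (\<integral>\<^sup>+t. (\<integral>\<^sup>+x. ennreal (k (t, x) y * k (t, x) y') \<partial>LB I) \<partial>lborel)"
      unfolding A_def by (rule N.nn_integral_fst[symmetric]) (simp add: A_def[symmetric])
    also have "\<dots> = (\<integral>\<^sup>+t. (if 0 < t \<and> t < exp (- U y) \<and> t < exp (- U y') then 1 else 0) * ennreal (gdens I s y y') \<partial>lborel)"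
    proof (rule nn_integral_cong)
      fix t
      show "(\<integral>\<^sup>+x. ennreal (k (t, x) y * k (t, x) y') \<partial>LB I) = (if 0 < t \<and> t < exp (- U y) \<and> t < exp (- U y') then 1 else 0) * ennreal (gdens I s y y')"
      proof (cases "0 < t \<and> t < exp (- U y) \<and> t < exp (- U y')")
        case True
        then show ?thesis using gdens_semigroup[of y y'] by (simp add: k_def s'_def[abs_def])
      next
        case False
        then have z: "k (t, x) y * k (t, x) y' = 0" for x by (auto simp: k_def)
        have "(\<integral>\<^sup>+x. ennreal (k (t, x) y * k (t, x) y') \<partial>LB I) = 0" unfolding z by simp
        then show ?thesis unfolding if_not_P[OF False] by simp
      qed
    qed
    also have "\<dots> = ennreal (min (exp (- U y)) (exp (- U y'))) * ennreal (gdens I s y y')"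
      by (subst nn_integral_multc) (simp_all add: min_int)
    finally show ?thesis by (simp add: ennreal_mult)
  qed
  have k1: "(\<integral>\<^sup>+p. ennreal (k p y) \<partial>A) = ennreal (exp (- U y))" if y: "y \<in> RR I" for y
  proof -
    have [measurable]: "(\<lambda>z. k z y) \<in> borel_measurable A"
      using measurable_compose[OF measurable_Pair2' k2, of y] y by (simp add: space_LB)
    have "(\<integral>\<^sup>+p. ennreal (k p y) \<partial>A) = (\<integral>\<^sup>+t. (\<integral>\<^sup>+x. ennreal (k (t, x) y) \<partial>LB I) \<partial>lborel)"
      unfolding A_def by (rule N.nn_integral_fst[symmetric]) (simp add: A_def[symmetric])
    also have "\<dots> = (\<integral>\<^sup>+t. (if 0 < t \<and> t < exp (- U y) \<and> t < exp (- U y) then 1 else 0) \<partial>lborel)"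
    proof (rule nn_integral_cong)
      fix t
      have "(\<integral>\<^sup>+x. ennreal (gdens I s' x y) \<partial>LB I) = 1" unfolding gdens_sym[of I s' _ y] by (rule G'.nn_integral_gdens)
      then show "(\<integral>\<^sup>+x. ennreal (k (t, x) y) \<partial>LB I) = (if 0 < t \<and> t < exp (- U y) \<and> t < exp (- U y) then 1 else 0)"
        unfolding k_def fst_conv snd_conv by (cases "0 < t \<and> t < exp (- U y)") auto
    qed
    also have "\<dots> = ennreal (exp (- U y))" using min_int[of "exp (- U y)" "exp (- U y)"] by simp
    finally show ?thesis .
  qed
  have F1: "(\<lambda>z. f (snd z)) \<in> borel_measurable (A \<Otimes>\<^sub>M LB I)" by (rule measurable_compose[OF measurable_snd]) measurable
  have "rw_form I U s f = (\<integral>\<^sup>+y. (\<integral>\<^sup>+y'. (\<integral>\<^sup>+p. ennreal ((f y' - f y)\<^sup>2) * ennreal (k p y * k p y') \<partial>A) \<partial>LB I) \<partial>LB I)"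
    unfolding rw_form_def
  proof (intro nn_integral_cong)
    fix y y' assume "y \<in> space (LB I)" "y' \<in> space (LB I)"
    then have yy: "y \<in> RR I" "y' \<in> RR I" by (simp_all add: space_LB)
    have [measurable]: "(\<lambda>z. k z y) \<in> borel_measurable A" "(\<lambda>z. k z y') \<in> borel_measurable A"
      using measurable_compose[OF measurable_Pair2' k2, of y] measurable_compose[OF measurable_Pair2' k2, of y'] yy by (simp_all add: space_LB)
    show "ennreal ((f y' - f y)\<^sup>2) * ennreal (min (exp (- U y)) (exp (- U y')) * gdens I s y y')
      = (\<integral>\<^sup>+p. ennreal ((f y' - f y)\<^sup>2) * ennreal (k p y * k p y') \<partial>A)"
      by (subst nn_integral_cmult) (simp_all add: kk[OF yy])
  qed
  also have "\<dots> = (\<integral>\<^sup>+p. (\<integral>\<^sup>+y. (\<integral>\<^sup>+y'. ennreal ((f y' - f y)\<^sup>2) * ennreal (k p y * k p y') \<partial>LB I) \<partial>LB I) \<partial>A)"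
  proof (rule nn_integral_triple_swap[OF sA N.sigma_finite_measure_axioms])
    have m1: "(\<lambda>q. k (fst q) (fst (snd q))) \<in> borel_measurable (A \<Otimes>\<^sub>M (LB I \<Otimes>\<^sub>M LB I))"
      using measurable_compose[OF measurable_Pair[OF measurable_fst measurable_compose[OF measurable_snd measurable_fst]] k2] by simp
    have m2: "(\<lambda>q. k (fst q) (snd (snd q))) \<in> borel_measurable (A \<Otimes>\<^sub>M (LB I \<Otimes>\<^sub>M LB I))"
      using measurable_compose[OF measurable_Pair[OF measurable_fst measurable_compose[OF measurable_snd measurable_snd]] k2] by simp
    note [measurable] = m1 m2
    show "(\<lambda>q. ennreal ((f (snd (snd q)) - f (fst (snd q)))\<^sup>2) * ennreal (k (fst q) (fst (snd q)) * k (fst q) (snd (snd q)))) \<in> borel_measurable (A \<Otimes>\<^sub>M (LB I \<Otimes>\<^sub>M LB I))"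
      by measurable
  qed
  also have "\<dots> \<le> (\<integral>\<^sup>+p. 2 * (\<integral>\<^sup>+y. ennreal ((f y)\<^sup>2) * ennreal (k p y) \<partial>LB I) \<partial>A)"
  proof (rule nn_integral_mono)
    fix p
    \<comment> \<open>For fixed \<open>p\<close> the double integral is the pairwise square of
      \<open>f\<close> under one measure of mass at most 1, hence at most twice its second moment
      there.\<close>
    let ?M = "density (LB I) (\<lambda>y. ennreal (k p y))"
    have em: "emeasure ?M (space ?M) = (\<integral>\<^sup>+y. ennreal (k p y) \<partial>LB I)" by (simp add: emeasure_density cong: nn_integral_cong)
    interpret M: finite_measure ?M
    proof
      show "emeasure ?M (space ?M) \<noteq> \<infinity>" unfolding em using mass[of p] by (auto simp: top_unique)
    qed
    have "(\<integral>\<^sup>+y. (\<integral>\<^sup>+y'. ennreal ((f y' - f y)\<^sup>2) * ennreal (k p y * k p y') \<partial>LB I) \<partial>LB I)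
      = (\<integral>\<^sup>+y. ennreal (k p y) * (\<integral>\<^sup>+y'. ennreal (k p y') * ennreal ((f y' - f y)\<^sup>2) \<partial>LB I) \<partial>LB I)"
      by (subst nn_integral_cmult[symmetric]) (auto simp: ennreal_mult mult_ac)
    also have "\<dots> = (\<integral>\<^sup>+y. (\<integral>\<^sup>+y'. ennreal ((f y' - f y)\<^sup>2) \<partial>?M) \<partial>?M)"
    proof -
      have "(\<integral>\<^sup>+y'. ennreal ((f y' - f y)\<^sup>2) \<partial>?M) = (\<integral>\<^sup>+y'. ennreal (k p y') * ennreal ((f y' - f y)\<^sup>2) \<partial>LB I)" for y
        by (rule nn_integral_density) measurable
      then show ?thesis by (simp only:) (rule nn_integral_density[symmetric]; measurable)
    qed
    also have "\<dots> \<le> 2 * emeasure ?M (space ?M) * (\<integral>\<^sup>+y. ennreal ((f y)\<^sup>2) \<partial>?M)"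
      by (rule M.nn_integral_pairwise_square_le) simp
    also have "\<dots> \<le> 2 * 1 * (\<integral>\<^sup>+y. ennreal ((f y)\<^sup>2) \<partial>?M)"
      unfolding em by (intro mult_right_mono mult_left_mono mass) auto
    also have "(\<integral>\<^sup>+y. ennreal ((f y)\<^sup>2) \<partial>?M) = (\<integral>\<^sup>+y. ennreal ((f y)\<^sup>2) * ennreal (k p y) \<partial>LB I)"
      by (subst nn_integral_density) (simp_all add: mult.commute)
    finally show "(\<integral>\<^sup>+y. (\<integral>\<^sup>+y'. ennreal ((f y' - f y)\<^sup>2) * ennreal (k p y * k p y') \<partial>LB I) \<partial>LB I) \<le> 2 * (\<integral>\<^sup>+y. ennreal ((f y)\<^sup>2) * ennreal (k p y) \<partial>LB I)"
      by simp
  qed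
  also have "\<dots> = 2 * (\<integral>\<^sup>+p. (\<integral>\<^sup>+y. ennreal ((f y)\<^sup>2) * ennreal (k p y) \<partial>LB I) \<partial>A)"
  proof (rule nn_integral_cmult)
    show "(\<lambda>p. \<integral>\<^sup>+y. ennreal ((f y)\<^sup>2) * ennreal (k p y) \<partial>LB I) \<in> borel_measurable A"
      by (rule N.borel_measurable_nn_integral) (use F1 in \<open>simp add: split_beta'\<close>)
  qed
  also have "(\<integral>\<^sup>+p. (\<integral>\<^sup>+y. ennreal ((f y)\<^sup>2) * ennreal (k p y) \<partial>LB I) \<partial>A) = (\<integral>\<^sup>+y. (\<integral>\<^sup>+p. ennreal ((f y)\<^sup>2) * ennreal (k p y) \<partial>A) \<partial>LB I)"
    by (rule AN.Fubini'[symmetric]) (use F1 in \<open>simp add: split_beta'\<close>)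
  also have "\<dots> = (\<integral>\<^sup>+y. ennreal ((f y)\<^sup>2) * ennreal (exp (- U y)) \<partial>LB I)"
  proof (rule nn_integral_cong)
    fix y assume "y \<in> space (LB I)"
    then have y: "y \<in> RR I" by (simp add: space_LB)
    have [measurable]: "(\<lambda>z. k z y) \<in> borel_measurable A"
      using measurable_compose[OF measurable_Pair2' k2, of y] y by (simp add: space_LB)
    show "(\<integral>\<^sup>+p. ennreal ((f y)\<^sup>2) * ennreal (k p y) \<partial>A) = ennreal ((f y)\<^sup>2) * ennreal (exp (- U y))"
      by (subst nn_integral_cmult) (simp_all add: k1[OF y])
  qed
  finally show ?thesis .
qed

end

text \<open>If the double integral is finite, \<open>f - f x\<close> is square-integrable for almost
  every \<open>x\<close>; one such \<open>x\<close> is enough.\<close>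

lemma (in prob_space) pairs_finite_imp_L2:
  fixes f :: "'a \<Rightarrow> real"
  assumes [measurable]: "f \<in> borel_measurable M" and fin: "pairs M f < \<infinity>"
  shows "f \<in> L2 M"
proof -
  have [measurable]: "(\<lambda>x. \<integral>\<^sup>+y. ennreal ((f y - f x)\<^sup>2) \<partial>M) \<in> borel_measurable M" by measurable
  have "AE x in M. (\<integral>\<^sup>+y. ennreal ((f y - f x)\<^sup>2) \<partial>M) \<noteq> \<infinity>"
    using fin by (intro nn_integral_PInf_AE) (auto simp: pairs_def)
  then have "\<exists>x\<in>space M. (\<integral>\<^sup>+y. ennreal ((f y - f x)\<^sup>2) \<partial>M) \<noteq> \<infinity>"
    by (rule contrapos_pp) (auto dest: AE_E_prob simp: AE_False not_empty)
  then obtain x where "(\<integral>\<^sup>+y. ennreal ((f y - f x)\<^sup>2) \<partial>M) \<noteq> \<infinity>" by blast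
  then have "integrable M (\<lambda>y. (f y - f x)\<^sup>2)"
    by (intro integrableI_nonneg) (auto simp: top.not_eq_extremum)
  then have "(\<lambda>y. f y - f x) \<in> L2 M" by (simp add: L2_def)
  moreover have "(\<lambda>y. f x) \<in> L2 M" by (simp add: L2_def)
  ultimately have "(\<lambda>y. (f y - f x) + f x) \<in> L2 M" by (rule L2_add)
  then show ?thesis by simp
qed

text \<open>The Metropolis form does not see constants, so \<open>f\<close> may be centred;
  positivity then bounds it by twice the variance, which is the form of exact resampling.\<close>

lemma (in smooth_target) rw_form_le_pairs:
  assumes f[measurable]: "f \<in> borel_measurable (LB I)"
  shows "rw_form I U s f \<le> ennreal Z * pairs (gibbs I U) f"
proof (cases "pairs (gibbs I U) f < \<infinity>")
  case False
  then have "pairs (gibbs I U) f = \<top>" by (metis infinity_ennreal_def top.not_eq_extremum)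
  then show ?thesis using Z_pos by (simp add: ennreal_mult_top)
next
  case True
  interpret P: prob_space "gibbs I U" by (rule prob_space_gibbs)
  have [measurable]: "f \<in> borel_measurable (gibbs I U)" by (simp cong: measurable_cong_sets)
  have fL: "f \<in> L2 (gibbs I U)" by (rule P.pairs_finite_imp_L2[OF _ True]) simp
  define m where "m = P.expectation f"
  have i: "integrable (gibbs I U) (\<lambda>x. (f x - m)\<^sup>2)"
    using L2_add[OF fL, of "\<lambda>_. - m"] by (simp add: L2_def)
  have "rw_form I U s f = rw_form I U s (\<lambda>x. f x - m)" by (simp add: rw_form_def)
  also have "\<dots> \<le> 2 * (\<integral>\<^sup>+y. ennreal ((f y - m)\<^sup>2) * ennreal (exp (- U y)) \<partial>LB I)"
    by (rule rw_form_le) measurable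
  also have "(\<integral>\<^sup>+y. ennreal ((f y - m)\<^sup>2) * ennreal (exp (- U y)) \<partial>LB I) = ennreal Z * (\<integral>\<^sup>+y. ennreal ((f y - m)\<^sup>2) \<partial>gibbs I U)"
    using Z_pos by (subst nn_integral_gibbs(2)) (simp_all add: mult.assoc[symmetric] ennreal_mult[symmetric] mult.commute[of _ "ennreal (exp _)"])
  also have "(\<integral>\<^sup>+y. ennreal ((f y - m)\<^sup>2) \<partial>gibbs I U) = ennreal (\<integral>x. (f x - m)\<^sup>2 \<partial>gibbs I U)"
    by (rule nn_integral_eq_integral[OF i]) simp
  also have "2 * (ennreal Z * ennreal (\<integral>x. (f x - m)\<^sup>2 \<partial>gibbs I U)) = ennreal Z * pairs (gibbs I U) f"
    unfolding pairs_def P.nn_integral_pairwise_square[OF fL] m_def[symmetric]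
    by (simp add: ennreal_mult mult_ac)
  finally show ?thesis .
qed

lemma prob_algebra_cong: "sets M = sets N \<Longrightarrow> prob_algebra M = prob_algebra N"
  unfolding prob_algebra_def by (simp cong: subprob_algebra_cong)

lemma reversibleI:
  assumes "\<And>u v. u \<in> borel_measurable M \<Longrightarrow> v \<in> borel_measurable M \<Longrightarrow>
    (\<integral>\<^sup>+x. u x * (\<integral>\<^sup>+y. v y \<partial>K x) \<partial>M) = (\<integral>\<^sup>+x. v x * (\<integral>\<^sup>+y. u y \<partial>K x) \<partial>M)"
  shows "reversible M K"
  unfolding reversible_def by (intro ballI assms)

lemma reversibleD:
  assumes "reversible M K" "u \<in> borel_measurable M" "v \<in> borel_measurable M"
  shows "(\<integral>\<^sup>+x. u x * (\<integral>\<^sup>+y. v y \<partial>K x) \<partial>M) = (\<integral>\<^sup>+x. v x * (\<integral>\<^sup>+y. u y \<partial>K x) \<partial>M)"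
  by (rule assms(1)[unfolded reversible_def, THEN bspec, THEN bspec, OF assms(2,3)])

section \<open>Mixtures of coordinate updates\<close>

lemma
  assumes M: "sets \<mu>1 = sets S" "sets \<mu>2 = sets S" "sets \<mu>3 = sets S"
  shows sets_mixture3: "sets (mixture3 S p1 p2 p3 \<mu>1 \<mu>2 \<mu>3) = sets S"
    and space_mixture3: "space (mixture3 S p1 p2 p3 \<mu>1 \<mu>2 \<mu>3) = space S"
    and emeasure_mixture3: "A \<in> sets S \<Longrightarrow> emeasure (mixture3 S p1 p2 p3 \<mu>1 \<mu>2 \<mu>3) A
       = ennreal p1 * emeasure \<mu>1 A + ennreal p2 * emeasure \<mu>2 A + ennreal p3 * emeasure \<mu>3 A"
proof -
  let ?f = "\<lambda>A. ennreal p1 * emeasure \<mu>1 A + ennreal p2 * emeasure \<mu>2 A + ennreal p3 * emeasure \<mu>3 A"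
  show s: "sets (mixture3 S p1 p2 p3 \<mu>1 \<mu>2 \<mu>3) = sets S" and "space (mixture3 S p1 p2 p3 \<mu>1 \<mu>2 \<mu>3) = space S"
    unfolding mixture3_def by simp_all
  assume A: "A \<in> sets S"
  show "emeasure (mixture3 S p1 p2 p3 \<mu>1 \<mu>2 \<mu>3) A = ?f A"
  proof (rule emeasure_measure_of[OF mixture3_def])
    show "sets S \<subseteq> Pow (space S)" by (rule sets.space_closed)
    show "A \<in> sets (mixture3 S p1 p2 p3 \<mu>1 \<mu>2 \<mu>3)" using A s by simp
    show "positive (sets (mixture3 S p1 p2 p3 \<mu>1 \<mu>2 \<mu>3)) ?f" by (simp add: positive_def)
    show "countably_additive (sets (mixture3 S p1 p2 p3 \<mu>1 \<mu>2 \<mu>3)) ?f"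
    proof (rule countably_additiveI)
      fix B :: "nat \<Rightarrow> 'a set" assume B: "range B \<subseteq> sets (mixture3 S p1 p2 p3 \<mu>1 \<mu>2 \<mu>3)" and d: "disjoint_family B"
      have e: "(\<Sum>i. emeasure \<mu> (B i)) = emeasure \<mu> (\<Union>i. B i)" if "sets \<mu> = sets S" for \<mu>
        using B d that s by (intro suminf_emeasure) auto
      show "(\<Sum>i. ?f (B i)) = ?f (\<Union>i. B i)"
        by (simp add: suminf_add[symmetric] ennreal_suminf_cmult e M)
    qed
  qed
qed

lemma nn_integral_mixture3:
  assumes M: "sets \<mu>1 = sets S" "sets \<mu>2 = sets S" "sets \<mu>3 = sets S"
    and F: "F \<in> borel_measurable S"
  shows "(\<integral>\<^sup>+x. F x \<partial>mixture3 S p1 p2 p3 \<mu>1 \<mu>2 \<mu>3)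
    = ennreal p1 * (\<integral>\<^sup>+x. F x \<partial>\<mu>1) + ennreal p2 * (\<integral>\<^sup>+x. F x \<partial>\<mu>2) + ennreal p3 * (\<integral>\<^sup>+x. F x \<partial>\<mu>3)"
  using F
proof (induction rule: borel_measurable_induct)
  note sp = sets_eq_imp_space_eq[OF M(1)] sets_eq_imp_space_eq[OF M(2)] sets_eq_imp_space_eq[OF M(3)] space_mixture3[OF M]
  note mc = measurable_cong_sets[OF M(1) refl] measurable_cong_sets[OF M(2) refl] measurable_cong_sets[OF M(3) refl] measurable_cong_sets[OF sets_mixture3[OF M] refl]
  {
    case (cong f g)
    have "(\<integral>\<^sup>+x. f x \<partial>\<mu>) = (\<integral>\<^sup>+x. g x \<partial>\<mu>)" if "space \<mu> = space S" for \<mu>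
      using cong(3) that by (intro nn_integral_cong) simp
    with cong(4) show ?case by (simp add: sp)
  next
    case (set A)
    then show ?case by (simp add: emeasure_mixture3[OF M] sets_mixture3[OF M] M)
  next
    case (mult u c)
    then show ?case by (simp add: nn_integral_cmult mc distrib_left mult_ac)
  next
    case (add u v)
    then show ?case by (simp add: nn_integral_add mc distrib_left add_ac)
  next
    case (seq U)
    have i: "(\<integral>\<^sup>+x. (SUP i. U i x) \<partial>\<mu>) = (SUP i. \<integral>\<^sup>+x. U i x \<partial>\<mu>)" if "sets \<mu> = sets S" for \<mu>
      using seq by (intro nn_integral_monotone_convergence_SUP) (simp_all add: measurable_cong_sets[OF that refl])
    have inc: "incseq (\<lambda>i. ennreal c * (\<integral>\<^sup>+x. U i x \<partial>\<mu>))" for c \<mu>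
      using seq(3) by (auto simp: incseq_def le_fun_def intro!: mult_left_mono nn_integral_mono)
    have "(\<integral>\<^sup>+x. (SUP i. U i) x \<partial>mixture3 S p1 p2 p3 \<mu>1 \<mu>2 \<mu>3)
      = (SUP i. ennreal p1 * (\<integral>\<^sup>+x. U i x \<partial>\<mu>1) + ennreal p2 * (\<integral>\<^sup>+x. U i x \<partial>\<mu>2) + ennreal p3 * (\<integral>\<^sup>+x. U i x \<partial>\<mu>3))"
      unfolding SUP_apply by (subst i[OF sets_mixture3[OF M]]) (simp add: seq)
    also have "\<dots> = ennreal p1 * (\<integral>\<^sup>+x. (SUP i. U i) x \<partial>\<mu>1) + ennreal p2 * (\<integral>\<^sup>+x. (SUP i. U i) x \<partial>\<mu>2) + ennreal p3 * (\<integral>\<^sup>+x. (SUP i. U i) x \<partial>\<mu>3)"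
    proof -
      let ?I = "\<lambda>c \<mu> i. ennreal c * (\<integral>\<^sup>+x. U i x \<partial>\<mu>)"
      have "(SUP i. ?I p1 \<mu>1 i + ?I p2 \<mu>2 i + ?I p3 \<mu>3 i) = (SUP i. ?I p1 \<mu>1 i + ?I p2 \<mu>2 i) + (SUP i. ?I p3 \<mu>3 i)"
        using inc[of p1 \<mu>1] inc[of p2 \<mu>2] inc[of p3 \<mu>3] by (intro ennreal_SUP_add) (auto simp: incseq_def add_mono)
      also have "(SUP i. ?I p1 \<mu>1 i + ?I p2 \<mu>2 i) = (SUP i. ?I p1 \<mu>1 i) + (SUP i. ?I p2 \<mu>2 i)"
        by (intro ennreal_SUP_add inc)
      finally show ?thesis
        unfolding SUP_apply i[OF M(1)] i[OF M(2)] i[OF M(3)] SUP_mult_left_ennreal .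
    qed
    finally show ?case .
  }
qed

text \<open>Reversibility, positivity and Dirichlet forms are additive in the kernel, so the random
  scan inherits them from its components.\<close>

locale three_kernels = prob_space \<pi> for \<pi> :: "'a measure" +
  fixes S :: "'a measure" and K1 K2 K3 :: "'a \<Rightarrow> 'a measure" and p1 p2 p3 :: real
  assumes sets_\<pi>: "sets \<pi> = sets S"
    and K: "K1 \<in> S \<rightarrow>\<^sub>M prob_algebra S" "K2 \<in> S \<rightarrow>\<^sub>M prob_algebra S" "K3 \<in> S \<rightarrow>\<^sub>M prob_algebra S"
    and rev: "reversible \<pi> K1" "reversible \<pi> K2" "reversible \<pi> K3"
    and pos: "\<And>f. f \<in> borel_measurable S \<Longrightarrow> dform \<pi> K1 f \<le> 2 * (\<integral>\<^sup>+x. ennreal ((f x)\<^sup>2) \<partial>\<pi>)"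
       "\<And>f. f \<in> borel_measurable S \<Longrightarrow> dform \<pi> K2 f \<le> 2 * (\<integral>\<^sup>+x. ennreal ((f x)\<^sup>2) \<partial>\<pi>)"
       "\<And>f. f \<in> borel_measurable S \<Longrightarrow> dform \<pi> K3 f \<le> 2 * (\<integral>\<^sup>+x. ennreal ((f x)\<^sup>2) \<partial>\<pi>)"
    and p: "0 \<le> p1" "0 \<le> p2" "0 \<le> p3" "p1 + p2 + p3 = 1"
begin

definition K :: "'a \<Rightarrow> 'a measure" where "K s = mixture3 S p1 p2 p3 (K1 s) (K2 s) (K3 s)"

lemma space_\<pi>: "space \<pi> = space S" by (rule sets_eq_imp_space_eq[OF sets_\<pi>])

lemma sets_K:
  assumes "s \<in> space S" shows "sets (K1 s) = sets S" "sets (K2 s) = sets S" "sets (K3 s) = sets S"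
  using K[THEN measurable_space, OF assms] by (auto simp: space_prob_algebra)

lemma p_ennreal: "ennreal p1 + ennreal p2 + ennreal p3 = 1"
  using p by (simp add: ennreal_plus[symmetric] del: ennreal_plus)

lemma K_kernel: "K \<in> S \<rightarrow>\<^sub>M prob_algebra S"
proof -
  note kk = K[THEN measurable_prob_algebraD]
  have pr: "prob_space (K s)" if s: "s \<in> space S" for s
  proof (rule prob_spaceI)
    have "emeasure (Ki s) (space S) = 1" if "Ki \<in> S \<rightarrow>\<^sub>M prob_algebra S" for Ki
      using measurable_space[OF that s] prob_space.emeasure_space_1[of "Ki s"] sets_eq_imp_space_eq[of "Ki s" S]
      by (auto simp: space_prob_algebra)
    then show "emeasure (K s) (space (K s)) = 1"
      using K p_ennreal unfolding K_def space_mixture3[OF sets_K[OF s]] by (simp add: emeasure_mixture3[OF sets_K[OF s]])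
  qed
  show ?thesis
  proof (rule measurable_prob_algebraI[OF pr])
    show "K \<in> S \<rightarrow>\<^sub>M subprob_algebra S"
    proof (rule measurable_subprob_algebra)
      show "subprob_space (K s)" if "s \<in> space S" for s using pr[OF that] by (rule prob_space_imp_subprob_space)
      show "sets (K s) = sets S" if "s \<in> space S" for s unfolding K_def by (rule sets_mixture3[OF sets_K[OF that]])
      fix A assume A[measurable]: "A \<in> sets S"
      have [measurable]: "(\<lambda>s. emeasure (K1 s) A) \<in> borel_measurable S" "(\<lambda>s. emeasure (K2 s) A) \<in> borel_measurable S" "(\<lambda>s. emeasure (K3 s) A) \<in> borel_measurable S"
        using kk by (auto intro!: measurable_emeasure_subprob_algebra[THEN measurable_compose[rotated]] A)
      have "(\<lambda>s. ennreal p1 * emeasure (K1 s) A + ennreal p2 * emeasure (K2 s) A + ennreal p3 * emeasure (K3 s) A) \<in> borel_measurable S"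
        by measurable
      then show "(\<lambda>s. emeasure (K s) A) \<in> borel_measurable S"
        by (rule measurable_cong[THEN iffD1, rotated]) (simp add: K_def emeasure_mixture3[OF sets_K] A)
    qed
  qed
qed

lemma nn_integral_K:
  assumes "s \<in> space S" "F \<in> borel_measurable S"
  shows "(\<integral>\<^sup>+y. F y \<partial>K s) = ennreal p1 * (\<integral>\<^sup>+y. F y \<partial>K1 s) + ennreal p2 * (\<integral>\<^sup>+y. F y \<partial>K2 s) + ennreal p3 * (\<integral>\<^sup>+y. F y \<partial>K3 s)"
  unfolding K_def by (rule nn_integral_mixture3[OF sets_K[OF assms(1)] assms(2)])

lemma nn_integral_kernel_measurable:
  assumes k: "k \<in> S \<rightarrow>\<^sub>M prob_algebra S" and F[measurable]: "(\<lambda>z. F (fst z) (snd z)) \<in> borel_measurable (S \<Otimes>\<^sub>M S)"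
  shows "(\<lambda>x. \<integral>\<^sup>+y. F x y \<partial>k x) \<in> borel_measurable S"
  by (rule nn_integral_measurable_subprob_algebra2[OF _ measurable_prob_algebraD[OF k]]) (use F in \<open>simp add: split_beta'\<close>)

lemma split_form:
  assumes [measurable]: "(\<lambda>z. F (fst z) (snd z)) \<in> borel_measurable (S \<Otimes>\<^sub>M S)"
  shows "(\<integral>\<^sup>+x. (\<integral>\<^sup>+y. F x y \<partial>K x) \<partial>\<pi>) = ennreal p1 * (\<integral>\<^sup>+x. (\<integral>\<^sup>+y. F x y \<partial>K1 x) \<partial>\<pi>)
    + ennreal p2 * (\<integral>\<^sup>+x. (\<integral>\<^sup>+y. F x y \<partial>K2 x) \<partial>\<pi>) + ennreal p3 * (\<integral>\<^sup>+x. (\<integral>\<^sup>+y. F x y \<partial>K3 x) \<partial>\<pi>)"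
proof -
  have m[measurable]: "(\<lambda>x. \<integral>\<^sup>+y. F x y \<partial>K1 x) \<in> borel_measurable \<pi>" "(\<lambda>x. \<integral>\<^sup>+y. F x y \<partial>K2 x) \<in> borel_measurable \<pi>"
    "(\<lambda>x. \<integral>\<^sup>+y. F x y \<partial>K3 x) \<in> borel_measurable \<pi>"
    unfolding measurable_cong_sets[OF sets_\<pi> refl] by (intro nn_integral_kernel_measurable K assms)+
  have "(\<integral>\<^sup>+x. (\<integral>\<^sup>+y. F x y \<partial>K x) \<partial>\<pi>) = (\<integral>\<^sup>+x. ennreal p1 * (\<integral>\<^sup>+y. F x y \<partial>K1 x) + ennreal p2 * (\<integral>\<^sup>+y. F x y \<partial>K2 x) + ennreal p3 * (\<integral>\<^sup>+y. F x y \<partial>K3 x) \<partial>\<pi>)"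
  proof (rule nn_integral_cong)
    fix x assume "x \<in> space \<pi>"
    then have x: "x \<in> space S" by (simp add: space_\<pi>)
    have "F x \<in> borel_measurable S" using measurable_compose[OF measurable_Pair1'[OF x] assms] by simp
    then show "(\<integral>\<^sup>+y. F x y \<partial>K x) = ennreal p1 * (\<integral>\<^sup>+y. F x y \<partial>K1 x) + ennreal p2 * (\<integral>\<^sup>+y. F x y \<partial>K2 x) + ennreal p3 * (\<integral>\<^sup>+y. F x y \<partial>K3 x)"
      by (rule nn_integral_K[OF x])
  qed
  also have "\<dots> = ennreal p1 * (\<integral>\<^sup>+x. (\<integral>\<^sup>+y. F x y \<partial>K1 x) \<partial>\<pi>)
    + ennreal p2 * (\<integral>\<^sup>+x. (\<integral>\<^sup>+y. F x y \<partial>K2 x) \<partial>\<pi>) + ennreal p3 * (\<integral>\<^sup>+x. (\<integral>\<^sup>+y. F x y \<partial>K3 x) \<partial>\<pi>)"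
    by (simp add: nn_integral_add nn_integral_cmult)
  finally show ?thesis .
qed

lemma dform_K:
  assumes [measurable]: "f \<in> borel_measurable S"
  shows "dform \<pi> K f = ennreal p1 * dform \<pi> K1 f + ennreal p2 * dform \<pi> K2 f + ennreal p3 * dform \<pi> K3 f"
  unfolding dform_def by (rule split_form) measurable

lemma positive_kernel_K: "positive_kernel \<pi> K"
proof
  show "K \<in> \<pi> \<rightarrow>\<^sub>M prob_algebra \<pi>"
    using K_kernel unfolding prob_algebra_cong[OF sets_\<pi>] measurable_cong_sets[OF sets_\<pi> refl] .
  show "reversible \<pi> K"
  proof (rule reversibleI)
    fix u v :: "'a \<Rightarrow> ennreal" assume uv: "u \<in> borel_measurable \<pi>" "v \<in> borel_measurable \<pi>"
    then have m[measurable]: "u \<in> borel_measurable S" "v \<in> borel_measurable S" by (simp_all add: measurable_cong_sets[OF sets_\<pi> refl])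
    have e: "(\<integral>\<^sup>+x. a x * (\<integral>\<^sup>+y. b y \<partial>k x) \<partial>\<pi>) = (\<integral>\<^sup>+x. (\<integral>\<^sup>+y. a x * b y \<partial>k x) \<partial>\<pi>)"
      if [measurable]: "b \<in> borel_measurable S" and k: "k \<in> S \<rightarrow>\<^sub>M prob_algebra S" for a b :: "'a \<Rightarrow> ennreal" and k
    proof (rule nn_integral_cong)
      fix x assume "x \<in> space \<pi>"
      then have "sets (k x) = sets S" using measurable_space[OF k, of x] by (simp add: space_prob_algebra space_\<pi>)
      then have "b \<in> borel_measurable (k x)" by (simp add: measurable_cong_sets[of "k x" S])
      then show "a x * (\<integral>\<^sup>+y. b y \<partial>k x) = (\<integral>\<^sup>+y. a x * b y \<partial>k x)" by (rule nn_integral_cmult[symmetric])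
    qed
    have s: "(\<integral>\<^sup>+x. a x * (\<integral>\<^sup>+y. b y \<partial>K x) \<partial>\<pi>) = ennreal p1 * (\<integral>\<^sup>+x. a x * (\<integral>\<^sup>+y. b y \<partial>K1 x) \<partial>\<pi>)
      + ennreal p2 * (\<integral>\<^sup>+x. a x * (\<integral>\<^sup>+y. b y \<partial>K2 x) \<partial>\<pi>) + ennreal p3 * (\<integral>\<^sup>+x. a x * (\<integral>\<^sup>+y. b y \<partial>K3 x) \<partial>\<pi>)"
      if [measurable]: "a \<in> borel_measurable S" "b \<in> borel_measurable S" for a b :: "'a \<Rightarrow> ennreal"
      unfolding e[OF that(2) K_kernel] e[OF that(2) K(1)] e[OF that(2) K(2)] e[OF that(2) K(3)]
      by (rule split_form) measurable
    show "(\<integral>\<^sup>+x. u x * (\<integral>\<^sup>+y. v y \<partial>K x) \<partial>\<pi>) = (\<integral>\<^sup>+x. v x * (\<integral>\<^sup>+y. u y \<partial>K x) \<partial>\<pi>)"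
      unfolding s[OF m] s[OF m(2,1)] reversibleD[OF rev(1) uv] reversibleD[OF rev(2) uv] reversibleD[OF rev(3) uv] ..
  qed
  fix f :: "'a \<Rightarrow> real" assume "f \<in> borel_measurable \<pi>"
  then have f: "f \<in> borel_measurable S" by (simp add: measurable_cong_sets[OF sets_\<pi> refl])
  let ?X = "2 * (\<integral>\<^sup>+x. ennreal ((f x)\<^sup>2) \<partial>\<pi>)"
  have "dform \<pi> K f \<le> ennreal p1 * ?X + ennreal p2 * ?X + ennreal p3 * ?X"
    unfolding dform_K[OF f] by (intro add_mono mult_left_mono pos f) auto
  also have "\<dots> = ?X" unfolding distrib_right[symmetric] p_ennreal by simp
  finally show "dform \<pi> K f \<le> ?X" .
qed

end

text \<open>A state is \<open>u r a\<close>, where \<open>a\<close> is the coordinate being updated, and \<open>upd s a\<close> replaces that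
  coordinate of \<open>s\<close>.\<close>

locale coordinate_update =
  fixes S :: "'s measure" and A :: "'a measure" and R :: "'r measure"
    and u :: "'r \<Rightarrow> 'a \<Rightarrow> 's" and upd :: "'s \<Rightarrow> 'a \<Rightarrow> 's" and W :: "'s \<Rightarrow> real"
  assumes u: "\<And>r. r \<in> space R \<Longrightarrow> u r \<in> A \<rightarrow>\<^sub>M S"
    and upd: "(\<lambda>z. upd (fst z) (snd z)) \<in> S \<Otimes>\<^sub>M A \<rightarrow>\<^sub>M S"
    and upd_u: "\<And>r a a'. r \<in> space R \<Longrightarrow> a \<in> space A \<Longrightarrow> a' \<in> space A \<Longrightarrow> upd (u r a) a' = u r a'"
    and Fub: "\<And>F. F \<in> borel_measurable S \<Longrightarrow> (\<integral>\<^sup>+s. F s \<partial>S) = (\<integral>\<^sup>+r. (\<integral>\<^sup>+a. F (u r a) \<partial>A) \<partial>R)"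
    and W[measurable]: "W \<in> borel_measurable S"
begin

definition \<pi> :: "'s measure" where "\<pi> = density S (\<lambda>s. ennreal (W s))"

definition lifted :: "('s \<Rightarrow> 'a measure) \<Rightarrow> 's \<Rightarrow> 's measure" where
  "lifted k s = distr (k s) S (upd s)"

lemma upd_fst: "s \<in> space S \<Longrightarrow> upd s \<in> A \<rightarrow>\<^sub>M S"
  using measurable_compose[OF measurable_Pair1' upd, of s] by simp

lemma lifted_kernel:
  assumes k: "k \<in> S \<rightarrow>\<^sub>M prob_algebra A" shows "lifted k \<in> S \<rightarrow>\<^sub>M prob_algebra S"
proof (rule measurable_prob_algebraI)
  fix s assume s: "s \<in> space S"
  then have "prob_space (k s)" "sets (k s) = sets A" using measurable_space[OF k s] by (auto simp: space_prob_algebra)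
  then show "prob_space (lifted k s)"
    unfolding lifted_def using upd_fst[OF s] by (intro prob_space.prob_space_distr) (simp_all add: measurable_cong_sets[of "k s" A])
next
  show "lifted k \<in> S \<rightarrow>\<^sub>M subprob_algebra S"
    unfolding lifted_def[abs_def]
    by (rule measurable_distr2[OF _ measurable_prob_algebraD[OF k]]) (use upd in \<open>simp add: split_beta'\<close>)
qed

lemma nn_integral_lifted:
  assumes k: "k \<in> S \<rightarrow>\<^sub>M prob_algebra A" and s: "s \<in> space S" and F: "F \<in> borel_measurable S"
  shows "(\<integral>\<^sup>+y. F y \<partial>lifted k s) = (\<integral>\<^sup>+a. F (upd s a) \<partial>k s)"
proof -
  have "sets (k s) = sets A" using measurable_space[OF k s] by (auto simp: space_prob_algebra)
  then show ?thesis
    unfolding lifted_def using upd_fst[OF s] F by (subst nn_integral_distr) (simp_all add: measurable_cong_sets[of "k s" A])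
qed

lemma nn_integral_\<pi>:
  assumes F[measurable]: "F \<in> borel_measurable S"
  shows "(\<integral>\<^sup>+s. F s \<partial>\<pi>) = (\<integral>\<^sup>+r. (\<integral>\<^sup>+a. ennreal (W (u r a)) * F (u r a) \<partial>A) \<partial>R)"
  unfolding \<pi>_def by (subst nn_integral_density) (simp_all add: Fub)

text \<open>A lifted kernel never leaves its fibre, so every form of it is an integral of forms on
  the fibres.\<close>

lemma form_lifted:
  assumes k: "k \<in> S \<rightarrow>\<^sub>M prob_algebra A" and F: "(\<lambda>z. F (fst z) (snd z)) \<in> borel_measurable (S \<Otimes>\<^sub>M S)"
  shows "(\<integral>\<^sup>+x. (\<integral>\<^sup>+y. F x y \<partial>lifted k x) \<partial>\<pi>)
    = (\<integral>\<^sup>+r. (\<integral>\<^sup>+a. ennreal (W (u r a)) * (\<integral>\<^sup>+a'. F (u r a) (u r a') \<partial>k (u r a)) \<partial>A) \<partial>R)"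
proof -
  have "(\<lambda>x. \<integral>\<^sup>+y. F x y \<partial>lifted k x) \<in> borel_measurable S"
    by (rule nn_integral_measurable_subprob_algebra2[OF _ measurable_prob_algebraD[OF lifted_kernel[OF k]]])
       (use F in \<open>simp add: split_beta'\<close>)
  then have "(\<integral>\<^sup>+x. (\<integral>\<^sup>+y. F x y \<partial>lifted k x) \<partial>\<pi>) = (\<integral>\<^sup>+r. (\<integral>\<^sup>+a. ennreal (W (u r a)) * (\<integral>\<^sup>+y. F (u r a) y \<partial>lifted k (u r a)) \<partial>A) \<partial>R)"
    by (rule nn_integral_\<pi>)
  also have "\<dots> = (\<integral>\<^sup>+r. (\<integral>\<^sup>+a. ennreal (W (u r a)) * (\<integral>\<^sup>+a'. F (u r a) (u r a') \<partial>k (u r a)) \<partial>A) \<partial>R)"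
  proof (intro nn_integral_cong arg_cong2[where f="(*)"] refl)
    fix r a assume r: "r \<in> space R" and a: "a \<in> space A"
    have s: "u r a \<in> space S" using measurable_space[OF u[OF r] a] .
    have sp: "space (k (u r a)) = space A" using measurable_space[OF k s] by (auto simp: space_prob_algebra dest: sets_eq_imp_space_eq)
    have "F (u r a) \<in> borel_measurable S" using measurable_compose[OF measurable_Pair1'[OF s] F] by simp
    then have "(\<integral>\<^sup>+y. F (u r a) y \<partial>lifted k (u r a)) = (\<integral>\<^sup>+a'. F (u r a) (upd (u r a) a') \<partial>k (u r a))"
      by (rule nn_integral_lifted[OF k s])
    also have "\<dots> = (\<integral>\<^sup>+a'. F (u r a) (u r a') \<partial>k (u r a))"
      by (intro nn_integral_cong) (simp add: sp upd_u[OF r a])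
    finally show "(\<integral>\<^sup>+y. F (u r a) y \<partial>lifted k (u r a)) = (\<integral>\<^sup>+a'. F (u r a) (u r a') \<partial>k (u r a))" .
  qed
  finally show ?thesis .
qed

lemma dform_lifted:
  assumes k: "k \<in> S \<rightarrow>\<^sub>M prob_algebra A" and f[measurable]: "f \<in> borel_measurable S"
  shows "dform \<pi> (lifted k) f
    = (\<integral>\<^sup>+r. (\<integral>\<^sup>+a. ennreal (W (u r a)) * (\<integral>\<^sup>+a'. ennreal ((f (u r a') - f (u r a))\<^sup>2) \<partial>k (u r a)) \<partial>A) \<partial>R)"
  unfolding dform_def by (rule form_lifted[OF k]) measurable

lemma reversible_lifted:
  assumes k: "k \<in> S \<rightarrow>\<^sub>M prob_algebra A"
    and rev: "\<And>r g h. r \<in> space R \<Longrightarrow> g \<in> borel_measurable A \<Longrightarrow> h \<in> borel_measurable A \<Longrightarrow>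
      (\<integral>\<^sup>+a. ennreal (W (u r a)) * (g a * (\<integral>\<^sup>+a'. h a' \<partial>k (u r a))) \<partial>A) = (\<integral>\<^sup>+a. ennreal (W (u r a)) * (h a * (\<integral>\<^sup>+a'. g a' \<partial>k (u r a))) \<partial>A)"
  shows "reversible \<pi> (lifted k)"
proof (rule reversibleI)
  fix g h :: "'s \<Rightarrow> ennreal" assume "g \<in> borel_measurable \<pi>" "h \<in> borel_measurable \<pi>"
  then have [measurable]: "g \<in> borel_measurable S" "h \<in> borel_measurable S" by (simp_all add: \<pi>_def)
  have e: "(\<integral>\<^sup>+x. g x * (\<integral>\<^sup>+y. h y \<partial>lifted k x) \<partial>\<pi>)
     = (\<integral>\<^sup>+r. (\<integral>\<^sup>+a. ennreal (W (u r a)) * (g (u r a) * (\<integral>\<^sup>+a'. h (u r a') \<partial>k (u r a))) \<partial>A) \<partial>R)"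
    if [measurable]: "g \<in> borel_measurable S" "h \<in> borel_measurable S" for g h :: "'s \<Rightarrow> ennreal"
  proof -
    have "(\<integral>\<^sup>+x. g x * (\<integral>\<^sup>+y. h y \<partial>lifted k x) \<partial>\<pi>) = (\<integral>\<^sup>+x. (\<integral>\<^sup>+y. g x * h y \<partial>lifted k x) \<partial>\<pi>)"
      by (intro nn_integral_cong nn_integral_cmult[symmetric]) (simp add: lifted_def)
    also have "\<dots> = (\<integral>\<^sup>+r. (\<integral>\<^sup>+a. ennreal (W (u r a)) * (\<integral>\<^sup>+a'. g (u r a) * h (u r a') \<partial>k (u r a)) \<partial>A) \<partial>R)"
      by (rule form_lifted[OF k]) measurable
    also have "\<dots> = (\<integral>\<^sup>+r. (\<integral>\<^sup>+a. ennreal (W (u r a)) * (g (u r a) * (\<integral>\<^sup>+a'. h (u r a') \<partial>k (u r a))) \<partial>A) \<partial>R)"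
    proof (intro nn_integral_cong arg_cong2[where f="(*)"] refl nn_integral_cmult)
      fix r a assume r: "r \<in> space R" and a: "a \<in> space A"
      have "sets (k (u r a)) = sets A" using measurable_space[OF k measurable_space[OF u[OF r] a]] by (auto simp: space_prob_algebra)
      then show "(\<lambda>a'. h (u r a')) \<in> borel_measurable (k (u r a))"
        using u[OF r] by (simp add: measurable_cong_sets[of "k (u r a)" A])
    qed
    finally show ?thesis .
  qed
  show "(\<integral>\<^sup>+x. g x * (\<integral>\<^sup>+y. h y \<partial>lifted k x) \<partial>\<pi>) = (\<integral>\<^sup>+x. h x * (\<integral>\<^sup>+y. g y \<partial>lifted k x) \<partial>\<pi>)"
    by (subst (1 2) e) (simp_all, rule nn_integral_cong, rule rev, auto intro!: measurable_compose[OF u])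
qed

lemma dform_lifted_le:
  assumes k: "k \<in> S \<rightarrow>\<^sub>M prob_algebra A" and f[measurable]: "f \<in> borel_measurable S"
    and pos: "\<And>r g. r \<in> space R \<Longrightarrow> g \<in> borel_measurable A \<Longrightarrow>
      (\<integral>\<^sup>+a. ennreal (W (u r a)) * (\<integral>\<^sup>+a'. ennreal ((g a' - g a)\<^sup>2) \<partial>k (u r a)) \<partial>A) \<le> 2 * (\<integral>\<^sup>+a. ennreal (W (u r a)) * ennreal ((g a)\<^sup>2) \<partial>A)"
    and Rm: "(\<lambda>r. \<integral>\<^sup>+a. ennreal (W (u r a)) * ennreal ((f (u r a))\<^sup>2) \<partial>A) \<in> borel_measurable R"
  shows "dform \<pi> (lifted k) f \<le> 2 * (\<integral>\<^sup>+x. ennreal ((f x)\<^sup>2) \<partial>\<pi>)"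
proof -
  have "dform \<pi> (lifted k) f \<le> (\<integral>\<^sup>+r. 2 * (\<integral>\<^sup>+a. ennreal (W (u r a)) * ennreal ((f (u r a))\<^sup>2) \<partial>A) \<partial>R)"
    unfolding dform_lifted[OF k f] by (intro nn_integral_mono pos) (auto intro!: measurable_compose[OF u])
  also have "\<dots> = 2 * (\<integral>\<^sup>+r. (\<integral>\<^sup>+a. ennreal (W (u r a)) * ennreal ((f (u r a))\<^sup>2) \<partial>A) \<partial>R)"
    by (rule nn_integral_cmult[OF Rm])
  also have "\<dots> = 2 * (\<integral>\<^sup>+x. ennreal ((f x)\<^sup>2) \<partial>\<pi>)" by (subst nn_integral_\<pi>) simp_all
  finally show ?thesis .
qed

end

section \<open>Twice continuously differentiable log-likelihoods\<close>

lemma tendsto_fun_componentwise: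
  fixes f :: "'b \<Rightarrow> 'a \<Rightarrow> 'c::topological_space"
  assumes "\<And>i. ((\<lambda>c. f c i) \<longlongrightarrow> l i) F" shows "(f \<longlongrightarrow> l) F"
proof -
  have "limitin (product_topology (\<lambda>i. euclidean) UNIV) f l F"
    unfolding limitin_componentwise using assms by (auto simp: limitin_canonical_iff)
  then show ?thesis by (simp add: euclidean_product_topology limitin_canonical_iff)
qed

lemma C1_on_RdD:
  assumes "C1_on_Rd d g" "i < d"
  shows "x \<in> Rd d \<Longrightarrow> has_partial i g x" "continuous_on (Rd d) (partial i g)" "continuous_on (Rd d) g"
  using assms by (auto simp: C1_on_Rd_def)

lemma has_partial_DERIV:
  assumes "\<And>t. has_partial i g (x(i := t))"
  shows "DERIV (\<lambda>t. g (x(i := t))) t :> partial i g (x(i := t))"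
  using assms[of t] unfolding has_partial_def partial_def
  by (simp add: DERIV_deriv_iff_real_differentiable)

text \<open>The line \<open>x + t * h\<close>, with entries from \<open>d\<close> on held at
  \<open>undefined\<close> so that it stays in \<open>Rd d\<close>.\<close>

definition shift :: "nat \<Rightarrow> (nat \<Rightarrow> real) \<Rightarrow> (nat \<Rightarrow> real) \<Rightarrow> real \<Rightarrow> nat \<Rightarrow> real" where
  "shift d x h t = (\<lambda>j. if j < d then x j + t * h j else undefined)"

lemma shift_in_Rd[simp]: "shift d x h t \<in> Rd d" by (auto simp: shift_def Rd_def PiE_iff extensional_def)

lemma shift_0: "x \<in> Rd d \<Longrightarrow> shift d x h 0 = x" by (auto simp: shift_def Rd_def PiE_iff extensional_def)

lemma shift_shift: "shift d (shift d x h t) h e = shift d x h (t + e)" by (auto simp: shift_def algebra_simps)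

text \<open>Telescoping over the coordinates reduces the increment to one-dimensional ones, to which the mean
  value theorem applies.\<close>

lemma C1_increment:
  assumes C1: "C1_on_Rd d g" and x: "x \<in> Rd d"
  shows "\<exists>\<xi>. (\<forall>k<d. \<xi> k \<in> Rd d \<and> (\<forall>i<d. \<bar>\<xi> k i - x i\<bar> \<le> \<bar>e * h i\<bar>)) \<and>
     g (shift d x h e) - g x = (\<Sum>k<d. e * h k * partial k g (\<xi> k))"
proof -
  \<comment> \<open>The corner points of a path that moves one coordinate at a time.\<close>
  define p where "p k = (\<lambda>j. if j < d then (if j < k then x j + e * h j else x j) else undefined)" for k
  have p_Rd: "p k \<in> Rd d" for k by (auto simp: p_def Rd_def PiE_iff extensional_def)
  have p0: "p 0 = x" using x by (auto simp: p_def Rd_def PiE_iff extensional_def)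
  have pd: "p d = shift d x h e" by (auto simp: p_def shift_def)
  have pS: "p (Suc k) = (p k)(k := x k + e * h k)" and pk: "p k = (p k)(k := x k)" if "k < d" for k
    using that by (auto simp: p_def fun_eq_iff)
  have step: "\<exists>\<xi>. \<xi> \<in> Rd d \<and> (\<forall>i<d. \<bar>\<xi> i - x i\<bar> \<le> \<bar>e * h i\<bar>) \<and> g (p (Suc k)) - g (p k) = e * h k * partial k g \<xi>" if k: "k < d" for k
  proof -
    have upd: "(p k)(k := t) \<in> Rd d" for t using p_Rd[of k] k by (auto simp: Rd_def PiE_iff extensional_def)
    have D: "DERIV (\<lambda>t. g ((p k)(k := t))) t :> partial k g ((p k)(k := t))" for t
      by (rule has_partial_DERIV) (use C1_on_RdD(1)[OF C1 k] upd in auto)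
    have near: "\<bar>((p k)(k := t)) i - x i\<bar> \<le> \<bar>e * h i\<bar>" if "i < d" "\<bar>t - x k\<bar> \<le> \<bar>e * h k\<bar>" for i t
      using that k by (auto simp: p_def)
    consider "e * h k = 0" | "0 < e * h k" | "e * h k < 0" by linarith
    then show ?thesis
    proof cases
      case 1
      then show ?thesis using x pS[OF k] pk[OF k] by (intro exI[of _ x]) auto
    next
      case 2
      then have "x k < x k + e * h k" by simp
      from MVT2[OF this D] obtain t where t: "x k < t" "t < x k + e * h k"
        "g ((p k)(k := x k + e * h k)) - g ((p k)(k := x k)) = (x k + e * h k - x k) * partial k g ((p k)(k := t))" by blast
      then show ?thesis using upd near[where t=t] pS[OF k] pk[OF k] by (intro exI[of _ "(p k)(k := t)"]) auto
    next
      case 3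
      then have "x k + e * h k < x k" by simp
      from MVT2[OF this D] obtain t where t: "x k + e * h k < t" "t < x k"
        "g ((p k)(k := x k)) - g ((p k)(k := x k + e * h k)) = (x k - (x k + e * h k)) * partial k g ((p k)(k := t))" by blast
      have "g (p (Suc k)) - g (p k) = e * h k * partial k g ((p k)(k := t))"
        using t(3) pS[OF k] pk[OF k] by (simp add: algebra_simps)
      then show ?thesis using t upd near[where t=t] by (intro exI[of _ "(p k)(k := t)"]) auto
    qed
  qed
  then have "\<forall>k\<in>{..<d}. \<exists>\<xi>. \<xi> \<in> Rd d \<and> (\<forall>i<d. \<bar>\<xi> i - x i\<bar> \<le> \<bar>e * h i\<bar>) \<and> g (p (Suc k)) - g (p k) = e * h k * partial k g \<xi>" by auto
  from bchoice[OF this] obtain \<xi> where \<xi>: "\<And>k. k < d \<Longrightarrow> \<xi> k \<in> Rd d \<and> (\<forall>i<d. \<bar>\<xi> k i - x i\<bar> \<le> \<bar>e * h i\<bar>) \<and> g (p (Suc k)) - g (p k) = e * h k * partial k g (\<xi> k)"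
    by auto
  have "g (shift d x h e) - g x = (\<Sum>k<d. g (p (Suc k)) - g (p k))"
    by (simp add: sum_lessThan_telescope[of "\<lambda>k. g (p k)" d] p0 pd)
  also have "\<dots> = (\<Sum>k<d. e * h k * partial k g (\<xi> k))" using \<xi> by (intro sum.cong) auto
  finally show ?thesis using \<xi> by blast
qed

text \<open>The chain rule: the intermediate points of the mean value theorem converge to the base
  point, and the partial derivatives are continuous there.\<close>

lemma C1_DERIV_shift:
  assumes C1: "C1_on_Rd d g"
  shows "DERIV (\<lambda>t. g (shift d x h t)) t :> (\<Sum>k<d. h k * partial k g (shift d x h t))"
proof -
  define c where "c = shift d x h t"
  have c: "c \<in> Rd d" by (simp add: c_def)
  have "\<forall>e. \<exists>\<xi>. (\<forall>k<d. \<xi> k \<in> Rd d \<and> (\<forall>i<d. \<bar>\<xi> k i - c i\<bar> \<le> \<bar>e * h i\<bar>)) \<and>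
     g (shift d c h e) - g c = (\<Sum>k<d. e * h k * partial k g (\<xi> k))"
    using C1_increment[OF C1 c] by blast
  from choice[OF this] obtain \<xi> where
    \<xi>: "\<And>e k. k < d \<Longrightarrow> \<xi> e k \<in> Rd d" "\<And>e k i. k < d \<Longrightarrow> i < d \<Longrightarrow> \<bar>\<xi> e k i - c i\<bar> \<le> \<bar>e * h i\<bar>"
      "\<And>e. g (shift d c h e) - g c = (\<Sum>k<d. e * h k * partial k g (\<xi> e k))" by blast
  have lim: "((\<lambda>e. \<xi> e k) \<longlongrightarrow> c) (at 0)" if k: "k < d" for k
  proof (rule tendsto_fun_componentwise)
    fix i
    show "((\<lambda>e. \<xi> e k i) \<longlongrightarrow> c i) (at 0)"
    proof (cases "i < d")
      case True
      have "((\<lambda>e. \<xi> e k i - c i) \<longlongrightarrow> 0) (at 0)"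
      proof (rule Lim_null_comparison)
        show "\<forall>\<^sub>F e in at 0. norm (\<xi> e k i - c i) \<le> \<bar>e * h i\<bar>" using \<xi>(2)[OF k True] by simp
        show "((\<lambda>e. \<bar>e * h i\<bar>) \<longlongrightarrow> 0) (at 0)" by (auto intro!: tendsto_eq_intros)
      qed
      then show ?thesis by (simp add: LIM_zero_iff)
    next
      case False
      then have "\<xi> e k i = c i" for e using \<xi>(1)[OF k, of e] c by (auto simp: Rd_def PiE_iff extensional_def)
      then show ?thesis by simp
    qed
  qed
  have "((\<lambda>e. \<Sum>k<d. h k * partial k g (\<xi> e k)) \<longlongrightarrow> (\<Sum>k<d. h k * partial k g c)) (at 0)"
  proof (intro tendsto_sum tendsto_mult tendsto_const)
    fix k assume "k \<in> {..<d}"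
    then have k: "k < d" by simp
    show "((\<lambda>e. partial k g (\<xi> e k)) \<longlongrightarrow> partial k g c) (at 0)"
      by (rule continuous_on_tendsto_compose[OF C1_on_RdD(2)[OF C1 k] lim[OF k] c]) (use \<xi>(1)[OF k] in simp)
  qed
  then have "((\<lambda>e. (g (shift d x h (t + e)) - g (shift d x h t)) / e) \<longlongrightarrow> (\<Sum>k<d. h k * partial k g c)) (at 0)"
  proof (rule Lim_transform_eventually)
    have "(\<Sum>k<d. h k * partial k g (\<xi> e k)) = (g (shift d x h (t + e)) - g (shift d x h t)) / e" if "e \<noteq> 0" for e
      using \<xi>(3)[of e] that unfolding c_def shift_shift mult.assoc sum_distrib_left[symmetric] by simp
    then show "\<forall>\<^sub>F e in at 0. (\<Sum>k<d. h k * partial k g (\<xi> e k)) = (g (shift d x h (t + e)) - g (shift d x h t)) / e"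
      by (auto simp: eventually_at_filter)
  qed
  then show ?thesis unfolding DERIV_def c_def .
qed

text \<open>Taylor's formula of order two along the segment from \<open>x\<close> to
  \<open>y\<close>; the remainder is the Hessian form at an intermediate point.\<close>

lemma Hessian_bounds:
  assumes C2: "C2_on_Rd d l" and x: "x \<in> Rd d" and y: "y \<in> Rd d"
    and H: "\<And>\<beta>. \<beta> \<in> Rd d \<Longrightarrow> loewner_le d (\<lambda>i j. 0) (\<lambda>i j. - hessian l \<beta> i j) \<and> loewner_le d (\<lambda>i j. - hessian l \<beta> i j) (\<lambda>i j. L * id_mat i j)"
  shows "l y - l x \<le> (\<Sum>k<d. partial k l x * (y k - x k))"
    and "(\<Sum>k<d. partial k l x * (y k - x k)) - L / 2 * (\<Sum>k<d. (y k - x k)\<^sup>2) \<le> l y - l x"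
proof -
  define h where "h k = y k - x k" for k
  have C1: "C1_on_Rd d l" and C1p: "\<And>i. i < d \<Longrightarrow> C1_on_Rd d (partial i l)" using C2 by (auto simp: C2_on_Rd_def)
  \<comment> \<open>The restriction to the line and its first two derivatives, in the format of
    \<open>Maclaurin\<close>; values of \<open>m\<close> above 2 are irrelevant.\<close>
  define D :: "nat \<Rightarrow> real \<Rightarrow> real" where "D m t = (case m of 0 \<Rightarrow> l (shift d x h t) | Suc 0 \<Rightarrow> (\<Sum>k<d. h k * partial k l (shift d x h t))
     | Suc (Suc n) \<Rightarrow> (\<Sum>i<d. \<Sum>j<d. h i * hessian l (shift d x h t) i j * h j))" for m t
  have "DERIV (D 1) t :> D 2 t" for t
  proof -
    have "DERIV (\<lambda>t. \<Sum>k<d. h k * partial k l (shift d x h t)) t :> (\<Sum>k<d. h k * (\<Sum>i<d. h i * partial i (partial k l) (shift d x h t)))"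
      by (intro DERIV_sum DERIV_cmult C1_DERIV_shift C1p) simp
    also have "(\<Sum>k<d. h k * (\<Sum>i<d. h i * partial i (partial k l) (shift d x h t))) = (\<Sum>k<d. \<Sum>i<d. h i * hessian l (shift d x h t) i k * h k)"
      by (simp add: hessian_def sum_distrib_left mult_ac)
    also have "\<dots> = (\<Sum>i<d. \<Sum>k<d. h i * hessian l (shift d x h t) i k * h k)" by (rule sum.swap)
    also have "\<dots> = D 2 t" by (simp add: D_def numeral_2_eq_2)
    finally show ?thesis by (simp add: D_def[abs_def])
  qed
  moreover have "DERIV (D 0) t :> D 1 t" for t using C1_DERIV_shift[OF C1, of x h t] by (simp add: D_def[abs_def])
  ultimately have der: "\<forall>m t. m < 2 \<and> 0 \<le> t \<and> t \<le> 1 \<longrightarrow> DERIV (D m) t :> D (Suc m) t"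
    by (auto simp: less_Suc_eq numeral_2_eq_2)
  obtain t where t: "D 0 1 = (\<Sum>m<2. (D m 0 / fact m) * 1 ^ m) + (D 2 t / fact 2) * 1 ^ 2"
    using Maclaurin[of 1 2 D "D 0", OF _ _ _ der] by auto
  have "shift d x h 1 = y" using y by (auto simp: shift_def h_def Rd_def PiE_iff extensional_def)
  then have main: "l y - l x = (\<Sum>k<d. partial k l x * h k) + D 2 t / 2"
    using t by (simp add: D_def numeral_2_eq_2 shift_0[OF x] mult.commute)
  have D2: "D 2 t = (\<Sum>i<d. \<Sum>j<d. h i * hessian l (shift d x h t) i j * h j)" by (simp add: D_def numeral_2_eq_2)
  have "D 2 t \<le> 0"
    using H[OF shift_in_Rd, of x h t] unfolding loewner_le_def psd_def D2 by (auto simp: sum_negf dest: spec[of _ h])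
  then show "l y - l x \<le> (\<Sum>k<d. partial k l x * (y k - x k))" using main by (simp add: h_def)
  have "0 \<le> (\<Sum>i<d. \<Sum>j<d. h i * (L * id_mat i j - - hessian l (shift d x h t) i j) * h j)"
    using H[OF shift_in_Rd, of x h t] unfolding loewner_le_def psd_def by blast
  also have "\<dots> = (\<Sum>i<d. \<Sum>j<d. L * (h i * id_mat i j * h j)) + D 2 t"
    unfolding D2 sum.distrib[symmetric] by (intro sum.cong refl) (simp add: algebra_simps)
  also have "(\<Sum>i<d. \<Sum>j<d. L * (h i * id_mat i j * h j)) = L * (\<Sum>i<d. (h i)\<^sup>2)"
    unfolding sum_distrib_left
  proof (rule sum.cong[OF refl])
    fix i assume "i \<in> {..<d}"
    then show "(\<Sum>j<d. L * (h i * id_mat i j * h j)) = L * (h i)\<^sup>2"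
      by (simp add: id_mat_def if_distrib[of "\<lambda>a. h i * a"] if_distrib[of "\<lambda>a. a * h _"] if_distrib[of "\<lambda>a. L * a"] power2_eq_square cong: if_cong)
  qed
  finally show "(\<Sum>k<d. partial k l x * (y k - x k)) - L / 2 * (\<Sum>k<d. (y k - x k)\<^sup>2) \<le> l y - l x"
    using main by (simp add: h_def)
qed

text \<open>Continuity refers to the topology of all functions on \<open>nat\<close>, measurability
  to a product over \<open>d\<close> coordinates. The inclusion is measurable because the remaining
  coordinates are constant.\<close>

lemma continuous_on_Rd_measurable:
  assumes "continuous_on (Rd d) g" shows "g \<in> borel_measurable (beta_space d)"
proof -
  have "(\<lambda>x. x) \<in> beta_space d \<rightarrow>\<^sub>M PiM UNIV (\<lambda>_. borel)"
  proof (rule measurable_PiM_single')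
    fix i :: nat
    show "(\<lambda>x. x i) \<in> borel_measurable (beta_space d)"
    proof (cases "i < d")
      case True
      then show ?thesis unfolding beta_space_def using measurable_component_singleton[of i "{..<d}" "\<lambda>_. lborel"] by simp
    next
      case False
      then have "x i = undefined" if "x \<in> space (beta_space d)" for x
        using that by (auto simp: beta_space_def space_PiM PiE_iff extensional_def)
      then show ?thesis by (subst measurable_cong[where g="\<lambda>_. undefined"]) auto
    qed
  qed auto
  then have "(\<lambda>x. x) \<in> beta_space d \<rightarrow>\<^sub>M borel"
    using measurable_cong_sets[OF refl sets_PiM_equal_borel] by blast
  then have "(\<lambda>x. x) \<in> beta_space d \<rightarrow>\<^sub>M restrict_space borel (Rd d)"
    by (rule measurable_restrict_space2[rotated]) (auto simp: beta_space_def space_PiM Rd_def)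
  from measurable_compose[OF this borel_measurable_continuous_on_restrict[OF assms]] show ?thesis .
qed

lemma Gaussian_integral_shifted:
  assumes t: "0 < (t :: real)"
  shows "integrable lborel (\<lambda>x. exp (- v * x - x\<^sup>2 / (2 * t)))"
proof -
  have "exp (- v * x - x\<^sup>2 / (2 * t)) = (exp (v\<^sup>2 * t / 2) * sqrt (2 * pi * t)) * normal_density (- v * t) (sqrt t) x" for x
  proof -
    have "v\<^sup>2 * t / 2 - (x - - v * t)\<^sup>2 / (2 * t) = - v * x - x\<^sup>2 / (2 * t)"
      using t by (simp add: power2_eq_square field_simps)
    then have "exp (- v * x - x\<^sup>2 / (2 * t)) = exp (v\<^sup>2 * t / 2) * exp (- (x - - v * t)\<^sup>2 / (2 * t))"
      by (simp add: exp_add[symmetric])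
    then show ?thesis using t by (simp add: normal_density_def)
  qed
  then show ?thesis using t by simp
qed

text \<open>The negative log-density of \<open>\<beta>\<close> given the other coordinates, up to an additive constant.\<close>

definition pot :: "nat \<Rightarrow> ((nat \<Rightarrow> real) \<Rightarrow> real) \<Rightarrow> (nat \<Rightarrow> real) \<Rightarrow> (nat \<Rightarrow> real) \<Rightarrow> real" where
  "pot d l \<tau> x = - l x + (\<Sum>j<d. (x j)\<^sup>2 / (2 * \<tau> j))"

text \<open>The Gaussian prior contributes exactly \<open>nd / 2\<close> to the second-order term,
  the source of strong convexity with constant 1. The concave log-likelihood only adds convexity,
  and at most \<open>b * L\<close> to the smoothness constant.\<close>

lemma smooth_target_pot:
  fixes \<tau> :: "nat \<Rightarrow> real"
  assumes d: "d \<ge> 1" and C2: "C2_on_Rd d l" and L: "0 < L" and \<tau>: "\<And>j. j < d \<Longrightarrow> 0 < \<tau> j" "\<And>j. j < d \<Longrightarrow> \<tau> j \<le> b"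
    and H: "\<And>\<beta>. \<beta> \<in> Rd d \<Longrightarrow> loewner_le d (\<lambda>i j. 0) (\<lambda>i j. - hessian l \<beta> i j) \<and> loewner_le d (\<lambda>i j. - hessian l \<beta> i j) (\<lambda>i j. L * id_mat i j)"
    and \<sigma>: "0 < \<sigma>" "\<sigma>\<^sup>2 = 1 / (2 * real d * (b * L + 1))"
  shows "smooth_target {..<d} (pot d l \<tau>) \<tau> \<sigma> (b * L + 1)"
proof -
  define U where "U = pot d l \<tau>"
  define v where "v x j = - partial j l x + x j / \<tau> j" for x j
  have b: "0 < b" using \<tau>[of 0] d by force
  have quad: "(\<Sum>j<d. (u j)\<^sup>2 / (2 * \<tau> j)) - (\<Sum>j<d. (x j)\<^sup>2 / (2 * \<tau> j)) = (\<Sum>j<d. x j / \<tau> j * (u j - x j)) + nd {..<d} \<tau> u x / 2" for u x :: "nat \<Rightarrow> real"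
    unfolding nd_def sum_subtractf[symmetric] sum_divide_distrib sum.distrib[symmetric]
  proof (rule sum.cong[OF refl])
    fix j assume "j \<in> {..<d}"
    then have "\<tau> j \<noteq> 0" using \<tau>(1)[of j] by simp
    then show "(u j)\<^sup>2 / (2 * \<tau> j) - (x j)\<^sup>2 / (2 * \<tau> j) = x j / \<tau> j * (u j - x j) + (u j - x j)\<^sup>2 / \<tau> j / 2"
      by (simp add: field_simps power2_eq_square)
  qed
  have sv: "(\<Sum>j<d. v x j * (u j - x j)) = - (\<Sum>j<d. partial j l x * (u j - x j)) + (\<Sum>j<d. x j / \<tau> j * (u j - x j))" for u x
    unfolding sum_negf[symmetric] sum.distrib[symmetric] by (intro sum.cong refl) (simp add: v_def algebra_simps)
  have lo: "(\<Sum>j<d. v x j * (u j - x j)) + nd {..<d} \<tau> u x / 2 \<le> U u - U x" if "x \<in> Rd d" "u \<in> Rd d" for x u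
    using Hessian_bounds(1)[OF C2 that H] quad[of u x] unfolding sv U_def pot_def by simp
  \<comment> \<open>Here the largest prior variance enters: \<open>\<tau> j \<le> b\<close> bounds
    the Euclidean square by \<open>b\<close> times \<open>nd\<close>.\<close>
  have up: "U u - U x \<le> (\<Sum>j<d. v x j * (u j - x j)) + (b * L + 1) / 2 * nd {..<d} \<tau> u x" if "x \<in> Rd d" "u \<in> Rd d" for x u
  proof -
    have "(\<Sum>j<d. (u j - x j)\<^sup>2) \<le> (\<Sum>j<d. b * ((u j - x j)\<^sup>2 / \<tau> j))"
    proof (rule sum_mono)
      fix j assume "j \<in> {..<d}"
      then have j: "0 < \<tau> j" "\<tau> j \<le> b" using \<tau> by auto
      have "\<tau> j * (u j - x j)\<^sup>2 \<le> b * (u j - x j)\<^sup>2" using j by (intro mult_right_mono) auto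
      then show "(u j - x j)\<^sup>2 \<le> b * ((u j - x j)\<^sup>2 / \<tau> j)" using j by (simp add: pos_le_divide_eq mult.commute)
    qed
    then have "L / 2 * (\<Sum>j<d. (u j - x j)\<^sup>2) \<le> L / 2 * (b * nd {..<d} \<tau> u x)"
      using L by (intro mult_left_mono) (simp_all add: nd_def sum_distrib_left)
    moreover have "(b * L + 1) / 2 * nd {..<d} \<tau> u x = L / 2 * (b * nd {..<d} \<tau> u x) + nd {..<d} \<tau> u x / 2" by (simp add: field_simps)
    ultimately show ?thesis
      using Hessian_bounds(2)[OF C2 that H] quad[of u x] unfolding sv U_def pot_def by linarith
  qed
  have nd0: "0 \<le> nd {..<d} \<tau> x y" for x y by (rule nd_nonneg) (simp add: \<tau>)
  have Um: "U \<in> borel_measurable (LB {..<d})"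
  proof -
    have [measurable]: "l \<in> borel_measurable (LB {..<d})"
      using continuous_on_Rd_measurable[of d l] C2 by (simp add: C2_on_Rd_def C1_on_Rd_def beta_space_def)
    have "(\<lambda>x. \<Sum>j<d. (x j)\<^sup>2 / (2 * \<tau> j)) \<in> borel_measurable (LB {..<d})"
      by (intro borel_measurable_sum borel_measurable_divide borel_measurable_power borel_measurable_const) simp
    then show ?thesis unfolding U_def pot_def[abs_def] by measurable
  qed
  show ?thesis unfolding U_def[symmetric]
  proof
    show "finite {..<d}" by simp
    show "U \<in> borel_measurable (LB {..<d})" by (rule Um)
    \<comment> \<open>The quadratic lower bound at the origin dominates \<open>exp (- U)\<close> by
      a product of shifted Gaussians.\<close>
    show "integrable (LB {..<d}) (\<lambda>y. exp (- U y))"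
    proof (rule Bochner_Integration.integrable_bound)
      define z where "z = (\<lambda>j\<in>{..<d}. 0 :: real)"
      have z: "z \<in> Rd d" by (simp add: z_def Rd_def)
      show "integrable (LB {..<d}) (\<lambda>y. exp (- U z) * (\<Prod>j<d. exp (- v z j * y j - (y j)\<^sup>2 / (2 * \<tau> j))))"
        by (intro integrable_mult_right lborel_product.product_integrable_prod Gaussian_integral_shifted \<tau>) auto
      show "AE y in LB {..<d}. norm (exp (- U y)) \<le> norm (exp (- U z) * (\<Prod>j<d. exp (- v z j * y j - (y j)\<^sup>2 / (2 * \<tau> j))))"
      proof (rule AE_I2)
        fix y assume "y \<in> space (LB {..<d})"
        then have y: "y \<in> Rd d" by (simp add: space_PiM Rd_def)
        have "(\<Sum>j<d. v z j * (y j - z j)) + nd {..<d} \<tau> y z / 2 = (\<Sum>j<d. v z j * y j + (y j)\<^sup>2 / (2 * \<tau> j))"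
          unfolding nd_def sum_divide_distrib sum.distrib[symmetric] by (intro sum.cong refl) (simp add: z_def)
        then have "- U y \<le> - U z + (\<Sum>j<d. - v z j * y j - (y j)\<^sup>2 / (2 * \<tau> j))"
          using lo[OF z y] by (simp add: sum_subtractf sum_negf sum.distrib)
        then have "exp (- U y) \<le> exp (- U z) * (\<Prod>j<d. exp (- v z j * y j - (y j)\<^sup>2 / (2 * \<tau> j)))"
          by (simp add: exp_sum[symmetric] exp_add[symmetric])
        then show "norm (exp (- U y)) \<le> norm (exp (- U z) * (\<Prod>j<d. exp (- v z j * y j - (y j)\<^sup>2 / (2 * \<tau> j))))"
          using order_trans[OF _ abs_ge_self] by (simp add: abs_prod)
      qed
    qed (use Um in measurable)
    show "0 < \<tau> j" if "j \<in> {..<d}" for j using \<tau>(1) that by simp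
    show "0 < \<sigma>" by (rule \<sigma>)
    have bL: "0 < b * L + 1" using b L by (simp add: add_pos_pos)
    then show "0 \<le> b * L + 1" by simp
    \<comment> \<open>Equality holds for the prescribed step size.\<close>
    show "(b * L + 1) * \<sigma>\<^sup>2 * real (card {..<d}) \<le> 1 / 2" unfolding \<sigma>(2) using bL d by (simp add: field_simps)
    show "{..<d} \<noteq> {}" using d by (simp add: lessThan_empty_iff)
    \<comment> \<open>Sum of the lower bounds at the midpoint: the linear terms cancel, and each
      endpoint has squared distance \<open>nd / 4\<close> from it.\<close>
    show "2 * U (midp {..<d} x y) + 1 / 4 * nd {..<d} \<tau> x y \<le> U x + U y" if "x \<in> RR {..<d}" "y \<in> RR {..<d}" for x y
    proof -
      define m where "m = midp {..<d} x y"
      have m: "m \<in> Rd d" by (simp add: m_def Rd_def)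
      have xy: "x \<in> Rd d" "y \<in> Rd d" using that by (simp_all add: Rd_def)
      have "(\<Sum>j<d. v m j * (y j - m j)) = - (\<Sum>j<d. v m j * (x j - m j))"
        unfolding sum_negf[symmetric] by (intro sum.cong refl) (simp add: m_def field_simps)
      moreover have "nd {..<d} \<tau> x m = nd {..<d} \<tau> x y / 4" "nd {..<d} \<tau> y m = nd {..<d} \<tau> x y / 4"
        unfolding nd_def sum_divide_distrib by (intro sum.cong refl; simp add: m_def power2_eq_square field_simps)+
      ultimately show ?thesis using lo[OF m xy(1)] lo[OF m xy(2)] unfolding m_def[symmetric] by argo
    qed
    show "\<exists>v. \<forall>u\<in>RR {..<d}. (\<Sum>j<d. v j * (u j - x j)) \<le> U u - U x \<and> U u - U x \<le> (\<Sum>j<d. v j * (u j - x j)) + (b * L + 1) / 2 * nd {..<d} \<tau> u x"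
      if "x \<in> RR {..<d}" for x
    proof (intro exI[of _ "v x"] ballI conjI)
      fix u assume "u \<in> RR {..<d}"
      then have xu: "x \<in> Rd d" "u \<in> Rd d" using that by (simp_all add: Rd_def)
      show "(\<Sum>j<d. v x j * (u j - x j)) \<le> U u - U x" using lo[OF xu] nd0[of u x] by simp
      show "U u - U x \<le> (\<Sum>j<d. v x j * (u j - x j)) + (b * L + 1) / 2 * nd {..<d} \<tau> u x" by (rule up[OF xu])
    qed
  qed
qed

section \<open>The spike-and-slab posterior\<close>

locale unnormalized_density = sigma_finite_measure N for N :: "'a measure" +
  fixes g :: "'a \<Rightarrow> real"
  assumes g_meas[measurable]: "g \<in> borel_measurable N" and g_nn: "\<And>x. x \<in> space N \<Longrightarrow> 0 \<le> g x"
    and g_int: "integrable N g" and g_pos: "0 < (\<integral>x. g x \<partial>N)"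
begin

lemma nn_integral_g: "(\<integral>\<^sup>+x. ennreal (g x) \<partial>N) = ennreal (\<integral>x. g x \<partial>N)"
  by (rule nn_integral_eq_integral[OF g_int]) (use g_nn in auto)

lemma nn_integral_normalized:
  assumes [measurable]: "v \<in> borel_measurable N"
  shows "(\<integral>\<^sup>+x. v x \<partial>normalized N g) = ennreal (1 / (\<integral>x. g x \<partial>N)) * (\<integral>\<^sup>+x. ennreal (g x) * v x \<partial>N)"
proof -
  have "(\<integral>\<^sup>+x. v x \<partial>normalized N g) = (\<integral>\<^sup>+x. ennreal (normalized_density N g x) * v x \<partial>N)"
    unfolding normalized_def by (rule nn_integral_density) (simp_all add: normalized_density_def[abs_def])
  also have "\<dots> = (\<integral>\<^sup>+x. ennreal (1 / (\<integral>x. g x \<partial>N)) * (ennreal (g x) * v x) \<partial>N)"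
    using g_pos g_nn by (intro nn_integral_cong) (simp add: normalized_density_def mult.assoc[symmetric] ennreal_mult[symmetric])
  also have "\<dots> = ennreal (1 / (\<integral>x. g x \<partial>N)) * (\<integral>\<^sup>+x. ennreal (g x) * v x \<partial>N)" by (rule nn_integral_cmult) simp
  finally show ?thesis .
qed

lemma emeasure_normalized: "(\<integral>\<^sup>+x. ennreal (normalized_density N g x) \<partial>N) = 1"
proof -
  have "(\<integral>\<^sup>+x. ennreal (normalized_density N g x) \<partial>N) = (\<integral>\<^sup>+x. ennreal (1 / (\<integral>x. g x \<partial>N)) * ennreal (g x) \<partial>N)"
    using g_pos g_nn by (intro nn_integral_cong) (simp add: normalized_density_def ennreal_mult[symmetric])
  also have "\<dots> = 1" using g_pos by (subst nn_integral_cmult) (simp_all add: nn_integral_g ennreal_mult[symmetric])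
  finally show ?thesis .
qed

text \<open>For resampling that ignores the current value both sides factor into the same two
  integrals.\<close>

lemma normalized_reversible:
  assumes c: "0 \<le> c" and W: "\<And>a. a \<in> space N \<Longrightarrow> W a = c * g a"
    and k: "\<And>a. a \<in> space N \<Longrightarrow> k a = normalized N g"
    and [measurable]: "u \<in> borel_measurable N" "v \<in> borel_measurable N"
  shows "(\<integral>\<^sup>+a. ennreal (W a) * (u a * (\<integral>\<^sup>+a'. v a' \<partial>k a)) \<partial>N) = (\<integral>\<^sup>+a. ennreal (W a) * (v a * (\<integral>\<^sup>+a'. u a' \<partial>k a)) \<partial>N)"
proof -
  have e: "(\<integral>\<^sup>+a. ennreal (W a) * (u a * (\<integral>\<^sup>+a'. v a' \<partial>k a)) \<partial>N)
     = ennreal c * (ennreal (1 / (\<integral>x. g x \<partial>N)) * ((\<integral>\<^sup>+x. ennreal (g x) * u x \<partial>N) * (\<integral>\<^sup>+x. ennreal (g x) * v x \<partial>N)))"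
    if [measurable]: "u \<in> borel_measurable N" "v \<in> borel_measurable N" for u v
  proof -
    define X where "X = ennreal c * (\<integral>\<^sup>+a'. v a' \<partial>normalized N g)"
    have "(\<integral>\<^sup>+a. ennreal (W a) * (u a * (\<integral>\<^sup>+a'. v a' \<partial>k a)) \<partial>N) = (\<integral>\<^sup>+a. X * (ennreal (g a) * u a) \<partial>N)"
      using c g_nn by (intro nn_integral_cong) (simp add: W k X_def ennreal_mult mult_ac)
    also have "\<dots> = X * (\<integral>\<^sup>+a. ennreal (g a) * u a \<partial>N)" by (rule nn_integral_cmult) simp
    finally show ?thesis unfolding X_def by (simp add: nn_integral_normalized mult_ac)
  qed
  show ?thesis by (simp add: e mult.commute[of "\<integral>\<^sup>+x. ennreal (g x) * u x \<partial>N"])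
qed

text \<open>On a fibre the form of exact resampling is the pairwise square under a probability
  measure.\<close>

lemma normalized_positive:
  fixes h :: "'a \<Rightarrow> real"
  assumes c: "0 \<le> c" and W: "\<And>a. a \<in> space N \<Longrightarrow> W a = c * g a"
    and k: "\<And>a. a \<in> space N \<Longrightarrow> k a = normalized N g"
    and [measurable]: "h \<in> borel_measurable N"
  shows "(\<integral>\<^sup>+a. ennreal (W a) * (\<integral>\<^sup>+a'. ennreal ((h a' - h a)\<^sup>2) \<partial>k a) \<partial>N) \<le> 2 * (\<integral>\<^sup>+a. ennreal (W a) * ennreal ((h a)\<^sup>2) \<partial>N)"
proof -
  let ?P = "normalized N g"
  have sP: "sets ?P = sets N" by (simp add: normalized_def)
  interpret P: prob_space ?P
  proof (rule prob_spaceI)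
    show "emeasure ?P (space ?P) = 1"
      using emeasure_normalized by (simp add: normalized_def emeasure_density normalized_density_def[abs_def] cong: nn_integral_cong)
  qed
  have [measurable]: "h \<in> borel_measurable ?P" by (simp add: measurable_cong_sets[OF sP refl])
  define G where "G = (\<integral>x. g x \<partial>N)"
  have e: "(\<integral>\<^sup>+a. ennreal (W a) * F a \<partial>N) = ennreal (c * G) * (\<integral>\<^sup>+a. F a \<partial>?P)" if [measurable]: "F \<in> borel_measurable N" for F
  proof -
    have "(\<integral>\<^sup>+a. ennreal (W a) * F a \<partial>N) = (\<integral>\<^sup>+a. ennreal c * (ennreal (g a) * F a) \<partial>N)"
      using c g_nn by (intro nn_integral_cong) (simp add: W ennreal_mult mult_ac)
    also have "\<dots> = ennreal c * (\<integral>\<^sup>+a. ennreal (g a) * F a \<partial>N)" by (rule nn_integral_cmult) simp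
    also have "\<dots> = ennreal (c * G) * (\<integral>\<^sup>+a. F a \<partial>?P)"
      using g_pos c by (simp add: nn_integral_normalized G_def mult.assoc[symmetric] ennreal_mult[symmetric])
    finally show ?thesis .
  qed
  have m: "(\<lambda>a. \<integral>\<^sup>+a'. ennreal ((h a' - h a)\<^sup>2) \<partial>?P) \<in> borel_measurable N"
    unfolding measurable_cong_sets[OF sP[symmetric] refl] by measurable
  have "(\<integral>\<^sup>+a. ennreal (W a) * (\<integral>\<^sup>+a'. ennreal ((h a' - h a)\<^sup>2) \<partial>k a) \<partial>N) = (\<integral>\<^sup>+a. ennreal (W a) * (\<integral>\<^sup>+a'. ennreal ((h a' - h a)\<^sup>2) \<partial>?P) \<partial>N)"
    by (rule nn_integral_cong) (simp add: k)
  also have "\<dots> = ennreal (c * G) * (\<integral>\<^sup>+a. (\<integral>\<^sup>+a'. ennreal ((h a' - h a)\<^sup>2) \<partial>?P) \<partial>?P)" by (rule e[OF m])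
  also have "\<dots> \<le> ennreal (c * G) * (2 * emeasure ?P (space ?P) * (\<integral>\<^sup>+x. ennreal ((h x)\<^sup>2) \<partial>?P))"
    by (intro mult_left_mono P.nn_integral_pairwise_square_le) auto
  also have "\<dots> = 2 * (ennreal (c * G) * (\<integral>\<^sup>+x. ennreal ((h x)\<^sup>2) \<partial>?P))" by (simp add: P.emeasure_space_1 mult_ac)
  also have "ennreal (c * G) * (\<integral>\<^sup>+x. ennreal ((h x)\<^sup>2) \<partial>?P) = (\<integral>\<^sup>+a. ennreal (W a) * ennreal ((h a)\<^sup>2) \<partial>N)"
    by (rule e[symmetric]) measurable
  finally show ?thesis .
qed

end

lemma normalized_kernel:
  assumes un: "\<And>x. x \<in> space M \<Longrightarrow> unnormalized_density N (g x)" and N: "sigma_finite_measure N" "space N \<noteq> {}"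
    and g[measurable]: "(\<lambda>z. g (fst z) (snd z)) \<in> borel_measurable (M \<Otimes>\<^sub>M N)"
  shows "(\<lambda>x. normalized N (g x)) \<in> M \<rightarrow>\<^sub>M prob_algebra N"
proof -
  interpret N: sigma_finite_measure N by fact
  have [measurable]: "(\<lambda>x. \<integral>y. g x y \<partial>N) \<in> borel_measurable M"
    by (rule N.borel_measurable_lebesgue_integral) (simp add: split_beta')
  have m2: "(\<lambda>z. \<integral>y. g (fst z) y \<partial>N) \<in> borel_measurable (M \<Otimes>\<^sub>M N)"
    by (rule measurable_compose[OF measurable_fst]) simp
  show ?thesis unfolding normalized_def
  proof (rule density_kernel[OF N])
    show "(\<lambda>(x, y). ennreal (normalized_density N (g x) y)) \<in> borel_measurable (M \<Otimes>\<^sub>M N)"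
      unfolding normalized_density_def split_beta' using m2 by measurable
    show "(\<integral>\<^sup>+y. ennreal (normalized_density N (g x) y) \<partial>N) = 1" if "x \<in> space M" for x
      by (rule unnormalized_density.emeasure_normalized[OF un[OF that]])
  qed
qed

section \<open>The Metropolis kernel on one fibre\<close>

context smooth_target
begin

definition metropolis :: "('i \<Rightarrow> real) \<Rightarrow> ('i \<Rightarrow> real) measure" where
  "metropolis x = \<gamma> x \<bind> (\<lambda>w. distr (measure_pmf (bernoulli_pmf (min 1 (exp (U x - U w))))) (LB I) (\<lambda>acc. if acc then w else x))"

definition accr :: "('i \<Rightarrow> real) \<Rightarrow> ('i \<Rightarrow> real) \<Rightarrow> real" where "accr x w = min 1 (exp (U x - U w))"

lemma accr: "0 \<le> accr x w" "accr x w \<le> 1" by (auto simp: accr_def)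

lemma accr_measurable[measurable]: "accr x \<in> borel_measurable (LB I)" unfolding accr_def[abs_def] by measurable

lemma nn_integral_accept:
  assumes x: "x \<in> RR I" "w \<in> RR I" and [measurable]: "F \<in> borel_measurable (LB I)"
  shows "(\<integral>\<^sup>+y. F y \<partial>distr (measure_pmf (bernoulli_pmf (accr x w))) (LB I) (\<lambda>acc. if acc then w else x))
    = ennreal (accr x w) * F w + ennreal (1 - accr x w) * F x"
proof -
  have "(\<integral>\<^sup>+y. F y \<partial>distr (measure_pmf (bernoulli_pmf (accr x w))) (LB I) (\<lambda>acc. if acc then w else x))
    = (\<integral>\<^sup>+acc. F (if acc then w else x) \<partial>measure_pmf (bernoulli_pmf (accr x w)))"
    by (rule nn_integral_distr) (use x in \<open>auto simp: space_LB\<close>)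
  also have "\<dots> = ennreal (accr x w) * F w + ennreal (1 - accr x w) * F x"
    using accr[of x w] by (subst nn_integral_bernoulli_pmf) (simp_all add: mult.commute)
  finally show ?thesis .
qed

lemma accept_kernel:
  assumes x: "x \<in> RR I"
  shows "(\<lambda>w. distr (measure_pmf (bernoulli_pmf (accr x w))) (LB I) (\<lambda>acc. if acc then w else x)) \<in> LB I \<rightarrow>\<^sub>M subprob_algebra (LB I)"
proof (rule measurable_subprob_algebra)
  fix w assume "w \<in> space (LB I)"
  then have w: "w \<in> RR I" by (simp add: space_LB)
  show "subprob_space (distr (measure_pmf (bernoulli_pmf (accr x w))) (LB I) (\<lambda>acc. if acc then w else x))"
    by (rule prob_space_imp_subprob_space, rule measure_pmf.prob_space_distr) (use x w in \<open>auto simp: space_LB\<close>)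
next
  fix A assume A[measurable]: "A \<in> sets (LB I)"
  have "emeasure (distr (measure_pmf (bernoulli_pmf (accr x w))) (LB I) (\<lambda>acc. if acc then w else x)) A
     = ennreal (accr x w) * indicator A w + ennreal (1 - accr x w) * indicator A x" if "w \<in> space (LB I)" for w
    using nn_integral_accept[OF x, of w "indicator A"] that by (simp add: space_LB)
  then show "(\<lambda>w. emeasure (distr (measure_pmf (bernoulli_pmf (accr x w))) (LB I) (\<lambda>acc. if acc then w else x)) A) \<in> borel_measurable (LB I)"
    by (subst measurable_cong) measurable
qed simp

lemma nn_integral_metropolis:
  assumes x: "x \<in> RR I" and F[measurable]: "F \<in> borel_measurable (LB I)"
  shows "(\<integral>\<^sup>+y. F y \<partial>metropolis x) = (\<integral>\<^sup>+w. ennreal (gdens I s x w) * (ennreal (accr x w) * F w + ennreal (1 - accr x w) * F x) \<partial>LB I)"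
proof -
  have "(\<integral>\<^sup>+y. F y \<partial>metropolis x) = (\<integral>\<^sup>+w. (\<integral>\<^sup>+y. F y \<partial>distr (measure_pmf (bernoulli_pmf (accr x w))) (LB I) (\<lambda>acc. if acc then w else x)) \<partial>\<gamma> x)"
    unfolding metropolis_def accr_def[symmetric]
    by (rule nn_integral_bind[where B="LB I"]) (use accept_kernel[OF x] in \<open>simp_all cong: measurable_cong_sets\<close>)
  also have "\<dots> = (\<integral>\<^sup>+w. ennreal (accr x w) * F w + ennreal (1 - accr x w) * F x \<partial>\<gamma> x)"
    by (rule nn_integral_cong) (simp add: nn_integral_accept[OF x _ F])
  also have "\<dots> = (\<integral>\<^sup>+w. ennreal (gdens I s x w) * (ennreal (accr x w) * F w + ennreal (1 - accr x w) * F x) \<partial>LB I)"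
    by (rule nn_integral_gauss) simp
  finally show ?thesis .
qed

lemma sets_metropolis: "sets (metropolis x) = sets (LB I)"
  unfolding metropolis_def by (rule sets_bind) (simp_all add: RR_not_empty)

lemma prob_space_metropolis: assumes x: "x \<in> RR I" shows "prob_space (metropolis x)"
proof (rule prob_spaceI)
  have "emeasure (metropolis x) (space (metropolis x)) = (\<integral>\<^sup>+y. 1 \<partial>metropolis x)" by simp
  also have "\<dots> = (\<integral>\<^sup>+w. ennreal (gdens I s x w) * (ennreal (accr x w) * 1 + ennreal (1 - accr x w) * 1) \<partial>LB I)"
    by (rule nn_integral_metropolis[OF x]) simp
  also have "\<dots> = 1" using accr[of x] by (simp add: ennreal_plus[symmetric] nn_integral_gdens del: ennreal_plus)
  finally show "emeasure (metropolis x) (space (metropolis x)) = 1" .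
qed

lemma accr_measurable2[measurable]: "(\<lambda>z. accr (fst z) (snd z)) \<in> borel_measurable (LB I \<Otimes>\<^sub>M LB I)"
  unfolding accr_def by measurable

lemma accr_balance: "exp (- U x) * accr x w = exp (- U w) * accr w x"
proof -
  have "exp (- U x) * accr x w = min (exp (- U x)) (exp (- U w))" for x w
    by (simp add: accr_def min_mult_distrib_left exp_add[symmetric])
  then show ?thesis by (simp add: min.commute)
qed

text \<open>Accepted moves have the symmetric density \<open>q\<close>; rejected ones stay put and
  contribute a diagonal term, symmetric in \<open>u\<close> and \<open>v\<close> by itself.\<close>

lemma metropolis_reversible:
  assumes [measurable]: "u \<in> borel_measurable (LB I)" "v \<in> borel_measurable (LB I)"
  shows "(\<integral>\<^sup>+x. ennreal (exp (- U x)) * (u x * (\<integral>\<^sup>+y. v y \<partial>metropolis x)) \<partial>LB I)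
    = (\<integral>\<^sup>+x. ennreal (exp (- U x)) * (v x * (\<integral>\<^sup>+y. u y \<partial>metropolis x)) \<partial>LB I)"
proof -
  interpret N: sigma_finite_measure "LB I" by (rule sigma_finite_LB[OF fin])
  interpret NN: pair_sigma_finite "LB I" "LB I" ..
  define q where "q x w = ennreal (exp (- U x) * accr x w * gdens I s x w)" for x w
  define stay where "stay x = (\<integral>\<^sup>+w. ennreal (gdens I s x w * (1 - accr x w)) \<partial>LB I)" for x
  have qs: "q x w = q w x" for x w unfolding q_def accr_balance[of x w] gdens_sym[of I s x w] ..
  have [measurable]: "(\<lambda>z. q (fst z) (snd z)) \<in> borel_measurable (LB I \<Otimes>\<^sub>M LB I)" unfolding q_def by measurable
  have [measurable]: "stay \<in> borel_measurable (LB I)" unfolding stay_def[abs_def]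
    by (rule N.borel_measurable_nn_integral) (simp add: split_beta')
  have e: "(\<integral>\<^sup>+x. ennreal (exp (- U x)) * (u x * (\<integral>\<^sup>+y. v y \<partial>metropolis x)) \<partial>LB I)
     = (\<integral>\<^sup>+x. (\<integral>\<^sup>+w. q x w * (u x * v w) \<partial>LB I) \<partial>LB I) + (\<integral>\<^sup>+x. ennreal (exp (- U x)) * (u x * v x) * stay x \<partial>LB I)"
    if [measurable]: "u \<in> borel_measurable (LB I)" "v \<in> borel_measurable (LB I)" for u v
  proof -
    have [measurable]: "(\<lambda>z. u (fst z)) \<in> borel_measurable (LB I \<Otimes>\<^sub>M LB I)" "(\<lambda>z. v (snd z)) \<in> borel_measurable (LB I \<Otimes>\<^sub>M LB I)"
      by (rule measurable_compose[OF measurable_fst] measurable_compose[OF measurable_snd], measurable)+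
    have "(\<integral>\<^sup>+x. ennreal (exp (- U x)) * (u x * (\<integral>\<^sup>+y. v y \<partial>metropolis x)) \<partial>LB I)
      = (\<integral>\<^sup>+x. (\<integral>\<^sup>+w. q x w * (u x * v w) \<partial>LB I) + ennreal (exp (- U x)) * (u x * v x) * stay x \<partial>LB I)"
    proof (rule nn_integral_cong)
      fix x assume x: "x \<in> space (LB I)"
      have [measurable]: "q x \<in> borel_measurable (LB I)" "gdens I s x \<in> borel_measurable (LB I)" unfolding q_def[abs_def] by measurable
      have "ennreal (exp (- U x)) * (u x * (\<integral>\<^sup>+y. v y \<partial>metropolis x))
        = (\<integral>\<^sup>+w. ennreal (exp (- U x)) * (u x * (ennreal (gdens I s x w) * (ennreal (accr x w) * v w + ennreal (1 - accr x w) * v x))) \<partial>LB I)"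
        using x by (subst nn_integral_metropolis) (simp_all add: space_LB nn_integral_cmult)
      also have "\<dots> = (\<integral>\<^sup>+w. q x w * (u x * v w) + ennreal (exp (- U x)) * (u x * v x) * ennreal (gdens I s x w * (1 - accr x w)) \<partial>LB I)"
        using accr by (intro nn_integral_cong) (simp add: q_def ennreal_mult distrib_left mult_ac)
      also have "\<dots> = (\<integral>\<^sup>+w. q x w * (u x * v w) \<partial>LB I) + ennreal (exp (- U x)) * (u x * v x) * stay x"
        unfolding stay_def by (subst nn_integral_add) (simp_all add: nn_integral_cmult)
      finally show "ennreal (exp (- U x)) * (u x * (\<integral>\<^sup>+y. v y \<partial>metropolis x)) = (\<integral>\<^sup>+w. q x w * (u x * v w) \<partial>LB I) + ennreal (exp (- U x)) * (u x * v x) * stay x" .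
    qed
    also have "\<dots> = (\<integral>\<^sup>+x. (\<integral>\<^sup>+w. q x w * (u x * v w) \<partial>LB I) \<partial>LB I) + (\<integral>\<^sup>+x. ennreal (exp (- U x)) * (u x * v x) * stay x \<partial>LB I)"
    proof (rule nn_integral_add)
      show "(\<lambda>x. \<integral>\<^sup>+w. q x w * (u x * v w) \<partial>LB I) \<in> borel_measurable (LB I)"
        by (rule N.borel_measurable_nn_integral) (simp add: split_beta')
    qed measurable
    finally show ?thesis .
  qed
  have [measurable]: "(\<lambda>z. u (snd z)) \<in> borel_measurable (LB I \<Otimes>\<^sub>M LB I)" "(\<lambda>z. v (fst z)) \<in> borel_measurable (LB I \<Otimes>\<^sub>M LB I)"
    by (rule measurable_compose[OF measurable_fst] measurable_compose[OF measurable_snd], measurable)+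
  have "(\<integral>\<^sup>+x. (\<integral>\<^sup>+w. q x w * (v x * u w) \<partial>LB I) \<partial>LB I) = (\<integral>\<^sup>+w. (\<integral>\<^sup>+x. q x w * (v x * u w) \<partial>LB I) \<partial>LB I)"
    by (rule NN.Fubini') (simp add: split_beta' qs[of "snd _" "fst _"])
  also have "\<dots> = (\<integral>\<^sup>+x. (\<integral>\<^sup>+w. q x w * (u x * v w) \<partial>LB I) \<partial>LB I)"
    by (intro nn_integral_cong) (simp add: mult_ac qs)
  finally show ?thesis by (simp add: e mult.commute[of "v _" "u _"])
qed

text \<open>Rejections leave the state unchanged and contribute nothing.\<close>

lemma metropolis_rw_form:
  assumes [measurable]: "f \<in> borel_measurable (LB I)"
  shows "(\<integral>\<^sup>+x. ennreal (exp (- U x)) * (\<integral>\<^sup>+y. ennreal ((f y - f x)\<^sup>2) \<partial>metropolis x) \<partial>LB I) = rw_form I U s f"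
  unfolding rw_form_def
proof (rule nn_integral_cong)
  fix x assume x: "x \<in> space (LB I)"
  have "ennreal (exp (- U x)) * (\<integral>\<^sup>+y. ennreal ((f y - f x)\<^sup>2) \<partial>metropolis x)
    = (\<integral>\<^sup>+w. ennreal (exp (- U x)) * (ennreal (gdens I s x w) * (ennreal (accr x w) * ennreal ((f w - f x)\<^sup>2) + ennreal (1 - accr x w) * ennreal ((f x - f x)\<^sup>2))) \<partial>LB I)"
    using x by (subst nn_integral_metropolis) (simp_all add: space_LB nn_integral_cmult)
  also have "\<dots> = (\<integral>\<^sup>+w. ennreal ((f w - f x)\<^sup>2) * ennreal (min (exp (- U x)) (exp (- U w)) * gdens I s x w) \<partial>LB I)"
  proof (rule nn_integral_cong)
    fix w
    have "min (exp (- U x)) (exp (- U w)) = exp (- U x) * accr x w"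
      by (simp add: accr_def min_mult_distrib_left exp_add[symmetric])
    then show "ennreal (exp (- U x)) * (ennreal (gdens I s x w) * (ennreal (accr x w) * ennreal ((f w - f x)\<^sup>2) + ennreal (1 - accr x w) * ennreal ((f x - f x)\<^sup>2)))
      = ennreal ((f w - f x)\<^sup>2) * ennreal (min (exp (- U x)) (exp (- U w)) * gdens I s x w)"
      using accr[of x w] by (simp add: ennreal_mult mult_ac)
  qed
  finally show "ennreal (exp (- U x)) * (\<integral>\<^sup>+y. ennreal ((f y - f x)\<^sup>2) \<partial>metropolis x)
    = (\<integral>\<^sup>+w. ennreal ((f w - f x)\<^sup>2) * ennreal (min (exp (- U x)) (exp (- U w)) * gdens I s x w) \<partial>LB I)" .
qed

end

section \<open>Component spaces and measurability of the weights\<close>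

lemma beta_space_LB: "beta_space d = LB {..<d}" by (simp add: beta_space_def)

lemma sigma_finite_beta_space: "sigma_finite_measure (beta_space d)"
  unfolding beta_space_LB by (rule sigma_finite_LB) simp

lemma space_z_space: "z \<in> space (z_space d) \<Longrightarrow> j < d \<Longrightarrow> z j \<in> {0, 1}"
  by (auto simp: z_space_def space_PiM PiE_iff)

lemma emeasure_z_space: "emeasure (z_space d) (space (z_space d)) = 2 ^ d"
proof -
  interpret product_sigma_finite "\<lambda>_::nat. count_space {0, 1 :: nat}"
    by (simp add: product_sigma_finite_def sigma_finite_measure_count_space_finite)
  have "emeasure (z_space d) (PiE {..<d} (\<lambda>_. {0, 1})) = (\<Prod>j<d. emeasure (count_space {0, 1 :: nat}) {0, 1})"
    unfolding z_space_def by (rule emeasure_PiM) auto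
  then show ?thesis by (simp add: z_space_def space_PiM numeral_2_eq_2 card_insert_if)
qed

lemma finite_measure_z_space: "finite_measure (z_space d)"
  by (rule finite_measureI) (simp add: emeasure_z_space power_eq_top_ennreal)

lemma space_q_space: "space q_space = {0<..<1}" by (simp add: q_space_def)

lemma sigma_finite_q_space: "sigma_finite_measure q_space"
  unfolding q_space_def by (rule sigma_finite_measure_restrict_space) (auto intro: lborel.sigma_finite_measure_axioms)

lemma beta_component:
  "B \<in> M \<rightarrow>\<^sub>M beta_space d \<Longrightarrow> j < d \<Longrightarrow> (\<lambda>s. B s j) \<in> borel_measurable M"
  unfolding beta_space_def using measurable_compose[OF _ measurable_component_singleton[of j "{..<d}" "\<lambda>_. lborel"]] by simp

lemma z_component:
  assumes "Y \<in> M \<rightarrow>\<^sub>M z_space d" "j < d" shows "(\<lambda>s. Y s j) \<in> M \<rightarrow>\<^sub>M count_space {0, 1}"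
  using assms(1) unfolding z_space_def by (rule measurable_compose) (use assms(2) in simp)

lemma slab_var_measurable:
  assumes "Y \<in> M \<rightarrow>\<^sub>M z_space d" "j < d" shows "(\<lambda>s. slab_var a b (Y s j)) \<in> borel_measurable M"
  by (rule measurable_compose[OF z_component[OF assms]]) simp

lemma q_measurable: "Q \<in> M \<rightarrow>\<^sub>M q_space \<Longrightarrow> Q \<in> borel_measurable M"
  by (rule measurable_compose[of Q M q_space "\<lambda>x. x"]) (auto simp: q_space_def intro: measurable_restrict_space1)

text \<open>The exponent varies with the state but takes only two values, so measurability is
  checked for each fixed exponent.\<close>

lemma power_z_measurable:
  fixes R :: "'s \<Rightarrow> real"
  assumes [measurable]: "R \<in> borel_measurable M" and z: "Y \<in> M \<rightarrow>\<^sub>M count_space {0, 1 :: nat}"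
  shows "(\<lambda>s. R s ^ Y s) \<in> borel_measurable M" "(\<lambda>s. R s ^ (1 - Y s)) \<in> borel_measurable M"
  by (rule measurable_compose_countable'[where f="\<lambda>i s. R s ^ i" and g=Y, OF _ z]; simp)
     (rule measurable_compose_countable'[where f="\<lambda>i s. R s ^ (1 - i)" and g=Y, OF _ z]; simp)

lemma weight_measurable:
  assumes l: "l \<in> borel_measurable (beta_space d)"
    and B: "B \<in> M \<rightarrow>\<^sub>M beta_space d" and Y: "Y \<in> M \<rightarrow>\<^sub>M z_space d" and Q: "Q \<in> M \<rightarrow>\<^sub>M q_space"
  shows "(\<lambda>s. weight d a b l (B s) (Y s) (Q s)) \<in> borel_measurable M"
  unfolding weight_def
proof (intro borel_measurable_times borel_measurable_prod)
  show "(\<lambda>s. exp (l (B s))) \<in> borel_measurable M" using measurable_compose[OF B l] by measurable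
  fix j assume "j \<in> {..<d}"
  then have j: "j < d" by simp
  note [measurable] = beta_component[OF B j] slab_var_measurable[OF Y j] q_measurable[OF Q]
  show "(\<lambda>s. 1 / sqrt (slab_var a b (Y s j))) \<in> borel_measurable M"
    and "(\<lambda>s. exp (- (B s j)\<^sup>2 / (2 * slab_var a b (Y s j)))) \<in> borel_measurable M" by measurable
  show "(\<lambda>s. Q s ^ Y s j) \<in> borel_measurable M"
    by (rule power_z_measurable(1)[OF _ z_component[OF Y j]]) measurable
  have "(\<lambda>s. 1 - Q s) \<in> borel_measurable M" by measurable
  then show "(\<lambda>s. (1 - Q s) ^ (1 - Y s j)) \<in> borel_measurable M"
    by (rule power_z_measurable(2)[OF _ z_component[OF Y j]])
qed

lemma pot_measurable:
  assumes l: "l \<in> borel_measurable (beta_space d)"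
    and B: "B \<in> M \<rightarrow>\<^sub>M beta_space d" and Y: "Y \<in> M \<rightarrow>\<^sub>M z_space d"
  shows "(\<lambda>s. pot d l (\<lambda>j. slab_var a b (Y s j)) (B s)) \<in> borel_measurable M"
  unfolding pot_def
proof (intro borel_measurable_add borel_measurable_uminus borel_measurable_sum)
  show "(\<lambda>s. l (B s)) \<in> borel_measurable M" by (rule measurable_compose[OF B l])
  fix j assume "j \<in> {..<d}"
  then have j: "j < d" by simp
  note [measurable] = beta_component[OF B j] slab_var_measurable[OF Y j]
  show "(\<lambda>s. (B s j)\<^sup>2 / (2 * slab_var a b (Y s j))) \<in> borel_measurable M" by measurable
qed

definition zq_weight :: "nat \<Rightarrow> real \<Rightarrow> real \<Rightarrow> (nat \<Rightarrow> nat) \<Rightarrow> real \<Rightarrow> real" where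
  "zq_weight d a b z q = (\<Prod>j<d. 1 / sqrt (slab_var a b (z j)) * (q ^ z j * (1 - q) ^ (1 - z j)))"

text \<open>Separates the only factor containing \<open>\<beta>\<close>. It does not involve
  \<open>q\<close>, so the conditional law of \<open>\<beta>\<close> depends on \<open>z\<close>
  alone.\<close>

lemma weight_eq:
  "weight d a b l \<beta> z q = zq_weight d a b z q * exp (- pot d l (\<lambda>j. slab_var a b (z j)) \<beta>)"
proof -
  have "exp (- pot d l (\<lambda>j. slab_var a b (z j)) \<beta>) = exp (l \<beta>) * (\<Prod>j<d. exp (- (\<beta> j)\<^sup>2 / (2 * slab_var a b (z j))))"
    by (simp add: pot_def exp_sum[symmetric] exp_add[symmetric] sum_negf)
  then show ?thesis unfolding weight_def zq_weight_def prod.distrib by (simp add: mult_ac)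
qed

lemma unnormalized_densityI:
  assumes "sigma_finite_measure N" and [measurable]: "g \<in> borel_measurable N" and nn: "\<And>x. x \<in> space N \<Longrightarrow> 0 \<le> g x"
    and fin: "(\<integral>\<^sup>+x. ennreal (g x) \<partial>N) < \<infinity>" and pos: "(\<integral>\<^sup>+x. ennreal (g x) \<partial>N) \<noteq> 0"
  shows "unnormalized_density N g"
proof -
  have i: "integrable N g" by (rule integrableI_nonneg) (use nn fin in auto)
  have "ennreal (\<integral>x. g x \<partial>N) \<noteq> 0" using pos nn_integral_eq_integral[OF i] nn by (auto simp: AE_I2)
  then have "0 < (\<integral>x. g x \<partial>N)" by (meson ennreal_neg not_le)
  then show ?thesis using assms i by (simp add: unnormalized_density_def unnormalized_density_axioms_def)
qed

section \<open>The posterior and its conditional laws\<close>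

locale spike_slab =
  fixes d :: nat and a b L \<sigma> p1 p2 p3 :: real and l :: "(nat \<Rightarrow> real) \<Rightarrow> real" and f :: "real \<Rightarrow> real"
  assumes d: "d \<ge> 1" and ab: "0 < a" "a < b" and f: "prob_density_01 f"
    and p: "0 \<le> p1" "0 \<le> p2" "0 \<le> p3" "p1 + p2 + p3 = 1"
    and C2: "C2_on_Rd d l" and L: "L > 0"
    and H: "\<And>\<beta>. \<beta> \<in> Rd d \<Longrightarrow> loewner_le d (\<lambda>i j. 0) (\<lambda>i j. - hessian l \<beta> i j) \<and> loewner_le d (\<lambda>i j. - hessian l \<beta> i j) (\<lambda>i j. L * id_mat i j)"
    and \<sigma>: "\<sigma> > 0" "\<sigma>\<^sup>2 = 1 / (2 * real d * (b * L + 1))"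
begin

abbreviation "BS \<equiv> beta_space d"
abbreviation "ZS \<equiv> z_space d"
abbreviation "QS \<equiv> q_space"
abbreviation "S \<equiv> state_space d"

sublocale B: sigma_finite_measure BS by (rule sigma_finite_beta_space)
sublocale Zf: finite_measure ZS by (rule finite_measure_z_space)
sublocale Q: sigma_finite_measure QS by (rule sigma_finite_q_space)
sublocale ZQ: pair_sigma_finite ZS QS ..
sublocale BZQ: pair_sigma_finite BS "ZS \<Otimes>\<^sub>M QS" ..

lemma S_def: "S = BS \<Otimes>\<^sub>M (ZS \<Otimes>\<^sub>M QS)" by (simp add: state_space_def)

lemma l_meas[measurable]: "l \<in> borel_measurable BS"
  using C2 by (intro continuous_on_Rd_measurable) (simp add: C2_on_Rd_def C1_on_Rd_def)

lemma f_meas[measurable]: "f \<in> borel_measurable QS" and f_nn: "q \<in> space QS \<Longrightarrow> 0 \<le> f q"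
  and f_int: "(\<integral>\<^sup>+q. ennreal (f q) \<partial>QS) = 1"
  using f by (auto simp: prob_density_01_def space_q_space)

definition \<tau> :: "(nat \<Rightarrow> nat) \<Rightarrow> nat \<Rightarrow> real" where "\<tau> z j = slab_var a b (z j)"

lemma \<tau>: assumes "z \<in> space ZS" "j < d" shows "0 < \<tau> z j" "a \<le> \<tau> z j" "\<tau> z j \<le> b"
  using space_z_space[OF assms] ab by (auto simp: \<tau>_def slab_var_def)

definition U :: "(nat \<Rightarrow> nat) \<Rightarrow> (nat \<Rightarrow> real) \<Rightarrow> real" where "U z = pot d l (\<tau> z)"

definition cz :: "(nat \<Rightarrow> nat) \<Rightarrow> real \<Rightarrow> real" where "cz z q = zq_weight d a b z q"

abbreviation "w \<equiv> weight d a b l"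

lemma w_eq: "w \<beta> z q = cz z q * exp (- U z \<beta>)" by (simp add: weight_eq cz_def U_def \<tau>_def[abs_def])

lemma cz: assumes z: "z \<in> space ZS" and q: "q \<in> space QS" shows "0 < cz z q" "cz z q \<le> (1 / sqrt a) ^ d"
proof -
  have q01: "0 < q" "q < 1" using q by (auto simp: space_q_space)
  show "0 < cz z q" unfolding cz_def zq_weight_def
    using \<tau>(1)[OF z] q01 by (intro prod_pos ballI mult_pos_pos) (auto simp: \<tau>_def)
  have "cz z q \<le> (\<Prod>j<d. 1 / sqrt a)" unfolding cz_def zq_weight_def
  proof (rule prod_mono)
    fix j assume "j \<in> {..<d}"
    then have j: "j < d" by simp
    have t: "0 < slab_var a b (z j)" "a \<le> slab_var a b (z j)" using \<tau>[OF z j] by (simp_all add: \<tau>_def)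
    have "q ^ z j * (1 - q) ^ (1 - z j) \<le> 1 * 1" using q01 by (intro mult_mono power_le_one) auto
    moreover have "1 / sqrt (slab_var a b (z j)) \<le> 1 / sqrt a" using t ab by (simp add: frac_le)
    ultimately have "1 / sqrt (slab_var a b (z j)) * (q ^ z j * (1 - q) ^ (1 - z j)) \<le> 1 / sqrt a * 1"
      using q01 t ab by (intro mult_mono) auto
    then show "0 \<le> 1 / sqrt (slab_var a b (z j)) * (q ^ z j * (1 - q) ^ (1 - z j)) \<and> 1 / sqrt (slab_var a b (z j)) * (q ^ z j * (1 - q) ^ (1 - z j)) \<le> 1 / sqrt a"
      using q01 t by simp
  qed
  then show "cz z q \<le> (1 / sqrt a) ^ d" by simp
qed

lemma smooth_U: assumes "z \<in> space ZS" shows "smooth_target {..<d} (U z) (\<tau> z) \<sigma> (b * L + 1)"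
  unfolding U_def by (rule smooth_target_pot[OF d C2 L _ _ H \<sigma>]) (use \<tau>[OF assms] in auto)

text \<open>With all variances equal to \<open>b\<close> the potential is the smallest, so it
  dominates every \<open>exp (- U z)\<close> at once.\<close>

lemma smooth_Ub: "smooth_target {..<d} (pot d l (\<lambda>_. b)) (\<lambda>_. b) \<sigma> (b * L + 1)"
  by (rule smooth_target_pot[OF d C2 L _ _ H \<sigma>]) (use ab in auto)

lemma w_pos: assumes "z \<in> space ZS" "q \<in> space QS" shows "0 < w \<beta> z q"
  unfolding w_eq using cz(1)[OF assms] by simp

text \<open>A bound for the mass of every fibre in \<open>\<beta>\<close>, uniform in
  \<open>z\<close> and \<open>q\<close>. As \<open>z\<close> takes \<open>2 ^ d\<close> values and
  \<open>f\<close> has mass 1, it makes the posterior proper.\<close>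

definition Cw :: ennreal where "Cw = ennreal ((1 / sqrt a) ^ d) * (\<integral>\<^sup>+\<beta>. ennreal (exp (- pot d l (\<lambda>_. b) \<beta>)) \<partial>BS)"

lemma Cw_finite: "Cw < \<infinity>"
proof -
  interpret T: smooth_target "{..<d}" "pot d l (\<lambda>_. b)" "\<lambda>_. b" \<sigma> "b * L + 1" by (rule smooth_Ub)
  show ?thesis unfolding Cw_def beta_space_LB T.nn_integral_exp by (simp add: ennreal_mult_less_top)
qed

lemma w_beta_measurable: "z \<in> space ZS \<Longrightarrow> q \<in> space QS \<Longrightarrow> (\<lambda>\<beta>. w \<beta> z q) \<in> borel_measurable BS"
  by (rule weight_measurable[OF l_meas]) simp_all

lemma w_le_Cw: assumes z: "z \<in> space ZS" and q: "q \<in> space QS" shows "(\<integral>\<^sup>+\<beta>. ennreal (w \<beta> z q) \<partial>BS) \<le> Cw"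
proof -
  have "(\<integral>\<^sup>+\<beta>. ennreal (w \<beta> z q) \<partial>BS) \<le> (\<integral>\<^sup>+\<beta>. ennreal ((1 / sqrt a) ^ d) * ennreal (exp (- pot d l (\<lambda>_. b) \<beta>)) \<partial>BS)"
  proof (rule nn_integral_mono)
    fix \<beta>
    have "(\<Sum>j<d. (\<beta> j)\<^sup>2 / (2 * b)) \<le> (\<Sum>j<d. (\<beta> j)\<^sup>2 / (2 * \<tau> z j))"
      using \<tau>[OF z] ab by (intro sum_mono divide_left_mono) auto
    then have "exp (- U z \<beta>) \<le> exp (- pot d l (\<lambda>_. b) \<beta>)" by (simp add: U_def pot_def)
    then have "w \<beta> z q \<le> (1 / sqrt a) ^ d * exp (- pot d l (\<lambda>_. b) \<beta>)"
      unfolding w_eq using cz[OF z q] by (intro mult_mono) auto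
    then show "ennreal (w \<beta> z q) \<le> ennreal ((1 / sqrt a) ^ d) * ennreal (exp (- pot d l (\<lambda>_. b) \<beta>))"
      using ab by (simp add: ennreal_mult[symmetric] ennreal_leI)
  qed
  also have "\<dots> = Cw" unfolding Cw_def
  proof (rule nn_integral_cmult)
    interpret T: smooth_target "{..<d}" "pot d l (\<lambda>_. b)" "\<lambda>_. b" \<sigma> "b * L + 1" by (rule smooth_Ub)
    show "(\<lambda>\<beta>. ennreal (exp (- pot d l (\<lambda>_. b) \<beta>))) \<in> borel_measurable BS"
      unfolding beta_space_LB by measurable
  qed
  finally show ?thesis .
qed

lemma unnormalized_beta:
  assumes z: "z \<in> space ZS" and q: "q \<in> space QS" shows "unnormalized_density BS (\<lambda>\<beta>. w \<beta> z q)"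
proof (rule unnormalized_densityI)
  note m = w_beta_measurable[OF z q]
  show "(\<integral>\<^sup>+\<beta>. ennreal (w \<beta> z q) \<partial>BS) < \<infinity>" using w_le_Cw[OF z q] Cw_finite by (rule order_le_less_trans)
  show "(\<integral>\<^sup>+\<beta>. ennreal (w \<beta> z q) \<partial>BS) \<noteq> 0"
  proof
    assume "(\<integral>\<^sup>+\<beta>. ennreal (w \<beta> z q) \<partial>BS) = 0"
    then have "AE \<beta> in BS. ennreal (w \<beta> z q) = 0" using m by (subst (asm) nn_integral_0_iff_AE) simp_all
    then have "AE \<beta> in BS. False" using w_pos[OF z q] by (simp add: not_le[symmetric] ennreal_eq_0_iff)
    then show False using LB_space_not_null[of "{..<d}"] by (simp add: beta_space_LB ae_filter_eq_bot_iff[symmetric] trivial_limit_def)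
  qed
qed (use w_pos[OF z q] w_beta_measurable[OF z q] in \<open>auto intro: less_imp_le B.sigma_finite_measure_axioms\<close>)

lemma unnormalized_z:
  assumes \<beta>: "\<beta> \<in> space BS" and q: "q \<in> space QS" shows "unnormalized_density ZS (\<lambda>z. w \<beta> z q)"
proof (rule unnormalized_densityI)
  show m[measurable]: "(\<lambda>z. w \<beta> z q) \<in> borel_measurable ZS"
    by (rule weight_measurable[OF l_meas]) (use \<beta> q in simp_all)
  have fin: "finite (space ZS)" by (simp add: z_space_def space_PiM finite_PiE)
  have "(\<integral>\<^sup>+z. ennreal (w \<beta> z q) \<partial>ZS) \<le> (\<integral>\<^sup>+z. (\<Sum>z'\<in>space ZS. ennreal (w \<beta> z' q)) \<partial>ZS)"
    by (intro nn_integral_mono member_le_sum) (use fin in auto)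
  also have "(\<Sum>z'\<in>space ZS. ennreal (w \<beta> z' q)) = ennreal (\<Sum>z'\<in>space ZS. w \<beta> z' q)"
    using w_pos[OF _ q] by (intro sum_ennreal) (auto intro: less_imp_le)
  also have "(\<integral>\<^sup>+z. ennreal (\<Sum>z'\<in>space ZS. w \<beta> z' q) \<partial>ZS) < \<infinity>"
    by (simp add: emeasure_z_space ennreal_mult_eq_top_iff power_eq_top_ennreal less_top[symmetric])
  finally show "(\<integral>\<^sup>+z. ennreal (w \<beta> z q) \<partial>ZS) < \<infinity>" .
  show "(\<integral>\<^sup>+z. ennreal (w \<beta> z q) \<partial>ZS) \<noteq> 0"
  proof
    assume "(\<integral>\<^sup>+z. ennreal (w \<beta> z q) \<partial>ZS) = 0"
    then have "AE z in ZS. ennreal (w \<beta> z q) = 0" by (subst (asm) nn_integral_0_iff_AE) simp_all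
    then have "AE z in ZS. False" by (rule AE_mp[OF _ AE_I2]) (use w_pos[OF _ q] in \<open>auto simp: not_le[symmetric] ennreal_eq_0_iff\<close>)
    moreover have "emeasure ZS (space ZS) \<noteq> 0" by (simp add: emeasure_z_space)
    ultimately show False by (simp add: ae_filter_eq_bot_iff[symmetric] trivial_limit_def)
  qed
qed (use w_pos[OF _ q] in \<open>auto intro: less_imp_le Zf.sigma_finite_measure_axioms\<close>)

lemma unnormalized_q:
  assumes \<beta>: "\<beta> \<in> space BS" and z: "z \<in> space ZS" shows "unnormalized_density QS (\<lambda>q. w \<beta> z q * f q)"
proof (rule unnormalized_densityI)
  have [measurable]: "(\<lambda>q. w \<beta> z q) \<in> borel_measurable QS"
    by (rule weight_measurable[OF l_meas]) (use \<beta> z in simp_all)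
  show m: "(\<lambda>q. w \<beta> z q * f q) \<in> borel_measurable QS" by measurable
  have "(\<integral>\<^sup>+q. ennreal (w \<beta> z q * f q) \<partial>QS) \<le> (\<integral>\<^sup>+q. ennreal ((1 / sqrt a) ^ d * exp (- U z \<beta>)) * ennreal (f q) \<partial>QS)"
    by (intro nn_integral_mono) (use cz[OF z] f_nn ab in \<open>auto simp: w_eq ennreal_mult[symmetric] intro!: ennreal_leI mult_right_mono\<close>)
  also have "\<dots> < \<infinity>" by (subst nn_integral_cmult) (simp_all add: f_int)
  finally show "(\<integral>\<^sup>+q. ennreal (w \<beta> z q * f q) \<partial>QS) < \<infinity>" .
  show "(\<integral>\<^sup>+q. ennreal (w \<beta> z q * f q) \<partial>QS) \<noteq> 0"
  proof
    assume "(\<integral>\<^sup>+q. ennreal (w \<beta> z q * f q) \<partial>QS) = 0"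
    then have "AE q in QS. ennreal (w \<beta> z q * f q) = 0" using m by (subst (asm) nn_integral_0_iff_AE) simp_all
    \<comment> \<open>\<open>f\<close> may vanish on a large set, but not almost everywhere, having
      mass 1.\<close>
    then have "AE q in QS. ennreal (f q) = 0"
    proof (rule AE_mp[OF _ AE_I2], intro impI)
      fix q assume "q \<in> space QS" "ennreal (w \<beta> z q * f q) = 0"
      then show "ennreal (f q) = 0" using w_pos[OF z, of q \<beta>] by (auto simp: ennreal_eq_0_iff mult_le_0_iff)
    qed
    then have "(\<integral>\<^sup>+q. ennreal (f q) \<partial>QS) = 0" by (subst nn_integral_0_iff_AE) simp_all
    then show False using f_int by simp
  qed
  show "0 \<le> w \<beta> z q * f q" if "q \<in> space QS" for q
    using w_pos[OF z that, of \<beta>] f_nn[OF that] by simp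
qed (rule Q.sigma_finite_measure_axioms)

lemma Fubini_beta:
  assumes F: "F \<in> borel_measurable S"
  shows "(\<integral>\<^sup>+s. F s \<partial>S) = (\<integral>\<^sup>+r. (\<integral>\<^sup>+\<beta>. F (\<beta>, r) \<partial>BS) \<partial>(ZS \<Otimes>\<^sub>M QS))"
  using F unfolding S_def by (rule BZQ.nn_integral_snd[symmetric])

lemma Fubini_iterated:
  assumes F: "F \<in> borel_measurable S"
  shows "(\<integral>\<^sup>+s. F s \<partial>S) = (\<integral>\<^sup>+\<beta>. (\<integral>\<^sup>+z. (\<integral>\<^sup>+q. F (\<beta>, z, q) \<partial>QS) \<partial>ZS) \<partial>BS)"
proof -
  have F': "F \<in> borel_measurable (BS \<Otimes>\<^sub>M (ZS \<Otimes>\<^sub>M QS))" using F by (simp add: S_def)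
  have "(\<integral>\<^sup>+s. F s \<partial>S) = (\<integral>\<^sup>+\<beta>. (\<integral>\<^sup>+r. F (\<beta>, r) \<partial>(ZS \<Otimes>\<^sub>M QS)) \<partial>BS)"
    unfolding S_def by (rule sigma_finite_measure.nn_integral_fst[OF ZQ.sigma_finite_measure_axioms F', symmetric])
  also have "\<dots> = (\<integral>\<^sup>+\<beta>. (\<integral>\<^sup>+z. (\<integral>\<^sup>+q. F (\<beta>, z, q) \<partial>QS) \<partial>ZS) \<partial>BS)"
  proof (rule nn_integral_cong)
    fix \<beta> assume "\<beta> \<in> space BS"
    then have "(\<lambda>r. F (\<beta>, r)) \<in> borel_measurable (ZS \<Otimes>\<^sub>M QS)" using measurable_compose[OF measurable_Pair1' F'] by simp
    then show "(\<integral>\<^sup>+r. F (\<beta>, r) \<partial>(ZS \<Otimes>\<^sub>M QS)) = (\<integral>\<^sup>+z. (\<integral>\<^sup>+q. F (\<beta>, z, q) \<partial>QS) \<partial>ZS)" by (rule Q.nn_integral_fst[symmetric])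
  qed
  finally show ?thesis .
qed

lemma Fubini_q:
  assumes F: "F \<in> borel_measurable S"
  shows "(\<integral>\<^sup>+s. F s \<partial>S) = (\<integral>\<^sup>+r. (\<integral>\<^sup>+q. F (fst r, snd r, q) \<partial>QS) \<partial>(BS \<Otimes>\<^sub>M ZS))"
proof -
  have F'[measurable]: "F \<in> borel_measurable (BS \<Otimes>\<^sub>M (ZS \<Otimes>\<^sub>M QS))" using F by (simp add: S_def)
  have "(\<lambda>r. \<integral>\<^sup>+q. F (fst r, snd r, q) \<partial>QS) \<in> borel_measurable (BS \<Otimes>\<^sub>M ZS)"
    by (rule Q.borel_measurable_nn_integral) measurable
  from Zf.nn_integral_fst[OF this] show ?thesis unfolding Fubini_iterated[OF F] by simp
qed

lemma Fubini_z:
  assumes F: "F \<in> borel_measurable S"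
  shows "(\<integral>\<^sup>+s. F s \<partial>S) = (\<integral>\<^sup>+r. (\<integral>\<^sup>+z. F (fst r, z, snd r) \<partial>ZS) \<partial>(BS \<Otimes>\<^sub>M QS))"
proof -
  have F'[measurable]: "F \<in> borel_measurable (BS \<Otimes>\<^sub>M (ZS \<Otimes>\<^sub>M QS))" using F by (simp add: S_def)
  have "(\<lambda>r. \<integral>\<^sup>+z. F (fst r, z, snd r) \<partial>ZS) \<in> borel_measurable (BS \<Otimes>\<^sub>M QS)"
    by (rule Zf.borel_measurable_nn_integral) measurable
  from Q.nn_integral_fst[OF this]
  have "(\<integral>\<^sup>+r. (\<integral>\<^sup>+z. F (fst r, z, snd r) \<partial>ZS) \<partial>(BS \<Otimes>\<^sub>M QS)) = (\<integral>\<^sup>+\<beta>. (\<integral>\<^sup>+q. (\<integral>\<^sup>+z. F (\<beta>, z, q) \<partial>ZS) \<partial>QS) \<partial>BS)" by simp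
  also have "\<dots> = (\<integral>\<^sup>+\<beta>. (\<integral>\<^sup>+z. (\<integral>\<^sup>+q. F (\<beta>, z, q) \<partial>QS) \<partial>ZS) \<partial>BS)"
  proof (rule nn_integral_cong)
    fix \<beta> assume "\<beta> \<in> space BS"
    then have "(\<lambda>r. F (\<beta>, r)) \<in> borel_measurable (ZS \<Otimes>\<^sub>M QS)" using measurable_compose[OF measurable_Pair1' F'] by simp
    then show "(\<integral>\<^sup>+q. (\<integral>\<^sup>+z. F (\<beta>, z, q) \<partial>ZS) \<partial>QS) = (\<integral>\<^sup>+z. (\<integral>\<^sup>+q. F (\<beta>, z, q) \<partial>QS) \<partial>ZS)"
      by (intro ZQ.Fubini') (simp add: split_beta')
  qed
  finally show ?thesis unfolding Fubini_iterated[OF F] by simp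
qed

definition wf :: "state \<Rightarrow> real" where
  "wf s = w (fst s) (fst (snd s)) (snd (snd s)) * f (snd (snd s))"

lemma coords[measurable]: "fst \<in> S \<rightarrow>\<^sub>M BS" "(\<lambda>s. fst (snd s)) \<in> S \<rightarrow>\<^sub>M ZS" "(\<lambda>s. snd (snd s)) \<in> S \<rightarrow>\<^sub>M QS"
  unfolding S_def by measurable

lemma space_S: "space S = space BS \<times> space ZS \<times> space QS" by (simp add: S_def space_pair_measure)

lemma w_S_measurable[measurable]: "(\<lambda>s. w (fst s) (fst (snd s)) (snd (snd s))) \<in> borel_measurable S"
  by (rule weight_measurable[OF l_meas]) measurable

lemma wf_measurable[measurable]: "wf \<in> borel_measurable S"
  unfolding wf_def[abs_def] by measurable

lemma unnormalized_posterior: "unnormalized_density S wf"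
proof (rule unnormalized_densityI)
  show "sigma_finite_measure S" unfolding S_def by (rule BZQ.sigma_finite_measure_axioms)
  show "wf \<in> borel_measurable S" by simp
  show "0 \<le> wf s" if "s \<in> space S" for s
    using that w_pos[of "fst (snd s)" "snd (snd s)" "fst s"] f_nn[of "snd (snd s)"] by (auto simp: wf_def space_S less_imp_le)
  have e: "(\<integral>\<^sup>+s. ennreal (wf s) \<partial>S) = (\<integral>\<^sup>+r. (\<integral>\<^sup>+\<beta>. ennreal (wf (\<beta>, r)) \<partial>BS) \<partial>(ZS \<Otimes>\<^sub>M QS))"
    by (rule Fubini_beta) simp
  have fm: "(\<lambda>r. ennreal (f (snd r))) \<in> borel_measurable (ZS \<Otimes>\<^sub>M QS)" by measurable
  have fi: "(\<integral>\<^sup>+r. ennreal (f (snd r)) \<partial>(ZS \<Otimes>\<^sub>M QS)) = 2 ^ d"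
    by (subst Q.nn_integral_fst[OF fm, symmetric]) (simp add: f_int emeasure_z_space)
  have inner: "(\<integral>\<^sup>+\<beta>. ennreal (wf (\<beta>, r)) \<partial>BS) = ennreal (f (snd r)) * (\<integral>\<^sup>+\<beta>. ennreal (w \<beta> (fst r) (snd r)) \<partial>BS)"
    if r: "r \<in> space (ZS \<Otimes>\<^sub>M QS)" for r
  proof -
    have zq: "fst r \<in> space ZS" "snd r \<in> space QS" using r by (auto simp: space_pair_measure)
    have "(\<integral>\<^sup>+\<beta>. ennreal (wf (\<beta>, r)) \<partial>BS) = (\<integral>\<^sup>+\<beta>. ennreal (f (snd r)) * ennreal (w \<beta> (fst r) (snd r)) \<partial>BS)"
      using w_pos[OF zq] f_nn[OF zq(2)] by (intro nn_integral_cong) (simp add: wf_def ennreal_mult[symmetric] less_imp_le mult.commute)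
    then show ?thesis using w_beta_measurable[OF zq] by (simp add: nn_integral_cmult)
  qed
  have "(\<integral>\<^sup>+s. ennreal (wf s) \<partial>S) \<le> (\<integral>\<^sup>+r. ennreal (f (snd r)) * Cw \<partial>(ZS \<Otimes>\<^sub>M QS))"
    unfolding e
  proof (rule nn_integral_mono)
    fix r assume r: "r \<in> space (ZS \<Otimes>\<^sub>M QS)"
    then have "fst r \<in> space ZS" "snd r \<in> space QS" by (auto simp: space_pair_measure)
    then show "(\<integral>\<^sup>+\<beta>. ennreal (wf (\<beta>, r)) \<partial>BS) \<le> ennreal (f (snd r)) * Cw"
      unfolding inner[OF r] by (intro mult_left_mono w_le_Cw) auto
  qed
  also have "\<dots> = 2 ^ d * Cw" by (subst nn_integral_multc[OF fm]) (simp add: fi)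
  also have "\<dots> < \<infinity>" using Cw_finite by (simp add: ennreal_mult_less_top power_less_top_ennreal)
  finally show "(\<integral>\<^sup>+s. ennreal (wf s) \<partial>S) < \<infinity>" .
  show "(\<integral>\<^sup>+s. ennreal (wf s) \<partial>S) \<noteq> 0"
  proof
    assume "(\<integral>\<^sup>+s. ennreal (wf s) \<partial>S) = 0"
    moreover have m: "(\<lambda>r. \<integral>\<^sup>+\<beta>. ennreal (wf (\<beta>, r)) \<partial>BS) \<in> borel_measurable (ZS \<Otimes>\<^sub>M QS)"
    proof (rule B.borel_measurable_nn_integral)
      have "(\<lambda>z. wf (snd z, fst z)) \<in> borel_measurable ((ZS \<Otimes>\<^sub>M QS) \<Otimes>\<^sub>M BS)"
        by (rule measurable_compose[OF _ wf_measurable]) (simp add: S_def)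
      then show "(\<lambda>(r, \<beta>). ennreal (wf (\<beta>, r))) \<in> borel_measurable ((ZS \<Otimes>\<^sub>M QS) \<Otimes>\<^sub>M BS)" by (simp add: split_beta')
    qed
    ultimately have "AE r in ZS \<Otimes>\<^sub>M QS. (\<integral>\<^sup>+\<beta>. ennreal (wf (\<beta>, r)) \<partial>BS) = 0"
      unfolding e by (subst (asm) nn_integral_0_iff_AE) simp_all
    then have "AE r in ZS \<Otimes>\<^sub>M QS. ennreal (f (snd r)) = 0"
    proof (rule AE_mp[OF _ AE_I2], intro impI)
      fix r assume r: "r \<in> space (ZS \<Otimes>\<^sub>M QS)" and z: "(\<integral>\<^sup>+\<beta>. ennreal (wf (\<beta>, r)) \<partial>BS) = 0"
      then have zq: "fst r \<in> space ZS" "snd r \<in> space QS" by (auto simp: space_pair_measure)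
      interpret u: unnormalized_density BS "\<lambda>\<beta>. w \<beta> (fst r) (snd r)" by (rule unnormalized_beta[OF zq])
      show "ennreal (f (snd r)) = 0" using z u.g_pos unfolding inner[OF r] u.nn_integral_g by simp
    qed
    then have "(\<integral>\<^sup>+r. ennreal (f (snd r)) \<partial>(ZS \<Otimes>\<^sub>M QS)) = 0" using fm by (subst nn_integral_0_iff_AE) simp_all
    then show False unfolding fi by simp
  qed
qed

definition Zp :: real where "Zp = (\<integral>s. wf s \<partial>S)"

definition W :: "state \<Rightarrow> real" where "W s = wf s / Zp"

sublocale post: unnormalized_density S wf by (rule unnormalized_posterior)

lemma Zp_pos: "0 < Zp" unfolding Zp_def by (rule post.g_pos)

lemma W_measurable[measurable]: "W \<in> borel_measurable S" unfolding W_def[abs_def] by measurable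

definition "\<pi>S = posterior d a b l f"

lemma \<pi>S_eq: "\<pi>S = density S (\<lambda>s. ennreal (W s))"
proof -
  have "(\<lambda>(\<beta>, z, q). weight d a b l \<beta> z q * f q) = wf" by (auto simp: wf_def)
  then show ?thesis unfolding \<pi>S_def posterior_def normalized_def normalized_density_def W_def Zp_def by simp
qed

lemma sets_\<pi>S: "sets \<pi>S = sets S" by (simp add: \<pi>S_eq)

lemma prob_space_\<pi>S: "prob_space \<pi>S"
proof (rule prob_spaceI)
  have "emeasure \<pi>S (space \<pi>S) = (\<integral>\<^sup>+s. ennreal (W s) \<partial>S)"
    unfolding \<pi>S_eq by (simp add: emeasure_density cong: nn_integral_cong)
  also have "\<dots> = 1" using post.emeasure_normalized by (simp add: normalized_density_def W_def Zp_def)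
  finally show "emeasure \<pi>S (space \<pi>S) = 1" .
qed

sublocale c1: coordinate_update S BS "ZS \<Otimes>\<^sub>M QS" "\<lambda>r \<beta>. (\<beta>, r)" "\<lambda>s \<beta>. (\<beta>, snd s)" W
proof
  show "(\<lambda>\<beta>. (\<beta>, r)) \<in> BS \<rightarrow>\<^sub>M S" if "r \<in> space (ZS \<Otimes>\<^sub>M QS)" for r unfolding S_def using that by simp
  show "(\<lambda>z. (snd z, snd (fst z))) \<in> S \<Otimes>\<^sub>M BS \<rightarrow>\<^sub>M S" unfolding S_def by measurable
qed (simp_all add: Fubini_beta)

sublocale c2: coordinate_update S ZS "BS \<Otimes>\<^sub>M QS" "\<lambda>r z. (fst r, z, snd r)" "\<lambda>s z. (fst s, z, snd (snd s))" W
proof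
  show "(\<lambda>z. (fst r, z, snd r)) \<in> ZS \<rightarrow>\<^sub>M S" if "r \<in> space (BS \<Otimes>\<^sub>M QS)" for r
    unfolding S_def using that by (simp add: space_pair_measure mem_Times_iff)
  show "(\<lambda>z. (fst (fst z), snd z, snd (snd (fst z)))) \<in> S \<Otimes>\<^sub>M ZS \<rightarrow>\<^sub>M S" unfolding S_def by measurable
qed (simp_all add: Fubini_z)

sublocale c3: coordinate_update S QS "BS \<Otimes>\<^sub>M ZS" "\<lambda>r q. (fst r, snd r, q)" "\<lambda>s q. (fst s, fst (snd s), q)" W
proof
  show "(\<lambda>q. (fst r, snd r, q)) \<in> QS \<rightarrow>\<^sub>M S" if "r \<in> space (BS \<Otimes>\<^sub>M ZS)" for r
    unfolding S_def using that by (simp add: space_pair_measure mem_Times_iff)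
  show "(\<lambda>z. (fst (fst z), fst (snd (fst z)), snd z)) \<in> S \<Otimes>\<^sub>M QS \<rightarrow>\<^sub>M S" unfolding S_def by measurable
qed (simp_all add: Fubini_q)

lemma \<pi>_eqs: "c1.\<pi> = \<pi>S" "c2.\<pi> = \<pi>S" "c3.\<pi> = \<pi>S"
  by (simp_all add: c1.\<pi>_def c2.\<pi>_def c3.\<pi>_def \<pi>S_eq)

definition k1 :: "state \<Rightarrow> (nat \<Rightarrow> real) measure" where "k1 s = cond_beta d a b l (fst (snd s)) (snd (snd s))"
definition k2 :: "state \<Rightarrow> (nat \<Rightarrow> nat) measure" where "k2 s = cond_z d a b l (fst s) (snd (snd s))"
definition k3 :: "state \<Rightarrow> real measure" where "k3 s = cond_q d a b l f (fst s) (fst (snd s))"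
definition km :: "state \<Rightarrow> (nat \<Rightarrow> real) measure" where "km s = mh_kernel d a b l \<sigma> (fst (snd s)) (snd (snd s)) (fst s)"

lemma k1_eq: "k1 s = normalized BS (\<lambda>\<beta>. w \<beta> (fst (snd s)) (snd (snd s)))" by (simp add: k1_def cond_beta_def)
lemma k2_eq: "k2 s = normalized ZS (\<lambda>z. w (fst s) z (snd (snd s)))" by (simp add: k2_def cond_z_def)
lemma k3_eq: "k3 s = normalized QS (\<lambda>q. w (fst s) (fst (snd s)) q * f q)" by (simp add: k3_def cond_q_def)

lemma spaces_not_empty: "space BS \<noteq> {}" "space ZS \<noteq> {}" "space QS \<noteq> {}"
proof -
  show "space BS \<noteq> {}" by (simp add: beta_space_LB space_LB RR_not_empty)
  show "space ZS \<noteq> {}" by (simp add: z_space_def space_PiM PiE_eq_empty_iff)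
  show "space QS \<noteq> {}" by (simp add: space_q_space)
qed

lemma coords2[measurable]:
  "(\<lambda>z. fst (fst z)) \<in> S \<Otimes>\<^sub>M N \<rightarrow>\<^sub>M BS" "(\<lambda>z. fst (snd (fst z))) \<in> S \<Otimes>\<^sub>M N \<rightarrow>\<^sub>M ZS" "(\<lambda>z. snd (snd (fst z))) \<in> S \<Otimes>\<^sub>M N \<rightarrow>\<^sub>M QS"
  by (rule measurable_compose[OF measurable_fst], rule coords)+

lemma k1_kernel: "k1 \<in> S \<rightarrow>\<^sub>M prob_algebra BS"
  unfolding k1_eq[abs_def]
proof (rule normalized_kernel)
  show "unnormalized_density BS (\<lambda>\<beta>. w \<beta> (fst (snd s)) (snd (snd s)))" if "s \<in> space S" for s
    using that by (intro unnormalized_beta) (auto simp: space_S)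
  show "(\<lambda>z. w (snd z) (fst (snd (fst z))) (snd (snd (fst z)))) \<in> borel_measurable (S \<Otimes>\<^sub>M BS)"
    by (rule weight_measurable[OF l_meas]) measurable
qed (use spaces_not_empty B.sigma_finite_measure_axioms in auto)

lemma k2_kernel: "k2 \<in> S \<rightarrow>\<^sub>M prob_algebra ZS"
  unfolding k2_eq[abs_def]
proof (rule normalized_kernel)
  show "unnormalized_density ZS (\<lambda>z. w (fst s) z (snd (snd s)))" if "s \<in> space S" for s
    using that by (intro unnormalized_z) (auto simp: space_S)
  show "(\<lambda>z. w (fst (fst z)) (snd z) (snd (snd (fst z)))) \<in> borel_measurable (S \<Otimes>\<^sub>M ZS)"
    by (rule weight_measurable[OF l_meas]) measurable
qed (use spaces_not_empty Zf.sigma_finite_measure_axioms in auto)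

lemma k3_kernel: "k3 \<in> S \<rightarrow>\<^sub>M prob_algebra QS"
  unfolding k3_eq[abs_def]
proof (rule normalized_kernel)
  show "unnormalized_density QS (\<lambda>q. w (fst s) (fst (snd s)) q * f q)" if "s \<in> space S" for s
    using that by (intro unnormalized_q) (auto simp: space_S)
  have [measurable]: "(\<lambda>z. w (fst (fst z)) (fst (snd (fst z))) (snd z)) \<in> borel_measurable (S \<Otimes>\<^sub>M QS)"
    by (rule weight_measurable[OF l_meas]) measurable
  show "(\<lambda>z. w (fst (fst z)) (fst (snd (fst z))) (snd z) * f (snd z)) \<in> borel_measurable (S \<Otimes>\<^sub>M QS)" by measurable
qed (use spaces_not_empty Q.sigma_finite_measure_axioms in auto)

lemma kernels:
  "c1.lifted k1 \<in> S \<rightarrow>\<^sub>M prob_algebra S" "c2.lifted k2 \<in> S \<rightarrow>\<^sub>M prob_algebra S" "c3.lifted k3 \<in> S \<rightarrow>\<^sub>M prob_algebra S"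
  by (rule c1.lifted_kernel[OF k1_kernel] c2.lifted_kernel[OF k2_kernel] c3.lifted_kernel[OF k3_kernel])+

text \<open>On each fibre the posterior density is a constant times the density being resampled. The
  factor \<open>f q\<close> belongs to the constant when \<open>\<beta>\<close> or \<open>z\<close>
  moves and to the density when \<open>q\<close> moves.\<close>

lemma W_coeff:
  "q \<in> space QS \<Longrightarrow> 0 \<le> f q / Zp" "W (\<beta>, z, q) = f q / Zp * w \<beta> z q" "W (\<beta>, z, q) = 1 / Zp * (w \<beta> z q * f q)"
  using Zp_pos f_nn[of q] by (auto simp: W_def wf_def)

lemma reversible_exact:
  "reversible \<pi>S (c1.lifted k1)" "reversible \<pi>S (c2.lifted k2)" "reversible \<pi>S (c3.lifted k3)"
proof -
  show "reversible \<pi>S (c1.lifted k1)"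
    unfolding \<pi>_eqs(1)[symmetric]
  proof (rule c1.reversible_lifted[OF k1_kernel])
    fix r and g h :: "_ \<Rightarrow> ennreal" assume r: "r \<in> space (ZS \<Otimes>\<^sub>M QS)" and gh: "g \<in> borel_measurable BS" "h \<in> borel_measurable BS"
    obtain z q where rz: "r = (z, q)" "z \<in> space ZS" "q \<in> space QS" using r by (auto simp: space_pair_measure)
    interpret u: unnormalized_density BS "\<lambda>\<beta>. w \<beta> z q" by (rule unnormalized_beta[OF rz(2,3)])
    show "(\<integral>\<^sup>+a. ennreal (W (a, r)) * (g a * (\<integral>\<^sup>+a'. h a' \<partial>k1 (a, r))) \<partial>BS) = (\<integral>\<^sup>+a. ennreal (W (a, r)) * (h a * (\<integral>\<^sup>+a'. g a' \<partial>k1 (a, r))) \<partial>BS)"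
      by (rule u.normalized_reversible[where c="f q / Zp"]) (use gh W_coeff(1)[OF rz(3)] in \<open>simp_all add: rz(1) W_coeff(2) k1_eq\<close>)
  qed
  show "reversible \<pi>S (c2.lifted k2)"
    unfolding \<pi>_eqs(2)[symmetric]
  proof (rule c2.reversible_lifted[OF k2_kernel])
    fix r and g h :: "_ \<Rightarrow> ennreal" assume r: "r \<in> space (BS \<Otimes>\<^sub>M QS)" and gh: "g \<in> borel_measurable ZS" "h \<in> borel_measurable ZS"
    obtain \<beta> q where rz: "r = (\<beta>, q)" "\<beta> \<in> space BS" "q \<in> space QS" using r by (auto simp: space_pair_measure)
    interpret u: unnormalized_density ZS "\<lambda>z. w \<beta> z q" by (rule unnormalized_z[OF rz(2,3)])
    show "(\<integral>\<^sup>+a. ennreal (W (fst r, a, snd r)) * (g a * (\<integral>\<^sup>+a'. h a' \<partial>k2 (fst r, a, snd r))) \<partial>ZS) = (\<integral>\<^sup>+a. ennreal (W (fst r, a, snd r)) * (h a * (\<integral>\<^sup>+a'. g a' \<partial>k2 (fst r, a, snd r))) \<partial>ZS)"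
      by (rule u.normalized_reversible[where c="f q / Zp"]) (use gh W_coeff(1)[OF rz(3)] in \<open>simp_all add: rz(1) W_coeff(2) k2_eq\<close>)
  qed
  show "reversible \<pi>S (c3.lifted k3)"
    unfolding \<pi>_eqs(3)[symmetric]
  proof (rule c3.reversible_lifted[OF k3_kernel])
    fix r and g h :: "_ \<Rightarrow> ennreal" assume r: "r \<in> space (BS \<Otimes>\<^sub>M ZS)" and gh: "g \<in> borel_measurable QS" "h \<in> borel_measurable QS"
    obtain \<beta> z where rz: "r = (\<beta>, z)" "\<beta> \<in> space BS" "z \<in> space ZS" using r by (auto simp: space_pair_measure)
    interpret u: unnormalized_density QS "\<lambda>q. w \<beta> z q * f q" by (rule unnormalized_q[OF rz(2,3)])
    show "(\<integral>\<^sup>+a. ennreal (W (fst r, snd r, a)) * (g a * (\<integral>\<^sup>+a'. h a' \<partial>k3 (fst r, snd r, a))) \<partial>QS) = (\<integral>\<^sup>+a. ennreal (W (fst r, snd r, a)) * (h a * (\<integral>\<^sup>+a'. g a' \<partial>k3 (fst r, snd r, a))) \<partial>QS)"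
      by (rule u.normalized_reversible[where c="1 / Zp"]) (use gh Zp_pos in \<open>simp_all add: rz(1) W_coeff(3) k3_eq\<close>)
  qed
qed

lemma coordinate_integral_measurable:
  assumes [measurable]: "F \<in> borel_measurable S"
  shows "(\<lambda>r. \<integral>\<^sup>+\<beta>. F (\<beta>, r) \<partial>BS) \<in> borel_measurable (ZS \<Otimes>\<^sub>M QS)"
    and "(\<lambda>r. \<integral>\<^sup>+z. F (fst r, z, snd r) \<partial>ZS) \<in> borel_measurable (BS \<Otimes>\<^sub>M QS)"
    and "(\<lambda>r. \<integral>\<^sup>+q. F (fst r, snd r, q) \<partial>QS) \<in> borel_measurable (BS \<Otimes>\<^sub>M ZS)"
proof -
  have F: "F \<in> borel_measurable (BS \<Otimes>\<^sub>M (ZS \<Otimes>\<^sub>M QS))" using assms by (simp add: S_def)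
  have 1: "(\<lambda>z. (snd z, fst z)) \<in> (ZS \<Otimes>\<^sub>M QS) \<Otimes>\<^sub>M BS \<rightarrow>\<^sub>M BS \<Otimes>\<^sub>M (ZS \<Otimes>\<^sub>M QS)" by measurable
  have 2: "(\<lambda>z. (fst (fst z), snd z, snd (fst z))) \<in> (BS \<Otimes>\<^sub>M QS) \<Otimes>\<^sub>M ZS \<rightarrow>\<^sub>M BS \<Otimes>\<^sub>M (ZS \<Otimes>\<^sub>M QS)" by measurable
  have 3: "(\<lambda>z. (fst (fst z), snd (fst z), snd z)) \<in> (BS \<Otimes>\<^sub>M ZS) \<Otimes>\<^sub>M QS \<rightarrow>\<^sub>M BS \<Otimes>\<^sub>M (ZS \<Otimes>\<^sub>M QS)" by measurable
  show "(\<lambda>r. \<integral>\<^sup>+\<beta>. F (\<beta>, r) \<partial>BS) \<in> borel_measurable (ZS \<Otimes>\<^sub>M QS)"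
    by (rule B.borel_measurable_nn_integral) (use measurable_compose[OF 1 F] in \<open>simp add: split_beta'\<close>)
  show "(\<lambda>r. \<integral>\<^sup>+z. F (fst r, z, snd r) \<partial>ZS) \<in> borel_measurable (BS \<Otimes>\<^sub>M QS)"
    by (rule Zf.borel_measurable_nn_integral) (use measurable_compose[OF 2 F] in \<open>simp add: split_beta'\<close>)
  show "(\<lambda>r. \<integral>\<^sup>+q. F (fst r, snd r, q) \<partial>QS) \<in> borel_measurable (BS \<Otimes>\<^sub>M ZS)"
    by (rule Q.borel_measurable_nn_integral) (use measurable_compose[OF 3 F] in \<open>simp add: split_beta'\<close>)
qed

lemma positive_exact:
  assumes h[measurable]: "h \<in> borel_measurable S"
  shows "dform \<pi>S (c1.lifted k1) h \<le> 2 * (\<integral>\<^sup>+x. ennreal ((h x)\<^sup>2) \<partial>\<pi>S)"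
    and "dform \<pi>S (c2.lifted k2) h \<le> 2 * (\<integral>\<^sup>+x. ennreal ((h x)\<^sup>2) \<partial>\<pi>S)"
    and "dform \<pi>S (c3.lifted k3) h \<le> 2 * (\<integral>\<^sup>+x. ennreal ((h x)\<^sup>2) \<partial>\<pi>S)"
proof -
  have m: "(\<lambda>s. ennreal (W s) * ennreal ((h s)\<^sup>2)) \<in> borel_measurable S" by measurable
  note Rm = coordinate_integral_measurable[OF m]
  show "dform \<pi>S (c1.lifted k1) h \<le> 2 * (\<integral>\<^sup>+x. ennreal ((h x)\<^sup>2) \<partial>\<pi>S)"
    unfolding \<pi>_eqs(1)[symmetric]
  proof (rule c1.dform_lifted_le[OF k1_kernel h _ Rm(1)])
    fix r and g :: "_ \<Rightarrow> real" assume r: "r \<in> space (ZS \<Otimes>\<^sub>M QS)" and g: "g \<in> borel_measurable BS"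
    obtain z q where rz: "r = (z, q)" "z \<in> space ZS" "q \<in> space QS" using r by (auto simp: space_pair_measure)
    interpret u: unnormalized_density BS "\<lambda>\<beta>. w \<beta> z q" by (rule unnormalized_beta[OF rz(2,3)])
    show "(\<integral>\<^sup>+a. ennreal (W (a, r)) * (\<integral>\<^sup>+a'. ennreal ((g a' - g a)\<^sup>2) \<partial>k1 (a, r)) \<partial>BS) \<le> 2 * (\<integral>\<^sup>+a. ennreal (W (a, r)) * ennreal ((g a)\<^sup>2) \<partial>BS)"
      by (rule u.normalized_positive[where c="f q / Zp"]) (use g W_coeff(1)[OF rz(3)] in \<open>simp_all add: rz(1) W_coeff(2) k1_eq\<close>)
  qed
  show "dform \<pi>S (c2.lifted k2) h \<le> 2 * (\<integral>\<^sup>+x. ennreal ((h x)\<^sup>2) \<partial>\<pi>S)"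
    unfolding \<pi>_eqs(2)[symmetric]
  proof (rule c2.dform_lifted_le[OF k2_kernel h _ Rm(2)])
    fix r and g :: "_ \<Rightarrow> real" assume r: "r \<in> space (BS \<Otimes>\<^sub>M QS)" and g: "g \<in> borel_measurable ZS"
    obtain \<beta> q where rz: "r = (\<beta>, q)" "\<beta> \<in> space BS" "q \<in> space QS" using r by (auto simp: space_pair_measure)
    interpret u: unnormalized_density ZS "\<lambda>z. w \<beta> z q" by (rule unnormalized_z[OF rz(2,3)])
    show "(\<integral>\<^sup>+a. ennreal (W (fst r, a, snd r)) * (\<integral>\<^sup>+a'. ennreal ((g a' - g a)\<^sup>2) \<partial>k2 (fst r, a, snd r)) \<partial>ZS) \<le> 2 * (\<integral>\<^sup>+a. ennreal (W (fst r, a, snd r)) * ennreal ((g a)\<^sup>2) \<partial>ZS)"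
      by (rule u.normalized_positive[where c="f q / Zp"]) (use g W_coeff(1)[OF rz(3)] in \<open>simp_all add: rz(1) W_coeff(2) k2_eq\<close>)
  qed
  show "dform \<pi>S (c3.lifted k3) h \<le> 2 * (\<integral>\<^sup>+x. ennreal ((h x)\<^sup>2) \<partial>\<pi>S)"
    unfolding \<pi>_eqs(3)[symmetric]
  proof (rule c3.dform_lifted_le[OF k3_kernel h _ Rm(3)])
    fix r and g :: "_ \<Rightarrow> real" assume r: "r \<in> space (BS \<Otimes>\<^sub>M ZS)" and g: "g \<in> borel_measurable QS"
    obtain \<beta> z where rz: "r = (\<beta>, z)" "\<beta> \<in> space BS" "z \<in> space ZS" using r by (auto simp: space_pair_measure)
    interpret u: unnormalized_density QS "\<lambda>q. w \<beta> z q * f q" by (rule unnormalized_q[OF rz(2,3)])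
    show "(\<integral>\<^sup>+a. ennreal (W (fst r, snd r, a)) * (\<integral>\<^sup>+a'. ennreal ((g a' - g a)\<^sup>2) \<partial>k3 (fst r, snd r, a)) \<partial>QS) \<le> 2 * (\<integral>\<^sup>+a. ennreal (W (fst r, snd r, a)) * ennreal ((g a)\<^sup>2) \<partial>QS)"
      by (rule u.normalized_positive[where c="1 / Zp"]) (use g Zp_pos in \<open>simp_all add: rz(1) W_coeff(3) k3_eq\<close>)
  qed
qed

lemma W_U: "W (\<beta>, z, q) = f q / Zp * cz z q * exp (- U z \<beta>)" unfolding W_coeff(2) w_eq by simp

lemma k1_gibbs:
  assumes z: "z \<in> space ZS" and q: "q \<in> space QS" shows "k1 (\<beta>, z, q) = gibbs {..<d} (U z)"
proof -
  have "normalized_density BS (\<lambda>\<beta>. w \<beta> z q) x = exp (- U z x) / (\<integral>y. exp (- U z y) \<partial>BS)" for x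
    unfolding normalized_density_def w_eq using cz(1)[OF z q] by simp
  then show ?thesis by (simp add: k1_eq normalized_def gibbs_def beta_space_LB)
qed

text \<open>Normalization and the factor \<open>cz z q\<close> cancel in the acceptance ratio,
  leaving a difference of potentials.\<close>

lemma km_eq:
  assumes z: "z \<in> space ZS" and q: "q \<in> space QS"
  shows "km (\<beta>, z, q) = smooth_target.metropolis {..<d} (U z) (\<tau> z) \<sigma> \<beta>"
proof -
  interpret T: smooth_target "{..<d}" "U z" "\<tau> z" \<sigma> "b * L + 1" by (rule smooth_U[OF z])
  let ?dens = "normalized_density BS (\<lambda>\<beta>. w \<beta> z q)"
  have I: "(\<integral>\<beta>. w \<beta> z q \<partial>BS) = cz z q * T.Z"
    unfolding w_eq T.Z_def beta_space_LB by (rule integral_mult_right_zero)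
  have r: "?dens x / ?dens y = exp (U z y - U z x)" for x y
    unfolding normalized_density_def I unfolding w_eq using cz(1)[OF z q] T.Z_pos
    by (simp add: exp_diff exp_minus field_simps)
  have "proposal d a b \<sigma> z \<beta> = gauss {..<d} T.s \<beta>"
    unfolding proposal_def gauss_def using \<sigma>(1)
    by (intro PiM_cong refl) (simp add: \<tau>_def real_sqrt_mult mult.commute)
  then show ?thesis
    unfolding km_def mh_kernel_def T.metropolis_def Let_def fst_conv snd_conv r by (simp add: beta_space_LB)
qed

text \<open>The fibre results hold for each fixed \<open>z\<close>, while a kernel must be
  measurable in the whole state. This is seen from the explicit integral over proposals.\<close>

lemma km_kernel: "km \<in> S \<rightarrow>\<^sub>M prob_algebra BS"
proof (rule measurable_prob_algebraI)
  have props: "prob_space (km s) \<and> sets (km s) = sets BS" if sS: "s \<in> space S" for s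
  proof -
    obtain \<beta> z q where s: "s = (\<beta>, z, q)" and m: "\<beta> \<in> space BS" "z \<in> space ZS" "q \<in> space QS"
      using sS by (auto simp: space_S)
    interpret T: smooth_target "{..<d}" "U z" "\<tau> z" \<sigma> "b * L + 1" by (rule smooth_U[OF m(2)])
    show ?thesis unfolding s km_eq[OF m(2,3)]
      using T.prob_space_metropolis[of \<beta>] T.sets_metropolis[of \<beta>] m(1) by (simp add: beta_space_LB space_LB)
  qed
  then show "prob_space (km s)" if "s \<in> space S" for s using that by blast
  show "km \<in> S \<rightarrow>\<^sub>M subprob_algebra BS"
  proof (rule measurable_subprob_algebra)
    show "subprob_space (km s)" if "s \<in> space S" for s using props[OF that] by (auto intro: prob_space_imp_subprob_space)
    show "sets (km s) = sets BS" if "s \<in> space S" for s using props[OF that] by blast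
    fix A assume A[measurable]: "A \<in> sets BS"
    \<comment> \<open>The proposal density and the acceptance probability as functions of the full
      state, jointly measurable in state and proposal.\<close>
    define Gd where "Gd s y = (\<Prod>j<d. normal_density (fst s j) (\<sigma> * sqrt (slab_var a b (fst (snd s) j))) (y j))" for s :: state and y :: "nat \<Rightarrow> real"
    define ac where "ac s y = min 1 (exp (pot d l (\<lambda>j. slab_var a b (fst (snd s) j)) (fst s) - pot d l (\<lambda>j. slab_var a b (fst (snd s) j)) y))" for s :: state and y
    have [measurable]: "(\<lambda>p. Gd (fst p) (snd p)) \<in> borel_measurable (S \<Otimes>\<^sub>M BS)"
      unfolding Gd_def
    proof (rule borel_measurable_prod)
      fix j assume "j \<in> {..<d}"
      then have j: "j < d" by simp
      note [measurable] = beta_component[OF coords2(1) j] beta_component[OF measurable_snd j] slab_var_measurable[OF coords2(2) j]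
      show "(\<lambda>p. normal_density (fst (fst p) j) (\<sigma> * sqrt (slab_var a b (fst (snd (fst p)) j))) (snd p j)) \<in> borel_measurable (S \<Otimes>\<^sub>M BS)"
        unfolding normal_density_def by measurable
    qed
    have [measurable]: "(\<lambda>p. pot d l (\<lambda>j. slab_var a b (fst (snd (fst p)) j)) (fst (fst p))) \<in> borel_measurable (S \<Otimes>\<^sub>M BS)"
      "(\<lambda>p. pot d l (\<lambda>j. slab_var a b (fst (snd (fst p)) j)) (snd p)) \<in> borel_measurable (S \<Otimes>\<^sub>M BS)"
      by (rule pot_measurable[OF l_meas], measurable)+
    have [measurable]: "(\<lambda>p. ac (fst p) (snd p)) \<in> borel_measurable (S \<Otimes>\<^sub>M BS)" unfolding ac_def by measurable
    have "(\<lambda>s. \<integral>\<^sup>+y. ennreal (Gd s y) * (ennreal (ac s y) * indicator A y + ennreal (1 - ac s y) * indicator A (fst s)) \<partial>BS) \<in> borel_measurable S"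
      by (rule B.borel_measurable_nn_integral) (simp add: split_beta')
    then show "(\<lambda>s. emeasure (km s) A) \<in> borel_measurable S"
    proof (rule measurable_cong[THEN iffD2, rotated])
      fix s assume "s \<in> space S"
      then obtain \<beta> z q where s: "s = (\<beta>, z, q)" and m: "\<beta> \<in> space BS" "z \<in> space ZS" "q \<in> space QS"
        by (auto simp: space_S)
      interpret T: smooth_target "{..<d}" "U z" "\<tau> z" \<sigma> "b * L + 1" by (rule smooth_U[OF m(2)])
      have "A \<in> sets (T.metropolis \<beta>)" using A by (simp add: T.sets_metropolis beta_space_LB)
      then have "emeasure (km s) A = (\<integral>\<^sup>+y. indicator A y \<partial>T.metropolis \<beta>)" unfolding s km_eq[OF m(2,3)] by simp
      also have "\<dots> = (\<integral>\<^sup>+y. ennreal (gdens {..<d} T.s \<beta> y) * (ennreal (T.accr \<beta> y) * indicator A y + ennreal (1 - T.accr \<beta> y) * indicator A \<beta>) \<partial>LB {..<d})"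
        by (rule T.nn_integral_metropolis) (use m(1) A in \<open>simp_all add: beta_space_LB space_LB\<close>)
      also have "\<dots> = (\<integral>\<^sup>+y. ennreal (Gd s y) * (ennreal (ac s y) * indicator A y + ennreal (1 - ac s y) * indicator A (fst s)) \<partial>BS)"
        unfolding T.accr_def by (simp add: beta_space_LB gdens_def Gd_def ac_def s U_def \<tau>_def[abs_def])
      finally show "emeasure (km s) A = (\<integral>\<^sup>+y. ennreal (Gd s y) * (ennreal (ac s y) * indicator A y + ennreal (1 - ac s y) * indicator A (fst s)) \<partial>BS)" .
    qed
  qed
qed

lemma W_split:
  assumes "z \<in> space ZS" "q \<in> space QS"
  shows "ennreal (W (\<beta>, z, q)) * X = ennreal (f q / Zp * cz z q) * (ennreal (exp (- U z \<beta>)) * X)"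
proof -
  have "0 \<le> f q / Zp * cz z q" using cz(1)[OF assms] W_coeff(1)[OF assms(2)] by (intro mult_nonneg_nonneg) auto
  then show ?thesis unfolding W_U by (subst ennreal_mult) (simp_all only: mult.assoc exp_ge_zero)
qed

lemma reversible_km: "reversible \<pi>S (c1.lifted km)"
  unfolding \<pi>_eqs(1)[symmetric]
proof (rule c1.reversible_lifted[OF km_kernel])
  fix r and g h :: "_ \<Rightarrow> ennreal" assume r: "r \<in> space (ZS \<Otimes>\<^sub>M QS)" and gh: "g \<in> borel_measurable BS" "h \<in> borel_measurable BS"
  obtain z q where rz: "r = (z, q)" "z \<in> space ZS" "q \<in> space QS" using r by (auto simp: space_pair_measure)
  interpret T: smooth_target "{..<d}" "U z" "\<tau> z" \<sigma> "b * L + 1" by (rule smooth_U[OF rz(2)])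
  have "T.metropolis \<in> LB {..<d} \<rightarrow>\<^sub>M prob_algebra (LB {..<d})"
  proof -
    have "(\<lambda>\<beta>. (\<beta>, z, q)) \<in> BS \<rightarrow>\<^sub>M S" using rz by (simp add: S_def)
    from measurable_compose[OF this km_kernel] show ?thesis unfolding km_eq[OF rz(2,3)] by (simp add: beta_space_LB)
  qed
  note K[measurable] = measurable_prob_algebraD[OF this]
  have gh': "g \<in> borel_measurable (LB {..<d})" "h \<in> borel_measurable (LB {..<d})" using gh by (simp_all add: beta_space_LB)
  have m: "(\<lambda>x. \<integral>\<^sup>+y. v y \<partial>T.metropolis x) \<in> borel_measurable (LB {..<d})" if "v \<in> borel_measurable (LB {..<d})" for v
    by (rule measurable_compose[OF K nn_integral_measurable_subprob_algebra[OF that]])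
  have e: "(\<integral>\<^sup>+x. c * (ennreal (exp (- U z x)) * (u x * (\<integral>\<^sup>+y. v y \<partial>T.metropolis x))) \<partial>LB {..<d})
     = c * (\<integral>\<^sup>+x. ennreal (exp (- U z x)) * (u x * (\<integral>\<^sup>+y. v y \<partial>T.metropolis x)) \<partial>LB {..<d})"
    if "u \<in> borel_measurable (LB {..<d})" "v \<in> borel_measurable (LB {..<d})" for u v and c :: ennreal
  proof -
    note [measurable] = that(1) m[OF that(2)]
    show ?thesis by (rule nn_integral_cmult) measurable
  qed
  show "(\<integral>\<^sup>+a. ennreal (W (a, r)) * (g a * (\<integral>\<^sup>+a'. h a' \<partial>km (a, r))) \<partial>BS) = (\<integral>\<^sup>+a. ennreal (W (a, r)) * (h a * (\<integral>\<^sup>+a'. g a' \<partial>km (a, r))) \<partial>BS)"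
    unfolding rz(1) km_eq[OF rz(2,3)] W_split[OF rz(2,3)] beta_space_LB e[OF gh'] e[OF gh'(2,1)]
    by (rule arg_cong[OF T.metropolis_reversible[OF gh']])
qed

text \<open>On the fibre over \<open>(z, q)\<close> all three quantities carry the same factor
  \<open>C\<close>, which may be 0 where \<open>f q = 0\<close>; comparisons thus reduce to those
  for \<open>gibbs {..<d} (U z)\<close>.\<close>

lemma fibre_forms:
  assumes z: "z \<in> space ZS" and q: "q \<in> space QS" and h: "h \<in> borel_measurable BS"
  defines "C \<equiv> ennreal (f q / Zp * cz z q)"
  shows "(\<integral>\<^sup>+\<beta>. ennreal (W (\<beta>, z, q)) * (\<integral>\<^sup>+\<beta>'. ennreal ((h \<beta>' - h \<beta>)\<^sup>2) \<partial>k1 (\<beta>, z, q)) \<partial>BS)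
       = C * (ennreal (gibbs_potential.Z {..<d} (U z)) * pairs (gibbs {..<d} (U z)) h)" (is ?exact)
    and "(\<integral>\<^sup>+\<beta>. ennreal (W (\<beta>, z, q)) * (\<integral>\<^sup>+\<beta>'. ennreal ((h \<beta>' - h \<beta>)\<^sup>2) \<partial>km (\<beta>, z, q)) \<partial>BS)
       = C * rw_form {..<d} (U z) (\<lambda>j. \<sigma> * sqrt (\<tau> z j)) h" (is ?mh)
    and "(\<integral>\<^sup>+\<beta>. ennreal (W (\<beta>, z, q)) * ennreal ((h \<beta>)\<^sup>2) \<partial>BS) = C * (\<integral>\<^sup>+\<beta>. ennreal ((h \<beta>)\<^sup>2) * ennreal (exp (- U z \<beta>)) \<partial>LB {..<d})" (is ?sq)
proof -
  interpret T: smooth_target "{..<d}" "U z" "\<tau> z" \<sigma> "b * L + 1" by (rule smooth_U[OF z])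
  have hm[measurable]: "h \<in> borel_measurable (LB {..<d})" using h by (simp add: beta_space_LB)
  interpret P: prob_space "gibbs {..<d} (U z)" by (rule T.prob_space_gibbs)
  have [measurable]: "(\<lambda>\<beta>. \<integral>\<^sup>+\<beta>'. ennreal ((h \<beta>' - h \<beta>)\<^sup>2) \<partial>gibbs {..<d} (U z)) \<in> borel_measurable (LB {..<d})"
    unfolding measurable_cong_sets[OF sets_gibbs[symmetric] refl] by (rule P.borel_measurable_nn_integral) simp
  show ?exact
    unfolding k1_gibbs[OF z q] W_split[OF z q] beta_space_LB C_def pairs_def
    by (subst nn_integral_cmult, simp, subst (2) T.nn_integral_gibbs(2), simp)
       (use T.Z_pos in \<open>simp add: mult.assoc[symmetric] ennreal_mult[symmetric]\<close>)
  have "T.metropolis \<in> LB {..<d} \<rightarrow>\<^sub>M prob_algebra (LB {..<d})"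
  proof -
    have "(\<lambda>\<beta>. (\<beta>, z, q)) \<in> BS \<rightarrow>\<^sub>M S" using z q by (simp add: S_def)
    from measurable_compose[OF this km_kernel] show ?thesis unfolding km_eq[OF z q] by (simp add: beta_space_LB)
  qed
  note K = measurable_prob_algebraD[OF this]
  have [measurable]: "(\<lambda>\<beta>. \<integral>\<^sup>+\<beta>'. ennreal ((h \<beta>' - h \<beta>)\<^sup>2) \<partial>T.metropolis \<beta>) \<in> borel_measurable (LB {..<d})"
    by (rule nn_integral_measurable_subprob_algebra2[OF _ K]) measurable
  show ?mh
    unfolding km_eq[OF z q] W_split[OF z q] beta_space_LB C_def
    by (subst nn_integral_cmult) (simp_all add: T.metropolis_rw_form)
  show ?sq
    unfolding W_split[OF z q] beta_space_LB C_def
    by (subst nn_integral_cmult) (simp_all add: mult.commute)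
qed

section \<open>Comparison of the exact and the hybrid kernel\<close>

definition D :: real where "D = real d * (b * L + 1)"

lemma D_ge_1: "1 \<le> D"
proof -
  have "1 * 1 \<le> real d * (b * L + 1)" using d ab L by (intro mult_mono) auto
  then show ?thesis by (simp add: D_def)
qed

lemma \<sigma>_D: "\<sigma>\<^sup>2 = 1 / (2 * D)" using \<sigma>(2) by (simp add: D_def mult.assoc)

lemma fibre_measurable:
  assumes h: "h \<in> borel_measurable S" and r: "(z, q) \<in> space (ZS \<Otimes>\<^sub>M QS)"
  shows "(\<lambda>\<beta>. h (\<beta>, z, q)) \<in> borel_measurable BS"
  using measurable_compose[OF c1.u[OF r] h] .

lemma dform_km_le:
  assumes h: "h \<in> borel_measurable S"
  shows "dform \<pi>S (c1.lifted km) h \<le> dform \<pi>S (c1.lifted k1) h"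
  unfolding \<pi>_eqs(1)[symmetric] c1.dform_lifted[OF km_kernel h] c1.dform_lifted[OF k1_kernel h]
proof (rule nn_integral_mono)
  fix r assume r: "r \<in> space (ZS \<Otimes>\<^sub>M QS)"
  obtain z q where rz: "r = (z, q)" "z \<in> space ZS" "q \<in> space QS" using r by (auto simp: space_pair_measure)
  interpret T: smooth_target "{..<d}" "U z" "\<tau> z" \<sigma> "b * L + 1" by (rule smooth_U[OF rz(2)])
  note hm = fibre_measurable[OF h r[unfolded rz(1)]]
  show "(\<integral>\<^sup>+\<beta>. ennreal (W (\<beta>, r)) * (\<integral>\<^sup>+\<beta>'. ennreal ((h (\<beta>', r) - h (\<beta>, r))\<^sup>2) \<partial>km (\<beta>, r)) \<partial>BS)
    \<le> (\<integral>\<^sup>+\<beta>. ennreal (W (\<beta>, r)) * (\<integral>\<^sup>+\<beta>'. ennreal ((h (\<beta>', r) - h (\<beta>, r))\<^sup>2) \<partial>k1 (\<beta>, r)) \<partial>BS)"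
    unfolding rz(1) fibre_forms(1,2)[OF rz(2,3) hm]
    using hm by (intro mult_left_mono T.rw_form_le_pairs) (simp_all add: beta_space_LB)
qed

lemma dform_k1_le:
  assumes h: "h \<in> borel_measurable S"
  shows "dform \<pi>S (c1.lifted k1) h \<le> ennreal (1000000000 * D) * dform \<pi>S (c1.lifted km) h"
proof -
  have "dform \<pi>S (c1.lifted k1) h \<le> (\<integral>\<^sup>+r. ennreal (1000000000 * D) * (\<integral>\<^sup>+\<beta>. ennreal (W (\<beta>, r)) * (\<integral>\<^sup>+\<beta>'. ennreal ((h (\<beta>', r) - h (\<beta>, r))\<^sup>2) \<partial>km (\<beta>, r)) \<partial>BS) \<partial>(ZS \<Otimes>\<^sub>M QS))"
    unfolding \<pi>_eqs(1)[symmetric] c1.dform_lifted[OF k1_kernel h]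
  proof (rule nn_integral_mono)
    fix r assume r: "r \<in> space (ZS \<Otimes>\<^sub>M QS)"
    obtain z q where rz: "r = (z, q)" "z \<in> space ZS" "q \<in> space QS" using r by (auto simp: space_pair_measure)
    interpret T: smooth_target "{..<d}" "U z" "\<tau> z" \<sigma> "b * L + 1" by (rule smooth_U[OF rz(2)])
    note hm = fibre_measurable[OF h r[unfolded rz(1)]]
    let ?h = "\<lambda>\<beta>. h (\<beta>, z, q)"
    let ?rw = "rw_form {..<d} (U z) (\<lambda>j. \<sigma> * sqrt (\<tau> z j)) ?h"
    have "\<sigma>\<^sup>2 \<le> 1" using D_ge_1 by (simp add: \<sigma>_D)
    then have "ennreal T.Z * pairs (gibbs {..<d} (U z)) ?h \<le> ennreal T.Z * (ennreal (90000000 / \<sigma>\<^sup>2 / T.Z) * ?rw)"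
      using hm by (intro mult_left_mono T.spectral_gap) (simp_all add: beta_space_LB)
    \<comment> \<open>The step size gives \<open>1 / \<sigma>\<^sup>2 = 2 * D\<close>: here the
      dimension and the smoothness enter the final constant.\<close>
    also have "\<dots> = ennreal (180000000 * D) * ?rw"
      using T.Z_pos D_ge_1 by (simp add: mult.assoc[symmetric] ennreal_mult[symmetric] \<sigma>_D)
    also have "\<dots> \<le> ennreal (1000000000 * D) * ?rw"
      using D_ge_1 by (intro mult_right_mono ennreal_leI) auto
    finally have "ennreal (f q / Zp * cz z q) * (ennreal T.Z * pairs (gibbs {..<d} (U z)) ?h) \<le> ennreal (1000000000 * D) * (ennreal (f q / Zp * cz z q) * ?rw)"
      by (subst mult.left_commute) (rule mult_left_mono, simp_all)
    then show "(\<integral>\<^sup>+\<beta>. ennreal (W (\<beta>, r)) * (\<integral>\<^sup>+\<beta>'. ennreal ((h (\<beta>', r) - h (\<beta>, r))\<^sup>2) \<partial>k1 (\<beta>, r)) \<partial>BS)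
      \<le> ennreal (1000000000 * D) * (\<integral>\<^sup>+\<beta>. ennreal (W (\<beta>, r)) * (\<integral>\<^sup>+\<beta>'. ennreal ((h (\<beta>', r) - h (\<beta>, r))\<^sup>2) \<partial>km (\<beta>, r)) \<partial>BS)"
      unfolding rz(1) fibre_forms(1,2)[OF rz(2,3) hm] .
  qed
  also have "\<dots> = ennreal (1000000000 * D) * dform \<pi>S (c1.lifted km) h"
    unfolding \<pi>_eqs(1)[symmetric] c1.dform_lifted[OF km_kernel h]
  proof (rule nn_integral_cmult)
    have i: "(\<lambda>s. \<integral>\<^sup>+\<beta>'. ennreal ((h (\<beta>', snd s) - h s)\<^sup>2) \<partial>km s) \<in> borel_measurable S"
    proof (rule nn_integral_measurable_subprob_algebra2[OF _ measurable_prob_algebraD[OF km_kernel]])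
      have "(\<lambda>p. h (snd p, snd (fst p))) \<in> borel_measurable (S \<Otimes>\<^sub>M BS)"
        by (rule measurable_compose[OF _ h]) (simp add: S_def)
      moreover have "(\<lambda>p. h (fst p)) \<in> borel_measurable (S \<Otimes>\<^sub>M BS)" by (rule measurable_compose[OF measurable_fst h])
      ultimately show "(\<lambda>(s, \<beta>'). ennreal ((h (\<beta>', snd s) - h s)\<^sup>2)) \<in> borel_measurable (S \<Otimes>\<^sub>M BS)"
        unfolding split_beta' by measurable
    qed
    have "(\<lambda>s. ennreal (W s) * (\<integral>\<^sup>+\<beta>'. ennreal ((h (\<beta>', snd s) - h s)\<^sup>2) \<partial>km s)) \<in> borel_measurable S"
      using i by measurable
    from coordinate_integral_measurable(1)[OF this]
    show "(\<lambda>r. \<integral>\<^sup>+\<beta>. ennreal (W (\<beta>, r)) * (\<integral>\<^sup>+\<beta>'. ennreal ((h (\<beta>', r) - h (\<beta>, r))\<^sup>2) \<partial>km (\<beta>, r)) \<partial>BS) \<in> borel_measurable (ZS \<Otimes>\<^sub>M QS)"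
      by simp
  qed
  finally show ?thesis .
qed

lemma positive_km:
  assumes h: "h \<in> borel_measurable S"
  shows "dform \<pi>S (c1.lifted km) h \<le> 2 * (\<integral>\<^sup>+x. ennreal ((h x)\<^sup>2) \<partial>\<pi>S)"
  using dform_km_le[OF h] positive_exact(1)[OF h] by (rule order_trans)

sublocale ex: three_kernels \<pi>S S "c1.lifted k1" "c2.lifted k2" "c3.lifted k3" p1 p2 p3
proof -
  interpret prob_space \<pi>S by (rule prob_space_\<pi>S)
  show "three_kernels \<pi>S S (c1.lifted k1) (c2.lifted k2) (c3.lifted k3) p1 p2 p3"
    by unfold_locales (fact sets_\<pi>S kernels reversible_exact p | rule positive_exact, assumption)+
qed

sublocale hy: three_kernels \<pi>S S "c1.lifted km" "c2.lifted k2" "c3.lifted k3" p1 p2 p3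
proof -
  interpret prob_space \<pi>S by (rule prob_space_\<pi>S)
  show "three_kernels \<pi>S S (c1.lifted km) (c2.lifted k2) (c3.lifted k3) p1 p2 p3"
    by unfold_locales (fact sets_\<pi>S c1.lifted_kernel[OF km_kernel] kernels reversible_exact reversible_km p | rule positive_km positive_exact, assumption)+
qed

lemma gibbs_kernel_eq: "gibbs_kernel d a b l f p1 p2 p3 = ex.K"
proof
  fix s show "gibbs_kernel d a b l f p1 p2 p3 s = ex.K s"
    by (cases s) (simp add: gibbs_kernel_def random_scan_def ex.K_def c1.lifted_def c2.lifted_def c3.lifted_def k1_def k2_def k3_def)
qed

lemma hybrid_kernel_eq: "hybrid_kernel d a b l f \<sigma> p1 p2 p3 = hy.K"
proof
  fix s show "hybrid_kernel d a b l f \<sigma> p1 p2 p3 s = hy.K s"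
    by (cases s) (simp add: hybrid_kernel_def random_scan_def hy.K_def c1.lifted_def c2.lifted_def c3.lifted_def km_def k2_def k3_def)
qed

lemma borel_\<pi>S: "h \<in> borel_measurable \<pi>S \<Longrightarrow> h \<in> borel_measurable S"
  by (simp add: measurable_cong_sets[OF sets_\<pi>S refl])

lemma dform_hybrid_le:
  assumes "h \<in> borel_measurable \<pi>S" shows "dform \<pi>S hy.K h \<le> ennreal 1 * dform \<pi>S ex.K h"
  using dform_km_le[OF borel_\<pi>S[OF assms]]
  by (simp add: ex.dform_K hy.dform_K borel_\<pi>S[OF assms] add_mono mult_left_mono)

lemma dform_gibbs_le:
  assumes "h \<in> borel_measurable \<pi>S" shows "dform \<pi>S ex.K h \<le> ennreal (1000000000 * D) * dform \<pi>S hy.K h"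
proof -
  note h = borel_\<pi>S[OF assms]
  let ?c = "ennreal (1000000000 * D)"
  have 1: "1 \<le> ?c" using D_ge_1 by simp
  \<comment> \<open>The updates of \<open>z\<close> and \<open>q\<close> are shared by both kernels;
    a constant of at least 1 may be put in front of them as well.\<close>
  have ge: "X \<le> ?c * X" for X using mult_right_mono[OF 1, of X] by simp
  have "dform \<pi>S ex.K h \<le> ennreal p1 * (?c * dform \<pi>S (c1.lifted km) h) + ennreal p2 * (?c * dform \<pi>S (c2.lifted k2) h) + ennreal p3 * (?c * dform \<pi>S (c3.lifted k3) h)"
    unfolding ex.dform_K[OF h] by (intro add_mono mult_left_mono dform_k1_le[OF h] ge) auto
  also have "\<dots> = ?c * dform \<pi>S hy.K h" unfolding hy.dform_K[OF h] by (simp add: distrib_left mult_ac)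
  finally show ?thesis .
qed

text \<open>The general comparisons with \<open>\<kappa> = D / C0\<close> in one direction and
  \<open>\<kappa> = 1\<close> in the other, where the term with \<open>\<kappa> - 1\<close>
  disappears.\<close>

lemma comparison:
  fixes C0 :: real defines "C0 \<equiv> 1 / 1000000000"
  shows "C0 / D * (1 - kernel_norm \<pi>S ex.K) \<le> 1 - kernel_norm \<pi>S hy.K" "1 - kernel_norm \<pi>S hy.K \<le> 1 - kernel_norm \<pi>S ex.K"
    and "g \<in> L20 \<pi>S \<Longrightarrow> asymp_var \<pi>S ex.K g \<le> asymp_var \<pi>S hy.K g"
    and "g \<in> L20 \<pi>S \<Longrightarrow> asymp_var \<pi>S hy.K g \<le> ereal (D / C0) * asymp_var \<pi>S ex.K g + ereal ((D - C0) / C0 * (L2_norm \<pi>S g)\<^sup>2)"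
proof -
  note E = ex.positive_kernel_K and Hy = hy.positive_kernel_K
  have D1: "1 \<le> 1000000000 * D" using D_ge_1 by simp
  have eq: "D / C0 = 1000000000 * D" "(D - C0) / C0 = 1000000000 * D - 1" by (simp_all add: C0_def field_simps)
  show "C0 / D * (1 - kernel_norm \<pi>S ex.K) \<le> 1 - kernel_norm \<pi>S hy.K"
    using kernel_norm_comparison[OF E Hy D1 dform_gibbs_le] D_ge_1 by (simp add: C0_def)
  show "1 - kernel_norm \<pi>S hy.K \<le> 1 - kernel_norm \<pi>S ex.K"
    using kernel_norm_comparison[OF Hy E order_refl dform_hybrid_le] by simp
  assume g: "g \<in> L20 \<pi>S"
  show "asymp_var \<pi>S ex.K g \<le> asymp_var \<pi>S hy.K g"
    using asymp_var_comparison[OF Hy E zero_less_one dform_hybrid_le g] by (simp add: one_ereal_def[symmetric] zero_ereal_def[symmetric])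
  show "asymp_var \<pi>S hy.K g \<le> ereal (D / C0) * asymp_var \<pi>S ex.K g + ereal ((D - C0) / C0 * (L2_norm \<pi>S g)\<^sup>2)"
    unfolding eq by (rule asymp_var_comparison[OF E Hy _ dform_gibbs_le g]) (use D1 in simp)
qed

end

theorem corollary15:
  shows "\<exists>C0::real. C0 > 0 \<and>
    (\<forall>(d::nat) (a::real) (b::real) (L::real) (\<sigma>::real) (p1::real) (p2::real) (p3::real)
       (l :: (nat \<Rightarrow> real) \<Rightarrow> real) (f :: real \<Rightarrow> real).
       d \<ge> 1 \<longrightarrow> 0 < a \<longrightarrow> a < b \<longrightarrow> prob_density_01 f \<longrightarrow>
       0 \<le> p1 \<longrightarrow> 0 \<le> p2 \<longrightarrow> 0 \<le> p3 \<longrightarrow> p1 + p2 + p3 = 1 \<longrightarrow>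
       C2_on_Rd d l \<longrightarrow> L > 0 \<longrightarrow>
       (\<forall>\<beta>\<in>Rd d. loewner_le d (\<lambda>i j. 0) (\<lambda>i j. - hessian l \<beta> i j) \<and>
                  loewner_le d (\<lambda>i j. - hessian l \<beta> i j) (\<lambda>i j. L * id_mat i j)) \<longrightarrow>
       \<sigma> > 0 \<longrightarrow> \<sigma>\<^sup>2 = 1 / (2 * real d * (b * L + 1)) \<longrightarrow>
       (let \<pi> = posterior d a b l f;
            T = gibbs_kernel d a b l f p1 p2 p3;
            T' = hybrid_kernel d a b l f \<sigma> p1 p2 p3;
            D = real d * (b * L + 1)
        in C0 / D * (1 - kernel_norm \<pi> T) \<le> 1 - kernel_norm \<pi> T' \<and>
           1 - kernel_norm \<pi> T' \<le> 1 - kernel_norm \<pi> T \<and>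
           (\<forall>g\<in>L20 \<pi>.
              asymp_var \<pi> T g \<le> asymp_var \<pi> T' g \<and>
              asymp_var \<pi> T' g \<le> ereal (D / C0) * asymp_var \<pi> T g
                + ereal ((D - C0) / C0 * (L2_norm \<pi> g)\<^sup>2))))"
proof (intro exI[of _ "1 / 1000000000"] conjI allI impI)
  show "0 < (1 / 1000000000 :: real)" by simp
  fix d :: nat and a b L \<sigma> p1 p2 p3 :: real and l :: "(nat \<Rightarrow> real) \<Rightarrow> real" and f :: "real \<Rightarrow> real"
  assume "d \<ge> 1" "0 < a" "a < b" "prob_density_01 f" "0 \<le> p1" "0 \<le> p2" "0 \<le> p3" "p1 + p2 + p3 = 1"
    "C2_on_Rd d l" "L > 0"
    "\<forall>\<beta>\<in>Rd d. loewner_le d (\<lambda>i j. 0) (\<lambda>i j. - hessian l \<beta> i j) \<and> loewner_le d (\<lambda>i j. - hessian l \<beta> i j) (\<lambda>i j. L * id_mat i j)"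
    "\<sigma> > 0" "\<sigma>\<^sup>2 = 1 / (2 * real d * (b * L + 1))"
  then interpret s: spike_slab d a b L \<sigma> p1 p2 p3 l f by unfold_locales auto
  show "let \<pi> = posterior d a b l f; T = gibbs_kernel d a b l f p1 p2 p3; T' = hybrid_kernel d a b l f \<sigma> p1 p2 p3; D = real d * (b * L + 1)
    in (1 / 1000000000) / D * (1 - kernel_norm \<pi> T) \<le> 1 - kernel_norm \<pi> T' \<and> 1 - kernel_norm \<pi> T' \<le> 1 - kernel_norm \<pi> T \<and>
       (\<forall>g\<in>L20 \<pi>. asymp_var \<pi> T g \<le> asymp_var \<pi> T' g \<and>
          asymp_var \<pi> T' g \<le> ereal (D / (1 / 1000000000)) * asymp_var \<pi> T g + ereal ((D - 1 / 1000000000) / (1 / 1000000000) * (L2_norm \<pi> g)\<^sup>2))"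
    unfolding Let_def s.\<pi>S_def[symmetric] s.gibbs_kernel_eq s.hybrid_kernel_eq s.D_def[symmetric]
    using s.comparison by blast
qed

end
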